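(* Let $\Omega\subseteq\mathbb{R}^n$ be an open neighborhood of $x_0$ and let $P(x,D)=P_0(D)+\sum_{j=1}^rc_j(x)P_j(D)$ with $c_j\in\mathcal{G}(\Omega)$ for all $j$. Consider the hypotheses: (h1) for all $j=1,\dots,r$, $c_j(x_0)=0$ in $\widetilde{\mathbb{C}}$, and $P_0(D)$, $P_j(D)$ are differential operators with constant coefficients in $\widetilde{\mathbb{C}}$; (h2) $\widetilde{P_0}(\xi)$ is invertible in $\widetilde{\mathbb{R}}$ for some $\xi\in\mathbb{R}^n$; (h3) $P_0(D)$ is stronger than every $P_j(D)$, $j=1,\dots,r$. (A) If, for a certain choice of representatives, (h1), (h2), (h3) hold and in addition (h5) $\widetilde{P_{j,\varepsilon}}(\xi)\le\lambda_{j,\varepsilon}\widetilde{P_{0,\varepsilon}}(\xi)$ (for all $\xi\in\mathbb{R}^n$, $\varepsilon\in(0,1]$) with $$\sup_{|\alpha|\le n+1+\frac{n+1}{p}+N}\ \sup_{x\in\Omega}|\partial^\alpha c_{j,\varepsilon}(x)|\,\lambda_{j,\varepsilon}=O(1)\quad(\varepsilon\to0)$$ for some $p\in[1,\infty)$, for some $N\in\mathbb{N}$ and for all $j=1,\dots,r$, then there exists a sufficiently small neighborhood $\Omega_\delta:=\{x:|x-x_0|<\delta\}$ of $x_0$ such that (i) for all $F\in\mathcal{L}_b(\mathcal{G}(\mathbb{R}^n),\widetilde{\mathbb{C}})$ of order $N$ there exists $T\in\mathcal{L}_b(\mathcal{G}(\mathbb{R}^n),\widetilde{\mathbb{C}})$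 solving $P(x,D)T=F$ on $\Omega_\delta$. (B) If, for a certain choice of representatives, (h1), (h2), (h3) hold and in addition (h6) $\widetilde{P_{j,\varepsilon}}(\xi)\le\lambda_{j,\varepsilon}\widetilde{P_{0,\varepsilon}}(\xi)$ (for all $\xi\in\mathbb{R}^n$, $\varepsilon\in(0,1]$) with $$\forall N\in\mathbb{N}\ \exists a>0\qquad\sup_{|\alpha|\le n+1+N}\ \sup_{x\in\Omega}|\partial^\alpha c_{j,\varepsilon}(x)|\,\lambda_{j,\varepsilon}=O(\varepsilon^a)\quad(\varepsilon\to0)$$ for all $j=1,\dots,r$, then there exists a sufficiently small neighborhood $\Omega_\delta:=\{x:|x-x_0|<\delta\}$ of $x_0$ such that (ii) for all $F\in\mathcal{L}_b(\mathcal{G}(\mathbb{R}^n),\widetilde{\mathbb{C}})$ there exists $T\in\mathcal{L}_b(\mathcal{G}(\mathbb{R}^n),\widetilde{\mathbb{C}})$ solving $P(x,D)T=F$ on $\Omega_\delta$; (iii) for all $v\in\mathcal{G}_c(\mathbb{R}^n)$ there exists $u\in\mathcal{G}_c(\mathbb{R}^n)$ solving $P(x,D)u=v$ on $\Omega_\delta$.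
   Context: All nets are indexed by $\varepsilon\in(0,1]$ and $O(\cdot)$ refers to $\varepsilon\to0$. For a locally convex space $E$ with seminorms $\{p_i\}$: $\mathcal{M}_E$ is the set of nets $(u_\varepsilon)_\varepsilon\in E^{(0,1]}$ such that for every $i$ there is $N\in\mathbb{N}$ with $p_i(u_\varepsilon)=O(\varepsilon^{-N})$; $\mathcal{N}_E$ is the set of nets with $p_i(u_\varepsilon)=O(\varepsilon^q)$ for all $i$ and all $q\in\mathbb{N}$; $\mathcal{G}_E=\mathcal{M}_E/\mathcal{N}_E$. $\widetilde{\mathbb{C}}=\mathcal{G}_{\mathbb{C}}$, $\widetilde{\mathbb{R}}=\mathcal{G}_{\mathbb{R}}$; elements of $\mathcal{M}_{\mathbb{C}}$ are called moderate nets. $\mathcal{G}(\Omega)=\mathcal{G}_{\mathcal{C}^\infty(\Omega)}$ for $\Omega\subseteq\mathbb{R}^n$ open, and $\mathcal{G}_c(\Omega)$ is its subalgebra of compactly supported elements. For $c=[(c_\varepsilon)_\varepsilon]\in\mathcal{G}(\Omega)$, $c(x_0)=[(c_\varepsilon(x_0))_\varepsilon]\in\widetilde{\mathbb{C}}$. $\mathcal{L}_b(\mathcal{G}(\mathbb{R}^n),\widetilde{\mathbb{C}})$ (basic functionals) is the set of $\widetilde{\mathbb{C}}$-linear functionals $T:\mathcal{G}(\mathbb{R}^n)\to\widetilde{\mathbb{C}}$ of the form $T(u)=[(T_\varepsilon(u_\varepsilon))_\varepsilon]$, where $(T_\varepsilon)_\varepsilon$ is a net in $\mathcal{E}'(\mathbb{R}^n)$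 for which there are $K\Subset\mathbb{R}^n$, $j\in\mathbb{N}$, $c>0$, $M\in\mathbb{N}$, $\eta\in(0,1]$ with $|T_\varepsilon(f)|\le c\,\varepsilon^{-M}\sup_{x\in K,|\alpha|\le j}|\partial^\alpha f(x)|$ for all $f\in\mathcal{C}^\infty(\mathbb{R}^n)$, $\varepsilon\in(0,\eta]$. Such a $T$ is said to be of order $N$ if it is defined by a net $(T_\varepsilon)_\varepsilon$ in $\mathcal{E}'(\mathbb{R}^n)$ with $|T_\varepsilon(f)|\le\lambda_\varepsilon\sup_{x\in K,|\alpha|\le N}|\partial^\alpha f(x)|$ for all $f\in\mathcal{C}^\infty(\mathbb{R}^n)$ and $\varepsilon\in(0,1]$, for some $K\Subset\mathbb{R}^n$ and some moderate net $(\lambda_\varepsilon)_\varepsilon$. Differential operators with Colombeau coefficients on an open set act on functionals by transposition; "$P(x,D)T=F$ on $\Omega_\delta$" means that the restrictions of both sides to $\mathcal{G}_c(\Omega_\delta)$ coincide. Constant coefficient operators: $P(D)=\sum_{|\alpha|\le m}c_\alpha D^\alpha$, $c_\alpha\in\widetilde{\mathbb{C}}$, $D=-i\partial$, with polynomial $P(\xi)=\sum_{|\alpha|\le m}c_\alpha\xi^\alpha$. A representative of $P$ is a net of polynomials $P_\varepsilon(\xi)=\sum_{|\alpha|\le m}c_{\alpha,\varepsilon}\xi^\alpha$ with $(c_{\alpha,\varepsilon})_\varepsilon$ a representative of $c_\alpha$. For a polynomial $Q$, $\widetilde Q(\xi)=(\sum_\alpha|\partial^\alpha Q(\xi)|^2)^{1/2}$,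 and $\widetilde P(\xi)=[(\widetilde{P_\varepsilon}(\xi))_\varepsilon]\in\widetilde{\mathbb{R}}$. $P(D)$ is stronger than $Q(D)$ (written $Q(D)\prec P(D)$) if there exist representatives $(P_\varepsilon)_\varepsilon$, $(Q_\varepsilon)_\varepsilon$ and a moderate net $(\lambda_\varepsilon)_\varepsilon$ with $\widetilde{Q_\varepsilon}(\xi)\le\lambda_\varepsilon\widetilde{P_\varepsilon}(\xi)$ for all $\xi\in\mathbb{R}^n$, $\varepsilon\in(0,1]$. *)

theory Defs
  imports "HOL-Analysis.Analysis" "HOL-Library.Landau_Symbols"
begin

section \<open>Colombeau spaces over a locally convex space\<close>

text \<open>
  A net indexed by \<open>(0,1]\<close> is a total function on \<open>real\<close>; its values outside \<open>(0,1]\<close> are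
  irrelevant. A locally convex space is given by a carrier set \<open>E\<close> and a set \<open>S\<close> of seminorms on it.
\<close>

definition moderate_nets :: "'e set \<Rightarrow> ('e \<Rightarrow> real) set \<Rightarrow> (real \<Rightarrow> 'e) set" where
  "moderate_nets E S = {u. (\<forall>\<epsilon>\<in>{0<..1}. u \<epsilon> \<in> E) \<and>
     (\<forall>p\<in>S. \<exists>N::nat. (\<lambda>\<epsilon>. p (u \<epsilon>)) \<in> O[at_right 0](\<lambda>\<epsilon>. inverse (\<epsilon> ^ N)))}"

definition negligible_nets :: "'e set \<Rightarrow> ('e \<Rightarrow> real) set \<Rightarrow> (real \<Rightarrow> 'e) set" where
  "negligible_nets E S = {u. (\<forall>\<epsilon>\<in>{0<..1}. u \<epsilon> \<in> E) \<and>
     (\<forall>p\<in>S. \<forall>q::nat. (\<lambda>\<epsilon>. p (u \<epsilon>)) \<in> O[at_right 0](\<lambda>\<epsilon>. \<epsilon> ^ q))}"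

definition colombeau_rel ::
    "'e::minus set \<Rightarrow> ('e \<Rightarrow> real) set \<Rightarrow> ((real \<Rightarrow> 'e) \<times> (real \<Rightarrow> 'e)) set" where
  "colombeau_rel E S = {(u, v). u \<in> moderate_nets E S \<and> v \<in> moderate_nets E S \<and>
     (\<lambda>\<epsilon>. u \<epsilon> - v \<epsilon>) \<in> negligible_nets E S}"

definition colombeau_space :: "'e::minus set \<Rightarrow> ('e \<Rightarrow> real) set \<Rightarrow> (real \<Rightarrow> 'e) set set" where
  "colombeau_space E S = moderate_nets E S // colombeau_rel E S"


section \<open>Generalized numbers\<close>

abbreviation moderate :: "(real \<Rightarrow> 'a::real_normed_field) \<Rightarrow> bool" where
  "moderate u \<equiv> u \<in> moderate_nets UNIV {norm}"

abbreviation negligible_net :: "(real \<Rightarrow> 'a::real_normed_field) \<Rightarrow> bool" where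
  "negligible_net u \<equiv> u \<in> negligible_nets UNIV {norm}"

lemma moderate_iff:
  "moderate u \<longleftrightarrow> (\<exists>N::nat. u \<in> O[at_right 0](\<lambda>\<epsilon>. of_real (inverse (\<epsilon> ^ N))))"
proof -
  have "u \<in> O[at_right 0](\<lambda>\<epsilon>. of_real (inverse (\<epsilon> ^ N))) \<longleftrightarrow>
      (\<lambda>\<epsilon>. norm (u \<epsilon>)) \<in> O[at_right 0](\<lambda>\<epsilon>. inverse (\<epsilon> ^ N))" for N
    by (simp add: bigo_def del: of_real_inverse of_real_power)
  then show ?thesis by (simp add: moderate_nets_def)
qed

lemma negligible_iff:
  "negligible_net u \<longleftrightarrow> (\<forall>q::nat. u \<in> O[at_right 0](\<lambda>\<epsilon>. of_real (\<epsilon> ^ q)))"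
proof -
  have "u \<in> O[at_right 0](\<lambda>\<epsilon>. of_real (\<epsilon> ^ N)) \<longleftrightarrow>
      (\<lambda>\<epsilon>. norm (u \<epsilon>)) \<in> O[at_right 0](\<lambda>\<epsilon>. \<epsilon> ^ N)" for N
    by (simp add: bigo_def del: of_real_inverse of_real_power)
  then show ?thesis by (simp add: negligible_nets_def)
qed

lemma eventually_small: "\<forall>\<^sub>F \<epsilon> in at_right (0::real). 0 < \<epsilon> \<and> \<epsilon> \<le> 1"
  unfolding eventually_at_right_field by (intro exI[of _ 1]) auto

lemma inverse_power_bigo_mono:
  assumes "M \<le> N"
  shows "(\<lambda>\<epsilon>. of_real (inverse (\<epsilon> ^ M)) :: 'a::real_normed_field)
    \<in> O[at_right 0](\<lambda>\<epsilon>. of_real (inverse (\<epsilon> ^ N)))"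
proof (rule bigoI[of _ 1])
  show "\<forall>\<^sub>F \<epsilon> in at_right 0. norm (of_real (inverse (\<epsilon> ^ M)) :: 'a)
      \<le> 1 * norm (of_real (inverse (\<epsilon> ^ N)) :: 'a)"
    using eventually_small
  proof eventually_elim
    case (elim \<epsilon>)
    then have "\<epsilon> ^ N \<le> \<epsilon> ^ M" "0 < \<epsilon> ^ N" using assms by (auto intro: power_decreasing)
    then have "inverse (\<epsilon> ^ M) \<le> inverse (\<epsilon> ^ N)" by (rule le_imp_inverse_le)
    then show ?case using elim by (simp add: norm_inverse norm_power)
  qed
qed

lemma moderate_const: "moderate (\<lambda>_. c)"
  unfolding moderate_iff by (intro exI[of _ 0]) simp

lemma moderate_add:
  assumes "moderate u" "moderate v" shows "moderate (\<lambda>\<epsilon>. u \<epsilon> + v \<epsilon>)"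
proof -
  from assms obtain M N :: nat where
    "u \<in> O[at_right 0](\<lambda>\<epsilon>. of_real (inverse (\<epsilon> ^ M)))"
    "v \<in> O[at_right 0](\<lambda>\<epsilon>. of_real (inverse (\<epsilon> ^ N)))"
    unfolding moderate_iff by blast
  then have "u \<in> O[at_right 0](\<lambda>\<epsilon>. of_real (inverse (\<epsilon> ^ max M N)))"
    "v \<in> O[at_right 0](\<lambda>\<epsilon>. of_real (inverse (\<epsilon> ^ max M N)))"
    by - (rule landau_o.big_trans[OF _ inverse_power_bigo_mono], assumption, simp)+
  then show ?thesis unfolding moderate_iff by (intro exI[of _ "max M N"] sum_in_bigo)
qed

lemma moderate_mult:
  assumes "moderate u" "moderate v" shows "moderate (\<lambda>\<epsilon>. u \<epsilon> * v \<epsilon>)"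
proof -
  from assms obtain M N :: nat where
    "u \<in> O[at_right 0](\<lambda>\<epsilon>. of_real (inverse (\<epsilon> ^ M)))"
    "v \<in> O[at_right 0](\<lambda>\<epsilon>. of_real (inverse (\<epsilon> ^ N)))"
    unfolding moderate_iff by blast
  from landau_o.big.mult[OF this] show ?thesis unfolding moderate_iff
    by (intro exI[of _ "M + N"]) (simp add: power_add)
qed

lemma moderate_uminus: "moderate u \<Longrightarrow> moderate (\<lambda>\<epsilon>. - u \<epsilon>)"
  using moderate_mult[OF moderate_const[of "-1"]] by simp

lemma negligible_add:
  "negligible_net u \<Longrightarrow> negligible_net v \<Longrightarrow> negligible_net (\<lambda>\<epsilon>. u \<epsilon> + v \<epsilon>)"
  unfolding negligible_iff by (blast intro: sum_in_bigo)

lemma negligible_mult: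
  assumes "moderate u" "negligible_net v" shows "negligible_net (\<lambda>\<epsilon>. u \<epsilon> * v \<epsilon>)"
  unfolding negligible_iff
proof
  fix q :: nat
  from assms(1) obtain M :: nat where
    u: "u \<in> O[at_right 0](\<lambda>\<epsilon>. of_real (inverse (\<epsilon> ^ M)))" unfolding moderate_iff by blast
  have v: "v \<in> O[at_right 0](\<lambda>\<epsilon>. of_real (\<epsilon> ^ (M + q)))"
    using assms(2) unfolding negligible_iff by blast
  have "(\<lambda>\<epsilon>. u \<epsilon> * v \<epsilon>) \<in>
      O[at_right 0](\<lambda>\<epsilon>. of_real (inverse (\<epsilon> ^ M)) * of_real (\<epsilon> ^ (M + q)))"
    by (rule landau_o.big.mult[OF u v])
  also have "(\<lambda>\<epsilon>. of_real (inverse (\<epsilon> ^ M)) * of_real (\<epsilon> ^ (M + q)) :: 'a) \<in>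
      O[at_right 0](\<lambda>\<epsilon>. of_real (\<epsilon> ^ q))"
  proof (rule bigoI[of _ 1])
    show "\<forall>\<^sub>F \<epsilon> in at_right 0.
        norm (of_real (inverse (\<epsilon> ^ M)) * of_real (\<epsilon> ^ (M + q)) :: 'a)
        \<le> 1 * norm (of_real (\<epsilon> ^ q) :: 'a)"
      using eventually_small by eventually_elim (simp add: power_add field_simps norm_mult norm_divide)
  qed
  finally show "(\<lambda>\<epsilon>. u \<epsilon> * v \<epsilon>) \<in> O[at_right 0](\<lambda>\<epsilon>. of_real (\<epsilon> ^ q))" .
qed

lemma negligible_uminus: "negligible_net u \<Longrightarrow> negligible_net (\<lambda>\<epsilon>. - u \<epsilon>)"
  using negligible_mult[OF moderate_const[of "-1"]] by simp

lemma negligible_zero: "negligible_net (\<lambda>_. 0)"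
  unfolding negligible_iff by simp

lemma not_negligible_one: "\<not> negligible_net (\<lambda>_. 1)"
proof
  assume "negligible_net (\<lambda>_. 1 :: 'a)"
  then have "(\<lambda>_. 1 :: 'a) \<in> O[at_right 0](\<lambda>\<epsilon>. of_real (\<epsilon> ^ 1))"
    unfolding negligible_iff by blast
  then obtain c where c: "c > 0" "\<forall>\<^sub>F \<epsilon> in at_right 0. norm (1::'a) \<le> c * norm (of_real (\<epsilon> ^ 1) :: 'a)"
    by (rule landau_o.bigE)
  have "\<forall>\<^sub>F \<epsilon> in at_right (0::real). 0 < \<epsilon> \<and> \<epsilon> < 1 / c"
    unfolding eventually_at_right_field using c(1) by (intro exI[of _ "1 / c"]) auto
  with c(2) have "\<forall>\<^sub>F \<epsilon> in at_right (0::real). False"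
  proof (rule eventually_elim2)
    fix \<epsilon> :: real
    assume "norm (1::'a) \<le> c * norm (of_real (\<epsilon> ^ 1) :: 'a)" "0 < \<epsilon> \<and> \<epsilon> < 1 / c"
    then show False using c(1) by (simp add: field_simps)
  qed
  then show False by simp
qed

definition gen_num_rel :: "(real \<Rightarrow> 'a::real_normed_field) \<Rightarrow> (real \<Rightarrow> 'a) \<Rightarrow> bool" where
  "gen_num_rel u v \<longleftrightarrow> (u, v) \<in> colombeau_rel UNIV {norm}"

lemma gen_num_rel_iff:
  "gen_num_rel u v \<longleftrightarrow> moderate u \<and> moderate v \<and> negligible_net (\<lambda>\<epsilon>. u \<epsilon> - v \<epsilon>)"
  by (simp add: gen_num_rel_def colombeau_rel_def)

lemma part_equivp_gen_num_rel: "part_equivp (gen_num_rel :: (real \<Rightarrow> 'a::real_normed_field) \<Rightarrow> _)"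
proof (rule part_equivpI)
  show "\<exists>u :: real \<Rightarrow> 'a. gen_num_rel u u"
    by (rule exI[of _ "\<lambda>_. 0"]) (simp add: gen_num_rel_iff moderate_const negligible_zero)
  show "symp (gen_num_rel :: (real \<Rightarrow> 'a) \<Rightarrow> _)"
    by (rule sympI) (use negligible_uminus in \<open>fastforce simp: gen_num_rel_iff\<close>)
  show "transp (gen_num_rel :: (real \<Rightarrow> 'a) \<Rightarrow> _)"
    by (rule transpI) (use negligible_add in \<open>fastforce simp: gen_num_rel_iff\<close>)
qed

text \<open>
  \<open>complex gen_num\<close> is the ring of generalized complex numbers and \<open>real gen_num\<close> that of
  generalized real numbers. \<open>abs_gen_num u\<close> is the class of the moderate net \<open>u\<close>, and
  \<open>rep_gen_num\<close> chooses some representative.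
\<close>

quotient_type (overloaded) 'a gen_num = "real \<Rightarrow> 'a::real_normed_field" / partial: gen_num_rel
  by (rule part_equivp_gen_num_rel)

instantiation gen_num :: (real_normed_field) comm_ring_1
begin

lift_definition zero_gen_num :: "'a gen_num" is "\<lambda>_. 0"
  by (simp add: gen_num_rel_iff moderate_const negligible_zero)

lift_definition one_gen_num :: "'a gen_num" is "\<lambda>_. 1"
  by (simp add: gen_num_rel_iff moderate_const negligible_zero)

lift_definition plus_gen_num :: "'a gen_num \<Rightarrow> 'a gen_num \<Rightarrow> 'a gen_num" is "\<lambda>u v \<epsilon>. u \<epsilon> + v \<epsilon>"
  subgoal for u u' v v'
    using negligible_add[of "\<lambda>\<epsilon>. u \<epsilon> - u' \<epsilon>" "\<lambda>\<epsilon>. v \<epsilon> - v' \<epsilon>"]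
    by (simp add: gen_num_rel_iff moderate_add algebra_simps)
  done

lift_definition uminus_gen_num :: "'a gen_num \<Rightarrow> 'a gen_num" is "\<lambda>u \<epsilon>. - u \<epsilon>"
  subgoal for u u'
    using negligible_uminus[of "\<lambda>\<epsilon>. u \<epsilon> - u' \<epsilon>"]
    by (simp add: gen_num_rel_iff moderate_uminus algebra_simps)
  done

definition minus_gen_num :: "'a gen_num \<Rightarrow> 'a gen_num \<Rightarrow> 'a gen_num" where
  "minus_gen_num a b = a + - b"

lift_definition times_gen_num :: "'a gen_num \<Rightarrow> 'a gen_num \<Rightarrow> 'a gen_num" is "\<lambda>u v \<epsilon>. u \<epsilon> * v \<epsilon>"
  subgoal for u u' v v'
    using negligible_add[OF negligible_mult[of u "\<lambda>\<epsilon>. v \<epsilon> - v' \<epsilon>"] negligible_mult[of v' "\<lambda>\<epsilon>. u \<epsilon> - u' \<epsilon>"]]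
    by (simp add: gen_num_rel_iff moderate_mult algebra_simps)
  done

instance
proof
  fix a b c :: "'a gen_num"
  show "a + b + c = a + (b + c)" "a + b = b + a" "a * b * c = a * (b * c)" "a * b = b * a"
    "(a + b) * c = a * c + b * c"
    by (transfer; simp add: gen_num_rel_iff moderate_add moderate_mult negligible_zero algebra_simps)+
  show "0 + a = a" "- a + a = 0" "1 * a = a"
    by (transfer; simp add: gen_num_rel_iff moderate_const negligible_zero)+
  show "a - b = a + - b" by (simp add: minus_gen_num_def)
  show "(0::'a gen_num) \<noteq> 1"
  proof (transfer, rule notI)
    assume "gen_num_rel (\<lambda>_. 0::'a) (\<lambda>_. 1)"
    then have "negligible_net (\<lambda>_. - 1 :: 'a)" by (simp add: gen_num_rel_iff)
    from negligible_uminus[OF this] have "negligible_net (\<lambda>_. 1 :: 'a)" by simp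
    then show False by (rule notE[OF not_negligible_one])
  qed
qed

end


section \<open>Smooth functions\<close>

definition mi_order :: "('n::finite \<Rightarrow> nat) \<Rightarrow> nat" where
  "mi_order \<alpha> = (\<Sum>i\<in>UNIV. \<alpha> i)"

definition pd :: "'n::finite \<Rightarrow> (real^'n \<Rightarrow> complex) \<Rightarrow> real^'n \<Rightarrow> complex" where
  "pd i f x = frechet_derivative f (at x) (axis i 1)"

definition smooth_on :: "(real^'n::finite) set \<Rightarrow> (real^'n \<Rightarrow> complex) \<Rightarrow> bool" where
  "smooth_on \<Omega> f \<longleftrightarrow> (\<forall>is. \<forall>x\<in>\<Omega>. foldr pd is f differentiable (at x))"

text \<open>
  The partial derivative of multi-index order differentiates along a fixed enumeration of the
  coordinates; on smooth functions the enumeration is immaterial.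
\<close>

definition coordinates :: "'n::finite list" where
  "coordinates = (SOME is. distinct is \<and> set is = UNIV)"

definition mpd :: "('n::finite \<Rightarrow> nat) \<Rightarrow> (real^'n \<Rightarrow> complex) \<Rightarrow> real^'n \<Rightarrow> complex" where
  "mpd \<alpha> f = foldr (\<lambda>i. pd i ^^ \<alpha> i) coordinates f"

definition mD :: "('n::finite \<Rightarrow> nat) \<Rightarrow> (real^'n \<Rightarrow> complex) \<Rightarrow> real^'n \<Rightarrow> complex" where
  "mD \<alpha> f x = (- \<i>) ^ mi_order \<alpha> * mpd \<alpha> f x"

text \<open>The inserted \<open>0\<close> only matters for \<open>K = {}\<close>, where \<open>Sup\<close> on the reals is unspecified.\<close>

definition sup_seminorm :: "(real^'n::finite) set \<Rightarrow> nat \<Rightarrow> (real^'n \<Rightarrow> complex) \<Rightarrow> real" where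
  "sup_seminorm K j f = Sup (insert 0 {norm (mpd \<alpha> f x) | \<alpha> x. mi_order \<alpha> \<le> j \<and> x \<in> K})"


section \<open>Generalized functions\<close>

type_synonym 'n fnet = "real \<Rightarrow> real^'n \<Rightarrow> complex"
type_synonym 'n gfun = "'n fnet set"

definition smooth_functions :: "(real^'n::finite) set \<Rightarrow> (real^'n \<Rightarrow> complex) set" where
  "smooth_functions \<Omega> = {f. smooth_on \<Omega> f}"

definition smooth_seminorms :: "(real^'n::finite) set \<Rightarrow> ((real^'n \<Rightarrow> complex) \<Rightarrow> real) set" where
  "smooth_seminorms \<Omega> = {sup_seminorm K j | K j. compact K \<and> K \<subseteq> \<Omega>}"

text \<open>
  The elements of \<open>\<C>\<^sup>\<infinity>(\<Omega>)\<close> are total functions; functions agreeing on \<open>\<Omega>\<close> are identified by the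
  quotient, because the seminorms only see \<open>\<Omega>\<close>.
\<close>

definition gfuns :: "(real^'n::finite) set \<Rightarrow> 'n gfun set" where
  "gfuns \<Omega> = colombeau_space (smooth_functions \<Omega>) (smooth_seminorms \<Omega>)"

definition gcls :: "(real^'n::finite) set \<Rightarrow> 'n fnet \<Rightarrow> 'n gfun" where
  "gcls \<Omega> u = colombeau_rel (smooth_functions \<Omega>) (smooth_seminorms \<Omega>) `` {u}"

text \<open>
  All operations below are independent of the representative chosen by \<open>grep\<close> (and by
  \<open>rep_gen_num\<close>).
\<close>

definition grep :: "'n::finite gfun \<Rightarrow> 'n fnet" where
  "grep u = (SOME v. v \<in> u)"

definition gadd :: "(real^'n::finite) set \<Rightarrow> 'n gfun \<Rightarrow> 'n gfun \<Rightarrow> 'n gfun" where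
  "gadd \<Omega> u v = gcls \<Omega> (\<lambda>\<epsilon> x. grep u \<epsilon> x + grep v \<epsilon> x)"

definition gscale :: "(real^'n::finite) set \<Rightarrow> complex gen_num \<Rightarrow> 'n gfun \<Rightarrow> 'n gfun" where
  "gscale \<Omega> a u = gcls \<Omega> (\<lambda>\<epsilon> x. rep_gen_num a \<epsilon> * grep u \<epsilon> x)"

definition grestrict :: "(real^'n::finite) set \<Rightarrow> 'n gfun \<Rightarrow> 'n gfun" where
  "grestrict \<Omega>' u = gcls \<Omega>' (grep u)"

definition gvalue :: "'n::finite gfun \<Rightarrow> real^'n \<Rightarrow> complex gen_num" where
  "gvalue u x = abs_gen_num (\<lambda>\<epsilon>. grep u \<epsilon> x)"

definition gsupport :: "(real^'n::finite) set \<Rightarrow> 'n gfun \<Rightarrow> (real^'n) set" where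
  "gsupport \<Omega> u = \<Omega> - \<Union>{V. open V \<and> V \<subseteq> \<Omega> \<and> grestrict V u = gcls V (\<lambda>_ _. 0)}"

definition gfuns_c :: "(real^'n::finite) set \<Rightarrow> 'n gfun set" where
  "gfuns_c \<Omega> = {u \<in> gfuns \<Omega>. compact (gsupport \<Omega> u)}"

text \<open>The embedding of \<open>\<G>\<^sub>c(\<Omega>)\<close> into \<open>\<G>(\<real>\<^sup>n)\<close> (extension by zero).\<close>

definition gextend :: "(real^'n::finite) set \<Rightarrow> 'n gfun \<Rightarrow> 'n gfun" where
  "gextend \<Omega> u = (THE v. v \<in> gfuns UNIV \<and> grestrict \<Omega> v = u \<and> gsupport UNIV v = gsupport \<Omega> u)"


section \<open>Basic functionals\<close>

text \<open>
  The space \<open>\<E>'(\<real>\<^sup>n)\<close> of continuous linear functionals on \<open>\<C>\<^sup>\<infinity>(\<real>\<^sup>n)\<close>; values on non-smooth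
  functions are irrelevant. The seminorms are directed, so one of them suffices for continuity.
\<close>

definition compact_distributions :: "((real^'n::finite \<Rightarrow> complex) \<Rightarrow> complex) set" where
  "compact_distributions = {T.
     (\<forall>f g. smooth_on UNIV f \<longrightarrow> smooth_on UNIV g \<longrightarrow> T (\<lambda>x. f x + g x) = T f + T g) \<and>
     (\<forall>a f. smooth_on UNIV f \<longrightarrow> T (\<lambda>x. a * f x) = a * T f) \<and>
     (\<exists>K j C. compact K \<and> (\<forall>f. smooth_on UNIV f \<longrightarrow> norm (T f) \<le> C * sup_seminorm K j f))}"

definition defines_functional ::
    "(real \<Rightarrow> (real^'n::finite \<Rightarrow> complex) \<Rightarrow> complex) \<Rightarrow> ('n gfun \<Rightarrow> complex gen_num) \<Rightarrow> bool" where
  "defines_functional Tn T \<longleftrightarrow> (\<forall>\<epsilon>\<in>{0<..1}. Tn \<epsilon> \<in> compact_distributions) \<and>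
     (\<forall>u \<in> gfuns UNIV. \<forall>v \<in> u. T u = abs_gen_num (\<lambda>\<epsilon>. Tn \<epsilon> (v \<epsilon>)))"

definition basic_functionals :: "('n::finite gfun \<Rightarrow> complex gen_num) set" where
  "basic_functionals = {T.
     (\<forall>u\<in>gfuns UNIV. \<forall>v\<in>gfuns UNIV. T (gadd UNIV u v) = T u + T v) \<and>
     (\<forall>a. \<forall>u\<in>gfuns UNIV. T (gscale UNIV a u) = a * T u) \<and>
     (\<exists>Tn. defines_functional Tn T \<and>
       (\<exists>K j c (M::nat) \<eta>. compact K \<and> 0 < c \<and> \<eta> \<in> {0<..1} \<and>
         (\<forall>f. smooth_on UNIV f \<longrightarrow>
           (\<forall>\<epsilon>\<in>{0<..\<eta>}. norm (Tn \<epsilon> f) \<le> c * inverse (\<epsilon> ^ M) * sup_seminorm K j f))))}"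

definition of_order :: "nat \<Rightarrow> ('n::finite gfun \<Rightarrow> complex gen_num) \<Rightarrow> bool" where
  "of_order N T \<longleftrightarrow> (\<exists>Tn K l. defines_functional Tn T \<and> compact K \<and> moderate (l :: real \<Rightarrow> real) \<and>
     (\<forall>f. smooth_on UNIV f \<longrightarrow>
       (\<forall>\<epsilon>\<in>{0<..1}. norm (Tn \<epsilon> f) \<le> l \<epsilon> * sup_seminorm K N f)))"


section \<open>Differential operators with Colombeau coefficients\<close>

text \<open>
  An operator of order at most \<open>m\<close> on \<open>\<Omega>\<close> is given by its family \<open>a\<close> of coefficients in \<open>\<G>(\<Omega>)\<close>;
  only the entries \<open>a \<alpha>\<close> with \<open>mi_order \<alpha> \<le> m\<close> are used.
\<close>

definition diff_op ::
    "(real^'n::finite) set \<Rightarrow> nat \<Rightarrow> (('n \<Rightarrow> nat) \<Rightarrow> 'n gfun) \<Rightarrow> 'n gfun \<Rightarrow> 'n gfun" where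
  "diff_op \<Omega> m a u = gcls \<Omega> (\<lambda>\<epsilon> x. \<Sum>\<alpha> | mi_order \<alpha> \<le> m. grep (a \<alpha>) \<epsilon> x * mD \<alpha> (grep u \<epsilon>) x)"

definition transposed_op ::
    "(real^'n::finite) set \<Rightarrow> nat \<Rightarrow> (('n \<Rightarrow> nat) \<Rightarrow> 'n gfun) \<Rightarrow> 'n gfun \<Rightarrow> 'n gfun" where
  "transposed_op \<Omega> m a u = gcls \<Omega> (\<lambda>\<epsilon> x. \<Sum>\<alpha> | mi_order \<alpha> \<le> m.
     (- 1) ^ mi_order \<alpha> * mD \<alpha> (\<lambda>y. grep (a \<alpha>) \<epsilon> y * grep u \<epsilon> y) x)"

text \<open>\<open>P(x,D)T = F\<close> on \<open>\<Omega>'\<close>, for \<open>P(x,D)\<close> with coefficients on an open superset of \<open>\<Omega>'\<close>.\<close>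

definition functional_eq_on ::
    "(real^'n::finite) set \<Rightarrow> nat \<Rightarrow> (('n \<Rightarrow> nat) \<Rightarrow> 'n gfun) \<Rightarrow>
     ('n gfun \<Rightarrow> complex gen_num) \<Rightarrow> ('n gfun \<Rightarrow> complex gen_num) \<Rightarrow> bool" where
  "functional_eq_on \<Omega>' m a T F \<longleftrightarrow> (\<forall>\<phi>\<in>gfuns_c \<Omega>'.
     T (gextend \<Omega>' (transposed_op \<Omega>' m (\<lambda>\<alpha>. grestrict \<Omega>' (a \<alpha>)) \<phi>)) = F (gextend \<Omega>' \<phi>))"

text \<open>\<open>P(x,D)u = v\<close> on \<open>\<Omega>'\<close>, as an equality in \<open>\<G>(\<Omega>')\<close>.\<close>

definition gfun_eq_on ::
    "(real^'n::finite) set \<Rightarrow> nat \<Rightarrow> (('n \<Rightarrow> nat) \<Rightarrow> 'n gfun) \<Rightarrow> 'n gfun \<Rightarrow> 'n gfun \<Rightarrow> bool" where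
  "gfun_eq_on \<Omega>' m a u v \<longleftrightarrow>
     diff_op \<Omega>' m (\<lambda>\<alpha>. grestrict \<Omega>' (a \<alpha>)) (grestrict \<Omega>' u) = grestrict \<Omega>' v"


section \<open>Operators with constant coefficients\<close>

text \<open>
  A polynomial of degree at most \<open>m\<close> is given by its coefficients, indexed by multi-indices; again
  only the entries of order at most \<open>m\<close> are used.
\<close>

definition mpoly_eval :: "nat \<Rightarrow> (('n::finite \<Rightarrow> nat) \<Rightarrow> complex) \<Rightarrow> real^'n \<Rightarrow> complex" where
  "mpoly_eval m q \<xi> = (\<Sum>\<alpha> | mi_order \<alpha> \<le> m. q \<alpha> * (\<Prod>i\<in>UNIV. complex_of_real (\<xi> $ i) ^ \<alpha> i))"

text \<open>
  Hoermander's function \<open>(\<Sum>\<alpha>. \<bar>\<partial>\<^sup>\<alpha> Q(\<xi>)\<bar>\<^sup>2)\<^sup>1\<^sup>/\<^sup>2\<close> of a polynomial \<open>Q\<close> of degree at most \<open>m\<close>: the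
  derivatives of order greater than \<open>m\<close> vanish, so the sum over all \<open>\<alpha>\<close> is this finite one.
\<close>

definition weight :: "nat \<Rightarrow> (('n::finite \<Rightarrow> nat) \<Rightarrow> complex) \<Rightarrow> real^'n \<Rightarrow> real" where
  "weight m q \<xi> = sqrt (\<Sum>\<alpha> | mi_order \<alpha> \<le> m. (norm (mpd \<alpha> (mpoly_eval m q) \<xi>))\<^sup>2)"

definition gweight ::
    "nat \<Rightarrow> (('n::finite \<Rightarrow> nat) \<Rightarrow> complex gen_num) \<Rightarrow> real^'n \<Rightarrow> real gen_num" where
  "gweight m P \<xi> = abs_gen_num (\<lambda>\<epsilon>. weight m (\<lambda>\<alpha>. rep_gen_num (P \<alpha>) \<epsilon>) \<xi>)"

definition poly_represents ::
    "nat \<Rightarrow> (real \<Rightarrow> ('n::finite \<Rightarrow> nat) \<Rightarrow> complex) \<Rightarrow> (('n \<Rightarrow> nat) \<Rightarrow> complex gen_num) \<Rightarrow> bool" where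
  "poly_represents m Pn P \<longleftrightarrow>
     (\<forall>\<alpha>. mi_order \<alpha> \<le> m \<longrightarrow> moderate (\<lambda>\<epsilon>. Pn \<epsilon> \<alpha>) \<and> abs_gen_num (\<lambda>\<epsilon>. Pn \<epsilon> \<alpha>) = P \<alpha>)"

definition weight_dominated ::
    "nat \<Rightarrow> (real \<Rightarrow> ('n::finite \<Rightarrow> nat) \<Rightarrow> complex) \<Rightarrow> (real \<Rightarrow> ('n \<Rightarrow> nat) \<Rightarrow> complex) \<Rightarrow>
     (real \<Rightarrow> real) \<Rightarrow> bool" where
  "weight_dominated m Qn Pn l \<longleftrightarrow>
     (\<forall>\<xi>. \<forall>\<epsilon>\<in>{0<..1}. weight m (Qn \<epsilon>) \<xi> \<le> l \<epsilon> * weight m (Pn \<epsilon>) \<xi>)"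

definition stronger ::
    "nat \<Rightarrow> (('n::finite \<Rightarrow> nat) \<Rightarrow> complex gen_num) \<Rightarrow> (('n \<Rightarrow> nat) \<Rightarrow> complex gen_num) \<Rightarrow> bool" where
  "stronger m P Q \<longleftrightarrow> (\<exists>Pn Qn l. poly_represents m Pn P \<and> poly_represents m Qn Q \<and>
     moderate l \<and> weight_dominated m Qn Pn l)"

text \<open>The coefficients in \<open>\<G>(\<Omega>)\<close> of \<open>P\<^sub>0(D) + \<Sum>j=1..r. c\<^sub>j(x) P\<^sub>j(D)\<close>.\<close>

definition perturbed_coeffs ::
    "(real^'n::finite) set \<Rightarrow> nat \<Rightarrow> (nat \<Rightarrow> 'n gfun) \<Rightarrow>
     (nat \<Rightarrow> ('n \<Rightarrow> nat) \<Rightarrow> complex gen_num) \<Rightarrow> ('n \<Rightarrow> nat) \<Rightarrow> 'n gfun" where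
  "perturbed_coeffs \<Omega> r c P \<alpha> = gcls \<Omega> (\<lambda>\<epsilon> x.
     rep_gen_num (P 0 \<alpha>) \<epsilon> + (\<Sum>j=1..r. grep (c j) \<epsilon> x * rep_gen_num (P j \<alpha>) \<epsilon>))"


section \<open>Growth conditions on the coefficients\<close>

definition deriv_sup :: "(real^'n::finite) set \<Rightarrow> real \<Rightarrow> (real^'n \<Rightarrow> complex) \<Rightarrow> ereal" where
  "deriv_sup \<Omega> k f = (SUP \<alpha>\<in>{\<alpha>. real (mi_order \<alpha>) \<le> k}. SUP x\<in>\<Omega>. ereal (norm (mpd \<alpha> f x)))"

text \<open>
  \<open>f \<epsilon> = O(g \<epsilon>)\<close> as \<open>\<epsilon> \<rightarrow> 0\<close> for a net \<open>f\<close> of suprema that may be infinite; in products of the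
  form \<open>deriv_sup * \<lambda>\<close> the convention \<open>\<infinity> * 0 = 0\<close> applies.
\<close>

definition ereal_bigo :: "(real \<Rightarrow> ereal) \<Rightarrow> (real \<Rightarrow> real) \<Rightarrow> bool" where
  "ereal_bigo f g \<longleftrightarrow> (\<exists>C::real. \<forall>\<^sub>F \<epsilon> in at_right 0. \<bar>f \<epsilon>\<bar> \<le> ereal (C * \<bar>g \<epsilon>\<bar>))"

end

theory Submission
  imports Defs "HOL-Complex_Analysis.Cauchy_Integral_Formula" "HOL-Computational_Algebra.Fundamental_Theorem_Algebra"
begin

text \<open>
  Put \<open>x = x0 + \<rho> y\<close> and localise to \<open>y\<close> in the periodicity box \<open>[-\<pi>, \<pi>]\<^sup>n\<close>. Every frequency \<open>k\<close> is
  moved into the complex domain: on a suitable circle of shifts \<open>\<gamma>(z)\<close>, \<open>\<bar>z\<bar> = t\<close>, the polynomial \<open>P\<^sub>0\<close> is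
  bounded below by its weight, so \<open>e\<^sub>k / P\<^sub>0\<close> can be replaced by the mean over the circle of
  \<open>e\<^bsub>k/\<rho> + \<gamma>(z)\<^esub> / P\<^sub>0(k/\<rho> + \<gamma>(z))\<close>, a constant coefficient parametrix that needs neither Hahn-Banach nor a
  fundamental solution. Applying \<open>P(x,D)\<close> to a superposition with coefficients \<open>f\<close> gives
  \<open>\<Sum>\<^sub>k f\<^sub>k e\<^sub>k (1 + H\<^sub>k)\<close>, where \<open>H\<^sub>k\<close> consists of the terms \<open>c\<^sub>j P\<^sub>j / P\<^sub>0\<close> and is small in \<open>C\<^sup>q\<close>: by (h5) because
  \<open>c\<^sub>j(x0) = 0\<close> and \<open>\<rho>\<close> is small, by (h6) for every \<open>q\<close> because of the factor \<open>\<epsilon>\<^sup>a\<close>. On Fourier coefficients the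
  equation becomes \<open>(1 + S) f = v\<close> with a matrix \<open>S\<close> of norm at most \<open>1/2\<close> on polynomially weighted
  spaces, solved by Neumann iteration. All truncation parameters are of size \<open>exp (1/\<epsilon>)\<close>, which makes the errors
  negligible and keeps the bounds moderate. The functional \<open>T\<close> is integration against the resulting function.
\<close>

section \<open>Smooth functions\<close>

text \<open>The obstacle is uniformity in \<epsilon>: about the polynomials
  \<open>Pn 0 \<epsilon>\<close> only a lower bound of the weight is known, so dividing by them may
  cost no more than constants of the degree and the dimension. The circles achieve this. Along the
  curve z -> (z^((m+1)^i))_i a polynomial of degree m becomes a polynomial in one variable with the
  same coefficients; each root spoils at most one of finitely many integer radii, and away from the
  roots the polynomial dominates its coefficients, here the Taylor coefficients at the frequency.
  The curve is at 0 for z = 0, so by the mean value property the averaged exponential is 1; roots of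
  unity turn the circle mean into a finite sum. Dividing P_j by P_0 at the same shifted point leaves
  only \<lambda>_j, so the matrix loses no power of the frequency. The inverse of P_0 alone loses m
  powers; they enter the order of the solution, not the iteration. Row sums need n+1 powers for
  summation and N more for moving a weight of order N, which explains the N+n+1 derivatives of the
  coefficients.\<close>

lemma pd_eq: "(f has_derivative f') (at x) \<Longrightarrow> pd i f x = f' (axis i 1)"
  unfolding pd_def using frechet_derivative_at by metis

lemma pd_add:
  assumes "f differentiable at x" "g differentiable at x"
  shows "pd i (\<lambda>x. f x + g x) x = pd i f x + pd i g x"
  using pd_eq[OF has_derivative_add[OF assms[unfolded frechet_derivative_works]]]
  by (simp add: pd_def)

lemma pd_mult:
  assumes "f differentiable at x" "g differentiable at x"
  shows "pd i (\<lambda>x. f x * g x) x = f x * pd i g x + pd i f x * g x"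
  using pd_eq[OF has_derivative_mult[OF assms[unfolded frechet_derivative_works]]]
  by (simp add: pd_def)

lemma pd_const [simp]: "pd i (\<lambda>x. c) x = 0"
  by (simp add: pd_eq[OF has_derivative_const])

lemma differentiable_transform_open:
  assumes "open S" "x \<in> S" "\<And>y. y \<in> S \<Longrightarrow> f y = g y" "g differentiable at x"
  shows "f differentiable at x"
proof -
  obtain D where "(g has_derivative D) (at x)" using assms(4) unfolding differentiable_def by blast
  then have "(f has_derivative D) (at x)"
    by (rule has_derivative_transform_within_open[OF _ assms(1,2)]) (simp add: assms(3))
  then show ?thesis unfolding differentiable_def by blast
qed

lemma pd_cong_open:
  assumes "open S" "x \<in> S" "\<And>y. y \<in> S \<Longrightarrow> f y = g y"
  shows "pd i f x = pd i g x"
proof -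
  have "(f has_derivative D) (at x) \<longleftrightarrow> (g has_derivative D) (at x)" for D
    using assms has_derivative_transform_within_open by metis
  then show ?thesis by (simp add: pd_def frechet_derivative_def)
qed

lemma pds_cong_open:
  assumes "open S" "\<And>y. y \<in> S \<Longrightarrow> f y = g y" "x \<in> S"
  shows "foldr pd is f x = foldr pd is g x"
  using assms(3)
proof (induction "is" arbitrary: x)
  case (Cons i "is")
  then show ?case by (simp, intro pd_cong_open[OF assms(1)]) auto
qed (simp add: assms)

lemma smooth_onD: "smooth_on S f \<Longrightarrow> x \<in> S \<Longrightarrow> foldr pd is f differentiable at x"
  by (simp add: smooth_on_def)

lemma smooth_on_differentiable: "smooth_on S f \<Longrightarrow> x \<in> S \<Longrightarrow> f differentiable at x"
  using smooth_onD[of S f x "[]"] by simp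

lemma smooth_on_pds: "smooth_on S f \<Longrightarrow> smooth_on S (foldr pd is f)"
  unfolding smooth_on_def foldr_append[symmetric, THEN fun_cong, unfolded comp_def]
  by (metis foldr_append comp_apply)

lemma smooth_on_pd: "smooth_on S f \<Longrightarrow> smooth_on S (pd i f)"
  using smooth_on_pds[of S f "[i]"] by simp

lemma smooth_on_subset: "smooth_on S f \<Longrightarrow> T \<subseteq> S \<Longrightarrow> smooth_on T f"
  by (auto simp: smooth_on_def)

lemma smooth_on_cong:
  assumes "open S" "\<And>y. y \<in> S \<Longrightarrow> f y = g y" "smooth_on S g"
  shows "smooth_on S f"
  unfolding smooth_on_def
proof (intro allI ballI)
  fix "is" x assume x: "x \<in> S"
  show "foldr pd is f differentiable at x"
    by (rule differentiable_transform_open[OF assms(1) x pds_cong_open[OF assms(1,2)]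
          smooth_onD[OF assms(3) x]])
qed

lemma smooth_on_Un:
  assumes "smooth_on S f" "smooth_on T f"
  shows "smooth_on (S \<union> T) f"
  using assms by (auto simp: smooth_on_def)

lemma smooth_on_continuous_on: "smooth_on S f \<Longrightarrow> continuous_on S f"
  by (meson continuous_at_imp_continuous_on differentiable_imp_continuous_within smooth_on_differentiable)

inductive_set alg :: "(real^'n::finite \<Rightarrow> complex) set \<Rightarrow> (real^'n \<Rightarrow> complex) set" for F where
  base: "f \<in> F \<Longrightarrow> f \<in> alg F"
| const: "(\<lambda>_. c) \<in> alg F"
| add: "f \<in> alg F \<Longrightarrow> g \<in> alg F \<Longrightarrow> (\<lambda>x. f x + g x) \<in> alg F"
| mult: "f \<in> alg F \<Longrightarrow> g \<in> alg F \<Longrightarrow> (\<lambda>x. f x * g x) \<in> alg F"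

text \<open>Coinduction up to algebra operations: it suffices that the generators are differentiable with
  derivatives in the algebra they generate.\<close>

lemma smooth_on_alg:
  assumes S: "open S"
    and diff: "\<And>f x. f \<in> F \<Longrightarrow> x \<in> S \<Longrightarrow> f differentiable at x"
    and closed: "\<And>f i. f \<in> F \<Longrightarrow> \<exists>g\<in>alg F. \<forall>x\<in>S. pd i f x = g x"
    and f: "f \<in> alg F"
  shows "smooth_on S f"
proof -
  have 1: "(\<forall>x\<in>S. f differentiable at x) \<and> (\<forall>i. \<exists>g\<in>alg F. \<forall>x\<in>S. pd i f x = g x)"
    if "f \<in> alg F" for f
    using that
  proof induction
    case (base f)
    then show ?case using diff closed by blast
  next
    case (const c)
    then show ?case by (auto intro!: bexI[of _ "\<lambda>_. 0"] alg.const)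
  next
    case (add f g)
    have "\<exists>h\<in>alg F. \<forall>x\<in>S. pd i (\<lambda>x. f x + g x) x = h x" for i
    proof -
      obtain f' g' where "f' \<in> alg F" "g' \<in> alg F" "\<forall>x\<in>S. pd i f x = f' x" "\<forall>x\<in>S. pd i g x = g' x"
        using add.IH by blast
      then show ?thesis using add.IH
        by (intro bexI[of _ "\<lambda>x. f' x + g' x"]) (auto simp: pd_add intro: alg.add)
    qed
    then show ?case using add.IH by auto
  next
    case (mult f g)
    have "\<exists>h\<in>alg F. \<forall>x\<in>S. pd i (\<lambda>x. f x * g x) x = h x" for i
    proof -
      obtain f' g' where "f' \<in> alg F" "g' \<in> alg F" "\<forall>x\<in>S. pd i f x = f' x" "\<forall>x\<in>S. pd i g x = g' x"
        using mult.IH by blast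
      then show ?thesis using mult.IH mult.hyps
        by (intro bexI[of _ "\<lambda>x. f x * g' x + f' x * g x"]) (auto simp: pd_mult intro: alg.intros)
    qed
    then show ?case using mult.IH by auto
  qed
  \<comment> \<open>Iterated derivatives agree with elements of the algebra only on S. As S is open,
    this is enough to differentiate once more.\<close>
  have "\<exists>g\<in>alg F. \<forall>x\<in>S. foldr pd is f x = g x" for "is"
  proof (induction "is")
    case (Cons i "is")
    then obtain g where g: "g \<in> alg F" "\<forall>x\<in>S. foldr pd is f x = g x" by blast
    obtain h where "h \<in> alg F" "\<forall>x\<in>S. pd i g x = h x" using 1 g by blast
    moreover have "pd i (foldr pd is f) x = pd i g x" if "x \<in> S" for x
      by (rule pd_cong_open[OF S that]) (use g(2) in blast)
    ultimately show ?case by (intro bexI[of _ h]) auto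
  qed (use f in auto)
  note 2 = this
  show ?thesis unfolding smooth_on_def
  proof (intro allI ballI)
    fix "is" x assume x: "x \<in> S"
    obtain g where g: "g \<in> alg F" "\<forall>x\<in>S. foldr pd is f x = g x" using 2 by blast
    show "foldr pd is f differentiable at x"
      by (rule differentiable_transform_open[OF S x, of _ g]) (use g 1 x in auto)
  qed
qed

lemma smooth_on_alg_smooth:
  assumes "open S" "f \<in> alg {f. smooth_on S f}"
  shows "smooth_on S f"
proof (rule smooth_on_alg[OF assms(1) _ _ assms(2)])
  show "\<exists>g\<in>alg {f. smooth_on S f}. \<forall>x\<in>S. pd i f x = g x" if "f \<in> {f. smooth_on S f}" for f i
    by (rule bexI[of _ "pd i f"]) (use that smooth_on_pd in \<open>auto intro: alg.base\<close>)
qed (simp add: smooth_on_differentiable)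

context
  fixes S :: "(real^'n::finite) set"
  assumes S: "open S"
begin

lemma smooth_on_const: "smooth_on S (\<lambda>_. c)"
  by (rule smooth_on_alg_smooth[OF S alg.const])

lemma smooth_on_add: "smooth_on S f \<Longrightarrow> smooth_on S g \<Longrightarrow> smooth_on S (\<lambda>x. f x + g x)"
  by (rule smooth_on_alg_smooth[OF S alg.add]) (auto intro: alg.base)

lemma smooth_on_mult: "smooth_on S f \<Longrightarrow> smooth_on S g \<Longrightarrow> smooth_on S (\<lambda>x. f x * g x)"
  by (rule smooth_on_alg_smooth[OF S alg.mult]) (auto intro: alg.base)

lemma smooth_on_minus: "smooth_on S f \<Longrightarrow> smooth_on S (\<lambda>x. - f x)"
  using smooth_on_mult[OF smooth_on_const[of "-1"]] by simp

lemma smooth_on_diff: "smooth_on S f \<Longrightarrow> smooth_on S g \<Longrightarrow> smooth_on S (\<lambda>x. f x - g x)"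
  using smooth_on_add[OF _ smooth_on_minus] by simp

lemma smooth_on_sum: "(\<And>i. i \<in> I \<Longrightarrow> smooth_on S (f i)) \<Longrightarrow> smooth_on S (\<lambda>x. \<Sum>i\<in>I. f i x)"
  by (induction I rule: infinite_finite_induct) (auto intro: smooth_on_const smooth_on_add)

lemma smooth_on_inverse:
  assumes f: "smooth_on S f" and nz: "\<And>x. x \<in> S \<Longrightarrow> f x \<noteq> 0"
  shows "smooth_on S (\<lambda>x. inverse (f x))"
\<comment> \<open>Generators are 1/f and all smooth functions. The derivative of 1/f is -(1/f) f'
  (1/f), which lies in the algebra although 1/f is not yet known to be smooth.\<close>
proof (rule smooth_on_alg[OF S, where F = "insert (\<lambda>x. inverse (f x)) {f. smooth_on S f}"])
  let ?F = "insert (\<lambda>x. inverse (f x)) {f. smooth_on S f}"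
  have D: "((\<lambda>x. inverse (f x)) has_derivative
      (\<lambda>h. - (inverse (f x) * frechet_derivative f (at x) h * inverse (f x)))) (at x)" if "x \<in> S" for x
    using smooth_on_differentiable[OF f that] nz[OF that]
    by (intro Deriv.has_derivative_inverse) (auto simp: frechet_derivative_works)
  show "g differentiable at x" if "g \<in> ?F" "x \<in> S" for g x
    using that D smooth_on_differentiable by (auto simp: differentiable_def)
  show "\<exists>h\<in>alg ?F. \<forall>x\<in>S. pd i g x = h x" if g: "g \<in> ?F" for g i
  proof (cases "g = (\<lambda>x. inverse (f x))")
    case True
    have "pd i g x = (-1) * ((inverse (f x) * pd i f x) * inverse (f x))" if "x \<in> S" for x
      using pd_eq[OF D[OF that]] by (simp add: True) (simp add: pd_def)
    moreover have "(\<lambda>x. inverse (f x)) \<in> alg ?F" "pd i f \<in> alg ?F"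
      using smooth_on_pd[OF f] by (auto intro: alg.base)
    then have "(\<lambda>x. (-1) * ((inverse (f x) * pd i f x) * inverse (f x))) \<in> alg ?F"
      by (intro alg.mult[OF alg.const alg.mult[OF alg.mult]])
    ultimately show ?thesis by (rule_tac bexI) auto
  next
    case False
    then have "smooth_on S g" using g by auto
    then show ?thesis by (intro bexI[of _ "pd i g"]) (auto intro: alg.base smooth_on_pd)
  qed
  show "(\<lambda>x. inverse (f x)) \<in> alg ?F" by (auto intro: alg.base)
qed

end

lemma pd_coordinate [simp]: "pd i (\<lambda>x. complex_of_real (x $ j)) x = (if i = j then 1 else 0)"
proof -
  have "((\<lambda>x. complex_of_real (x $ j)) has_derivative (\<lambda>h. complex_of_real (h $ j))) (at x)"
    by (intro bounded_linear_imp_has_derivative bounded_linear_compose[OF bounded_linear_of_real bounded_linear_vec_nth])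
  from pd_eq[OF this] show ?thesis by (auto simp: axis_def)
qed

lemma smooth_on_coordinate:
  assumes "open S" shows "smooth_on S (\<lambda>x. complex_of_real (x $ j))"
proof (rule smooth_on_alg[OF assms, where F = "{\<lambda>x. complex_of_real (x $ j)}"])
  show "\<exists>g\<in>alg {\<lambda>x. complex_of_real (x $ j)}. \<forall>x\<in>S. pd i f x = g x"
    if "f \<in> {\<lambda>x. complex_of_real (x $ j)}" for f i
    using that by (intro bexI[of _ "\<lambda>_. if i = j then 1 else 0"] alg.const) auto
  have "(\<lambda>x. complex_of_real (x $ j)) differentiable at x" for x
    by (rule differentiableI, rule bounded_linear_imp_has_derivative,
        rule bounded_linear_compose[OF bounded_linear_of_real bounded_linear_vec_nth])
  then show "\<And>f x. f \<in> {\<lambda>x. complex_of_real (x $ j)} \<Longrightarrow> x \<in> S \<Longrightarrow> f differentiable at x"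
    by auto
qed (auto intro: alg.base)

section \<open>Linearity, scaling and symmetry of iterated derivatives\<close>

lemma pds_add:
  assumes "open S" "smooth_on S f" "smooth_on S g" "x \<in> S"
  shows "foldr pd is (\<lambda>x. f x + g x) x = foldr pd is f x + foldr pd is g x"
  using assms(4)
proof (induction "is" arbitrary: x)
  case (Cons i "is")
  have "pd i (foldr pd is (\<lambda>x. f x + g x)) x = pd i (\<lambda>x. foldr pd is f x + foldr pd is g x) x"
    by (rule pd_cong_open[OF assms(1) Cons.prems]) (rule Cons.IH)
  then show ?case by (simp add: pd_add smooth_onD[OF assms(2) Cons.prems] smooth_onD[OF assms(3) Cons.prems])
qed simp

lemma pds_cmult:
  assumes "open S" "smooth_on S f" "x \<in> S"
  shows "foldr pd is (\<lambda>x. c * f x) x = c * foldr pd is f x"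
  using assms(3)
proof (induction "is" arbitrary: x)
  case (Cons i "is")
  have "pd i (foldr pd is (\<lambda>x. c * f x)) x = pd i (\<lambda>x. c * foldr pd is f x) x"
    by (rule pd_cong_open[OF assms(1) Cons.prems]) (rule Cons.IH)
  then show ?case by (simp add: pd_mult smooth_onD[OF assms(2) Cons.prems])
qed simp

lemma pds_zero: "foldr pd is (\<lambda>x. 0) x = 0"
proof (induction "is" arbitrary: x)
  case (Cons i "is")
  have "foldr pd is (\<lambda>x. 0) = (\<lambda>_. 0)" by (rule ext) (rule Cons)
  then show ?case by simp
qed simp

lemma pds_sum:
  assumes "open S" "\<And>i. i \<in> I \<Longrightarrow> smooth_on S (f i)" "x \<in> S"
  shows "foldr pd is (\<lambda>x. \<Sum>i\<in>I. f i x) x = (\<Sum>i\<in>I. foldr pd is (f i) x)"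
  using assms(2)
  by (induction I rule: infinite_finite_induct)
     (simp_all add: pds_zero pds_add[OF assms(1) _ smooth_on_sum[OF assms(1)] assms(3)])

lemma pds_diff:
  assumes "open S" "smooth_on S f" "smooth_on S g" "x \<in> S"
  shows "foldr pd is (\<lambda>x. f x - g x) x = foldr pd is f x - foldr pd is g x"
  using pds_add[OF assms(1,2) smooth_on_minus[OF assms(1,3)] assms(4), of "is"] pds_cmult[OF assms(1,3,4), of "is" "-1"]
  by simp

lemma pds_affine:
  fixes f :: "real^'n::finite \<Rightarrow> complex"
  assumes "open S" "smooth_on S f" "a + r *\<^sub>R y \<in> S"
  shows "foldr pd is (\<lambda>y. f (a + r *\<^sub>R y)) y = of_real r ^ length is * foldr pd is f (a + r *\<^sub>R y)"
  using assms(3)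
proof (induction "is" arbitrary: y)
  case (Cons i "is")
  let ?g = "foldr pd is f" and ?h = "\<lambda>y. a + r *\<^sub>R y"
  have oS: "open {y. ?h y \<in> S}"
    by (rule open_vimage[OF assms(1), of ?h, unfolded vimage_def]) (intro continuous_intros)
  have D: "(?g has_derivative frechet_derivative ?g (at (?h y))) (at (?h y))"
    using smooth_onD[OF assms(2) Cons.prems] frechet_derivative_works by blast
  have "(?h has_derivative (\<lambda>h. r *\<^sub>R h)) (at y)" by (auto intro!: derivative_eq_intros)
  from has_derivative_compose[OF this D]
  have D2: "((\<lambda>y. ?g (?h y)) has_derivative (\<lambda>h. frechet_derivative ?g (at (?h y)) (r *\<^sub>R h))) (at y)" .
  have "pd i (foldr pd is (\<lambda>y. f (?h y))) y = pd i (\<lambda>y. of_real r ^ length is * ?g (?h y)) y"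
    using Cons by (intro pd_cong_open[OF oS]) auto
  also have "\<dots> = of_real r ^ length is * pd i (\<lambda>y. ?g (?h y)) y"
    using D2 by (subst pd_mult) (auto simp: differentiable_def)
  also have "pd i (\<lambda>y. ?g (?h y)) y = of_real r * pd i ?g (?h y)"
    using pd_eq[OF D2, of i] pd_eq[OF D, of i] linear_scale[OF has_derivative_linear[OF D]]
    by (simp add: scaleR_conv_of_real)
  finally show ?case by simp
qed simp

lemma smooth_on_affine:
  fixes f :: "real^'n::finite \<Rightarrow> complex"
  assumes "open S" "smooth_on S f"
  shows "smooth_on {y. a + r *\<^sub>R y \<in> S} (\<lambda>y. f (a + r *\<^sub>R y))"
  unfolding smooth_on_def
proof (intro allI ballI)
  fix "is" y assume y: "y \<in> {y. a + r *\<^sub>R y \<in> S}"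
  let ?g = "foldr pd is f" and ?h = "\<lambda>y. a + r *\<^sub>R y"
  have oS: "open {y. ?h y \<in> S}"
    by (rule open_vimage[OF assms(1), of ?h, unfolded vimage_def]) (intro continuous_intros)
  have "?h differentiable at y" by (auto intro!: derivative_intros)
  moreover have "?g differentiable at (?h y)" using smooth_onD[OF assms(2)] y by blast
  ultimately have "(\<lambda>y. ?g (?h y)) differentiable at y"
    using differentiable_chain_at[of ?h y ?g] by (simp add: comp_def)
  then have "(\<lambda>y. of_real r ^ length is * ?g (?h y)) differentiable at y" by (intro derivative_intros) auto
  then show "foldr pd is (\<lambda>y. f (a + r *\<^sub>R y)) differentiable at y"
    by (rule differentiable_transform_open[OF oS y, rotated]) (rule pds_affine[OF assms], simp)
qed

text \<open>Symmetry by integration: the fundamental theorem of calculus along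
  \<open>axis j 1\<close> is differentiated under the integral sign in the direction
  \<open>axis i 1\<close>, and the resulting integral is then differentiated in its upper
  limit.\<close>

lemma pd_commute:
  fixes f :: "real^'n::finite \<Rightarrow> complex"
  assumes S: "open S" and f: "smooth_on S f" and x: "x \<in> S"
  shows "pd i (pd j f) x = pd j (pd i f) x"
proof -
  obtain d where d: "d > 0" "cball x d \<subseteq> S" using S x open_contains_cball by blast
  define r where "r = d / 2"
  have r: "r > 0" using d by (simp add: r_def)
  let ?p = "\<lambda>s t. x + s *\<^sub>R axis i 1 + t *\<^sub>R axis j (1::real)"
  have inS: "?p s t \<in> S" if "\<bar>s\<bar> \<le> r" "\<bar>t\<bar> \<le> r" for s t
  proof -
    have "norm (s *\<^sub>R axis i 1 + t *\<^sub>R axis j (1::real)) \<le> \<bar>s\<bar> + \<bar>t\<bar>"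
      by (rule order_trans[OF norm_triangle_ineq]) simp
    then have "dist (x + (s *\<^sub>R axis i 1 + t *\<^sub>R axis j (1::real))) x \<le> d" using that by (simp add: dist_norm r_def)
    then have "?p s t \<in> cball x d" by (simp add: dist_commute add.assoc)
    then show ?thesis using d by blast
  qed
  have Dt: "((\<lambda>t. g (?p s t)) has_vector_derivative pd j g (?p s t)) (at t within T)"
    if "smooth_on S g" "\<bar>s\<bar> \<le> r" "\<bar>t\<bar> \<le> r" for g s t T
  proof -
    have "(g has_derivative frechet_derivative g (at (?p s t))) (at (?p s t))"
      using smooth_on_differentiable[OF that(1) inS[OF that(2,3)]] frechet_derivative_works by blast
    moreover have "((\<lambda>t. ?p s t) has_derivative (\<lambda>h. h *\<^sub>R axis j 1)) (at t within T)"
      by (auto intro!: derivative_eq_intros)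
    ultimately
    have "((\<lambda>t. g (?p s t)) has_derivative (\<lambda>h. frechet_derivative g (at (?p s t)) (h *\<^sub>R axis j 1))) (at t within T)"
      using has_derivative_compose[of "\<lambda>t. ?p s t"] by blast
    then show ?thesis unfolding has_vector_derivative_def pd_def
      using linear_scale[OF linear_frechet_derivative[OF smooth_on_differentiable[OF that(1) inS[OF that(2,3)]]]] by simp
  qed
  have Ds: "((\<lambda>s. g (?p s t)) has_vector_derivative pd i g (?p s t)) (at s within T)"
    if "smooth_on S g" "\<bar>s\<bar> \<le> r" "\<bar>t\<bar> \<le> r" for g s t T
  proof -
    have "(g has_derivative frechet_derivative g (at (?p s t))) (at (?p s t))"
      using smooth_on_differentiable[OF that(1) inS[OF that(2,3)]] frechet_derivative_works by blast
    moreover have "((\<lambda>s. ?p s t) has_derivative (\<lambda>h. h *\<^sub>R axis i 1)) (at s within T)"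
      by (auto intro!: derivative_eq_intros)
    ultimately
    have "((\<lambda>s. g (?p s t)) has_derivative (\<lambda>h. frechet_derivative g (at (?p s t)) (h *\<^sub>R axis i 1))) (at s within T)"
      using has_derivative_compose[of "\<lambda>s. ?p s t"] by blast
    then show ?thesis unfolding has_vector_derivative_def pd_def
      using linear_scale[OF linear_frechet_derivative[OF smooth_on_differentiable[OF that(1) inS[OF that(2,3)]]]] by simp
  qed
  have pc: "continuous_on ({-r..r} \<times> {-r..r}) (\<lambda>(s, t). g (?p s t))" if "smooth_on S g" for g
    unfolding case_prod_beta
    by (rule continuous_on_compose2[OF smooth_on_continuous_on[OF that]])
       (auto intro!: continuous_intros inS)
  have key: "pd i f (?p 0 t) = pd i f (?p 0 0) + integral {0..t} (\<lambda>\<tau>. pd i (pd j f) (?p 0 \<tau>))"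
    if t: "t \<in> {0..r}" for t
  proof -
    have I: "((\<lambda>\<tau>. pd j f (?p s \<tau>)) has_integral (f (?p s t) - f (?p s 0))) {0..t}" if "\<bar>s\<bar> \<le> r" for s
      using that t by (intro fundamental_theorem_of_calculus Dt f) auto
    have "((\<lambda>s. integral (cbox 0 t) (\<lambda>\<tau>. pd j f (?p s \<tau>))) has_vector_derivative
        integral (cbox 0 t) (\<lambda>\<tau>. pd i (pd j f) (?p 0 \<tau>))) (at 0 within {-r..r})"
    proof (rule leibniz_rule_vector_derivative)
      show "((\<lambda>s. pd j f (?p s \<tau>)) has_vector_derivative pd i (pd j f) (?p s \<tau>)) (at s within {-r..r})"
        if "s \<in> {-r..r}" "\<tau> \<in> cbox 0 t" for s \<tau>
        using that t by (intro Ds smooth_on_pd[OF f]) auto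
      show "(\<lambda>\<tau>. pd j f (?p s \<tau>)) integrable_on cbox 0 t" if "s \<in> {-r..r}" for s
        using has_integral_integrable[OF I[of s]] that by auto
      show "continuous_on ({-r..r} \<times> cbox 0 t) (\<lambda>(s, \<tau>). pd i (pd j f) (?p s \<tau>))"
        by (rule continuous_on_subset[OF pc[OF smooth_on_pd[OF smooth_on_pd[OF f]]]]) (use t in auto)
    qed (use r in auto)
    moreover have "integral (cbox 0 t) (\<lambda>\<tau>. pd j f (?p s \<tau>)) = f (?p s t) - f (?p s 0)" if "s \<in> {-r..r}" for s
      using I[of s] that by (intro integral_unique) auto
    ultimately have "((\<lambda>s. f (?p s t) - f (?p s 0)) has_vector_derivative
        integral {0..t} (\<lambda>\<tau>. pd i (pd j f) (?p 0 \<tau>))) (at 0 within {-r..r})"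
      using r by (auto elim!: has_vector_derivative_transform[rotated 2])
    moreover have "((\<lambda>s. f (?p s t) - f (?p s 0)) has_vector_derivative (pd i f (?p 0 t) - pd i f (?p 0 0))) (at 0 within {-r..r})"
      using t r by (intro has_vector_derivative_diff Ds f) auto
    ultimately have "integral {0..t} (\<lambda>\<tau>. pd i (pd j f) (?p 0 \<tau>)) = pd i f (?p 0 t) - pd i f (?p 0 0)"
      using r by (intro vector_derivative_unique_within_closed_interval[of "-r" r 0]) auto
    then show ?thesis by simp
  qed
  have "((\<lambda>t. pd i f (?p 0 0) + integral {0..t} (\<lambda>\<tau>. pd i (pd j f) (?p 0 \<tau>))) has_vector_derivative
      0 + pd i (pd j f) (?p 0 0)) (at 0 within {0..r})"
  proof (intro has_vector_derivative_add has_vector_derivative_const integral_has_vector_derivative)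
    show "continuous_on {0..r} (\<lambda>\<tau>. pd i (pd j f) (?p 0 \<tau>))"
      by (rule continuous_on_compose2[OF smooth_on_continuous_on[OF smooth_on_pd[OF smooth_on_pd[OF f]]]])
         (use r inS[of 0] in \<open>auto intro!: continuous_intros\<close>)
  qed (use r in auto)
  then have "((\<lambda>t. pd i f (?p 0 t)) has_vector_derivative pd i (pd j f) (?p 0 0)) (at 0 within {0..r})"
    using r key by (auto elim!: has_vector_derivative_transform[rotated 2])
  moreover have "((\<lambda>t. pd i f (?p 0 t)) has_vector_derivative pd j (pd i f) (?p 0 0)) (at 0 within {0..r})"
    using r by (intro Dt smooth_on_pd[OF f]) auto
  ultimately show ?thesis
    using vector_derivative_unique_within_closed_interval[of 0 r 0] r by fastforce
qed

lemma pds_insert: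
  assumes "open S" "smooth_on S f" "x \<in> S"
  shows "foldr pd (is @ i # js) f x = foldr pd (i # is @ js) f x"
  using assms(3)
proof (induction "is" arbitrary: x)
  case (Cons a "is")
  have "pd a (foldr pd (is @ i # js) f) x = pd a (pd i (foldr pd (is @ js) f)) x"
    using Cons by (intro pd_cong_open[OF assms(1)]) auto
  also have "\<dots> = pd i (pd a (foldr pd (is @ js) f)) x"
    by (rule pd_commute[OF assms(1) smooth_on_pds[OF assms(2)] Cons.prems])
  finally show ?case by simp
qed simp

lemma pds_perm:
  assumes "open S" "smooth_on S f" "x \<in> S" "mset is = mset js"
  shows "foldr pd is f x = foldr pd js f x"
  using assms(3,4)
proof (induction "is" arbitrary: js x)
  case (Cons i "is")
  then have "i \<in> set js" by (metis list.set_intros(1) set_mset_mset)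
  then obtain js1 js2 where js: "js = js1 @ i # js2" by (meson split_list)
  then have m: "mset is = mset (js1 @ js2)" using Cons.prems by simp
  have "foldr pd js f x = pd i (foldr pd (js1 @ js2) f) x"
    unfolding js using pds_insert[OF assms(1,2) Cons.prems(1)] by simp
  also have "\<dots> = pd i (foldr pd is f) x"
    by (rule pd_cong_open[OF assms(1) Cons.prems(1)]) (use Cons.IH[OF _ m] in auto)
  finally show ?case by simp
qed simp

section \<open>Multi-indices\<close>

text \<open>Passage from multi-indices to words in the coordinates. Estimates are stated for words,
  where one differentiation is one induction step; \<open>pds_eq_mpd\<close> leads back by sorting a
  word, which the symmetry of derivatives permits.\<close>

definition mi_list :: "('n::finite \<Rightarrow> nat) \<Rightarrow> 'n list" where
  "mi_list \<alpha> = concat (map (\<lambda>i. replicate (\<alpha> i) i) coordinates)"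

lemma coordinates: "distinct (coordinates :: 'n::finite list)" "set (coordinates :: 'n::finite list) = UNIV"
proof -
  have "\<exists>is. distinct is \<and> set is = (UNIV :: 'n set)" using finite_distinct_list[of "UNIV :: 'n set"] by auto
  from someI_ex[OF this] show "distinct (coordinates :: 'n list)" "set (coordinates :: 'n list) = UNIV"
    by (auto simp: coordinates_def)
qed

lemma pds_replicate: "foldr pd (replicate n i) f = (pd i ^^ n) f"
  by (induction n) auto

lemma mpd_eq_pds: "mpd \<alpha> f = foldr pd (mi_list \<alpha>) f"
proof -
  have "foldr (\<lambda>i. pd i ^^ \<alpha> i) is f = foldr pd (concat (map (\<lambda>i. replicate (\<alpha> i) i) is)) f" for "is"
    by (induction "is") (auto simp: pds_replicate)
  then show ?thesis by (simp add: mpd_def mi_list_def)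
qed

lemma length_mi_list: "length (mi_list \<alpha>) = mi_order \<alpha>"
  using sum_list_distinct_conv_sum_set[OF coordinates(1), of \<alpha>]
  by (simp add: mi_list_def length_concat comp_def coordinates(2) mi_order_def)

lemma count_mi_list: "count (mset (mi_list \<alpha>)) i = \<alpha> i"
proof -
  have "distinct is \<Longrightarrow> count (mset (concat (map (\<lambda>i. replicate (\<alpha> i) i) is))) i = (if i \<in> set is then \<alpha> i else 0)" for "is"
    by (induction "is") auto
  from this[OF coordinates(1)] show ?thesis by (simp add: mi_list_def coordinates(2))
qed

lemma mset_mi_list_count: "mset (mi_list (count (mset is))) = mset is"
  by (rule multiset_eqI) (simp add: count_mi_list)

lemma mi_order_count: "mi_order (count (mset is)) = length is"
  by (metis length_mi_list mset_mi_list_count size_mset)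

lemma pds_eq_mpd:
  assumes "open S" "smooth_on S f" "x \<in> S"
  shows "foldr pd is f x = mpd (count (mset is)) f x"
  unfolding mpd_eq_pds by (rule pds_perm[OF assms]) (simp add: mset_mi_list_count)

lemma finite_mi: "finite {\<alpha> :: 'n::finite \<Rightarrow> nat. mi_order \<alpha> \<le> m}"
proof (rule finite_subset)
  show "{\<alpha> :: 'n \<Rightarrow> nat. mi_order \<alpha> \<le> m} \<subseteq> PiE UNIV (\<lambda>_. {..m})"
  proof (clarsimp simp: PiE_UNIV_domain)
    fix \<alpha> :: "'n \<Rightarrow> nat" and i assume "mi_order \<alpha> \<le> m"
    moreover have "\<alpha> i \<le> mi_order \<alpha>" unfolding mi_order_def by (rule member_le_sum) auto
    ultimately show "\<alpha> i \<le> m" by simp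
  qed
qed (intro finite_PiE, auto)

section \<open>Bounds on derivatives\<close>

text \<open>A C^j bound as a relation instead of a supremum: it makes sense on noncompact sets and
  can be estimated without first proving boundedness. For compact subsets of an open domain
  \<open>sup_seminorm_le_iff\<close> translates back.\<close>

definition dbound :: "(real^'n::finite) set \<Rightarrow> nat \<Rightarrow> (real^'n \<Rightarrow> complex) \<Rightarrow> real \<Rightarrow> bool" where
  "dbound K j f B \<longleftrightarrow> (\<forall>is. \<forall>x\<in>K. length is \<le> j \<longrightarrow> norm (foldr pd is f x) \<le> B)"

lemma dboundD: "dbound K j f B \<Longrightarrow> x \<in> K \<Longrightarrow> length is \<le> j \<Longrightarrow> norm (foldr pd is f x) \<le> B"
  by (simp add: dbound_def)

lemma dboundD0: "dbound K j f B \<Longrightarrow> x \<in> K \<Longrightarrow> norm (f x) \<le> B"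
  using dboundD[of K j f B x "[]"] by simp

lemma dbound_mono:
  "dbound K j f B \<Longrightarrow> K' \<subseteq> K \<Longrightarrow> j' \<le> j \<Longrightarrow> B \<le> B' \<Longrightarrow> dbound K' j' f B'"
  unfolding dbound_def by (meson order_trans subsetD)

lemma dbound_pds: "dbound K (j + length is) f B \<Longrightarrow> dbound K j (foldr pd is f) B"
  unfolding dbound_def
  by (metis add_le_mono1 comp_apply foldr_append length_append)

lemma dbound_pd: "dbound K (Suc j) f B \<Longrightarrow> dbound K j (pd i f) B"
  using dbound_pds[of K j "[i]" f B] by simp

lemma dbound_SucI:
  fixes K :: "(real^'n::finite) set"
  assumes "\<And>x. x \<in> K \<Longrightarrow> norm (f x) \<le> B" "\<And>i. dbound K j (pd i f) B"
  shows "dbound K (Suc j) f B"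
  unfolding dbound_def
proof (intro allI ballI impI)
  fix "is" :: "'n list" and x assume *: "x \<in> K" "length is \<le> Suc j"
  show "norm (foldr pd is f x) \<le> B"
  proof (cases "is" rule: rev_cases)
    case (snoc js i)
    then show ?thesis using assms(2)[of i] * by (simp add: dbound_def)
  qed (use assms * in auto)
qed

lemma dbound_cong:
  fixes K :: "(real^'n::finite) set"
  assumes "open U" "K \<subseteq> U" "\<And>y. y \<in> U \<Longrightarrow> f y = g y" "dbound K j g B"
  shows "dbound K j f B"
  unfolding dbound_def
proof (intro allI ballI impI)
  fix "is" :: "'n list" and x assume "x \<in> K" "length is \<le> j"
  then show "norm (foldr pd is f x) \<le> B"
    using pds_cong_open[OF assms(1), of f g x "is"] assms(2-4) by (auto simp: dbound_def)
qed

lemma dbound_zero: "0 \<le> B \<Longrightarrow> dbound K j (\<lambda>_. 0) B"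
  by (simp add: dbound_def pds_zero)

lemma dbound_const: "dbound (K :: (real^'n::finite) set) j (\<lambda>_. c) (norm c)"
proof -
  have "pd i (\<lambda>_ :: real^'n. c) = (\<lambda>_. 0)" for i by (rule ext) simp
  then show ?thesis
    by (cases j) (auto intro!: dbound_SucI dbound_zero simp: dbound_def[of _ 0] simp del: pd_const)
qed

lemma dbound_add:
  fixes K :: "(real^'n::finite) set"
  assumes "open U" "K \<subseteq> U" "smooth_on U f" "smooth_on U g" "dbound K j f A" "dbound K j g B"
  shows "dbound K j (\<lambda>x. f x + g x) (A + B)"
  unfolding dbound_def
proof (intro allI ballI impI)
  fix "is" :: "'n list" and x assume *: "x \<in> K" "length is \<le> j"
  show "norm (foldr pd is (\<lambda>x. f x + g x) x) \<le> A + B"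
    using dboundD[OF assms(5) *] dboundD[OF assms(6) *] norm_triangle_ineq[of "foldr pd is f x" "foldr pd is g x"]
      pds_add[OF assms(1,3,4), of x "is"] * assms(2) by auto
qed

lemma dbound_cmult:
  fixes K :: "(real^'n::finite) set"
  assumes "open U" "K \<subseteq> U" "smooth_on U f" "dbound K j f A" "norm c * A \<le> B"
  shows "dbound K j (\<lambda>x. c * f x) B"
  unfolding dbound_def
proof (intro allI ballI impI)
  fix "is" :: "'n list" and x assume *: "x \<in> K" "length is \<le> j"
  have "norm c * norm (foldr pd is f x) \<le> norm c * A"
    by (rule mult_left_mono[OF dboundD[OF assms(4) *]]) simp
  then show "norm (foldr pd is (\<lambda>x. c * f x) x) \<le> B"
    using assms(5) pds_cmult[OF assms(1,3), of x "is" c] * assms(2) by (auto simp: norm_mult)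
qed

lemma dbound_minus:
  assumes "open U" "K \<subseteq> U" "smooth_on U f" "dbound K j f A"
  shows "dbound K j (\<lambda>x. - f x) A"
  using dbound_cmult[OF assms, of "-1" A] by simp

lemma dbound_diff:
  assumes "open U" "K \<subseteq> U" "smooth_on U f" "smooth_on U g" "dbound K j f A" "dbound K j g B"
  shows "dbound K j (\<lambda>x. f x - g x) (A + B)"
  using dbound_add[OF assms(1,2,3) smooth_on_minus[OF assms(1,4)] assms(5) dbound_minus[OF assms(1,2,4,6)]]
  by simp

lemma dbound_sum:
  assumes "open U" "K \<subseteq> U" "\<And>i. i \<in> I \<Longrightarrow> smooth_on U (f i)" "\<And>i. i \<in> I \<Longrightarrow> dbound K j (f i) (A i)"
  shows "dbound K j (\<lambda>x. \<Sum>i\<in>I. f i x) (\<Sum>i\<in>I. A i)"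
  using assms(3,4)
  by (induction I rule: infinite_finite_induct)
     (auto intro!: dbound_zero dbound_add[OF assms(1,2)] smooth_on_sum[OF assms(1)])

text \<open>Leibniz rule without binomial coefficients: each differentiation turns one product into
  two, whence the factor 2^j.\<close>

lemma dbound_mult:
  assumes "open U" "K \<subseteq> U" "smooth_on U f" "smooth_on U g" "dbound K j f A" "dbound K j g B"
  shows "dbound K j (\<lambda>x. f x * g x) (2 ^ j * A * B)"
  using assms(3-6)
proof (induction j arbitrary: f g)
  case 0
  then show ?case by (auto simp: dbound_def norm_mult intro!: mult_mono intro: order_trans[OF norm_ge_zero])
next
  case (Suc j)
  have 1: "norm (f x * g x) \<le> 2 ^ Suc j * A * B" if "x \<in> K" for x
  proof -
    have "norm (f x) \<le> A" "norm (g x) \<le> B" using dboundD0 Suc.prems that by blast+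
    then have "norm (f x * g x) \<le> A * B"
      by (auto simp: norm_mult intro!: mult_mono intro: order_trans[OF norm_ge_zero])
    moreover from this have "0 \<le> A * B" using norm_ge_zero order_trans by blast
    ultimately have "norm (f x * g x) \<le> A * B" "0 \<le> A * B" by auto
    moreover have "1 * (A * B) \<le> 2 ^ Suc j * (A * B)"
      by (rule mult_right_mono[OF one_le_power]) (use calculation in auto)
    ultimately show ?thesis by simp
  qed
  have 2: "dbound K j (pd i (\<lambda>x. f x * g x)) (2 ^ Suc j * A * B)" for i
  proof -
    have le: "dbound K j f A" "dbound K j g B"
      using Suc.prems(3,4) by (auto elim: dbound_mono)
    have "dbound K j (\<lambda>x. f x * pd i g x + pd i f x * g x) (2 ^ j * A * B + 2 ^ j * A * B)"
      using Suc.prems le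
      by (intro dbound_add[OF assms(1,2)] smooth_on_mult[OF assms(1)] Suc.IH smooth_on_pd dbound_pd) auto
    moreover have "2 ^ j * A * B + 2 ^ j * A * B = 2 ^ Suc j * A * B" by simp
    ultimately have "dbound K j (\<lambda>x. f x * pd i g x + pd i f x * g x) (2 ^ Suc j * A * B)" by metis
    then show ?thesis
      by (rule dbound_cong[OF assms(1,2), rotated])
         (use Suc.prems in \<open>auto intro!: pd_mult smooth_on_differentiable\<close>)
  qed
  show ?case by (rule dbound_SucI) (use 1 2 in auto)
qed

lemma dbound_affine:
  fixes K :: "(real^'n::finite) set"
  assumes "open U" "K \<subseteq> U" "smooth_on U f" "dbound K j f B" "\<bar>r\<bar> \<le> 1"
    and K': "\<And>y. y \<in> K' \<Longrightarrow> a + r *\<^sub>R y \<in> K"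
  shows "dbound K' j (\<lambda>y. f (a + r *\<^sub>R y)) B"
  unfolding dbound_def
proof (intro allI ballI impI)
  fix "is" :: "'n list" and y assume *: "y \<in> K'" "length is \<le> j"
  have "\<bar>r\<bar> ^ length is * norm (foldr pd is f (a + r *\<^sub>R y)) \<le> 1 * norm (foldr pd is f (a + r *\<^sub>R y))"
    by (rule mult_right_mono) (use assms(5) in \<open>auto intro: power_le_one\<close>)
  also have "\<dots> \<le> B" using dboundD[OF assms(4) K'[OF *(1)] *(2)] by simp
  finally show "norm (foldr pd is (\<lambda>y. f (a + r *\<^sub>R y)) y) \<le> B"
    using pds_affine[OF assms(1,3), of a r y "is"] K'[OF *(1)] assms(2) by (auto simp: norm_mult norm_power)
qed

lemma dbound_iff_mpd:
  fixes K :: "(real^'n::finite) set"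
  assumes "open U" "K \<subseteq> U" "smooth_on U f"
  shows "dbound K j f B \<longleftrightarrow> (\<forall>\<alpha>. \<forall>x\<in>K. mi_order \<alpha> \<le> j \<longrightarrow> norm (mpd \<alpha> f x) \<le> B)"
proof
  show "dbound K j f B \<Longrightarrow> \<forall>\<alpha>. \<forall>x\<in>K. mi_order \<alpha> \<le> j \<longrightarrow> norm (mpd \<alpha> f x) \<le> B"
    by (simp add: dbound_def mpd_eq_pds length_mi_list)
  show "dbound K j f B" if *: "\<forall>\<alpha>. \<forall>x\<in>K. mi_order \<alpha> \<le> j \<longrightarrow> norm (mpd \<alpha> f x) \<le> B"
    unfolding dbound_def
  proof (intro allI ballI impI)
    fix "is" :: "'n list" and x assume "x \<in> K" "length is \<le> j"
    then show "norm (foldr pd is f x) \<le> B"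
      using * assms(2) pds_eq_mpd[OF assms(1,3), of x "is"] by (auto simp: mi_order_count)
  qed
qed

lemma bounded_mpd:
  assumes "open U" "compact K" "K \<subseteq> U" "smooth_on U f"
  shows "bdd_above (insert 0 {norm (mpd \<alpha> f x) | \<alpha> x. mi_order \<alpha> \<le> j \<and> x \<in> K})"
proof -
  have "bounded (\<Union>\<alpha>\<in>{\<alpha>. mi_order \<alpha> \<le> j}. mpd \<alpha> f ` K)"
  proof (intro bounded_UN finite_mi ballI compact_imp_bounded compact_continuous_image assms(2))
    show "continuous_on K (mpd \<alpha> f)" for \<alpha>
      unfolding mpd_eq_pds
      by (rule continuous_on_subset[OF smooth_on_continuous_on[OF smooth_on_pds[OF assms(4)]] assms(3)])
  qed
  then obtain B where "\<forall>y\<in>(\<Union>\<alpha>\<in>{\<alpha>. mi_order \<alpha> \<le> j}. mpd \<alpha> f ` K). norm y \<le> B"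
    unfolding bounded_iff by blast
  then have "\<And>\<alpha> x. mi_order \<alpha> \<le> j \<Longrightarrow> x \<in> K \<Longrightarrow> norm (mpd \<alpha> f x) \<le> B" by blast
  then show ?thesis unfolding bdd_above_def by (intro exI[of _ "max 0 B"]) (auto simp: le_max_iff_disj)
qed

text \<open>Compactness of K makes the set of values bounded, so that \<open>Sup\<close> has its
  usual meaning; the condition 0 \<le> B comes from the inserted 0.\<close>

lemma sup_seminorm_le_iff:
  assumes "open U" "compact K" "K \<subseteq> U" "smooth_on U f"
  shows "sup_seminorm K j f \<le> B \<longleftrightarrow> 0 \<le> B \<and> dbound K j f B"
  unfolding sup_seminorm_def dbound_iff_mpd[OF assms(1,3,4)] cSup_le_iff[OF insert_not_empty bounded_mpd[OF assms]]
  by auto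

lemma sup_seminorm_nonneg:
  assumes "open U" "compact K" "K \<subseteq> U" "smooth_on U f"
  shows "0 \<le> sup_seminorm K j f"
  using sup_seminorm_le_iff[OF assms] by blast

lemma dbound_sup_seminorm:
  assumes "open U" "compact K" "K \<subseteq> U" "smooth_on U f"
  shows "dbound K j f (sup_seminorm K j f)"
  using sup_seminorm_le_iff[OF assms] by blast

lemma dbound_exists:
  assumes "open U" "compact K" "K \<subseteq> U" "smooth_on U f"
  obtains B where "B > 0" "dbound K j f B"
  using dbound_mono[OF dbound_sup_seminorm[OF assms] order_refl order_refl, of j "sup_seminorm K j f + 1"]
    sup_seminorm_nonneg[OF assms, of j] by (metis add.commute add_pos_nonneg less_add_one less_imp_le zero_less_one)

section \<open>Cutoff functions\<close>

text \<open>The functions exp(-1/t) t^(-k), extended by 0. All k occur together because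
  differentiation leads from k to k+1 and k+2.\<close>

definition flat :: "nat \<Rightarrow> real \<Rightarrow> real" where
  "flat k t = (if t > 0 then exp (- inverse t) * inverse t ^ k else 0)"

lemma flat_tendsto: "(flat k \<longlongrightarrow> 0) (at 0)"
proof -
  have "((\<lambda>t. inverse t ^ k / exp (inverse t)) \<longlongrightarrow> (0::real)) (at_right 0)"
    by (rule filterlim_compose[OF tendsto_power_div_exp_0 filterlim_inverse_at_top_right])
  then have "(flat k \<longlongrightarrow> 0) (at_right 0)"
  proof (rule tendsto_cong[THEN iffD1, rotated])
    show "\<forall>\<^sub>F t in at_right 0. inverse t ^ k / exp (inverse t) = flat k t"
      using eventually_at_right_less[of 0] by eventually_elim (simp add: flat_def exp_minus field_simps)
  qed
  moreover have "(flat k \<longlongrightarrow> 0) (at_left 0)"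
  proof (rule tendsto_cong[THEN iffD1, rotated])
    show "\<forall>\<^sub>F t in at_left 0. 0 = flat k t"
      using eventually_at_left_real[of "-1" "0::real"] by (auto elim!: eventually_mono simp: flat_def)
  qed simp
  ultimately show ?thesis by (simp add: filterlim_split_at)
qed

lemma flat_deriv: "(flat k has_real_derivative (flat (k + 2) t - real k * flat (Suc k) t)) (at t)"
proof -
  consider "t > 0" | "t < 0" | "t = 0" by linarith
  then show ?thesis
  proof cases
    case 1
    have "((\<lambda>t. exp (- inverse t) * inverse t ^ k) has_real_derivative (flat (k + 2) t - real k * flat (Suc k) t)) (at t)"
    proof (cases k)
      case (Suc n)
      have "real k * inverse t ^ (k - 1) * (inverse t)\<^sup>2 = real k * inverse t ^ Suc k"
        by (simp add: Suc power2_eq_square)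
      then show ?thesis
        using 1 by (auto intro!: derivative_eq_intros simp: flat_def power2_eq_square algebra_simps)
    qed (use 1 in \<open>auto intro!: derivative_eq_intros simp: flat_def power2_eq_square\<close>)
    then show ?thesis
      by (rule has_field_derivative_transform_within_open[where S = "{0<..}"]) (use 1 in \<open>auto simp: flat_def\<close>)
  next
    case 2
    have "((\<lambda>_. 0) has_real_derivative (flat (k + 2) t - real k * flat (Suc k) t)) (at t)"
      using 2 by (auto simp: flat_def)
    then show ?thesis
      by (rule has_field_derivative_transform_within_open[where S = "{..<0}"]) (use 2 in \<open>auto simp: flat_def\<close>)
  next
    case 3
    \<comment> \<open>Dividing by h raises the index by one, so the derivative at 0 is the limit of
      \<open>flat (Suc k)\<close>, which is 0.\<close>
    have "(\<lambda>h. (flat k h - flat k 0) / h) = flat (Suc k)" by (auto simp: flat_def field_simps)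
    then show ?thesis using flat_tendsto[of "Suc k"] 3 by (simp add: DERIV_def flat_def)
  qed
qed

text \<open>By the recursion in \<open>flat_deriv\<close> the compositions of all
  \<open>flat k\<close> with g, together with the smooth functions, generate an algebra that is
  closed under differentiation.\<close>

lemma smooth_on_flat:
  fixes g :: "real^'n::finite \<Rightarrow> real"
  assumes g: "smooth_on UNIV (\<lambda>x. complex_of_real (g x))"
  shows "smooth_on UNIV (\<lambda>x. complex_of_real (flat k (g x)))"
proof -
  define F where "F = range (\<lambda>k x. complex_of_real (flat k (g x))) \<union> {f. smooth_on UNIV f}"
  have D: "((\<lambda>x. complex_of_real (flat k (g x))) has_derivative
      (\<lambda>h. complex_of_real ((flat (k + 2) (g x) - real k * flat (Suc k) (g x)) * Re (frechet_derivative (\<lambda>x. complex_of_real (g x)) (at x) h)))) (at x)"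
    and D2: "pd i (\<lambda>x. complex_of_real (g x)) x =
        complex_of_real (Re (frechet_derivative (\<lambda>x. complex_of_real (g x)) (at x) (axis i 1)))" for k x i
  proof -
    have "((\<lambda>x. complex_of_real (g x)) has_derivative frechet_derivative (\<lambda>x. complex_of_real (g x)) (at x)) (at x)"
      using smooth_on_differentiable[OF g, of x] frechet_derivative_works by auto
    from bounded_linear.has_derivative[OF bounded_linear_Re this]
    have gD: "(g has_derivative (\<lambda>h. Re (frechet_derivative (\<lambda>x. complex_of_real (g x)) (at x) h))) (at x)" by simp
    have fl: "(flat k has_derivative (\<lambda>h. (flat (k + 2) (g x) - k * flat (Suc k) (g x)) * h)) (at (g x))"
      using flat_deriv[of k "g x"] by (simp add: has_field_derivative_def)
    show "((\<lambda>x. complex_of_real (flat k (g x))) has_derivative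
      (\<lambda>h. complex_of_real ((flat (k + 2) (g x) - real k * flat (Suc k) (g x)) * Re (frechet_derivative (\<lambda>x. complex_of_real (g x)) (at x) h)))) (at x)"
      by (rule bounded_linear.has_derivative[OF bounded_linear_of_real has_derivative_compose[OF gD fl]])
    show "pd i (\<lambda>x. complex_of_real (g x)) x =
        complex_of_real (Re (frechet_derivative (\<lambda>x. complex_of_real (g x)) (at x) (axis i 1)))"
      by (rule pd_eq[OF bounded_linear.has_derivative[OF bounded_linear_of_real gD]])
  qed
  show ?thesis
  proof (rule smooth_on_alg[where F = F])
    show "f differentiable at x" if fF: "f \<in> F" for f x
    proof (cases "smooth_on UNIV f")
      case True
      then show ?thesis by (rule smooth_on_differentiable) simp
    next
      case False
      then obtain k where "f = (\<lambda>x. complex_of_real (flat k (g x)))" using fF unfolding F_def by blast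
      then show ?thesis using D by (auto simp: differentiable_def)
    qed
    show "\<exists>h\<in>alg F. \<forall>x\<in>UNIV. pd i f x = h x" if fF: "f \<in> F" for f i
    proof (cases "smooth_on UNIV f")
      case True
      then show ?thesis by (intro bexI[of _ "pd i f"]) (auto simp: F_def intro: alg.base smooth_on_pd)
    next
      case False
      then obtain k where f: "f = (\<lambda>x. complex_of_real (flat k (g x)))" using fF unfolding F_def by blast
      have fl: "(\<lambda>x. complex_of_real (flat k (g x))) \<in> alg F" for k by (auto simp: F_def intro: alg.base)
      have g': "pd i (\<lambda>x. complex_of_real (g x)) \<in> alg F" using smooth_on_pd[OF g] by (auto simp: F_def intro: alg.base)
      have "(\<lambda>x. (complex_of_real (flat (k + 2) (g x)) + (- of_nat k) * complex_of_real (flat (Suc k) (g x)))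
          * pd i (\<lambda>x. complex_of_real (g x)) x) \<in> alg F"
        by (rule alg.mult[OF alg.add[OF fl alg.mult[OF alg.const fl]] g'])
      moreover have "pd i f x = (complex_of_real (flat (k + 2) (g x)) + (- of_nat k) * complex_of_real (flat (Suc k) (g x)))
          * pd i (\<lambda>x. complex_of_real (g x)) x" for x
        unfolding f D2 pd_eq[OF D] by simp
      then have "\<forall>x\<in>UNIV. pd i f x = (complex_of_real (flat (k + 2) (g x)) + (- of_nat k) * complex_of_real (flat (Suc k) (g x)))
          * pd i (\<lambda>x. complex_of_real (g x)) x" by simp
      ultimately show ?thesis by (rule_tac bexI[rotated])
    qed
  qed (auto simp: F_def intro: alg.base)
qed

text \<open>The quotient f1 / (f1 + f2) of flat functions of the squared distance, one positive for
  distances below b, the other for distances above a. As a < b, at every point one of them is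
  positive. The squared distance is taken because it is a polynomial in the coordinates.\<close>

lemma cutoff_exists:
  fixes x0 :: "real^'n::finite"
  assumes "0 < a" "a < b"
  obtains \<theta> where "smooth_on UNIV \<theta>" "\<And>x. x \<in> cball x0 a \<Longrightarrow> \<theta> x = 1" "\<And>x. b \<le> dist x0 x \<Longrightarrow> \<theta> x = 0"
proof -
  define N where "N x = (\<Sum>i\<in>UNIV. (x0 $ i - x $ i) * (x0 $ i - x $ i))" for x
  have N: "N x = (dist x0 x)\<^sup>2" for x
    by (simp add: N_def dist_commute[of x0] dist_norm norm_vec_def L2_set_def sum_nonneg power2_eq_square)
  have smN: "smooth_on UNIV (\<lambda>x. complex_of_real (N x))"
    unfolding N_def of_real_sum of_real_mult of_real_diff
    by (intro smooth_on_sum smooth_on_mult smooth_on_diff smooth_on_coordinate smooth_on_const) auto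
  define f1 where "f1 x = flat 0 (b\<^sup>2 - N x)" for x
  define f2 where "f2 x = flat 0 (N x - a\<^sup>2)" for x
  have s1: "smooth_on UNIV (\<lambda>x. complex_of_real (f1 x))" unfolding f1_def
    by (rule smooth_on_flat) (simp add: smooth_on_diff smooth_on_const smN)
  have s2: "smooth_on UNIV (\<lambda>x. complex_of_real (f2 x))" unfolding f2_def
    by (rule smooth_on_flat) (simp add: smooth_on_diff smooth_on_const smN)
  have "f1 x + f2 x > 0" for x
  proof -
    have "a\<^sup>2 < b\<^sup>2" using assms by (intro power_strict_mono) auto
    then have "b\<^sup>2 - N x > 0 \<or> N x - a\<^sup>2 > 0" by linarith
    then show ?thesis unfolding f1_def f2_def flat_def by (auto simp: add_pos_pos)
  qed
  then have nz: "complex_of_real (f1 x) + complex_of_real (f2 x) \<noteq> 0" for x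
    by (metis less_irrefl of_real_add of_real_eq_0_iff)
  show ?thesis
  proof
    show "smooth_on UNIV (\<lambda>x. complex_of_real (f1 x) * inverse (complex_of_real (f1 x) + complex_of_real (f2 x)))"
      by (intro smooth_on_mult smooth_on_inverse smooth_on_add s1 s2 open_UNIV nz)
    show "complex_of_real (f1 x) * inverse (complex_of_real (f1 x) + complex_of_real (f2 x)) = 1" if "x \<in> cball x0 a" for x
    proof -
      have "N x \<le> a\<^sup>2" using that assms by (auto simp: N intro: power_mono)
      then have "f2 x = 0" by (simp add: f2_def flat_def)
      then show ?thesis using nz[of x] by simp
    qed
    show "complex_of_real (f1 x) * inverse (complex_of_real (f1 x) + complex_of_real (f2 x)) = 0" if "b \<le> dist x0 x" for x
    proof -
      have "b\<^sup>2 \<le> N x" using that assms by (auto simp: N intro: power_mono)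
      then show ?thesis by (simp add: f1_def flat_def)
    qed
  qed
qed

section \<open>Exponentials\<close>

definition ex :: "('n::finite \<Rightarrow> complex) \<Rightarrow> real^'n \<Rightarrow> complex" where
  "ex \<zeta> y = exp (\<i> * (\<Sum>i\<in>UNIV. \<zeta> i * of_real (y $ i)))"

definition kc :: "('n \<Rightarrow> int) \<Rightarrow> 'n \<Rightarrow> complex" where
  "kc k = (\<lambda>i. of_int (k i))"

lemma ex_add: "ex (\<lambda>i. a i + b i) y = ex a y * ex b y"
  by (simp add: ex_def algebra_simps sum.distrib exp_add)

lemma ex_zero: "ex (\<lambda>_. 0) y = 1"
  by (simp add: ex_def)

lemma norm_ex: "norm (ex \<zeta> y) = exp (- (\<Sum>i\<in>UNIV. Im (\<zeta> i) * y $ i))"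
  by (simp add: ex_def)

lemma norm_ex_kc: "norm (ex (kc k) y) = 1"
  by (simp add: norm_ex kc_def)

lemma ex_has_derivative:
  fixes y :: "real^'n::finite"
  shows "(ex \<zeta> has_derivative (\<lambda>h. \<i> * (\<Sum>i\<in>UNIV. \<zeta> i * of_real (h $ i)) * ex \<zeta> y)) (at y)"
proof -
  have lin: "bounded_linear (\<lambda>h :: real^'n. \<i> * (\<Sum>i\<in>UNIV. \<zeta> i * of_real (h $ i)))"
    by (intro bounded_linear_const_mult bounded_linear_sum
        bounded_linear_compose[OF bounded_linear_of_real bounded_linear_vec_nth])
  have "(exp has_derivative (\<lambda>h. exp (\<i> * (\<Sum>i\<in>UNIV. \<zeta> i * of_real (y $ i))) * h))
     (at (\<i> * (\<Sum>i\<in>UNIV. \<zeta> i * of_real (y $ i))))"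
    using DERIV_exp unfolding has_field_derivative_def by blast
  from has_derivative_compose[OF bounded_linear_imp_has_derivative[OF lin] this]
  show ?thesis unfolding ex_def[abs_def] by (simp add: mult_ac)
qed

lemma ex_differentiable: "ex \<zeta> differentiable at y"
  using ex_has_derivative differentiable_def by blast

lemma pd_ex: "pd i (ex \<zeta>) = (\<lambda>y. (\<i> * \<zeta> i) * ex \<zeta> y)"
  by (rule ext, subst pd_eq[OF ex_has_derivative]) (simp add: axis_def if_distrib[of of_real] if_distrib[of "(*) _"] cong: if_cong)

lemma smooth_on_ex: assumes "open S" shows "smooth_on S (ex \<zeta>)"
proof (rule smooth_on_alg[OF assms, where F = "{ex \<zeta>}"])
  show "\<exists>g\<in>alg {ex \<zeta>}. \<forall>x\<in>S. pd i f x = g x" if "f \<in> {ex \<zeta>}" for f i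
    using that by (intro bexI[of _ "\<lambda>y. (\<i> * \<zeta> i) * ex \<zeta> y"] alg.mult alg.const alg.base) (auto simp: pd_ex)
  show "f differentiable at x" if "f \<in> {ex \<zeta>}" for f x
    using that ex_differentiable by auto
qed (auto intro: alg.base)

lemma pds_ex: "foldr pd is (ex \<zeta>) y = (\<Prod>i\<leftarrow>is. \<i> * \<zeta> i) * ex \<zeta> y"
proof (induction "is" arbitrary: y)
  case (Cons i "is")
  have "foldr pd is (ex \<zeta>) = (\<lambda>y. (\<Prod>i\<leftarrow>is. \<i> * \<zeta> i) * ex \<zeta> y)" by (rule ext) (rule Cons)
  then have "foldr pd (i # is) (ex \<zeta>) y = pd i (\<lambda>y. (\<Prod>i\<leftarrow>is. \<i> * \<zeta> i) * ex \<zeta> y) y" by simp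
  also have "\<dots> = (\<Prod>i\<leftarrow>is. \<i> * \<zeta> i) * pd i (ex \<zeta>) y"
    by (subst pd_mult) (auto simp: ex_differentiable)
  finally show ?case by (simp add: pd_ex)
qed simp

lemma norm_prod_list_le:
  assumes "\<And>i. norm (\<zeta> i) \<le> B" "1 \<le> B"
  shows "norm (\<Prod>i\<leftarrow>is. \<i> * \<zeta> i :: complex) \<le> B ^ length is"
proof (induction "is")
  case (Cons i "is")
  then show ?case using assms(1)[of i] assms(2) by (auto simp: norm_mult intro!: mult_mono)
qed simp

section \<open>Integration over the period box\<close>

definition pibox :: "(real^'n::finite) set" where
  "pibox = cbox (\<chi> i. - pi) (\<chi> i. pi)"

definition pimean :: "(real^'n::finite \<Rightarrow> complex) \<Rightarrow> complex" where
  "pimean g = integral pibox g / of_real ((2 * pi) ^ CARD('n))"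

definition fc :: "(real^'n::finite \<Rightarrow> complex) \<Rightarrow> ('n \<Rightarrow> int) \<Rightarrow> complex" where
  "fc g k = pimean (\<lambda>y. g y * ex (kc (\<lambda>i. - k i)) y)"

lemma pibox_iff: "y \<in> pibox \<longleftrightarrow> (\<forall>i. \<bar>y $ i\<bar> \<le> pi)"
  unfolding pibox_def mem_box_cart by (auto simp: abs_le_iff) (metis minus_le_iff)+

lemma compact_pibox: "compact pibox"
  by (simp add: pibox_def)

lemma content_pibox: "measure lborel (pibox :: (real^'n::finite) set) = (2 * pi) ^ CARD('n)"
  unfolding pibox_def by (subst content_cbox_cart) (auto simp: interval_ne_empty_cart)

lemma pibox_integrable: "continuous_on pibox g \<Longrightarrow> (g :: real^'n::finite \<Rightarrow> complex) integrable_on pibox"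
  unfolding pibox_def by (rule integrable_continuous)

lemma pimean_add:
  "continuous_on pibox f \<Longrightarrow> continuous_on pibox g \<Longrightarrow> pimean (\<lambda>y. f y + g y) = pimean f + pimean g"
  by (simp add: pimean_def integral_add pibox_integrable add_divide_distrib)

lemma pimean_cmult: "pimean (\<lambda>y. c * f y) = c * pimean f"
  by (simp add: pimean_def)

lemma pimean_diff:
  "continuous_on pibox f \<Longrightarrow> continuous_on pibox g \<Longrightarrow> pimean (\<lambda>y. f y - g y) = pimean f - pimean g"
  by (simp add: pimean_def integral_diff pibox_integrable diff_divide_distrib)

lemma pimean_sum:
  "(\<And>i. i \<in> A \<Longrightarrow> continuous_on pibox (f i)) \<Longrightarrow> pimean (\<lambda>y. \<Sum>i\<in>A. f i y) = (\<Sum>i\<in>A. pimean (f i))"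
proof (induction A rule: infinite_finite_induct)
  case (insert a A)
  then show ?case by (simp add: pimean_add continuous_on_sum)
qed (simp_all add: pimean_def)

lemma norm_pimean:
  assumes "continuous_on pibox g" "\<And>y. y \<in> pibox \<Longrightarrow> norm (g y) \<le> B"
  shows "norm (pimean (g :: real^'n::finite \<Rightarrow> complex)) \<le> B"
proof -
  have "0 \<in> (pibox :: (real^'n) set)" by (simp add: pibox_iff)
  then have "0 \<le> B" using assms(2) norm_ge_zero order_trans by blast
  then have "norm (integral (pibox :: (real^'n) set) g) \<le> B * measure lborel (pibox :: (real^'n) set)"
    using assms pibox_integrable[OF assms(1)] unfolding pibox_def
    by (intro has_integral_bound[OF _ integrable_integral]) auto
  then show ?thesis by (simp add: content_pibox pimean_def norm_divide norm_power norm_mult divide_simps)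
qed

text \<open>As 3 < pi, the radius 2 leaves room in the period box: translates by at most 1 are still
  supported in it.\<close>

abbreviation supp2 :: "(real^'n::finite \<Rightarrow> complex) \<Rightarrow> bool" where
  "supp2 g \<equiv> (\<forall>y. y \<notin> cball 0 2 \<longrightarrow> g y = 0)"

lemma cball_subset_pibox: "(cball 0 2 :: (real^'n::finite) set) \<subseteq> pibox"
proof
  fix y :: "real^'n" assume "y \<in> cball 0 2"
  then have "\<bar>y $ i\<bar> \<le> pi" for i using component_le_norm_cart[of y i] pi_gt3 by simp
  then show "y \<in> pibox" by (simp add: pibox_iff)
qed

text \<open>The integral of g(y + h e_i) over the box does not depend on h for |h| \<le> 1, because
  the translated support stays in the ball of radius 3 and hence in the box. Differentiation in h at
  0 gives the claim.\<close>

lemma integral_pd_zero: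
  fixes g :: "real^'n::finite \<Rightarrow> complex"
  assumes g: "smooth_on UNIV g" and supp: "supp2 g"
  shows "integral pibox (pd i g) = 0"
proof -
  let ?e = "axis i (1::real)"
  have cont: "continuous_on T (\<lambda>y. f (y + h *\<^sub>R ?e))" if "smooth_on UNIV f" for f h T
    by (rule continuous_on_compose2[OF smooth_on_continuous_on[OF that]]) (auto intro!: continuous_intros)
  have const: "integral pibox (\<lambda>y. g (y + h *\<^sub>R ?e)) = integral pibox g" if h: "h \<in> {-1..1}" for h
  proof -
    have gI: "(g has_integral integral pibox g) pibox"
      using pibox_integrable[OF continuous_on_subset[OF smooth_on_continuous_on[OF g]]] by auto
    have box: "y \<in> pibox" if "norm y \<le> 3" for y :: "real^'n"
      unfolding pibox_iff
    proof
      show "\<bar>y $ i\<bar> \<le> pi" for i using that component_le_norm_cart[of y i] pi_gt3 by simp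
    qed
    have zero: "g (y + h *\<^sub>R ?e) = 0" if "norm (y + h *\<^sub>R ?e) > 2" for y
      using supp that by auto
    have "((\<lambda>y. g (y + h *\<^sub>R ?e)) has_integral integral pibox g) (cbox ((\<chi> i. - pi) - h *\<^sub>R ?e) ((\<chi> i. pi) - h *\<^sub>R ?e))"
      using gI unfolding pibox_def by (rule has_integral_shift_cbox)
    then have "((\<lambda>y. g (y + h *\<^sub>R ?e)) has_integral integral pibox g) UNIV"
    proof (rule has_integral_on_superset)
      fix y assume y: "y \<notin> cbox ((\<chi> i. - pi) - h *\<^sub>R ?e) ((\<chi> i. pi) - h *\<^sub>R ?e)"
      have "y + h *\<^sub>R ?e \<notin> pibox"
        using y unfolding pibox_def mem_box_cart by (auto simp: algebra_simps)
      then show "g (y + h *\<^sub>R ?e) = 0" using box[of "y + h *\<^sub>R ?e"] zero[of y] by fastforce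
    qed auto
    moreover have "(\<lambda>y. if y \<in> pibox then g (y + h *\<^sub>R ?e) else 0) = (\<lambda>y. g (y + h *\<^sub>R ?e))"
    proof
      fix y
      show "(if y \<in> pibox then g (y + h *\<^sub>R ?e) else 0) = g (y + h *\<^sub>R ?e)"
      proof (cases "y \<in> pibox")
        case False
        then have "norm y > 3" using box[of y] by (rule_tac ccontr) auto
        moreover have "norm (h *\<^sub>R ?e) \<le> 1" using h by auto
        ultimately have "norm (y + h *\<^sub>R ?e) > 2"
          using norm_triangle_ineq4[of "y + h *\<^sub>R ?e" "h *\<^sub>R ?e"] by simp
        then show ?thesis using zero by simp
      qed simp
    qed
    ultimately have "((\<lambda>y. g (y + h *\<^sub>R ?e)) has_integral integral pibox g) pibox"
      using has_integral_restrict_UNIV[of pibox "\<lambda>y. g (y + h *\<^sub>R ?e)"] by metis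
    then show ?thesis by (rule integral_unique)
  qed
  have "((\<lambda>h. integral (cbox (\<chi> i. - pi) (\<chi> i. pi)) (\<lambda>y. g (y + h *\<^sub>R ?e))) has_vector_derivative
     integral (cbox (\<chi> i. - pi) (\<chi> i. pi)) (\<lambda>y. pd i g (y + 0 *\<^sub>R ?e))) (at 0 within {-1..1})"
  proof (rule leibniz_rule_vector_derivative)
    show "((\<lambda>h. g (y + h *\<^sub>R ?e)) has_vector_derivative pd i g (y + h *\<^sub>R ?e)) (at h within {-1..1})" for h y
    proof -
      have D: "(g has_derivative frechet_derivative g (at (y + h *\<^sub>R ?e))) (at (y + h *\<^sub>R ?e))"
        using smooth_on_differentiable[OF g] frechet_derivative_works by blast
      have "((\<lambda>h. y + h *\<^sub>R ?e) has_derivative (\<lambda>h. h *\<^sub>R ?e)) (at h within {-1..1})"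
        by (auto intro!: derivative_eq_intros)
      from has_derivative_compose[OF this D]
      show ?thesis unfolding has_vector_derivative_def pd_def
        using linear_scale[OF has_derivative_linear[OF D]] by simp
    qed
    show "continuous_on ({-1..1} \<times> cbox (\<chi> i. - pi) (\<chi> i. pi)) (\<lambda>(h, y). pd i g (y + h *\<^sub>R ?e))"
      unfolding case_prod_beta
      by (rule continuous_on_compose2[OF smooth_on_continuous_on[OF smooth_on_pd[OF g]]])
         (auto intro!: continuous_intros)
  qed (auto intro!: integrable_continuous cont[OF g])
  then have "((\<lambda>h. integral pibox (\<lambda>y. g (y + h *\<^sub>R ?e))) has_vector_derivative integral pibox (pd i g)) (at 0 within {-1..1})"
    by (simp add: pibox_def)
  then have "((\<lambda>h. integral pibox g) has_vector_derivative integral pibox (pd i g)) (at 0 within {-1..1})"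
    by (rule has_vector_derivative_transform[rotated 2]) (simp_all only: const, simp)
  moreover have "((\<lambda>h. integral pibox g) has_vector_derivative 0) (at (0::real) within {-1..1})" by simp
  ultimately have "integral pibox (pd i g) = 0"
    by (intro vector_derivative_unique_within_closed_interval[of "-1" "1::real" 0]) auto
  then show ?thesis .
qed

lemma supp2_pds:
  fixes g :: "real^'n::finite \<Rightarrow> complex"
  assumes "supp2 g" shows "supp2 (foldr pd is g)"
proof (intro allI impI)
  fix y :: "real^'n" assume "y \<notin> cball 0 2"
  then show "foldr pd is g y = 0"
    using pds_cong_open[OF open_Compl[OF closed_cball], of 0 2 g "\<lambda>_. 0" y "is"] assms
    by (simp add: pds_zero)
qed

lemma smooth_continuous_pibox: "smooth_on UNIV g \<Longrightarrow> continuous_on pibox g"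
  by (rule continuous_on_subset[OF smooth_on_continuous_on]) auto

lemma pimean_parts_pd:
  assumes "smooth_on UNIV a" "smooth_on UNIV b" "supp2 b"
  shows "pimean (\<lambda>y. a y * pd i b y) = - pimean (\<lambda>y. pd i a y * b y)"
proof -
  have eq: "pd i (\<lambda>y. a y * b y) = (\<lambda>y. a y * pd i b y + pd i a y * b y)"
    by (rule ext, rule pd_mult) (auto intro: smooth_on_differentiable[OF assms(1)] smooth_on_differentiable[OF assms(2)])
  have "integral pibox (pd i (\<lambda>y. a y * b y)) = 0"
    by (rule integral_pd_zero) (use assms in \<open>auto intro: smooth_on_mult\<close>)
  then have "pimean (\<lambda>y. a y * pd i b y + pd i a y * b y) = 0" by (simp add: pimean_def eq)
  then show ?thesis
    by (subst (asm) pimean_add)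
       (auto intro!: smooth_continuous_pibox smooth_on_mult smooth_on_pd assms simp: add_eq_0_iff)
qed

text \<open>Derivatives are moved one at a time beginning with the outermost, which reverses the
  word.\<close>

lemma pimean_parts:
  assumes "smooth_on UNIV a" "smooth_on UNIV b" "supp2 b"
  shows "pimean (\<lambda>y. a y * foldr pd is b y) = (- 1) ^ length is * pimean (\<lambda>y. foldr pd (rev is) a y * b y)"
  using assms(1)
proof (induction "is" arbitrary: a)
  case (Cons i "is")
  have "pimean (\<lambda>y. a y * foldr pd (i # is) b y) = - pimean (\<lambda>y. pd i a y * foldr pd is b y)"
    using pimean_parts_pd[OF Cons.prems smooth_on_pds[OF assms(2)] supp2_pds[OF assms(3)]] by simp
  then show ?case using Cons.IH[OF smooth_on_pd[OF Cons.prems]] by simp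
qed simp

lemma fc_pd:
  assumes "smooth_on UNIV g" "supp2 g"
  shows "fc (pd i g) k = (\<i> * of_int (k i)) * fc g k"
proof -
  have "pimean (\<lambda>y. ex (kc (\<lambda>i. - k i)) y * pd i g y) = - pimean (\<lambda>y. pd i (ex (kc (\<lambda>i. - k i))) y * g y)"
    by (rule pimean_parts_pd) (use assms in \<open>auto intro: smooth_on_ex\<close>)
  also have "\<dots> = - pimean (\<lambda>y. (- (\<i> * of_int (k i))) * (g y * ex (kc (\<lambda>i. - k i)) y))"
    by (simp add: pd_ex kc_def mult_ac)
  also have "\<dots> = (\<i> * of_int (k i)) * fc g k" unfolding pimean_cmult fc_def by simp
  finally show ?thesis by (simp add: fc_def mult.commute)
qed

lemma fc_pds:
  assumes "smooth_on UNIV g" "supp2 g"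
  shows "fc (foldr pd is g) k = (\<Prod>i\<leftarrow>is. \<i> * of_int (k i)) * fc g k"
  by (induction "is") (auto simp: fc_pd[OF smooth_on_pds[OF assms(1)] supp2_pds[OF assms(2)]])

lemma norm_fc:
  assumes "smooth_on UNIV g" "supp2 g" "\<And>y. y \<in> cball 0 2 \<Longrightarrow> norm (g y) \<le> B"
  shows "norm (fc g k) \<le> B"
  unfolding fc_def
proof (rule norm_pimean)
  have "0 \<le> B" using assms(3)[of 0] norm_ge_zero[of "g 0"] by (simp del: norm_ge_zero)
  then show "norm (g y * ex (kc (\<lambda>i. - k i)) y) \<le> B" for y
    using assms(2,3) by (cases "y \<in> cball 0 2") (auto simp: norm_mult norm_ex_kc)
qed (intro continuous_intros smooth_continuous_pibox assms smooth_on_ex open_UNIV)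

section \<open>Weights on the frequency lattice\<close>

text \<open>The counterpart of (1 + |k|^2)^(1/2). With the maximum norm it is submultiplicative
  under addition without a constant (\<open>wt_add\<close>), and it is attained in a single
  coordinate (\<open>wt_obtain\<close>), which suits integration by parts in one direction.\<close>

definition wt :: "('n::finite \<Rightarrow> int) \<Rightarrow> real" where
  "wt k = 1 + Max (range (\<lambda>i. \<bar>real_of_int (k i)\<bar>))"

lemma abs_le_wt: "\<bar>real_of_int (k i)\<bar> \<le> wt k - 1"
  unfolding wt_def using Max_ge[of "range (\<lambda>i. \<bar>real_of_int (k i)\<bar>)" "\<bar>real_of_int (k i)\<bar>"] by simp

lemma wt_obtain: obtains i where "wt k = 1 + \<bar>real_of_int (k i)\<bar>"
  using Max_in[of "range (\<lambda>i. \<bar>real_of_int (k i)\<bar>)"] unfolding wt_def by fastforce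

lemma wt_ge_1: "1 \<le> wt k"
  using abs_le_wt[of k undefined] by linarith

lemma wt_pos: "0 < wt k" using wt_ge_1[of k] by linarith

lemma wt_minus: "wt (\<lambda>i. - k i) = wt k"
  by (simp add: wt_def)

lemma wt_add: "wt (\<lambda>i. k i + l i) \<le> wt k * wt l"
proof -
  obtain i where i: "wt (\<lambda>i. k i + l i) = 1 + \<bar>real_of_int (k i + l i)\<bar>" by (rule wt_obtain)
  have "\<bar>real_of_int (k i + l i)\<bar> \<le> (wt k - 1) + (wt l - 1)"
    using abs_le_wt[of k i] abs_le_wt[of l i] by simp
  moreover have "0 \<le> (wt k - 1) * (wt l - 1)" using wt_ge_1[of k] wt_ge_1[of l] by simp
  ultimately show ?thesis unfolding i by (simp add: algebra_simps)
qed

text \<open>All q derivatives are taken in a coordinate i where \<open>wt k\<close> is attained. If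
  |k_i| > 1 then \<open>wt k\<close> is at most 2 |k_i|; otherwise it is at most 2 and the trivial
  bound is enough. Both cases produce the factor 2^q.\<close>

lemma fc_decay:
  assumes "smooth_on UNIV g" "supp2 g" "dbound (cball 0 2) q g B"
  shows "norm (fc g k) \<le> 2 ^ q * B / wt k ^ q"
proof -
  obtain i where i: "wt k = 1 + \<bar>real_of_int (k i)\<bar>" by (rule wt_obtain)
  have B: "norm (fc (foldr pd is g) k) \<le> B" if "length is \<le> q" for "is"
    by (rule norm_fc) (use assms that in \<open>auto intro!: smooth_on_pds supp2_pds[rule_format] dboundD[OF assms(3)]\<close>)
  have B0: "norm (fc g k) \<le> B" using B[of "[]"] by simp
  have Bq: "\<bar>real_of_int (k i)\<bar> ^ q * norm (fc g k) \<le> B"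
    using B[of "replicate q i"] unfolding fc_pds[OF assms(1,2)]
    by (simp add: norm_mult norm_power prod_list_replicate map_replicate)
  have "wt k ^ q * norm (fc g k) \<le> 2 ^ q * B"
  proof (cases "\<bar>real_of_int (k i)\<bar> \<le> 1")
    case True
    then have "wt k ^ q \<le> 2 ^ q" unfolding i by (intro power_mono) auto
    then show ?thesis using B0 by (intro mult_mono) auto
  next
    case False
    then have "wt k ^ q \<le> (2 * \<bar>real_of_int (k i)\<bar>) ^ q" unfolding i by (intro power_mono) auto
    then have "wt k ^ q * norm (fc g k) \<le> 2 ^ q * (\<bar>real_of_int (k i)\<bar> ^ q * norm (fc g k))"
      by (simp add: power_mult_distrib mult_right_mono mult.assoc[symmetric])
    also have "\<dots> \<le> 2 ^ q * B" by (intro mult_left_mono Bq) auto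
    finally show ?thesis .
  qed
  then show ?thesis using wt_pos[of k] by (simp add: field_simps)
qed

lemma sum_lattice_1d:
  assumes "s > 1"
  obtains C :: real where "\<And>R. (\<Sum>j\<in>{-int R..int R}. (1 + \<bar>real_of_int j\<bar>) powr - s) \<le> C"
proof -
  have sm: "summable (\<lambda>j. (1 + real j) powr - s)"
  proof -
    have "summable (\<lambda>j. real (Suc j) powr - s)"
      using summable_real_powr_iff[of "-s"] assms by (subst summable_Suc_iff) auto
    then show ?thesis by (simp add: add.commute)
  qed
  have "(\<Sum>j\<in>{-int R..int R}. (1 + \<bar>real_of_int j\<bar>) powr - s) \<le> 2 * (\<Sum>j. (1 + real j) powr - s)" for R
  proof -
    let ?f = "\<lambda>j. (1 + \<bar>real_of_int j\<bar>) powr - s"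
    let ?A = "int ` {..R}" and ?B = "(\<lambda>j. - int j) ` {..R}"
    have sub: "{-int R..int R} \<subseteq> ?A \<union> ?B"
    proof
      fix j assume j: "j \<in> {-int R..int R}"
      show "j \<in> ?A \<union> ?B"
      proof (cases "j \<ge> 0")
        case True
        then have "j = int (nat j)" "nat j \<le> R" using j by auto
        then show ?thesis by blast
      next
        case False
        then have "j = - int (nat (- j))" "nat (- j) \<le> R" using j by auto
        then show ?thesis by blast
      qed
    qed
    have "sum ?f {-int R..int R} \<le> sum ?f (?A \<union> ?B)" by (rule sum_mono2[OF _ sub]) auto
    also have "\<dots> \<le> sum ?f ?A + sum ?f ?B"
      using sum.union_inter[of ?A ?B ?f] sum_nonneg[of "?A \<inter> ?B" ?f] by simp
    also have "sum ?f ?A = (\<Sum>j\<le>R. (1 + real j) powr - s)" by (subst sum.reindex) (auto simp: inj_on_def)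
    also have "sum ?f ?B = (\<Sum>j\<le>R. (1 + real j) powr - s)" by (subst sum.reindex) (auto simp: inj_on_def)
    also have "(\<Sum>j\<le>R. (1 + real j) powr - s) \<le> (\<Sum>j. (1 + real j) powr - s)"
      by (rule sum_le_suminf[OF sm]) auto
    finally show ?thesis by simp
  qed
  then show ?thesis using that by blast
qed

lemma finite_lattice_bounded:
  assumes "finite (K :: ('n::finite \<Rightarrow> int) set)"
  obtains R :: nat where "K \<subseteq> PiE UNIV (\<lambda>_. {-int R..int R})"
proof -
  have fin: "finite ((\<lambda>(k, i). nat \<bar>k i\<bar>) ` (K \<times> UNIV))" using assms by simp
  define R where "R = Max (insert 0 ((\<lambda>(k, i). nat \<bar>k i\<bar>) ` (K \<times> UNIV)))"
  have "nat \<bar>k i\<bar> \<le> R" if "k \<in> K" for k i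
    unfolding R_def using that fin by (intro Max_ge) auto
  note bnd = this
  have "k i \<in> {-int R..int R}" if "k \<in> K" for k i
    using bnd[OF that, of i] by (simp, linarith)
  then have "K \<subseteq> PiE UNIV (\<lambda>_. {-int R..int R})"
    by (auto simp: PiE_UNIV_domain)
  then show ?thesis by (rule that)
qed

text \<open>The exponent n+1 is distributed over the n coordinates with s = 1 + 1/n > 1 for each.
  Since \<open>wt k\<close> dominates every 1 + |k_i|, the sum over a cube is bounded by a product
  of n convergent one-dimensional sums. A common bound for finite sums suffices, as all later sums
  run over finite sets.\<close>

lemma sum_wt_bounded:
  obtains C :: real where "C > 0"
    "\<And>K :: ('n::finite \<Rightarrow> int) set. finite K \<Longrightarrow> (\<Sum>k\<in>K. 1 / wt k ^ (CARD('n) + 1)) \<le> C"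
proof -
  define s where "s = 1 + 1 / real CARD('n)"
  have s: "s > 1" "s * real CARD('n) = real (CARD('n) + 1)" by (auto simp: s_def field_simps)
  obtain C where C: "\<And>R. (\<Sum>j\<in>{-int R..int R}. (1 + \<bar>real_of_int j\<bar>) powr - s) \<le> C"
    using sum_lattice_1d[OF s(1)] by blast
  have "(\<Sum>k\<in>K. 1 / wt k ^ (CARD('n) + 1)) \<le> C ^ CARD('n)" if K: "finite (K :: ('n \<Rightarrow> int) set)" for K
  proof -
    obtain R where R: "K \<subseteq> PiE UNIV (\<lambda>_. {-int R..int R})" using finite_lattice_bounded[OF K] .
    have le: "1 / wt k ^ (CARD('n) + 1) \<le> (\<Prod>i\<in>UNIV. (1 + \<bar>real_of_int (k i)\<bar>) powr - s)" for k :: "'n \<Rightarrow> int"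
    proof -
      have "1 / wt k ^ (CARD('n) + 1) = wt k powr - (s * real CARD('n))"
        unfolding s(2) powr_minus powr_realpow[OF wt_pos[of k]] by (simp add: divide_inverse)
      also have "\<dots> = (\<Prod>i\<in>(UNIV :: 'n set). wt k powr - s)"
        using wt_pos[of k] by (simp add: powr_realpow[symmetric] powr_powr)
      also have "\<dots> \<le> (\<Prod>i\<in>UNIV. (1 + \<bar>real_of_int (k i)\<bar>) powr - s)"
      proof (intro prod_mono conjI powr_mono2')
        show "1 + \<bar>real_of_int (k i)\<bar> \<le> wt k" for i using abs_le_wt[of k i] by simp
      qed (use s in auto)
      finally show ?thesis .
    qed
    have "(\<Sum>k\<in>K. 1 / wt k ^ (CARD('n) + 1)) \<le> (\<Sum>k\<in>K. \<Prod>i\<in>UNIV. (1 + \<bar>real_of_int (k i)\<bar>) powr - s)"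
      by (intro sum_mono le)
    also have "\<dots> \<le> (\<Sum>k\<in>PiE (UNIV :: 'n set) (\<lambda>_. {-int R..int R}). \<Prod>i\<in>UNIV. (1 + \<bar>real_of_int (k i)\<bar>) powr - s)"
      by (intro sum_mono2 R finite_PiE prod_nonneg) auto
    also have "\<dots> = (\<Prod>i\<in>(UNIV :: 'n set). \<Sum>j\<in>{-int R..int R}. (1 + \<bar>real_of_int j\<bar>) powr - s)"
      by (rule prod_sum_PiE[symmetric]) auto
    also have "\<dots> \<le> C ^ CARD('n)"
      using C[of R] by (simp add: power_mono sum_nonneg)
    finally show ?thesis .
  qed
  then have "(\<Sum>k\<in>K. 1 / wt k ^ (CARD('n) + 1)) \<le> max 1 (C ^ CARD('n))" if "finite (K :: ('n \<Rightarrow> int) set)" for K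
    using that by (simp add: le_max_iff_disj)
  then show ?thesis using that[of "max 1 (C ^ CARD('n))"] by simp
qed

section \<open>Trigonometric polynomials and Fourier inversion\<close>

text \<open>Fubini for products of functions of one coordinate, read off from the description of
  \<open>lborel\<close> as a product measure over \<open>Basis\<close>. Indicators of the interval
  turn the integral over the box into one over the whole space.\<close>

lemma integral_pibox_prod:
  fixes f :: "'n::finite \<Rightarrow> real \<Rightarrow> complex"
  assumes cont: "\<And>i. continuous_on {-pi..pi} (f i)"
  shows "integral (pibox :: (real^'n) set) (\<lambda>y. \<Prod>i\<in>UNIV. f i (y $ i)) = (\<Prod>i\<in>UNIV. integral {-pi..pi} (f i))"
proof -
  define h where "h i t = indicator {-pi..pi} t *\<^sub>R f i t" for i t
  have hint: "integrable lborel (h i)" for i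
    using borel_integrable_atLeastAtMost'[OF cont] unfolding h_def set_integrable_def .
  have hL: "integral\<^sup>L lborel (h i) = integral {-pi..pi} (f i)" for i
    using set_borel_integral_eq_integral(2)[OF borel_integrable_atLeastAtMost'[OF cont, of i]]
    unfolding set_lebesgue_integral_def h_def .
  have mem: "y $ i \<in> {-pi..pi}" if "y \<in> pibox" for y :: "real^'n" and i
  proof -
    have "\<bar>y $ i\<bar> \<le> pi" using that by (simp add: pibox_iff)
    then show ?thesis by auto
  qed
  have contP: "continuous_on pibox (\<lambda>y :: real^'n. \<Prod>i\<in>UNIV. f i (y $ i))"
    by (intro continuous_on_prod continuous_on_compose2[OF cont] continuous_intros) (use mem in auto)
  have "set_integrable lborel pibox (\<lambda>y :: real^'n. \<Prod>i\<in>UNIV. f i (y $ i))"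
    unfolding set_integrable_def by (rule borel_integrable_compact[OF compact_pibox contP])
  note set_borel_integral_eq_integral(2)[OF this, symmetric]
  also have "(LINT y:pibox|lborel. \<Prod>i\<in>UNIV. f i (y $ i)) = integral\<^sup>L lborel (\<lambda>y :: real^'n. \<Prod>i\<in>UNIV. h i (y $ i))"
    unfolding set_lebesgue_integral_def
  proof (rule Bochner_Integration.integral_cong[OF refl])
    fix y :: "real^'n"
    show "indicator pibox y *\<^sub>R (\<Prod>i\<in>UNIV. f i (y $ i)) = (\<Prod>i\<in>UNIV. h i (y $ i))"
    proof (cases "y \<in> pibox")
      case True
      then have "indicator {-pi..pi} (y $ i) = (1::real)" for i
        using mem[of y i] by simp
      then show ?thesis using True by (simp add: h_def)
    next
      case False
      then obtain i where "\<bar>y $ i\<bar> > pi" unfolding pibox_iff by (auto simp: not_le)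
      then have "y $ i \<notin> {-pi..pi}" by auto
      then have "h i (y $ i) = 0" by (simp add: h_def)
      then have "(\<Prod>i\<in>UNIV. h i (y $ i)) = 0" by (intro prod_zero) auto
      then show ?thesis using False by simp
    qed
  qed
  also have "\<dots> = integral\<^sup>L (\<Pi>\<^sub>M b\<in>(Basis :: (real^'n) set). lborel) (\<lambda>g. \<Prod>i\<in>UNIV. h i ((\<Sum>b\<in>(Basis :: (real^'n) set). g b *\<^sub>R b) $ i))"
  proof (subst lborel_eq, rule integral_distr)
    have [measurable]: "h i \<in> borel_measurable borel" for i
      using borel_measurable_integrable[OF hint[of i]] by simp
    have [measurable]: "(\<lambda>y :: real^'n. y $ i) \<in> borel_measurable borel" for i
      by (intro borel_measurable_continuous_onI continuous_intros)
    show "(\<lambda>y :: real^'n. \<Prod>i\<in>UNIV. h i (y $ i)) \<in> borel_measurable borel" by measurable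
  qed measurable
  \<comment> \<open>The product measure is indexed by basis vectors, the factors by coordinates;
    \<open>SOME\<close> recovers the coordinate belonging to a basis vector.\<close>
  also have "\<dots> = integral\<^sup>L (\<Pi>\<^sub>M b\<in>(Basis :: (real^'n) set). lborel) (\<lambda>g. \<Prod>b\<in>(Basis :: (real^'n) set). h (SOME i. b = axis i 1) (g b))"
  proof (rule Bochner_Integration.integral_cong[OF refl])
    fix g :: "real^'n \<Rightarrow> real"
    have B: "(Basis :: (real^'n) set) = range (\<lambda>i. axis i 1)" by (auto simp: Basis_vec_def)
    have inj: "inj (\<lambda>i :: 'n. axis i (1::real))" by (auto simp: inj_def axis_eq_axis)
    have c: "(\<Sum>b\<in>(Basis :: (real^'n) set). g b *\<^sub>R b) $ i = g (axis i 1)" for i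
      using inner_sum_left_Basis[of "axis i 1" g] by (auto simp: inner_axis B)
    have s: "(SOME j. axis i (1::real) = axis j 1) = i" for i :: 'n
      by (rule some_equality) (auto simp: axis_eq_axis)
    show "(\<Prod>i\<in>UNIV. h i ((\<Sum>b\<in>(Basis :: (real^'n) set). g b *\<^sub>R b) $ i)) = (\<Prod>b\<in>(Basis :: (real^'n) set). h (SOME i. b = axis i 1) (g b))"
      unfolding c unfolding B by (subst prod.reindex[OF inj]) (simp add: s)
  qed
  also have "\<dots> = (\<Prod>b\<in>(Basis :: (real^'n) set). integral\<^sup>L lborel (h (SOME i. b = axis i 1)))"
  proof -
    interpret product_sigma_finite "\<lambda>_ :: real^'n. lborel :: real measure" by standard
    show ?thesis by (rule product_integral_prod) (auto intro: hint)
  qed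
  also have "\<dots> = (\<Prod>i\<in>UNIV. integral {-pi..pi} (f i))"
  proof -
    have B: "(Basis :: (real^'n) set) = range (\<lambda>i. axis i 1)" by (auto simp: Basis_vec_def)
    have inj: "inj (\<lambda>i :: 'n. axis i (1::real))" by (auto simp: inj_def axis_eq_axis)
    have s: "(SOME j. axis i (1::real) = axis j 1) = i" for i :: 'n
      by (rule some_equality) (auto simp: axis_eq_axis)
    show ?thesis unfolding B by (subst prod.reindex[OF inj]) (simp add: s hL)
  qed
  finally show ?thesis .
qed

lemma integral_exp_period:
  "integral {-pi..pi} (\<lambda>t. exp (\<i> * (of_int j * of_real t))) = (if j = 0 then of_real (2 * pi) else 0)"
proof (cases "j = 0")
  case False
  let ?F = "\<lambda>t. exp (\<i> * (of_int j * of_real t)) / (\<i> * of_int j)"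
  have "((\<lambda>t. exp (\<i> * (of_int j * of_real t))) has_integral (?F pi - ?F (-pi))) {-pi..pi}"
  proof (rule fundamental_theorem_of_calculus)
    show "(?F has_vector_derivative exp (\<i> * (of_int j * of_real t))) (at t within {-pi..pi})" for t
    proof -
      have "((\<lambda>z. exp (\<i> * (of_int j * z)) / (\<i> * of_int j)) has_field_derivative exp (\<i> * (of_int j * of_real t))) (at (of_real t))"
        using False by (auto intro!: derivative_eq_intros simp: algebra_simps)
      from has_vector_derivative_real_field[OF this] show ?thesis .
    qed
  qed simp
  moreover have "?F pi - ?F (-pi) = 0"
  proof -
    have s: "sin (real_of_int j * pi) = 0" by (metis mult.commute sin_npi_int)
    have e: "exp (\<i> * (of_int j * of_real x)) = cis (real_of_int j * x)" for x by (simp add: cis_conv_exp mult_ac)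
    have "cis (real_of_int j * pi) = cis (real_of_int j * - pi)" using s by (simp add: complex_eq_iff)
    then show ?thesis unfolding e by simp
  qed
  ultimately show ?thesis using False by (simp add: integral_unique)
qed (simp add: scaleR_conv_of_real)

lemma pimean_ex_kc: "pimean (ex (kc k) :: real^'n::finite \<Rightarrow> complex) = (if k = (\<lambda>_. 0) then 1 else 0)"
proof -
  have eq: "ex (kc k) y = (\<Prod>i\<in>UNIV. exp (\<i> * (of_int (k i) * of_real (y $ i))))" for y :: "real^'n"
    by (simp add: ex_def kc_def sum_distrib_left exp_sum)
  have "integral (pibox :: (real^'n) set) (ex (kc k)) = (\<Prod>i\<in>UNIV. integral {-pi..pi} (\<lambda>t. exp (\<i> * (of_int (k i) * of_real t))))"
    unfolding eq[abs_def] by (rule integral_pibox_prod) (intro continuous_intros)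
  also have "\<dots> = (if k = (\<lambda>_. 0) then of_real ((2 * pi) ^ CARD('n)) else 0)"
    unfolding integral_exp_period by (auto simp: fun_eq_iff intro!: prod_zero)
  finally show ?thesis by (simp add: pimean_def)
qed

inductive_set trig :: "(real^'n::finite \<Rightarrow> complex) set" where
  base: "(\<lambda>y. c * ex (kc k) y) \<in> trig"
| add: "p \<in> trig \<Longrightarrow> q \<in> trig \<Longrightarrow> (\<lambda>y. p y + q y) \<in> trig"

lemma trig_const: "(\<lambda>y. c) \<in> trig"
  using trig.base[of c "\<lambda>_. 0"] by (simp add: kc_def ex_zero)

lemma trig_mult:
  assumes "p \<in> trig" "q \<in> trig" shows "(\<lambda>y. p y * q y) \<in> trig"
  using assms(1)
proof induction
  case (base c k)
  show ?case using assms(2)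
  proof induction
    case (base d l)
    have "(\<lambda>y. c * ex (kc k) y * (d * ex (kc l) y)) = (\<lambda>y. (c * d) * ex (kc (\<lambda>i. k i + l i)) y)"
      by (simp add: kc_def ex_add mult_ac)
    then show ?case using trig.base by simp
  next
    case (add p q)
    then show ?case using trig.add by (fastforce simp: distrib_left)
  qed
next
  case (add p q)
  then show ?case using trig.add by (fastforce simp: distrib_right)
qed

lemma trig_cmult: "p \<in> trig \<Longrightarrow> (\<lambda>y. c * p y) \<in> trig"
  by (rule trig_mult[OF trig_const])

lemma trig_sum: "(\<And>i. i \<in> I \<Longrightarrow> p i \<in> trig) \<Longrightarrow> (\<lambda>y. \<Sum>i\<in>I. p i y) \<in> trig"
  by (induction I rule: infinite_finite_induct) (auto intro: trig_const trig.add)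

lemma trig_cnj: "p \<in> trig \<Longrightarrow> (\<lambda>y. cnj (p y)) \<in> trig"
proof (induction rule: trig.induct)
  case (base c k)
  have "(\<lambda>y. cnj (c * ex (kc k) y)) = (\<lambda>y. cnj c * ex (kc (\<lambda>i. - k i)) y)"
    by (simp add: ex_def kc_def exp_cnj fun_eq_iff sum_negf)
  then show ?case by (simp add: trig.base)
qed (simp add: trig.add)

lemma smooth_on_trig: "p \<in> trig \<Longrightarrow> smooth_on UNIV p"
  by (induction rule: trig.induct) (auto intro!: smooth_on_add smooth_on_mult smooth_on_const smooth_on_ex)

text \<open>Maps the period box, with opposite faces identified, to a compact subset of
  \<open>complex^'n\<close>. The theorem of Stone and Weierstrass applies there, and polynomials in
  the real and imaginary parts pull back to trigonometric polynomials.\<close>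

definition torus :: "real^'n::finite \<Rightarrow> complex^'n" where
  "torus y = (\<chi> i. exp (\<i> * of_real (y $ i)))"

lemma trig_Re_Im:
  "(\<lambda>y. of_real (Re (exp (\<i> * of_real (y $ i))))) \<in> trig"
  "(\<lambda>y. of_real (Im (exp (\<i> * of_real (y $ i))))) \<in> trig"
proof -
  have e: "(\<lambda>y. exp (\<i> * of_real (y $ i))) \<in> trig"
  proof -
    have "ex (kc (\<lambda>j. if j = i then 1 else 0)) y = exp (\<i> * of_real (y $ i))" for y
      by (simp add: ex_def kc_def if_distrib[of "\<lambda>x. x * _"] if_distrib[of of_int] cong: if_cong)
    then show ?thesis using trig.base[of 1 "\<lambda>j. if j = i then 1 else 0"] by simp
  qed
  have c: "(\<lambda>y. cnj (exp (\<i> * of_real (y $ i)))) \<in> trig" by (rule trig_cnj[OF e])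
  have "of_real (Re z) = (1 / 2) * (z + cnj z)" "of_real (Im z) = (- \<i> / 2) * (z + (-1) * cnj z)" for z
    by (auto simp: complex_eq_iff)
  then show "(\<lambda>y. of_real (Re (exp (\<i> * of_real (y $ i))))) \<in> trig"
    "(\<lambda>y. of_real (Im (exp (\<i> * of_real (y $ i))))) \<in> trig"
    by (simp_all only:) (intro trig_cmult trig.add e c)+
qed

lemma real_polynomial_torus:
  assumes "real_polynomial_function (p :: complex^'n::finite \<Rightarrow> real)"
  shows "(\<lambda>y. of_real (p (torus y))) \<in> trig"
  using assms
proof induction
  case (linear f)
  then interpret bounded_linear f .
  have "complex_of_real (f z) = (\<Sum>b\<in>Basis. of_real (f b) * of_real (z \<bullet> b))" for z
  proof -
    have "f z = f (\<Sum>b\<in>Basis. (z \<bullet> b) *\<^sub>R b)" by (simp add: euclidean_representation)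
    also have "\<dots> = (\<Sum>b\<in>Basis. f b * (z \<bullet> b))" by (simp add: sum scaleR mult.commute)
    finally show ?thesis by simp
  qed
  note eq = this
  have t: "(\<lambda>y. of_real (torus y \<bullet> b)) \<in> trig" if bB: "b \<in> Basis" for b
  proof -
    obtain i u where b: "b = axis i u" "u \<in> Basis" using bB unfolding Basis_vec_def by blast
    have "torus y \<bullet> b = exp (\<i> * of_real (y $ i)) \<bullet> u" for y by (simp add: b inner_axis torus_def)
    then show ?thesis using b(2) trig_Re_Im[of i] by (auto simp: Basis_complex_def)
  qed
  have "(\<lambda>y. complex_of_real (f (torus y))) = (\<lambda>y. \<Sum>b\<in>Basis. of_real (f b) * of_real (torus y \<bullet> b))"
    by (rule ext) (rule eq)
  moreover have "(\<lambda>y. \<Sum>b\<in>Basis. of_real (f b) * of_real (torus y \<bullet> b)) \<in> trig"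
    by (rule trig_sum, rule trig_cmult, rule t)
  ultimately show ?case by (simp only:)
qed (auto intro: trig_const trig.add trig_mult)

text \<open>G is transported to the torus by taking arguments of the coordinates. The cut of
  \<open>Arg\<close> does no harm: near it some argument has modulus above 2, and G vanishes
  there.\<close>

lemma trig_approx:
  fixes G :: "real^'n::finite \<Rightarrow> complex"
  assumes G: "continuous_on UNIV G" "supp2 G" and e: "e > 0"
  obtains p where "p \<in> trig" "\<And>y. y \<in> pibox \<Longrightarrow> norm (G y - p y) < e"
proof -
  define T where "T = torus ` (pibox :: (real^'n) set)"
  define G' where "G' z = G (\<chi> i. Arg (z $ i))" for z :: "complex^'n"
  have T: "compact T" unfolding T_def torus_def
    by (intro compact_continuous_image compact_pibox continuous_on_vec_lambda continuous_intros)
  have nT: "norm (z $ i) = 1" if "z \<in> T" for z i using that by (auto simp: T_def torus_def)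
  have cont: "continuous_on T G'"
    unfolding continuous_on_eq_continuous_within
  proof
    fix z assume z: "z \<in> T"
    show "continuous (at z within T) G'"
    proof (cases "\<forall>i. z $ i \<notin> \<real>\<^sub>\<le>\<^sub>0")
      case True
      have "isCont (\<lambda>z. \<chi> i. Arg (z $ i)) z"
        unfolding isCont_def
      proof (rule vec_tendstoI)
        fix i
        have "isCont Arg (z $ i)" using continuous_at_Arg True by blast
        then have "isCont (\<lambda>z. Arg (z $ i)) z"
          by (rule isCont_o2[rotated]) (intro continuous_intros)
        then show "((\<lambda>z. (\<chi> i. Arg (z $ i)) $ i) \<longlongrightarrow> (\<chi> i. Arg (z $ i)) $ i) (at z)"
          by (simp add: isCont_def)
      qed
      moreover have "isCont G (\<chi> i. Arg (z $ i))" using G(1) continuous_on_eq_continuous_at by blast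
      ultimately have "isCont G' z" unfolding G'_def by (rule isCont_o2)
      then show ?thesis by (rule continuous_at_imp_continuous_at_within)
    next
      case False
      then obtain i where i: "z $ i \<in> \<real>\<^sub>\<le>\<^sub>0" by blast
      have "Im (z $ i) = 0" "Re (z $ i) \<le> 0" using i by (auto simp: complex_nonpos_Reals_iff)
      then have "Re (z $ i) = -1" using nT[OF z, of i] by (simp add: cmod_def)
      \<comment> \<open>A neighbourhood of the cut is described by the real part, which is
        continuous there: on the unit circle a real part below cos 2 means an argument of modulus
        above 2.\<close>
      moreover have c2: "-1 < cos (2::real)"
        using cos_monotone_0_pi[of 2 pi] pi_gt3 by simp
      ultimately have Rz: "Re (z $ i) < cos 2" by simp
      have zero: "G' w = 0" if "w \<in> T" "Re (w $ i) < cos 2" for w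
      proof -
        have "cos (Arg (w $ i)) = Re (w $ i)"
          using Arg_eq[of "w $ i"] nT[OF that(1), of i] by (metis Re_exp cis_conv_exp complex_Re_of_int cis.sel(1) mult_1 of_real_1 zero_neq_one norm_zero)
        then have "cos \<bar>Arg (w $ i)\<bar> < cos 2" using that by simp
        then have "\<bar>Arg (w $ i)\<bar> > 2"
          using cos_monotone_0_pi_le[of "\<bar>Arg (w $ i)\<bar>" 2] pi_gt3 by (smt (verit))
        moreover have "\<bar>Arg (w $ i)\<bar> \<le> norm (\<chi> i. Arg (w $ i))"
          using component_le_norm_cart[of "\<chi> i. Arg (w $ i)" i] by simp
        ultimately show ?thesis using G(2) by (auto simp: G'_def)
      qed
      have "\<forall>\<^sub>F w in at z within T. Re (w $ i) < cos 2"
      proof (rule order_tendstoD(2)[OF _ Rz])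
        show "((\<lambda>w. Re (w $ i)) \<longlongrightarrow> Re (z $ i)) (at z within T)" by (intro tendsto_intros)
      qed
      moreover have "\<forall>\<^sub>F w in at z within T. w \<in> T" by (simp add: eventually_at_filter)
      ultimately have "\<forall>\<^sub>F w in at z within T. G' w = 0" by eventually_elim (simp add: zero)
      then have "(G' \<longlongrightarrow> 0) (at z within T)" by (rule tendsto_eventually)
      then show ?thesis by (simp add: continuous_within zero[OF z Rz])
    qed
  qed
  obtain g where g: "polynomial_function g" "\<And>z. z \<in> T \<Longrightarrow> norm (G' z - g z) < e"
    using Stone_Weierstrass_polynomial_function[OF T cont e] by blast
  have "real_polynomial_function (Re \<circ> g)" "real_polynomial_function (Im \<circ> g)"
    using g(1) bounded_linear_Re bounded_linear_Im unfolding polynomial_function_def by blast+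
  note rp = this[THEN real_polynomial_torus]
  have "(\<lambda>y. of_real ((Re \<circ> g) (torus y)) + \<i> * of_real ((Im \<circ> g) (torus y))) \<in> trig"
    by (intro trig.add trig_cmult rp)
  then have p: "(\<lambda>y. g (torus y)) \<in> trig" by (simp add: complex_eq[symmetric])
  have eq: "G' (torus y) = G y" if y: "y \<in> pibox" for y
  proof (cases "\<forall>i. y $ i \<noteq> - pi")
    case True
    have "Arg (torus y $ i) = y $ i" for i
    proof -
      have "\<bar>y $ i\<bar> \<le> pi" "y $ i \<noteq> - pi" using y True by (auto simp: pibox_iff)
      then have "-pi < y $ i" "y $ i \<le> pi" by auto
      then show ?thesis unfolding torus_def by (simp add: Arg_exp)
    qed
    then show ?thesis by (simp add: G'_def)
  next
    case False
    \<comment> \<open>On such a face \<open>Arg\<close> returns pi instead of -pi, but both points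
      have norm above 2, so G is 0 at both.\<close>
    then obtain i where i: "y $ i = - pi" by blast
    have "exp (- (\<i> * complex_of_real pi)) = -1" by (simp add: exp_minus)
    moreover have "Arg (- 1) = pi" using Arg_cis[of pi] by simp
    ultimately have A: "Arg (torus y $ i) = pi" unfolding torus_def using i by simp
    have "2 < norm y" using component_le_norm_cart[of y i] i pi_gt3 by simp
    moreover have "2 < norm (\<chi> i. Arg (torus y $ i))"
      using component_le_norm_cart[of "\<chi> i. Arg (torus y $ i)" i] A pi_gt3 by simp
    ultimately show ?thesis using G(2) by (auto simp: G'_def)
  qed
  show ?thesis
  proof (rule that[OF p])
    show "norm (G y - g (torus y)) < e" if "y \<in> pibox" for y
      using g(2)[of "torus y"] eq[OF that] that by (auto simp: T_def)
  qed
qed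

section \<open>Cubic partial sums and Fourier inversion\<close>

definition cube :: "nat \<Rightarrow> ('n::finite \<Rightarrow> int) set" where
  "cube R = {k. \<forall>i. \<bar>k i\<bar> \<le> int R}"

lemma finite_cube: "finite (cube R :: ('n::finite \<Rightarrow> int) set)"
proof (rule finite_subset)
  show "cube R \<subseteq> PiE (UNIV :: 'n set) (\<lambda>_. {-int R..int R})"
  proof (clarsimp simp: cube_def PiE_UNIV_domain)
    fix k :: "'n \<Rightarrow> int" and i assume "\<forall>i. \<bar>k i\<bar> \<le> int R"
    then have "\<bar>k i\<bar> \<le> int R" by blast
    then show "- int R \<le> k i \<and> k i \<le> int R" by linarith
  qed
qed (auto intro: finite_PiE)

lemma cube_mono: "R \<le> R' \<Longrightarrow> cube R \<subseteq> cube R'"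
  unfolding cube_def by (auto intro: order_trans)

lemma cube_minus: "(\<lambda>i. - k i) \<in> cube R \<longleftrightarrow> k \<in> cube R"
  by (simp add: cube_def)

lemma wt_not_cube: "k \<notin> cube R \<Longrightarrow> real R + 1 \<le> wt k"
proof -
  assume "k \<notin> cube R"
  then obtain i where "\<bar>k i\<bar> > int R" by (auto simp: cube_def not_le)
  then have "real R \<le> \<bar>real_of_int (k i)\<bar>" by linarith
  then show ?thesis using abs_le_wt[of k i] by linarith
qed

lemma wt_cube: "k \<in> cube R \<Longrightarrow> wt k \<le> real R + 1"
proof -
  assume k: "k \<in> cube R"
  obtain i where "wt k = 1 + \<bar>real_of_int (k i)\<bar>" by (rule wt_obtain)
  moreover have "\<bar>k i\<bar> \<le> int R" using k by (auto simp: cube_def)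
  ultimately show ?thesis by linarith
qed

lemma exists_cube: "\<exists>R. k \<in> cube R"
proof -
  obtain R where "{k} \<subseteq> PiE UNIV (\<lambda>_. {-int R..int R})" using finite_lattice_bounded[of "{k}"] by auto
  then have "k i \<in> {-int R..int R}" for i by (auto simp: PiE_UNIV_domain)
  then have "\<bar>k i\<bar> \<le> int R" for i by (meson abs_le_iff atLeastAtMost_iff minus_le_iff)
  then have "k \<in> cube R" by (simp add: cube_def)
  then show ?thesis by blast
qed

definition psum :: "nat \<Rightarrow> (real^'n::finite \<Rightarrow> complex) \<Rightarrow> real^'n \<Rightarrow> complex" where
  "psum R g y = (\<Sum>k\<in>cube R. fc g k * ex (kc k) y)"

lemma psum_trig: "psum R g \<in> trig"
  unfolding psum_def[abs_def] by (intro trig_sum trig.base)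

lemma smooth_on_psum: "smooth_on UNIV (psum R g)"
  by (rule smooth_on_trig[OF psum_trig])

lemma pds_psum:
  assumes "smooth_on UNIV g" "supp2 g"
  shows "foldr pd is (psum R g) y = psum R (foldr pd is g) y"
proof -
  have "foldr pd is (psum R g) y = (\<Sum>k\<in>cube R. foldr pd is (\<lambda>y. fc g k * ex (kc k) y) y)"
    unfolding psum_def[abs_def]
    by (rule pds_sum[OF open_UNIV]) (auto intro!: smooth_on_mult smooth_on_const smooth_on_ex)
  also have "\<dots> = (\<Sum>k\<in>cube R. fc (foldr pd is g) k * ex (kc k) y)"
  proof (rule sum.cong[OF refl])
    fix k
    show "foldr pd is (\<lambda>y. fc g k * ex (kc k) y) y = fc (foldr pd is g) k * ex (kc k) y"
      by (subst pds_cmult[OF open_UNIV smooth_on_ex]) (auto simp: pds_ex fc_pds[OF assms] kc_def)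
  qed
  finally show ?thesis by (simp add: psum_def)
qed

text \<open>Of the q+n+1 powers of decay, n+1 make the sum converge; the remaining q are worth at
  least (R+1)^q outside the cube and give the rate.\<close>

lemma sum_tail:
  obtains C :: real where "C > 0" "\<And>(a :: ('n::finite \<Rightarrow> int) \<Rightarrow> complex) A q R K.
    finite K \<Longrightarrow> K \<inter> cube R = {} \<Longrightarrow> (\<And>k. norm (a k) \<le> A / wt k ^ (q + CARD('n) + 1)) \<Longrightarrow>
    (\<Sum>k\<in>K. norm (a k)) \<le> C * A / (real R + 1) ^ q"
proof -
  obtain C where C: "C > 0" "\<And>K :: ('n \<Rightarrow> int) set. finite K \<Longrightarrow> (\<Sum>k\<in>K. 1 / wt k ^ (CARD('n) + 1)) \<le> C"
    using sum_wt_bounded by blast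
  show ?thesis
  proof (rule that[OF C(1)])
    fix a :: "('n \<Rightarrow> int) \<Rightarrow> complex" and A q R and K :: "('n \<Rightarrow> int) set"
    assume K: "finite K" "K \<inter> cube R = {}" and a: "\<And>k. norm (a k) \<le> A / wt k ^ (q + CARD('n) + 1)"
    have "0 \<le> A / wt (\<lambda>_::'n. 0) ^ (q + CARD('n) + 1)" using a[of "\<lambda>_. 0"] norm_ge_zero order_trans by blast
    moreover have "0 < wt (\<lambda>_::'n. 0) ^ (q + CARD('n) + 1)" by (rule zero_less_power[OF wt_pos])
    ultimately have A: "A \<ge> 0" by (metis divide_less_0_iff not_less)
    have "(\<Sum>k\<in>K. norm (a k)) \<le> (\<Sum>k\<in>K. (A / (real R + 1) ^ q) * (1 / wt k ^ (CARD('n) + 1)))"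
    proof (rule sum_mono)
      fix k assume k: "k \<in> K"
      have le: "(real R + 1) ^ q \<le> wt k ^ q" using wt_not_cube[of k R] K k by (intro power_mono) auto
      have "A / wt k ^ (q + CARD('n) + 1) = (A / wt k ^ q) * (1 / wt k ^ (CARD('n) + 1))"
        by (simp add: power_add)
      also have "\<dots> \<le> (A / (real R + 1) ^ q) * (1 / wt k ^ (CARD('n) + 1))"
        using le A wt_pos[of k] by (intro mult_right_mono divide_left_mono mult_pos_pos) auto
      finally show "norm (a k) \<le> (A / (real R + 1) ^ q) * (1 / wt k ^ (CARD('n) + 1))" using a[of k] by simp
    qed
    also have "\<dots> = (A / (real R + 1) ^ q) * (\<Sum>k\<in>K. 1 / wt k ^ (CARD('n) + 1))" by (rule sum_distrib_left[symmetric])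
    also have "\<dots> \<le> (A / (real R + 1) ^ q) * C" using A by (intro mult_left_mono C(2) K) auto
    finally show "(\<Sum>k\<in>K. norm (a k)) \<le> C * A / (real R + 1) ^ q" by (simp add: mult.commute)
  qed
qed

lemma psum_tail:
  obtains C :: real where "C > 0" "\<And>(g :: real^'n::finite \<Rightarrow> complex) B q R R' y.
    smooth_on UNIV g \<Longrightarrow> supp2 g \<Longrightarrow> dbound (cball 0 2) (q + CARD('n) + 1) g B \<Longrightarrow> R \<le> R' \<Longrightarrow>
    norm (psum R' g y - psum R g y) \<le> C * 2 ^ q * B / (real R + 1) ^ q"
proof -
  obtain C where C: "C > 0" "\<And>(a :: ('n::finite \<Rightarrow> int) \<Rightarrow> complex) A q R K.
    finite K \<Longrightarrow> K \<inter> cube R = {} \<Longrightarrow> (\<And>k. norm (a k) \<le> A / wt k ^ (q + CARD('n) + 1)) \<Longrightarrow>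
    (\<Sum>k\<in>K. norm (a k)) \<le> C * A / (real R + 1) ^ q" using sum_tail by blast
  show ?thesis
  proof (rule that[of "C * 2 ^ (CARD('n) + 1)"])
    fix g :: "real^'n \<Rightarrow> complex" and B q R R' y
    assume g: "smooth_on UNIV g" "supp2 g" "dbound (cball 0 2) (q + CARD('n) + 1) g B" and R: "R \<le> (R'::nat)"
    have "psum R' g y - psum R g y = (\<Sum>k\<in>cube R' - cube R. fc g k * ex (kc k) y)"
      unfolding psum_def using cube_mono[OF R] by (subst sum_diff) (auto simp: finite_cube)
    also have "norm \<dots> \<le> (\<Sum>k\<in>cube R' - cube R. norm (fc g k))"
      by (rule order_trans[OF norm_sum]) (simp add: norm_mult norm_ex_kc)
    also have "\<dots> \<le> C * (2 ^ (q + CARD('n) + 1) * B) / (real R + 1) ^ q"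
      by (rule C(2)[OF _ _ fc_decay[OF g]]) (auto simp: finite_cube)
    finally show "norm (psum R' g y - psum R g y) \<le> C * 2 ^ (CARD('n) + 1) * 2 ^ q * B / (real R + 1) ^ q"
      by (simp add: power_add mult_ac)
  qed (use C in auto)
qed

lemma pimean_mult_trig_zero:
  assumes h: "continuous_on pibox h" and p: "p \<in> trig"
    and z: "\<And>k. pimean (\<lambda>y. h y * ex (kc k) y) = 0"
  shows "pimean (\<lambda>y. h y * p y) = 0"
  using p
proof induction
  case (base c k)
  have "pimean (\<lambda>y. c * (h y * ex (kc k) y)) = 0" by (simp only: pimean_cmult z mult_zero_right)
  then show ?case by (simp add: mult_ac)
next
  case (add p q)
  have "pimean (\<lambda>y. h y * p y + h y * q y) = 0"
    using add continuous_on_mult[OF h smooth_continuous_pibox[OF smooth_on_trig]]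
    by (subst pimean_add) auto
  then show ?case by (simp add: distrib_left)
qed

lemma pimean_norm_zero:
  fixes h :: "real^'n::finite \<Rightarrow> complex"
  assumes h: "continuous_on pibox h" and z: "pimean (\<lambda>y. h y * cnj (h y)) = 0" and y: "y \<in> pibox"
  shows "h y = 0"
proof -
  have eq: "h y * cnj (h y) = complex_of_real ((norm (h y))\<^sup>2)" for y
    using complex_norm_square[of "h y"] by simp
  have c: "continuous_on pibox (\<lambda>y. (norm (h y))\<^sup>2)" by (intro continuous_intros h)
  have "integral pibox (\<lambda>y. complex_of_real ((norm (h y))\<^sup>2)) = of_real (integral pibox (\<lambda>y. (norm (h y))\<^sup>2))"
    using integral_linear[OF integrable_continuous[OF c[unfolded pibox_def]] bounded_linear_of_real[where 'a = complex]]
    by (simp add: pibox_def comp_def)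
  then have "integral (pibox :: (real^'n) set) (\<lambda>y. (norm (h y))\<^sup>2) = 0"
    using z unfolding eq pimean_def by simp
  moreover have "box (\<chi> i. - pi) (\<chi> i. pi) \<noteq> ({} :: (real^'n) set)"
    by (auto simp: interval_ne_empty_cart)
  ultimately have "\<forall>y\<in>pibox. (norm (h y))\<^sup>2 = 0"
    using c unfolding pibox_def by (subst (asm) integral_cbox_eq_0_iff) auto
  then show ?thesis using y by simp
qed

lemma pimean_psum:
  assumes "k \<in> cube R"
  shows "pimean (\<lambda>y. psum R g y * ex (kc (\<lambda>i. - k i)) y) = fc g k"
proof -
  have e: "ex (kc l) y * ex (kc (\<lambda>i. - k i)) y = ex (kc (\<lambda>i. l i - k i)) y" for l y
    unfolding ex_add[symmetric] by (simp add: kc_def)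
  have "psum R g y * ex (kc (\<lambda>i. - k i)) y = (\<Sum>l\<in>cube R. fc g l * ex (kc (\<lambda>i. l i - k i)) y)" for y
    by (simp add: psum_def sum_distrib_right mult.assoc e)
  then have "pimean (\<lambda>y. psum R g y * ex (kc (\<lambda>i. - k i)) y) = (\<Sum>l\<in>cube R. fc g l * pimean (ex (kc (\<lambda>i. l i - k i))))"
    by (simp add: pimean_sum pimean_cmult smooth_continuous_pibox smooth_on_mult smooth_on_const smooth_on_ex)
  also have "\<dots> = (\<Sum>l\<in>cube R. if l = k then fc g l else 0)"
    by (rule sum.cong) (auto simp: pimean_ex_kc fun_eq_iff)
  finally show ?thesis using assms by (simp add: finite_cube)
qed

text \<open>Decay of the coefficients gives a uniform limit g; the point is that g = G. The
  difference h is continuous and orthogonal to all exponentials, hence to all trigonometric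
  polynomials. As it is a uniform limit of such polynomials on the box, the mean of |h|^2 is
  0.\<close>

lemma psum_tendsto:
  fixes G :: "real^'n::finite \<Rightarrow> complex"
  assumes G: "smooth_on UNIV G" "supp2 G" and y: "y \<in> pibox"
  shows "(\<lambda>R. psum R G y) \<longlonglongrightarrow> G y"
proof -
  obtain C where C: "C > 0" "\<And>(g :: real^'n::finite \<Rightarrow> complex) B q R R' y.
    smooth_on UNIV g \<Longrightarrow> supp2 g \<Longrightarrow> dbound (cball 0 2) (q + CARD('n) + 1) g B \<Longrightarrow> R \<le> R' \<Longrightarrow>
    norm (psum R' g y - psum R g y) \<le> C * 2 ^ q * B / (real R + 1) ^ q" using psum_tail by blast
  obtain B where B: "B > 0" "dbound (cball 0 2) (1 + CARD('n) + 1) G B"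
    by (rule dbound_exists[OF open_UNIV compact_cball _ G(1)]) auto
  define A where "A = C * 2 * B"
  have A: "A > 0" using B C by (simp add: A_def)
  have T: "norm (psum R' G y - psum R G y) \<le> A / (real R + 1)" if "R \<le> R'" for R R' y
    using C(2)[OF G B(2) that, of y] by (simp add: A_def)
  have small: "\<exists>R0. \<forall>R\<ge>R0. A / (real R + 1) < e" if "e > 0" for e
  proof -
    obtain R0 where R0: "real R0 > A / e" using reals_Archimedean2 by blast
    have "A / (real R + 1) < e" if "R \<ge> R0" for R
    proof -
      have "A / e < real R + 1" using R0 that by linarith
      then show ?thesis using \<open>e > 0\<close> by (simp add: field_simps)
    qed
    then show ?thesis by blast
  qed
  have "Cauchy (\<lambda>R. psum R G y)" for y
  proof (rule metric_CauchyI)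
    fix e :: real assume "e > 0"
    then obtain R0 where R0: "\<forall>R\<ge>R0. A / (real R + 1) < e" using small by blast
    have "dist (psum a G y) (psum b G y) < e" if "R0 \<le> a" "R0 \<le> b" for a b
    proof (cases "a \<le> b")
      case True
      then show ?thesis using T[OF True, of y] R0[rule_format, OF that(1)] by (simp add: dist_norm norm_minus_commute)
    next
      case False
      then show ?thesis using T[of b a y] R0[rule_format, OF that(2)] by (simp add: dist_norm)
    qed
    then show "\<exists>M. \<forall>m\<ge>M. \<forall>n\<ge>M. dist (psum m G y) (psum n G y) < e" by blast
  qed
  then have "\<exists>l. (\<lambda>R. psum R G y) \<longlonglongrightarrow> l" for y using Cauchy_convergent convergent_def by blast
  then obtain g where g: "\<And>y. (\<lambda>R. psum R G y) \<longlonglongrightarrow> g y" by metis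
  have gT: "norm (g y - psum R G y) \<le> A / (real R + 1)" for R y
  proof (rule tendsto_upperbound)
    show "(\<lambda>R'. norm (psum R' G y - psum R G y)) \<longlonglongrightarrow> norm (g y - psum R G y)" by (intro tendsto_intros g)
    show "\<forall>\<^sub>F R' in sequentially. norm (psum R' G y - psum R G y) \<le> A / (real R + 1)"
      using eventually_ge_at_top[of R] by eventually_elim (rule T)
  qed simp
  have gc: "continuous_on UNIV g"
  proof (rule uniform_limit_theorem)
    show "uniform_limit UNIV (\<lambda>R y. psum R G y) g sequentially"
      unfolding uniform_limit_iff eventually_sequentially
    proof (intro allI impI)
      fix e :: real assume "e > 0"
      then obtain R0 where R0: "\<forall>R\<ge>R0. A / (real R + 1) < e" using small by blast
      then show "\<exists>N. \<forall>R\<ge>N. \<forall>y\<in>UNIV. dist (psum R G y) (g y) < e"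
        using gT by (intro exI[of _ R0]) (auto simp: dist_norm norm_minus_commute intro: le_less_trans)
    qed
    show "\<forall>\<^sub>F R in sequentially. continuous_on UNIV (psum R G)"
      by (simp add: smooth_on_continuous_on smooth_on_psum)
  qed simp
  define h where "h y = G y - g y" for y
  have hc: "continuous_on UNIV h" unfolding h_def by (intro continuous_intros gc smooth_on_continuous_on G)
  have hc': "continuous_on pibox h" by (rule continuous_on_subset[OF hc]) simp
  have hz: "pimean (\<lambda>y. h y * ex (kc k) y) = 0" for k
  proof (rule ccontr)
    assume nz: "pimean (\<lambda>y. h y * ex (kc k) y) \<noteq> 0"
    then obtain R0 where R0: "\<forall>R\<ge>R0. A / (real R + 1) < norm (pimean (\<lambda>y. h y * ex (kc k) y))" using small by fastforce
    obtain R1 where R1: "(\<lambda>i. - k i) \<in> cube R1" using exists_cube by blast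
    define R where "R = max R0 R1"
    have k: "(\<lambda>i. - k i) \<in> cube R" using R1 cube_mono[of R1 R] by (auto simp: R_def)
    have c1: "continuous_on pibox (\<lambda>y. (G y - psum R G y) * ex (kc k) y)" "continuous_on pibox (\<lambda>y. (psum R G y - g y) * ex (kc k) y)"
      by (intro continuous_intros smooth_continuous_pibox smooth_on_psum smooth_on_ex G open_UNIV continuous_on_subset[OF gc]; simp)+
    have "pimean (\<lambda>y. h y * ex (kc k) y) = pimean (\<lambda>y. (G y - psum R G y) * ex (kc k) y + (psum R G y - g y) * ex (kc k) y)"
      by (simp add: h_def algebra_simps)
    also have "\<dots> = pimean (\<lambda>y. (G y - psum R G y) * ex (kc k) y) + pimean (\<lambda>y. (psum R G y - g y) * ex (kc k) y)"
      by (rule pimean_add[OF c1])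
    also have "pimean (\<lambda>y. (G y - psum R G y) * ex (kc k) y) = 0"
    proof -
      have "pimean (\<lambda>y. G y * ex (kc k) y - psum R G y * ex (kc k) y) = 0"
        using pimean_psum[OF k, of G]
        by (subst pimean_diff) (auto intro!: smooth_continuous_pibox smooth_on_mult smooth_on_psum smooth_on_ex G simp: fc_def)
      then show ?thesis by (simp add: left_diff_distrib)
    qed
    finally have "pimean (\<lambda>y. h y * ex (kc k) y) = pimean (\<lambda>y. (psum R G y - g y) * ex (kc k) y)" by simp
    moreover have "norm (pimean (\<lambda>y. (psum R G y - g y) * ex (kc k) y)) \<le> A / (real R + 1)"
      by (rule norm_pimean[OF c1(2)]) (use gT in \<open>simp add: norm_mult norm_ex_kc norm_minus_commute\<close>)
    moreover have "A / (real R + 1) < norm (pimean (\<lambda>y. h y * ex (kc k) y))" using R0 by (simp add: R_def)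
    ultimately show False by simp
  qed
  obtain Bh where Bh: "\<And>y. y \<in> pibox \<Longrightarrow> norm (h y) \<le> Bh"
    using compact_imp_bounded[OF compact_continuous_image[OF hc' compact_pibox]] unfolding bounded_iff by blast
  have Bh0: "Bh \<ge> 0" using Bh[OF y] norm_ge_zero order_trans by blast
  have "pimean (\<lambda>y. h y * cnj (h y)) = 0"
  proof (rule ccontr)
    assume nz: "pimean (\<lambda>y. h y * cnj (h y)) \<noteq> 0"
    define e where "e = norm (pimean (\<lambda>y. h y * cnj (h y))) / (3 * (Bh + 1))"
    have e: "e > 0" using nz Bh0 by (simp add: e_def)
    obtain p where p: "p \<in> trig" "\<And>y. y \<in> pibox \<Longrightarrow> norm (G y - p y) < e"
      using trig_approx[OF smooth_on_continuous_on[OF G(1)] G(2) e] by blast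
    obtain R where R: "A / (real R + 1) < e" using small[OF e] by blast
    \<comment> \<open>\<open>trig_approx\<close> applies to G but not to h, since g is not known to
      vanish outside the ball. Hence G is approximated by p, and g by a partial sum.\<close>
    define q where "q y = p y + (-1) * psum R G y" for y
    have q: "q \<in> trig" unfolding q_def[abs_def] by (intro trig.add p trig_cmult psum_trig)
    have hq: "norm (h y - q y) \<le> 2 * e" if "y \<in> pibox" for y
    proof -
      have "norm (h y - q y) \<le> norm (G y - p y) + norm (g y - psum R G y)"
        using norm_triangle_ineq4[of "G y - p y" "g y - psum R G y"] by (simp add: h_def q_def algebra_simps)
      then show ?thesis using p(2)[OF that] gT[of y R] R by linarith
    qed
    have qc: "continuous_on pibox q" by (rule smooth_continuous_pibox[OF smooth_on_trig[OF q]])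
    have "pimean (\<lambda>y. h y * cnj (h y)) = pimean (\<lambda>y. h y * cnj (h y - q y) + h y * cnj (q y))" by (simp add: algebra_simps)
    also have "\<dots> = pimean (\<lambda>y. h y * cnj (h y - q y))"
      using pimean_mult_trig_zero[OF hc' trig_cnj[OF q] hz]
      by (subst pimean_add) (auto intro!: continuous_intros hc' qc)
    also have "norm \<dots> \<le> Bh * (2 * e)"
    proof (rule norm_pimean)
      show "continuous_on pibox (\<lambda>y. h y * cnj (h y - q y))" by (intro continuous_intros hc' qc)
      show "norm (h y * cnj (h y - q y)) \<le> Bh * (2 * e)" if "y \<in> pibox" for y
        unfolding norm_mult complex_mod_cnj by (rule mult_mono[OF Bh[OF that] hq[OF that] Bh0]) simp
    qed
    also have "\<dots> < 3 * (Bh + 1) * e" using e Bh0 by (simp add: algebra_simps add_nonneg_pos)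
    also have "\<dots> = norm (pimean (\<lambda>y. h y * cnj (h y)))" using Bh0 by (simp add: e_def)
    finally show False by simp
  qed
  from pimean_norm_zero[OF hc' this y] have "G y = g y" by (simp add: h_def)
  then show ?thesis using g[of y] by simp
qed

text \<open>Partial sums commute with differentiation (\<open>pds_psum\<close>), so the uniform tail
  estimate, applied to every derivative up to order j, yields a C^j estimate with the same
  constant.\<close>

lemma fourier_approx:
  obtains C :: real where "C > 0" "\<And>(g :: real^'n::finite \<Rightarrow> complex) B j q R.
    smooth_on UNIV g \<Longrightarrow> supp2 g \<Longrightarrow> dbound (cball 0 2) (j + q + CARD('n) + 1) g B \<Longrightarrow>
    dbound pibox j (\<lambda>y. g y - psum R g y) (C * 2 ^ q * B / (real R + 1) ^ q)"
proof -
  obtain C where C: "C > 0" "\<And>(g :: real^'n::finite \<Rightarrow> complex) B q R R' y.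
    smooth_on UNIV g \<Longrightarrow> supp2 g \<Longrightarrow> dbound (cball 0 2) (q + CARD('n) + 1) g B \<Longrightarrow> R \<le> R' \<Longrightarrow>
    norm (psum R' g y - psum R g y) \<le> C * 2 ^ q * B / (real R + 1) ^ q" using psum_tail by blast
  show ?thesis
  proof (rule that[OF C(1)])
    fix g :: "real^'n \<Rightarrow> complex" and B j q R
    assume g: "smooth_on UNIV g" "supp2 g" and d: "dbound (cball 0 2) (j + q + CARD('n) + 1) g B"
    show "dbound pibox j (\<lambda>y. g y - psum R g y) (C * 2 ^ q * B / (real R + 1) ^ q)"
      unfolding dbound_def
    proof (intro allI ballI impI)
      fix "is" :: "'n list" and y :: "real^'n" assume y: "y \<in> pibox" and l: "length is \<le> j"
      let ?h = "foldr pd is g"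
      have h: "smooth_on UNIV ?h" "supp2 ?h" using smooth_on_pds[OF g(1)] supp2_pds[OF g(2)] by auto
      have dh: "dbound (cball 0 2) (q + CARD('n) + 1) ?h B"
        by (rule dbound_pds, rule dbound_mono[OF d]) (use l in auto)
      have "norm (?h y - psum R ?h y) \<le> C * 2 ^ q * B / (real R + 1) ^ q"
      proof (rule tendsto_upperbound)
        show "(\<lambda>R'. norm (psum R' ?h y - psum R ?h y)) \<longlonglongrightarrow> norm (?h y - psum R ?h y)"
          by (intro tendsto_intros psum_tendsto h y)
        show "\<forall>\<^sub>F R' in sequentially. norm (psum R' ?h y - psum R ?h y) \<le> C * 2 ^ q * B / (real R + 1) ^ q"
          using eventually_ge_at_top[of R] by eventually_elim (rule C(2)[OF h dh])
      qed simp
      then show "norm (foldr pd is (\<lambda>y. g y - psum R g y) y) \<le> C * 2 ^ q * B / (real R + 1) ^ q"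
        by (subst pds_diff[OF open_UNIV g(1) smooth_on_psum]) (simp_all add: pds_psum[OF g])
    qed
  qed
qed

section \<open>Polynomials and the weight function\<close>

definition mono_mi :: "('n::finite \<Rightarrow> nat) \<Rightarrow> ('n \<Rightarrow> complex) \<Rightarrow> complex" where
  "mono_mi \<alpha> \<zeta> = (\<Prod>i\<in>UNIV. \<zeta> i ^ \<alpha> i)"

text \<open>Extends \<open>mpoly_eval\<close> to complex arguments, because frequencies will be
  shifted off the real space.\<close>

definition peval :: "nat \<Rightarrow> (('n::finite \<Rightarrow> nat) \<Rightarrow> complex) \<Rightarrow> ('n \<Rightarrow> complex) \<Rightarrow> complex" where
  "peval m q \<zeta> = (\<Sum>\<alpha> | mi_order \<alpha> \<le> m. q \<alpha> * mono_mi \<alpha> \<zeta>)"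

definition rv :: "real^'n \<Rightarrow> 'n \<Rightarrow> complex" where
  "rv \<xi> = (\<lambda>i. of_real (\<xi> $ i))"

text \<open>\<open>\<partial>\<^sup>\<alpha> Q(\<xi>) / \<alpha>!\<close>\<close>

definition tayl :: "nat \<Rightarrow> (('n::finite \<Rightarrow> nat) \<Rightarrow> complex) \<Rightarrow> ('n \<Rightarrow> complex) \<Rightarrow> ('n \<Rightarrow> nat) \<Rightarrow> complex" where
  "tayl m q \<xi> \<alpha> = (\<Sum>\<beta> | mi_order \<beta> \<le> m. q \<beta> * (\<Prod>i\<in>UNIV. of_nat (\<beta> i choose \<alpha> i) * \<xi> i ^ (\<beta> i - \<alpha> i)))"

lemma mi_le_order: "\<alpha> i \<le> mi_order \<alpha>"
  unfolding mi_order_def by (rule member_le_sum) auto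

text \<open>The binomial formula in each coordinate, multiplied out. The range of \<alpha> can be
  adjusted freely because the product of binomial coefficients vanishes unless \<alpha> \<le>
  \<beta> in every coordinate.\<close>

lemma peval_taylor:
  fixes \<xi> w :: "'n::finite \<Rightarrow> complex"
  shows "peval m q (\<lambda>i. \<xi> i + w i) = (\<Sum>\<alpha> | mi_order \<alpha> \<le> m. tayl m q \<xi> \<alpha> * mono_mi \<alpha> w)"
proof -
  have m: "mono_mi \<beta> (\<lambda>i. \<xi> i + w i) =
      (\<Sum>\<alpha> | mi_order \<alpha> \<le> m. (\<Prod>i\<in>UNIV. of_nat (\<beta> i choose \<alpha> i) * \<xi> i ^ (\<beta> i - \<alpha> i)) * mono_mi \<alpha> w)"
    if \<beta>: "mi_order \<beta> \<le> m" for \<beta> :: "'n \<Rightarrow> nat"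
  proof -
    let ?t = "\<lambda>i a. of_nat (\<beta> i choose a) * \<xi> i ^ (\<beta> i - a) * w i ^ a"
    have b: "(\<xi> i + w i) ^ \<beta> i = (\<Sum>a\<in>{..m}. ?t i a)" for i
    proof -
      have "(\<xi> i + w i) ^ \<beta> i = (\<Sum>a\<le>\<beta> i. ?t i a)"
        using binomial_ring[of "w i" "\<xi> i" "\<beta> i"] by (simp add: add.commute mult_ac)
      also have "\<dots> = (\<Sum>a\<in>{..m}. ?t i a)"
        by (rule sum.mono_neutral_left) (use mi_le_order[of \<beta> i] \<beta> in auto)
      finally show ?thesis .
    qed
    have "mono_mi \<beta> (\<lambda>i. \<xi> i + w i) = (\<Sum>\<alpha>\<in>PiE UNIV (\<lambda>_. {..m}). \<Prod>i\<in>UNIV. ?t i (\<alpha> i))"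
      unfolding mono_mi_def b by (rule prod_sum_PiE) auto
    also have "\<dots> = (\<Sum>\<alpha> | mi_order \<alpha> \<le> m. \<Prod>i\<in>UNIV. ?t i (\<alpha> i))"
    proof (rule sum.mono_neutral_right)
      show "{\<alpha> :: 'n \<Rightarrow> nat. mi_order \<alpha> \<le> m} \<subseteq> PiE UNIV (\<lambda>_. {..m})"
        using mi_le_order order_trans by (auto simp: PiE_UNIV_domain) blast
      show "\<forall>\<alpha>\<in>PiE UNIV (\<lambda>_. {..m}) - {\<alpha>. mi_order \<alpha> \<le> m}. (\<Prod>i\<in>UNIV. ?t i (\<alpha> i)) = 0"
      proof
        fix \<alpha> :: "'n \<Rightarrow> nat" assume "\<alpha> \<in> PiE UNIV (\<lambda>_. {..m}) - {\<alpha>. mi_order \<alpha> \<le> m}"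
        then have "mi_order \<beta> < mi_order \<alpha>" using \<beta> by auto
        then obtain i where "\<beta> i < \<alpha> i" unfolding mi_order_def by (meson not_le sum_mono)
        then show "(\<Prod>i\<in>UNIV. ?t i (\<alpha> i)) = 0" by (intro prod_zero) (auto intro!: bexI[of _ i])
      qed
    qed (auto intro: finite_PiE)
    finally show ?thesis by (simp add: mono_mi_def prod.distrib[symmetric])
  qed
  have "peval m q (\<lambda>i. \<xi> i + w i) = (\<Sum>\<beta> | mi_order \<beta> \<le> m. \<Sum>\<alpha> | mi_order \<alpha> \<le> m.
      q \<beta> * (\<Prod>i\<in>UNIV. of_nat (\<beta> i choose \<alpha> i) * \<xi> i ^ (\<beta> i - \<alpha> i)) * mono_mi \<alpha> w)"
    unfolding peval_def by (rule sum.cong) (auto simp: m sum_distrib_left mult.assoc)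
  also have "\<dots> = (\<Sum>\<alpha> | mi_order \<alpha> \<le> m. tayl m q \<xi> \<alpha> * mono_mi \<alpha> w)"
    unfolding tayl_def sum_distrib_right by (rule sum.swap)
  finally show ?thesis .
qed

subsection \<open>The weight in terms of Taylor coefficients\<close>

definition mono_x :: "('n::finite \<Rightarrow> nat) \<Rightarrow> real^'n \<Rightarrow> complex" where
  "mono_x \<beta> x = (\<Prod>i\<in>UNIV. of_real (x $ i) ^ \<beta> i)"

lemma mono_x_has_derivative:
  fixes x :: "real^'n::finite"
  shows "(mono_x \<beta> has_derivative (\<lambda>h. \<Sum>j\<in>UNIV. (of_nat (\<beta> j) * of_real (h $ j) * of_real (x $ j) ^ (\<beta> j - 1)) *
    (\<Prod>k\<in>UNIV - {j}. of_real (x $ k) ^ \<beta> k))) (at x)"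
  unfolding mono_x_def[abs_def]
  by (rule has_derivative_prod, rule has_derivative_power, rule bounded_linear_imp_has_derivative,
      rule bounded_linear_compose[OF bounded_linear_of_real bounded_linear_vec_nth])

lemma pd_mono_x: "pd i (mono_x \<beta>) = (\<lambda>x. of_nat (\<beta> i) * mono_x (\<beta>(i := \<beta> i - 1)) x)"
proof
  fix x :: "real^'a"
  have "pd i (mono_x \<beta>) x = (\<Sum>j\<in>UNIV. if j = i then of_nat (\<beta> i) * of_real (x $ i) ^ (\<beta> i - 1) *
    (\<Prod>k\<in>UNIV - {i}. of_real (x $ k) ^ \<beta> k) else 0)"
    unfolding pd_eq[OF mono_x_has_derivative] by (rule sum.cong) (auto simp: axis_def)
  also have "\<dots> = of_nat (\<beta> i) * (of_real (x $ i) ^ (\<beta> i - 1) * (\<Prod>k\<in>UNIV - {i}. of_real (x $ k) ^ \<beta> k))"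
    by simp
  also have "of_real (x $ i) ^ (\<beta> i - 1) * (\<Prod>k\<in>UNIV - {i}. of_real (x $ k) ^ \<beta> k) = mono_x (\<beta>(i := \<beta> i - 1)) x"
    unfolding mono_x_def by (subst (2) prod.remove[of _ i]) auto
  finally show "pd i (mono_x \<beta>) x = of_nat (\<beta> i) * mono_x (\<beta>(i := \<beta> i - 1)) x" .
qed

lemma mono_x_differentiable: "mono_x \<beta> differentiable at x"
  using mono_x_has_derivative differentiable_def by blast

lemma pd_cmult:
  "f differentiable at x \<Longrightarrow> pd i (\<lambda>x. c * f x) x = c * pd i f x"
  by (subst pd_mult) auto

lemma smooth_on_mono_x: "smooth_on UNIV (mono_x \<beta>)"
proof (rule smooth_on_alg[where F = "range mono_x"])
  show "\<exists>g\<in>alg (range mono_x). \<forall>x\<in>UNIV. pd i f x = g x" if fr: "f \<in> range mono_x" for f and i :: 'a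
  proof -
    obtain \<beta> where "f = mono_x \<beta>" using fr by blast
    then show ?thesis
      by (intro bexI[of _ "\<lambda>x. of_nat (\<beta> i) * mono_x (\<beta>(i := \<beta> i - 1)) x"] alg.mult alg.const alg.base) (auto simp: pd_mono_x)
  qed
qed (auto intro: mono_x_differentiable alg.base)

lemma pd_pow_mono_x:
  "(pd i ^^ a) (mono_x \<beta>) = (\<lambda>x. of_nat ((\<beta> i choose a) * fact a) * mono_x (\<beta>(i := \<beta> i - a)) x)"
proof (induction a)
  case (Suc a)
  have "(pd i ^^ Suc a) (mono_x \<beta>) = (\<lambda>x. of_nat ((\<beta> i choose a) * fact a * (\<beta> i - a)) * mono_x (\<beta>(i := \<beta> i - Suc a)) x)"
  proof
    fix x
    have "(pd i ^^ Suc a) (mono_x \<beta>) x = of_nat ((\<beta> i choose a) * fact a) * pd i (mono_x (\<beta>(i := \<beta> i - a))) x"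
      unfolding funpow.simps comp_apply Suc by (rule pd_cmult[OF mono_x_differentiable])
    then show "(pd i ^^ Suc a) (mono_x \<beta>) x = of_nat ((\<beta> i choose a) * fact a * (\<beta> i - a)) * mono_x (\<beta>(i := \<beta> i - Suc a)) x"
      unfolding pd_mono_x by simp
  qed
  moreover have "(\<beta> i choose a) * fact a * (\<beta> i - a) = (\<beta> i choose Suc a) * fact (Suc a)"
  proof -
    have "(\<beta> i - a) * (\<beta> i choose a) = Suc a * (\<beta> i choose Suc a)"
      by (metis binomial_absorb_comp binomial_absorption)
    then show ?thesis by (simp add: algebra_simps)
  qed
  ultimately show ?case by (simp only:)
qed simp

lemma pd_pow_cmult_mono_x: "(pd i ^^ a) (\<lambda>x. c * mono_x \<beta> x) = (\<lambda>x. c * (pd i ^^ a) (mono_x \<beta>) x)"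
proof (induction a)
  case (Suc a)
  show ?case
    unfolding funpow.simps comp_apply Suc
    by (rule ext, rule pd_cmult) (simp add: pd_pow_mono_x mono_x_differentiable derivative_intros)
qed simp

lemma mpd_mono_x:
  fixes \<beta> :: "'n::finite \<Rightarrow> nat"
  shows "mpd \<alpha> (mono_x \<beta>) = (\<lambda>x. (\<Prod>i\<in>UNIV. fact (\<alpha> i)) * (\<Prod>i\<in>UNIV. of_nat (\<beta> i choose \<alpha> i) * of_real (x $ i) ^ (\<beta> i - \<alpha> i)))"
proof -
  have "distinct is \<Longrightarrow> foldr (\<lambda>i. pd i ^^ \<alpha> i) is (mono_x \<beta>) =
    (\<lambda>x. (\<Prod>i\<in>set is. of_nat ((\<beta> i choose \<alpha> i) * fact (\<alpha> i))) * mono_x (\<lambda>i. if i \<in> set is then \<beta> i - \<alpha> i else \<beta> i) x)" for "is"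
  proof (induction "is")
    case (Cons i "is")
    let ?b = "\<lambda>i. if i \<in> set is then \<beta> i - \<alpha> i else \<beta> i"
    have "?b i = \<beta> i" "?b(i := \<beta> i - \<alpha> i) = (\<lambda>j. if j \<in> set (i # is) then \<beta> j - \<alpha> j else \<beta> j)" using Cons.prems by auto
    note b = this
    have IH: "foldr (\<lambda>i. pd i ^^ \<alpha> i) is (mono_x \<beta>) = (\<lambda>x. (\<Prod>i\<in>set is. of_nat ((\<beta> i choose \<alpha> i) * fact (\<alpha> i))) * mono_x ?b x)"
      using Cons by simp
    have "foldr (\<lambda>i. pd i ^^ \<alpha> i) (i # is) (mono_x \<beta>) = (\<lambda>x. (\<Prod>i\<in>set is. of_nat ((\<beta> i choose \<alpha> i) * fact (\<alpha> i))) *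
        (of_nat ((?b i choose \<alpha> i) * fact (\<alpha> i)) * mono_x (?b(i := ?b i - \<alpha> i)) x))"
      unfolding foldr_Cons comp_apply IH pd_pow_cmult_mono_x pd_pow_mono_x ..
    then show ?case unfolding b using Cons.prems by (simp add: mult_ac)
  qed simp
  from this[OF coordinates(1)] show ?thesis
    by (simp add: mpd_def coordinates(2) fun_eq_iff mono_x_def prod.distrib mult_ac)
qed

lemma mpd_mpoly_eval:
  fixes q :: "('n::finite \<Rightarrow> nat) \<Rightarrow> complex"
  shows "mpd \<alpha> (mpoly_eval m q) \<xi> = (\<Prod>i\<in>UNIV. fact (\<alpha> i)) * tayl m q (rv \<xi>) \<alpha>"
proof -
  have "mpd \<alpha> (mpoly_eval m q) \<xi> = foldr pd (mi_list \<alpha>) (\<lambda>\<xi>. \<Sum>\<beta> | mi_order \<beta> \<le> m. q \<beta> * mono_x \<beta> \<xi>) \<xi>"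
    by (simp add: mpd_eq_pds mpoly_eval_def[abs_def] mono_x_def[abs_def])
  also have "\<dots> = (\<Sum>\<beta> | mi_order \<beta> \<le> m. q \<beta> * mpd \<alpha> (mono_x \<beta>) \<xi>)"
    by (subst pds_sum[OF open_UNIV])
       (auto intro!: smooth_on_mult smooth_on_const smooth_on_mono_x simp: mpd_eq_pds pds_cmult[OF open_UNIV smooth_on_mono_x])
  finally show ?thesis
    by (simp add: mpd_mono_x tayl_def rv_def sum_distrib_left mult_ac)
qed

lemma weight_eq:
  "weight m q \<xi> = sqrt (\<Sum>\<alpha> | mi_order \<alpha> \<le> m. ((\<Prod>i\<in>UNIV. fact (\<alpha> i)) * norm (tayl m q (rv \<xi>) \<alpha>))\<^sup>2)"
  by (simp add: weight_def mpd_mpoly_eval norm_mult prod_norm[symmetric] abs_prod)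

lemma weight_nonneg: "0 \<le> weight m q \<xi>"
  by (simp add: weight_def sum_nonneg)

text \<open>Together with \<open>weight_le_sum_tayl\<close> this makes the weight equivalent to the
  size of the Taylor coefficients, with constants depending only on m and the dimension.\<close>

lemma norm_tayl_le_weight:
  assumes "mi_order \<alpha> \<le> m"
  shows "norm (tayl m q (rv \<xi>) \<alpha>) \<le> weight m q (\<xi> :: real^'n::finite)"
proof -
  let ?f = "\<lambda>\<alpha>. (\<Prod>i\<in>UNIV. fact (\<alpha> i)) * norm (tayl m q (rv \<xi>) \<alpha>)"
  have "1 \<le> (\<Prod>i\<in>UNIV. fact (\<alpha> i) :: real)" by (rule prod_ge_1) simp
  then have "norm (tayl m q (rv \<xi>) \<alpha>) \<le> ?f \<alpha>" by (simp add: mult_left_mono[of 1, simplified] mult_le_cancel_right1)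
  also have "?f \<alpha> = sqrt ((?f \<alpha>)\<^sup>2)" by (simp add: prod_nonneg)
  also have "\<dots> \<le> weight m q \<xi>"
    unfolding weight_eq
    by (rule real_sqrt_le_mono, rule member_le_sum[of \<alpha> _ "\<lambda>\<alpha>. (?f \<alpha>)\<^sup>2"]) (use assms finite_mi in auto)
  finally show ?thesis .
qed

lemma weight_le_sum_tayl:
  "weight m q (\<xi> :: real^'n::finite) \<le> fact m ^ CARD('n) * (\<Sum>\<alpha> | mi_order \<alpha> \<le> m. norm (tayl m q (rv \<xi>) \<alpha>))"
proof -
  let ?f = "\<lambda>\<alpha>. (\<Prod>i\<in>UNIV. fact (\<alpha> i)) * norm (tayl m q (rv \<xi>) \<alpha>)"
  have "weight m q \<xi> = L2_set ?f {\<alpha>. mi_order \<alpha> \<le> m}" by (simp add: weight_eq L2_set_def)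
  also have "\<dots> \<le> sum ?f {\<alpha>. mi_order \<alpha> \<le> m}" by (rule L2_set_le_sum) (auto intro!: mult_nonneg_nonneg prod_nonneg)
  also have "\<dots> \<le> (\<Sum>\<alpha> | mi_order \<alpha> \<le> m. fact m ^ CARD('n) * norm (tayl m q (rv \<xi>) \<alpha>))"
  proof (rule sum_mono, rule mult_right_mono)
    fix \<alpha> :: "'n \<Rightarrow> nat" assume "\<alpha> \<in> {\<alpha>. mi_order \<alpha> \<le> m}"
    then have "(\<Prod>i\<in>UNIV. fact (\<alpha> i) :: real) \<le> (\<Prod>i\<in>(UNIV :: 'n set). fact m)"
      using mi_le_order[of \<alpha>] order_trans by (intro prod_mono conjI fact_mono) auto
    then show "(\<Prod>i\<in>UNIV. fact (\<alpha> i) :: real) \<le> fact m ^ CARD('n)" by simp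
  qed simp
  finally show ?thesis by (simp add: sum_distrib_left)
qed

subsection \<open>Kronecker substitution\<close>

definition idx :: "'n::finite \<Rightarrow> nat" where
  "idx = (SOME h. bij_betw h UNIV {0..<CARD('n)})"

lemma idx_bij: "bij_betw (idx :: 'n::finite \<Rightarrow> nat) UNIV {0..<CARD('n)}"
  using someI_ex[OF ex_bij_betw_finite_nat[OF finite_class.finite_UNIV[where 'a = 'n]]] by (simp add: idx_def)

definition kexp :: "nat \<Rightarrow> ('n::finite \<Rightarrow> nat) \<Rightarrow> nat" where
  "kexp m \<alpha> = (\<Sum>i\<in>UNIV. \<alpha> i * (m + 1) ^ idx i)"

text \<open>A curve (Kronecker substitution) along which no coefficient is lost: the monomial
  \<alpha> becomes z to the power \<open>kexp m \<alpha>\<close>, the number with digits \<alpha> in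
  base m+1, and different \<alpha> of order at most m have different exponents.\<close>

definition gam :: "nat \<Rightarrow> complex \<Rightarrow> 'n::finite \<Rightarrow> complex" where
  "gam m z = (\<lambda>i. z ^ ((m + 1) ^ idx i))"

definition kdeg :: "'n::finite itself \<Rightarrow> nat \<Rightarrow> nat" where
  "kdeg _ m = (\<Sum>i\<in>(UNIV :: 'n set). m * (m + 1) ^ idx i)"

lemma digits_unique:
  fixes a b :: "nat \<Rightarrow> nat"
  assumes "(\<Sum>j<n. a j * B ^ j) = (\<Sum>j<n. b j * B ^ j)" "\<And>j. j < n \<Longrightarrow> a j < B" "\<And>j. j < n \<Longrightarrow> b j < B" "j < n"
  shows "a j = b j"
  using assms
proof (induction n arbitrary: a b j)
  case (Suc n)
  have s: "(\<Sum>j<Suc n. c j * B ^ j) = c 0 + B * (\<Sum>j<n. c (Suc j) * B ^ j)" for c :: "nat \<Rightarrow> nat"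
    by (subst sum.lessThan_Suc_shift) (simp add: sum_distrib_left mult_ac)
  have eq: "a 0 + B * (\<Sum>j<n. a (Suc j) * B ^ j) = b 0 + B * (\<Sum>j<n. b (Suc j) * B ^ j)"
    using Suc.prems(1) by (simp only: s)
  have "a 0 < B" "b 0 < B" using Suc.prems by auto
  then have 0: "a 0 = b 0" using arg_cong[OF eq, of "\<lambda>x. x mod B"] by simp
  then have "(\<Sum>j<n. a (Suc j) * B ^ j) = (\<Sum>j<n. b (Suc j) * B ^ j)" using eq \<open>a 0 < B\<close> by simp
  from Suc.IH[OF this] Suc.prems(2-4) 0 show ?case by (cases j) auto
qed simp

lemma kexp_inj:
  fixes \<alpha> \<beta> :: "'n::finite \<Rightarrow> nat"
  assumes "kexp m \<alpha> = kexp m \<beta>" "mi_order \<alpha> \<le> m" "mi_order \<beta> \<le> m"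
  shows "\<alpha> = \<beta>"
proof
  fix i :: 'n
  let ?g = "inv_into UNIV (idx :: 'n \<Rightarrow> nat)"
  have g: "?g (idx i) = i" for i by (rule inv_into_f_f) (use idx_bij in \<open>auto simp: bij_betw_def\<close>)
  have k: "kexp m \<alpha> = (\<Sum>j<CARD('n). \<alpha> (?g j) * (m + 1) ^ j)" for \<alpha> :: "'n \<Rightarrow> nat"
    using sum.reindex_bij_betw[OF idx_bij[where 'n = 'n], of "\<lambda>j. \<alpha> (?g j) * (m + 1) ^ j"]
    by (simp add: kexp_def g atLeast0LessThan)
  have "\<alpha> (?g (idx i)) = \<beta> (?g (idx i))"
  proof (rule digits_unique[where a = "\<lambda>j. \<alpha> (?g j)" and b = "\<lambda>j. \<beta> (?g j)" and B = "m + 1"])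
    show "(\<Sum>j<CARD('n). \<alpha> (?g j) * (m + 1) ^ j) = (\<Sum>j<CARD('n). \<beta> (?g j) * (m + 1) ^ j)"
      using assms(1) by (simp only: k)
    show "\<alpha> (?g j) < m + 1" for j using mi_le_order[of \<alpha> "?g j"] assms(2) by simp
    show "\<beta> (?g j) < m + 1" for j using mi_le_order[of \<beta> "?g j"] assms(3) by simp
    show "idx i < CARD('n)" using idx_bij[where 'n = 'n] unfolding bij_betw_def by (metis atLeastLessThan_iff rangeI)
  qed
  then show "\<alpha> i = \<beta> i" by (simp only: g)
qed

lemma mono_mi_gam: "mono_mi \<alpha> (gam m z) = z ^ kexp m \<alpha>"
  by (simp add: mono_mi_def gam_def kexp_def power_sum power_mult[symmetric] mult.commute)

lemma kexp_le: "mi_order \<alpha> \<le> m \<Longrightarrow> kexp m (\<alpha> :: 'n::finite \<Rightarrow> nat) \<le> kdeg TYPE('n) m"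
  unfolding kexp_def kdeg_def using mi_le_order[of \<alpha>] order_trans by (intro sum_mono mult_right_mono) auto

definition kpoly :: "nat \<Rightarrow> (('n::finite \<Rightarrow> nat) \<Rightarrow> complex) \<Rightarrow> complex poly" where
  "kpoly m a = (\<Sum>\<alpha> | mi_order \<alpha> \<le> m. monom (a \<alpha>) (kexp m \<alpha>))"

lemma poly_kpoly: "poly (kpoly m a) z = (\<Sum>\<alpha> | mi_order \<alpha> \<le> m. a \<alpha> * mono_mi \<alpha> (gam m z))"
  by (simp add: kpoly_def poly_sum poly_monom mono_mi_gam)

lemma coeff_kpoly:
  assumes "mi_order \<alpha> \<le> m" shows "coeff (kpoly m a) (kexp m \<alpha>) = a \<alpha>"
proof -
  have "coeff (kpoly m a) (kexp m \<alpha>) = (\<Sum>\<beta> | mi_order \<beta> \<le> m. if \<beta> = \<alpha> then a \<beta> else 0)"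
    unfolding kpoly_def coeff_sum by (rule sum.cong) (use assms kexp_inj in auto)
  also have "\<dots> = a \<alpha>" using assms by (simp add: finite_mi)
  finally show ?thesis .
qed

lemma degree_kpoly: "degree (kpoly m (a :: ('n::finite \<Rightarrow> nat) \<Rightarrow> complex)) \<le> kdeg TYPE('n) m"
  unfolding kpoly_def using kexp_le by (intro degree_sum_le finite_mi) (auto intro: order_trans[OF degree_monom_le])

text \<open>The identity theorem for polynomials in several variables, reduced to one variable by
  restriction to the curve \<open>gam\<close>.\<close>

lemma mi_coeffs_unique:
  assumes "\<And>w. (\<Sum>\<alpha> | mi_order \<alpha> \<le> m. a \<alpha> * mono_mi \<alpha> w) = (\<Sum>\<alpha> | mi_order \<alpha> \<le> m. b \<alpha> * mono_mi \<alpha> w)"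
    and "mi_order \<alpha> \<le> m"
  shows "a \<alpha> = (b :: ('n::finite \<Rightarrow> nat) \<Rightarrow> complex) \<alpha>"
proof -
  have "poly (kpoly m a) = poly (kpoly m b)" by (rule ext) (simp add: poly_kpoly assms(1))
  then have "kpoly m a = kpoly m b" by (simp add: poly_eq_poly_eq_iff)
  then show ?thesis using coeff_kpoly[OF assms(2)] by metis
qed

text \<open>Both sides are the coefficients of w -> Q(\<xi>0 + w); on the right Q is first expanded
  at \<xi>.\<close>

lemma tayl_shift:
  assumes "mi_order \<alpha> \<le> m"
  shows "tayl m q \<xi>0 \<alpha> = tayl m (tayl m q \<xi>) (\<lambda>i. \<xi>0 i - \<xi> i) \<alpha>"
proof (rule mi_coeffs_unique[OF _ assms])
  fix w
  have "(\<Sum>\<alpha> | mi_order \<alpha> \<le> m. tayl m (tayl m q \<xi>) (\<lambda>i. \<xi>0 i - \<xi> i) \<alpha> * mono_mi \<alpha> w) = peval m (tayl m q \<xi>) (\<lambda>i. \<xi>0 i - \<xi> i + w i)"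
    by (rule peval_taylor[symmetric])
  also have "\<dots> = peval m q (\<lambda>i. \<xi> i + (\<xi>0 i - \<xi> i + w i))"
    unfolding peval_taylor[of m q \<xi>] by (simp add: peval_def)
  also have "\<dots> = (\<Sum>\<alpha> | mi_order \<alpha> \<le> m. tayl m q \<xi>0 \<alpha> * mono_mi \<alpha> w)"
    by (simp add: peval_taylor[symmetric] add.assoc[symmetric])
  finally show "(\<Sum>\<alpha> | mi_order \<alpha> \<le> m. tayl m q \<xi>0 \<alpha> * mono_mi \<alpha> w) =
     (\<Sum>\<alpha> | mi_order \<alpha> \<le> m. tayl m (tayl m q \<xi>) (\<lambda>i. \<xi>0 i - \<xi> i) \<alpha> * mono_mi \<alpha> w)" by simp
qed

text \<open>The weight is a temperate function in the sense of Hoermander: it varies at most like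
  the m-th power of the distance, with a constant independent of the polynomial. This turns
  invertibility of the weight at one point into a lower bound at all lattice frequencies.\<close>

lemma weight_shift:
  obtains C :: real where "C > 0" "\<And>q (\<xi> :: real^'n::finite) \<xi>0 H. 1 \<le> H \<Longrightarrow> (\<And>i. \<bar>\<xi>0 $ i - \<xi> $ i\<bar> \<le> H) \<Longrightarrow>
    weight m q \<xi>0 \<le> C * H ^ m * weight m q \<xi>"
proof -
  define K where "K = real (card {\<alpha> :: 'n \<Rightarrow> nat. mi_order \<alpha> \<le> m})"
  define C where "C = fact m ^ CARD('n) * (K * (K * (2 ^ m) ^ CARD('n)))"
  have "weight m q \<xi>0 \<le> (C + 1) * H ^ m * weight m q \<xi>"
    if H: "1 \<le> H" "\<And>i. \<bar>\<xi>0 $ i - \<xi> $ i\<bar> \<le> H" for q and \<xi> \<xi>0 :: "real^'n" and H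
  proof -
    have W: "0 \<le> weight m q \<xi>" by (rule weight_nonneg)
    have b: "norm (\<Prod>i\<in>UNIV. of_nat (\<beta> i choose \<alpha> i) * (rv \<xi>0 i - rv \<xi> i) ^ (\<beta> i - \<alpha> i)) \<le> (2 ^ m) ^ CARD('n) * H ^ m"
      if \<beta>: "mi_order \<beta> \<le> m" for \<alpha> \<beta> :: "'n \<Rightarrow> nat"
    proof -
      have "norm (\<Prod>i\<in>UNIV. of_nat (\<beta> i choose \<alpha> i) * (rv \<xi>0 i - rv \<xi> i) ^ (\<beta> i - \<alpha> i)) \<le> (\<Prod>i\<in>UNIV. 2 ^ m * H ^ \<beta> i)"
        unfolding prod_norm[symmetric]
      proof (rule prod_mono, intro conjI)
        fix i
        have "norm (rv \<xi>0 i - rv \<xi> i) \<le> H" using H(2)[of i] unfolding rv_def by (simp add: of_real_diff[symmetric] del: of_real_diff)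
        then have "norm (rv \<xi>0 i - rv \<xi> i) ^ (\<beta> i - \<alpha> i) \<le> H ^ (\<beta> i - \<alpha> i)" by (intro power_mono) auto
        also have "\<dots> \<le> H ^ \<beta> i" using H(1) by (intro power_increasing) auto
        finally have 1: "norm (rv \<xi>0 i - rv \<xi> i) ^ (\<beta> i - \<alpha> i) \<le> H ^ \<beta> i" .
        have "\<beta> i choose \<alpha> i \<le> 2 ^ \<beta> i" by (rule binomial_le_pow2)
        also have "(2::nat) ^ \<beta> i \<le> 2 ^ m" using mi_le_order[of \<beta> i] \<beta> by (intro power_increasing) auto
        finally have "real (\<beta> i choose \<alpha> i) \<le> 2 ^ m" by (metis of_nat_le_iff of_nat_numeral of_nat_power)
        then show "norm (of_nat (\<beta> i choose \<alpha> i) * (rv \<xi>0 i - rv \<xi> i) ^ (\<beta> i - \<alpha> i)) \<le> 2 ^ m * H ^ \<beta> i"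
          using 1 by (simp add: norm_mult norm_power mult_mono)
      qed simp
      also have "\<dots> = (2 ^ m) ^ CARD('n) * H ^ mi_order \<beta>" by (simp add: prod.distrib power_sum mi_order_def)
      also have "\<dots> \<le> (2 ^ m) ^ CARD('n) * H ^ m" using H(1) \<beta> by (intro mult_left_mono power_increasing) auto
      finally show ?thesis .
    qed
    have t: "norm (tayl m q (rv \<xi>0) \<alpha>) \<le> K * (weight m q \<xi> * ((2 ^ m) ^ CARD('n) * H ^ m))" if \<alpha>: "mi_order \<alpha> \<le> m" for \<alpha>
    proof -
      have "norm (tayl m q (rv \<xi>0) \<alpha>) \<le> (\<Sum>\<beta> | mi_order \<beta> \<le> m. norm (tayl m q (rv \<xi>) \<beta>) * norm (\<Prod>i\<in>UNIV. of_nat (\<beta> i choose \<alpha> i) * (rv \<xi>0 i - rv \<xi> i) ^ (\<beta> i - \<alpha> i)))"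
        unfolding tayl_shift[OF \<alpha>, of q "rv \<xi>0" "rv \<xi>"] tayl_def[of m "tayl m q (rv \<xi>)"] norm_mult[symmetric] by (rule norm_sum)
      also have "\<dots> \<le> (\<Sum>\<beta> :: 'n \<Rightarrow> nat | mi_order \<beta> \<le> m. weight m q \<xi> * ((2 ^ m) ^ CARD('n) * H ^ m))"
        by (intro sum_mono mult_mono b norm_tayl_le_weight W) auto
      finally show ?thesis by (simp add: K_def)
    qed
    have "weight m q \<xi>0 \<le> fact m ^ CARD('n) * (\<Sum>\<alpha> | mi_order \<alpha> \<le> m. norm (tayl m q (rv \<xi>0) \<alpha>))"
      by (rule weight_le_sum_tayl)
    also have "\<dots> \<le> fact m ^ CARD('n) * (\<Sum>\<alpha> :: 'n \<Rightarrow> nat | mi_order \<alpha> \<le> m. K * (weight m q \<xi> * ((2 ^ m) ^ CARD('n) * H ^ m)))"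
      by (intro mult_left_mono sum_mono t) auto
    also have "\<dots> = C * (H ^ m * weight m q \<xi>)" by (simp add: C_def K_def mult_ac)
    also have "\<dots> \<le> (C + 1) * (H ^ m * weight m q \<xi>)" using H(1) W by (intro mult_right_mono) auto
    finally show ?thesis by (simp add: mult_ac)
  qed
  moreover have "C + 1 > 0" unfolding C_def K_def by (intro add_nonneg_pos mult_nonneg_nonneg) auto
  ultimately show ?thesis using that by blast
qed

subsection \<open>Circles avoiding the zeros of a polynomial\<close>

text \<open>On expanding the product each factor contributes 1 or -x, so the moduli of all terms add
  up to at most the product of the numbers 1 + |x|.\<close>

lemma coeff_prod_roots:
  "norm (coeff (\<Prod>x\<in>#A. [:- x, 1:]) i) \<le> (\<Prod>x\<in>#A. 1 + norm (x :: complex))"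
proof (induction A arbitrary: i)
  case (add x A)
  let ?q = "\<Prod>x\<in>#A. [:- x, 1:]"
  have "coeff (\<Prod>x\<in>#add_mset x A. [:- x, 1:]) i = - x * coeff ?q i + (if i = 0 then 0 else coeff ?q (i - 1))"
    by (cases i) (auto simp: coeff_pCons)
  also have "norm \<dots> \<le> norm x * norm (coeff ?q i) + (if i = 0 then 0 else norm (coeff ?q (i - 1)))"
    by (rule order_trans[OF norm_triangle_ineq]) (auto simp: norm_mult)
  also have "\<dots> \<le> norm x * (\<Prod>x\<in>#A. 1 + norm x) + (\<Prod>x\<in>#A. 1 + norm x)"
    using add.IH norm_ge_zero order_trans by (intro add_mono mult_left_mono) (auto intro: order_trans[OF norm_ge_zero add.IH])
  finally show ?case by (simp add: algebra_simps)
qed (simp add: coeff_pCons split: nat.split)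

text \<open>Pigeonhole on radii: a root spoils at most one of the radii 1, ..., d+1, namely one
  within distance less than 1/2 of its modulus, and there are at most d roots. On a remaining circle
  every linear factor is at least a fixed multiple of 1 + |x|, and by
  \<open>coeff_prod_roots\<close> the product of these numbers dominates the coefficients.\<close>

lemma poly_lower_bound_circle:
  obtains c :: real where "c > 0" "\<And>p :: complex poly. degree p \<le> d \<Longrightarrow>
    \<exists>t\<in>{1..d + 1}. \<forall>z i. norm z = real t \<longrightarrow> c * norm (coeff p i) \<le> norm (poly p z)"
proof -
  \<comment> \<open>For roots of modulus at most 2(d+1) the gap 1/2 is compared with 1 + |x| \<le>
    2d+3; for larger roots |x| - |z| is at least (1 + |x|)/4, and c1 \<le> 1/4.\<close>
  define c1 where "c1 = 1 / (2 * (2 * real d + 3))"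
  have c1: "0 < c1" "c1 \<le> 1" "c1 \<le> 1 / 4" by (auto simp: c1_def divide_simps)
  have "\<exists>t\<in>{1..d + 1}. \<forall>z i. norm z = real t \<longrightarrow> c1 ^ d * norm (coeff p i) \<le> norm (poly p z)"
    if p: "degree p \<le> d" for p :: "complex poly"
  proof (cases "p = 0")
    case False
    obtain A where A: "size A = degree p" "p = smult (lead_coeff p) (\<Prod>x\<in>#A. [:- x, 1:])"
      using alg_closed_imp_factorization[OF False] by blast
    define bad where "bad x = {t \<in> {1..d + 1}. \<bar>real t - norm x\<bar> < 1 / 2}" for x :: complex
    have bad1: "card (bad x) \<le> 1" for x
    proof (rule card_le_Suc0_iff_eq[THEN iffD2, simplified One_nat_def[symmetric]])
      show "\<forall>a1\<in>bad x. \<forall>a2\<in>bad x. a1 = a2"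
      proof (intro ballI)
        fix a b assume "a \<in> bad x" "b \<in> bad x"
        then have "\<bar>real a - norm x\<bar> < 1 / 2" "\<bar>real b - norm x\<bar> < 1 / 2" by (simp_all add: bad_def)
        then have "\<bar>real a - real b\<bar> < 1" by linarith
        then show "a = b" by linarith
      qed
    qed (simp add: bad_def)
    have "card (\<Union>x\<in>set_mset A. bad x) \<le> (\<Sum>x\<in>set_mset A. card (bad x))" by (rule card_UN_le) simp
    also have "\<dots> \<le> card (set_mset A)" using sum_mono[of "set_mset A" "\<lambda>x. card (bad x)" "\<lambda>_. 1"] bad1 by simp
    also have "\<dots> \<le> size A" unfolding size_multiset_overloaded_eq card_eq_sum by (rule sum_mono) (simp add: Suc_le_eq)
    also have "\<dots> < card {1..d + 1}" using A p by simp
    finally have lt: "card (\<Union>x\<in>set_mset A. bad x) < card {1..d + 1}" .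
    have fin: "finite (\<Union>x\<in>set_mset A. bad x)" by (simp add: bad_def)
    have "\<not> {1..d + 1} \<subseteq> (\<Union>x\<in>set_mset A. bad x)"
      using card_mono[OF fin, of "{1..d + 1}"] lt by linarith
    then obtain t where t0: "t \<in> {1..d + 1}" "t \<notin> (\<Union>x\<in>set_mset A. bad x)" by blast
    have t: "t \<in> {1..d + 1}" "\<And>x. x \<in># A \<Longrightarrow> \<bar>real t - norm x\<bar> \<ge> 1 / 2"
      using t0 by (auto simp: bad_def)
    show ?thesis
    proof (intro bexI[OF _ t(1)] allI impI)
      fix z :: complex and i assume z: "norm z = real t"
      have lb: "c1 * (1 + norm x) \<le> norm (z - x)" if x: "x \<in># A" for x
      proof (cases "norm x \<le> 2 * (real d + 1)")
        case True
        have "c1 * (1 + norm x) \<le> c1 * (2 * real d + 3)" using True c1 by (intro mult_left_mono) auto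
        also have "\<dots> = 1 / 2" by (simp add: c1_def field_simps)
        also have "\<dots> \<le> \<bar>norm z - norm x\<bar>" using t(2)[OF x] z by simp
        also have "\<dots> \<le> norm (z - x)" by (rule norm_triangle_ineq3)
        finally show ?thesis .
      next
        case False
        have "c1 * (1 + norm x) \<le> (1 / 4) * (1 + norm x)" using c1 by (intro mult_right_mono) auto
        also have "\<dots> \<le> norm x - norm z" using False t(1) z by auto
        also have "\<dots> \<le> norm (z - x)" by (metis norm_minus_commute norm_triangle_ineq2)
        finally show ?thesis .
      qed
      have nn: "0 \<le> (\<Prod>x\<in>#B. 1 + norm x)" for B :: "complex multiset" by (induction B) auto
      have prod_lb: "c1 ^ size B * (\<Prod>x\<in>#B. 1 + norm x) \<le> (\<Prod>x\<in>#B. norm (z - x))" if "set_mset B \<subseteq> set_mset A" for B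
        using that
      proof (induction B)
        case (add x B)
        have "(c1 * (1 + norm x)) * (c1 ^ size B * (\<Prod>x\<in>#B. 1 + norm x)) \<le> norm (z - x) * (\<Prod>x\<in>#B. norm (z - x))"
          using add lb[of x] c1 nn[of B] by (intro mult_mono) auto
        then show ?case by (simp add: mult_ac)
      qed simp
      have "c1 ^ d * norm (coeff p i) \<le> c1 ^ size A * (norm (lead_coeff p) * (\<Prod>x\<in>#A. 1 + norm x))"
      proof (rule mult_mono)
        show "c1 ^ d \<le> c1 ^ size A" using c1 A p by (intro power_decreasing) auto
        show "norm (coeff p i) \<le> norm (lead_coeff p) * (\<Prod>x\<in>#A. 1 + norm x)"
          by (subst A(2)) (auto simp: norm_mult intro!: mult_left_mono coeff_prod_roots)
      qed (use c1 in auto)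
      also have "\<dots> \<le> norm (lead_coeff p) * (\<Prod>x\<in>#A. norm (z - x))"
        using mult_left_mono[OF prod_lb[OF order_refl], of "norm (lead_coeff p)"] by (simp add: mult_ac)
      also have "(\<Prod>x\<in>#A. norm (z - x)) = norm (poly (\<Prod>x\<in>#A. [:- x, 1:]) z)"
        by (induction A) (auto simp: norm_mult[symmetric] left_diff_distrib)
      also have "norm (lead_coeff p) * \<dots> = norm (poly p z)" by (subst (2) A(2)) (simp add: norm_mult)
      finally show "c1 ^ d * norm (coeff p i) \<le> norm (poly p z)" .
    qed
  qed (auto intro!: bexI[of _ 1])
  then show ?thesis using that[of "c1 ^ d"] c1 by auto
qed

text \<open>T, c and C depend only on m and the dimension, so they serve all polynomials, all
  frequencies and later all \<epsilon> at once; only the radius t varies. The coefficients of the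
  restriction to the curve are the Taylor coefficients at \<xi>, hence comparable to the
  weight.\<close>

lemma good_radius:
  obtains T :: nat and c C :: real where "T \<ge> 1" "c > 0" "C > 0"
    "\<And>q (\<xi> :: real^'n::finite). \<exists>t\<in>{1..T}. \<forall>z. norm z = real t \<longrightarrow>
        c * weight m q \<xi> \<le> norm (peval m q (\<lambda>i. rv \<xi> i + gam m z i))"
    "\<And>q (\<xi> :: real^'n::finite) z. norm z \<le> real T \<Longrightarrow> norm (peval m q (\<lambda>i. rv \<xi> i + gam m z i)) \<le> C * weight m q \<xi>"
proof -
  define d where "d = kdeg TYPE('n) m"
  define K where "K = fact m ^ CARD('n) * real (card {\<alpha> :: 'n \<Rightarrow> nat. mi_order \<alpha> \<le> m})"
  have "{\<alpha> :: 'n \<Rightarrow> nat. mi_order \<alpha> \<le> m} \<noteq> {}" by (auto intro!: exI[of _ "\<lambda>_. 0"] simp: mi_order_def)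
  then have card0: "card {\<alpha> :: 'n \<Rightarrow> nat. mi_order \<alpha> \<le> m} > 0" using finite_mi by (metis card_gt_0_iff)
  then have K: "K > 0" by (simp add: K_def)
  obtain c where c: "c > 0" "\<And>p :: complex poly. degree p \<le> d \<Longrightarrow>
    \<exists>t\<in>{1..d + 1}. \<forall>z i. norm z = real t \<longrightarrow> c * norm (coeff p i) \<le> norm (poly p z)"
    using poly_lower_bound_circle[of d] by blast
  have pe: "peval m q (\<lambda>i. rv \<xi> i + gam m z i) = poly (kpoly m (tayl m q (rv \<xi>))) z" for q and \<xi> :: "real^'n" and z :: complex
    by (simp add: peval_taylor poly_kpoly)
  show ?thesis
  proof (rule that[of "d + 1" "c / K" "real (card {\<alpha> :: 'n \<Rightarrow> nat. mi_order \<alpha> \<le> m}) * real (d + 1) ^ d"])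
    fix q :: "('n \<Rightarrow> nat) \<Rightarrow> complex" and \<xi> :: "real^'n"
    obtain t where t: "t \<in> {1..d + 1}" "\<And>z i. norm z = real t \<Longrightarrow> c * norm (coeff (kpoly m (tayl m q (rv \<xi>))) i) \<le> norm (poly (kpoly m (tayl m q (rv \<xi>))) z)"
      using c(2)[OF degree_kpoly[of m "tayl m q (rv \<xi>)", folded d_def]] by blast
    show "\<exists>t\<in>{1..d + 1}. \<forall>z. norm z = real t \<longrightarrow> c / K * weight m q \<xi> \<le> norm (peval m q (\<lambda>i. rv \<xi> i + gam m z i))"
    proof (intro bexI[OF _ t(1)] allI impI)
      fix z :: complex assume z: "norm z = real t"
      let ?P = "norm (peval m q (\<lambda>i. rv \<xi> i + gam m z i))"
      have 1: "norm (tayl m q (rv \<xi>) \<alpha>) \<le> ?P / c" if "mi_order \<alpha> \<le> m" for \<alpha>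
        using t(2)[OF z, of "kexp m \<alpha>"] c(1) by (simp add: coeff_kpoly[OF that] pe field_simps)
      have "weight m q \<xi> \<le> fact m ^ CARD('n) * (\<Sum>\<alpha> :: 'n \<Rightarrow> nat | mi_order \<alpha> \<le> m. ?P / c)"
        by (rule order_trans[OF weight_le_sum_tayl]) (intro mult_left_mono sum_mono 1, auto)
      also have "\<dots> = K * (?P / c)" by (simp add: K_def)
      finally show "c / K * weight m q \<xi> \<le> ?P" using c K by (simp add: field_simps)
    qed
  next
    fix q :: "('n \<Rightarrow> nat) \<Rightarrow> complex" and \<xi> :: "real^'n" and z :: complex assume z: "norm z \<le> real (d + 1)"
    have "norm (peval m q (\<lambda>i. rv \<xi> i + gam m z i)) \<le> (\<Sum>\<alpha> | mi_order \<alpha> \<le> m. norm (tayl m q (rv \<xi>) \<alpha>) * norm (mono_mi \<alpha> (gam m z)))"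
      unfolding peval_taylor norm_mult[symmetric] by (rule norm_sum)
    also have "\<dots> \<le> (\<Sum>\<alpha> :: 'n \<Rightarrow> nat | mi_order \<alpha> \<le> m. weight m q \<xi> * real (d + 1) ^ d)"
    proof (intro sum_mono mult_mono norm_tayl_le_weight weight_nonneg)
      fix \<alpha> :: "'n \<Rightarrow> nat" assume "\<alpha> \<in> {\<alpha>. mi_order \<alpha> \<le> m}"
      then have k: "kexp m \<alpha> \<le> d" using kexp_le[of \<alpha> m] by (simp add: d_def)
      have "norm z ^ kexp m \<alpha> \<le> real (d + 1) ^ kexp m \<alpha>" using z by (intro power_mono) auto
      also have "\<dots> \<le> real (d + 1) ^ d" using k by (intro power_increasing) auto
      finally show "norm (mono_mi \<alpha> (gam m z)) \<le> real (d + 1) ^ d" by (simp add: mono_mi_gam norm_power)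
    qed auto
    finally show "norm (peval m q (\<lambda>i. rv \<xi> i + gam m z i)) \<le> real (card {\<alpha> :: 'n \<Rightarrow> nat. mi_order \<alpha> \<le> m}) * real (d + 1) ^ d * weight m q \<xi>"
      by (simp add: mult_ac)
  qed (use c K card0 in auto)
qed

section \<open>Averages over roots of unity\<close>

definition uroot :: "nat \<Rightarrow> nat \<Rightarrow> complex" where
  "uroot M b = exp (\<i> * of_real (2 * pi * real b / real M))"

lemma norm_uroot [simp]: "norm (uroot M b) = 1"
  by (simp add: uroot_def)

lemma sum_uroot:
  assumes "0 < j" "j < M"
  shows "(\<Sum>b<M. uroot M b ^ j) = 0"
proof -
  let ?w = "exp (\<i> * of_real (2 * pi * real j / real M))"
  have e: "uroot M b ^ j = ?w ^ b" for b
    by (simp add: uroot_def exp_of_nat_mult[symmetric] mult_ac)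
  have "?w \<noteq> 1"
  proof
    assume "?w = 1"
    then obtain n :: int where "2 * pi * real j / real M = real_of_int (2 * n) * pi"
      unfolding exp_eq_1 by auto
    then have "real j = real_of_int n * real M" using assms by (simp add: field_simps)
    then have "real_of_int (int j) = real_of_int (n * int M)" by simp
    then have "int j = n * int M" by (simp only: of_int_eq_iff)
    then have "int M dvd int j" by simp
    then show False using assms by (auto dest: zdvd_imp_le)
  qed
  moreover have "?w ^ M = 1"
    using assms by (simp add: exp_of_nat_mult[symmetric] exp_eq_1) (rule exI[of _ "int j"], simp)
  ultimately show ?thesis unfolding e by (subst geometric_sum) auto
qed

text \<open>Averaging over the M-th roots of unity kills the powers 1, ..., M-1 of the Taylor series
  at 0, so the error starts at order M. Cauchy estimates on the circle of radius 2t dominate it by a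
  geometric series with ratio 1/2.\<close>

lemma average_uroot:
  fixes g :: "complex \<Rightarrow> complex"
  assumes g: "g holomorphic_on UNIV" and t: "0 < t" and M: "0 < M"
    and B: "\<And>z. norm z = 2 * t \<Longrightarrow> norm (g z) \<le> B"
  shows "norm ((\<Sum>b<M. g (of_real t * uroot M b)) / of_nat M - g 0) \<le> 2 * B / 2 ^ M"
proof -
  define a where "a j = (deriv ^^ j) g 0 / fact j" for j
  have B0: "0 \<le> B" using B[of "of_real (2 * t)"] t norm_ge_zero order_trans by (metis abs_of_pos norm_of_real mult_pos_pos zero_less_numeral)
  have sums: "(\<lambda>j. a j * z ^ j) sums g z" for z
    using holomorphic_power_series[OF holomorphic_on_subset[OF g], of 0 "norm z + 1" z] by (simp add: a_def)
  have a: "norm (a j) * (2 * t) ^ j \<le> B" for j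
  proof -
    have "norm ((deriv ^^ j) g 0) \<le> fact j * B / (2 * t) ^ j"
      by (rule Cauchy_inequality) (use g t B in \<open>auto intro: holomorphic_on_subset holomorphic_on_imp_continuous_on\<close>)
    then show ?thesis using t by (simp add: a_def norm_divide field_simps)
  qed
  define s where "s j = (\<Sum>b<M. uroot M b ^ j) / of_nat M" for j
  have s0: "s 0 = 1" using M by (simp add: s_def)
  have s1: "s j = 0" if "0 < j" "j < M" for j using sum_uroot[OF that] by (simp add: s_def)
  have sn: "norm (s j) \<le> 1" for j
  proof -
    have "norm (\<Sum>b<M. uroot M b ^ j) \<le> real M"
      by (rule order_trans[OF norm_sum]) (simp add: norm_power)
    then show ?thesis using M by (simp add: s_def norm_divide)
  qed
  have "(\<lambda>j. \<Sum>b<M. a j * (of_real t * uroot M b) ^ j) sums (\<Sum>b<M. g (of_real t * uroot M b))"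
    by (intro sums_sum sums)
  then have "(\<lambda>j. (\<Sum>b<M. a j * (of_real t * uroot M b) ^ j) / of_nat M) sums ((\<Sum>b<M. g (of_real t * uroot M b)) / of_nat M)"
    by (rule sums_divide)
  moreover have "(\<Sum>b<M. a j * (of_real t * uroot M b) ^ j) / of_nat M = a j * of_real t ^ j * s j" for j
    by (simp add: s_def sum_distrib_left power_mult_distrib mult_ac)
  ultimately have S: "(\<lambda>j. a j * of_real t ^ j * s j) sums ((\<Sum>b<M. g (of_real t * uroot M b)) / of_nat M)" by simp
  have "(\<lambda>j. a j * of_real t ^ j * s j - (if j = 0 then g 0 else 0)) sums ((\<Sum>b<M. g (of_real t * uroot M b)) / of_nat M - g 0)"
    by (intro sums_diff S sums_single)
  moreover have "a j * of_real t ^ j * s j - (if j = 0 then g 0 else 0) = (if j < M then 0 else a j * of_real t ^ j * s j)" for j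
    using M s1[of j] s0 by (cases "j = 0") (auto simp: a_def)
  ultimately have S2: "(\<lambda>j. if j < M then 0 else a j * of_real t ^ j * s j) sums ((\<Sum>b<M. g (of_real t * uroot M b)) / of_nat M - g 0)" by simp
  have S3: "(\<lambda>j. a (j + M) * of_real t ^ (j + M) * s (j + M)) sums ((\<Sum>b<M. g (of_real t * uroot M b)) / of_nat M - g 0)"
    using sums_split_initial_segment[OF S2, of M] by simp
  have b: "norm (a (j + M) * of_real t ^ (j + M) * s (j + M)) \<le> (B / 2 ^ M) * (1 / 2) ^ j" for j
  proof -
    have "norm (a (j + M)) * t ^ (j + M) \<le> B / 2 ^ (j + M)"
      using a[of "j + M"] by (simp add: power_mult_distrib field_simps)
    then have "norm (a (j + M)) * t ^ (j + M) * norm (s (j + M)) \<le> B / 2 ^ (j + M) * 1"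
      using sn[of "j + M"] t B0 by (intro mult_mono) auto
    then show ?thesis using t by (simp add: norm_mult norm_power power_add field_simps)
  qed
  have geo: "(\<lambda>j. (B / 2 ^ M) * (1 / 2) ^ j) sums ((B / 2 ^ M) * 2)"
    using sums_mult[OF geometric_sums[of "1 / 2 :: real"], of "B / 2 ^ M"] by simp
  have "norm ((\<Sum>b<M. g (of_real t * uroot M b)) / of_nat M - g 0) \<le> (B / 2 ^ M) * 2"
    using S3 geo b by (rule norm_sums_le)
  then show ?thesis by (simp add: mult.commute)
qed

text \<open>The discretised circle mean of the exponential whose frequency is \<rho> times the
  shift. The exact mean is the value at z = 0, which is 1.\<close>

definition gavg :: "nat \<Rightarrow> nat \<Rightarrow> real \<Rightarrow> nat \<Rightarrow> real^'n::finite \<Rightarrow> complex" where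
  "gavg m M \<rho> t y = (\<Sum>b<M. ex (\<lambda>i. of_real \<rho> * gam m (of_real (real t) * uroot M b) i) y) / of_nat M"

lemma norm_gam_le:
  assumes "norm z \<le> A" "1 \<le> A"
  shows "norm (gam m z (i :: 'n::finite)) \<le> A ^ ((m + 1) ^ CARD('n))"
proof -
  have "idx i < CARD('n)" using idx_bij[where 'n = 'n] unfolding bij_betw_def by (metis atLeastLessThan_iff rangeI)
  then have "(m + 1) ^ idx i \<le> (m + 1) ^ CARD('n)" by (intro power_increasing) auto
  then have "A ^ ((m + 1) ^ idx i) \<le> A ^ ((m + 1) ^ CARD('n))" by (rule power_increasing[OF _ assms(2)])
  moreover have "norm z ^ ((m + 1) ^ idx i) \<le> A ^ ((m + 1) ^ idx i)" using assms by (intro power_mono) auto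
  ultimately show ?thesis by (simp add: gam_def norm_power)
qed

lemma norm_ex_le:
  assumes "\<And>i. norm (\<zeta> i) \<le> A" "y \<in> cball (0 :: real^'n::finite) 2"
  shows "norm (ex \<zeta> y) \<le> exp (2 * A * CARD('n))"
proof -
  have A: "0 \<le> A" using assms(1) norm_ge_zero order_trans by blast
  have "- (\<Sum>i\<in>UNIV. Im (\<zeta> i) * y $ i) \<le> (\<Sum>i\<in>(UNIV :: 'n set). A * 2)"
    unfolding sum_negf[symmetric]
  proof (rule sum_mono)
    fix i
    have "- (Im (\<zeta> i) * y $ i) \<le> \<bar>Im (\<zeta> i)\<bar> * \<bar>y $ i\<bar>" by (metis abs_ge_minus_self abs_mult)
    also have "\<dots> \<le> A * 2"
      using assms(1)[of i] abs_Im_le_cmod[of "\<zeta> i"] component_le_norm_cart[of y i] assms(2) A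
      by (intro mult_mono) auto
    finally show "- (Im (\<zeta> i) * y $ i) \<le> A * 2" .
  qed
  then show ?thesis by (simp add: norm_ex mult_ac)
qed

lemma dbound_ex:
  assumes "\<And>i. norm (\<zeta> i) \<le> A" "1 \<le> A"
  shows "dbound (cball (0 :: real^'n::finite) 2) j (ex \<zeta>) (A ^ j * exp (2 * A * CARD('n)))"
  unfolding dbound_def
proof (intro allI ballI impI)
  fix "is" :: "'n list" and y :: "real^'n" assume y: "y \<in> cball 0 2" and l: "length is \<le> j"
  have "norm (\<Prod>i\<leftarrow>is. \<i> * \<zeta> i) \<le> A ^ length is" by (rule norm_prod_list_le) (use assms in auto)
  also have "\<dots> \<le> A ^ j" using assms l by (intro power_increasing) auto
  finally show "norm (foldr pd is (ex \<zeta>) y) \<le> A ^ j * exp (2 * A * CARD('n))"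
    unfolding pds_ex norm_mult using norm_ex_le[OF assms(1) y] assms(2) by (intro mult_mono) auto
qed

lemma dbound_ex_kc: "dbound K j (ex (kc k)) (wt (k :: 'n::finite \<Rightarrow> int) ^ j)"
  unfolding dbound_def
proof (intro allI ballI impI)
  fix "is" :: "'n list" and y :: "real^'n" assume l: "length is \<le> j"
  have "norm (kc k i) \<le> wt k" for i using abs_le_wt[of k i] by (simp add: kc_def)
  then have "norm (\<Prod>i\<leftarrow>is. \<i> * kc k i) \<le> wt k ^ length is" by (rule norm_prod_list_le[OF _ wt_ge_1])
  also have "\<dots> \<le> wt k ^ j" using wt_ge_1 l by (intro power_increasing) auto
  finally show "norm (foldr pd is (ex (kc k)) y) \<le> wt k ^ j"
    by (simp add: pds_ex norm_mult norm_ex_kc)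
qed

lemma smooth_on_gavg: "smooth_on UNIV (gavg m M \<rho> t)"
  unfolding gavg_def[abs_def] divide_inverse
  by (intro smooth_on_mult smooth_on_sum smooth_on_const smooth_on_ex open_UNIV)

text \<open>Every y-derivative of the exponential is entire in z, so \<open>average_uroot\<close>
  applies to it. The bound on the circle of radius 2t is uniform in \<rho> and t, and therefore M0
  depends on neither.\<close>

lemma gavg_tendsto_1:
  assumes e: "e > 0"
  obtains M0 where "\<And>M \<rho> t. M0 \<le> M \<Longrightarrow> 0 < M \<Longrightarrow> \<bar>\<rho>\<bar> \<le> 1 \<Longrightarrow> t \<in> {1..T} \<Longrightarrow>
    dbound (cball (0 :: real^'n::finite) 2) q (\<lambda>y. gavg m M \<rho> t y - 1) e"
proof -
  define A where "A = (2 * real T + 1) ^ ((m + 1) ^ CARD('n))"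
  have A: "1 \<le> A" by (simp add: A_def)
  define B where "B = A ^ q * exp (2 * A * CARD('n))"
  have B: "B > 0" using A by (simp add: B_def)
  obtain M0 where M0: "2 * B / e < 2 ^ M0" using real_arch_pow[of 2 "2 * B / e"] by auto
  show ?thesis
  proof (rule that[of M0])
    fix M t and \<rho> :: real assume M: "M0 \<le> M" "0 < M" and \<rho>: "\<bar>\<rho>\<bar> \<le> 1" and t: "t \<in> {1..T}"
    show "dbound (cball (0 :: real^'n) 2) q (\<lambda>y. gavg m M \<rho> t y - 1) e"
      unfolding dbound_def
    proof (intro allI ballI impI)
      fix "is" :: "'n list" and y :: "real^'n" assume y: "y \<in> cball 0 2" and l: "length is \<le> q"
      define g where "g z = foldr pd is (ex (\<lambda>i. of_real \<rho> * gam m z i)) y" for z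
      have g_eq: "g z = (\<Prod>i\<leftarrow>is. \<i> * (of_real \<rho> * gam m z i)) * ex (\<lambda>i. of_real \<rho> * gam m z i) y" for z
        by (simp add: g_def pds_ex)
      have hol: "(\<lambda>z. \<Prod>i\<leftarrow>js. \<i> * (of_real \<rho> * gam m z i)) holomorphic_on UNIV" for js :: "'n list"
        by (induction js) (auto simp: gam_def intro!: holomorphic_intros)
      have "g holomorphic_on UNIV"
        unfolding g_eq[abs_def] ex_def by (intro holomorphic_intros hol) (auto simp: gam_def intro!: holomorphic_intros)
      moreover have "norm (g z) \<le> B" if "norm z = 2 * real t" for z
      proof -
        have "norm z \<le> 2 * real T + 1" using that t by auto
        then have "norm (gam m z i) \<le> A" for i :: 'n unfolding A_def by (rule norm_gam_le) simp
        moreover have "\<bar>\<rho>\<bar> * norm (gam m z i) \<le> 1 * norm (gam m z i)" for i :: 'n using \<rho> by (intro mult_right_mono) auto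
        ultimately have "norm (of_real \<rho> * gam m z i) \<le> A" for i :: 'n unfolding norm_mult norm_of_real mult_1 using order_trans by blast
        from dboundD[OF dbound_ex[OF this A, of q] y l] show ?thesis by (simp add: g_def B_def)
      qed
      ultimately have "norm ((\<Sum>b<M. g (of_real (real t) * uroot M b)) / of_nat M - g 0) \<le> 2 * B / 2 ^ M"
        using t M by (intro average_uroot) auto
      also have "\<dots> \<le> 2 * B / 2 ^ M0" using B M by (intro divide_left_mono power_increasing) auto
      also have "\<dots> \<le> e" using M0 e by (simp add: field_simps)
      also have "(\<Sum>b<M. g (of_real (real t) * uroot M b)) / of_nat M - g 0 = foldr pd is (\<lambda>y. gavg m M \<rho> t y - 1) y"
      proof -
        have g0: "gam m 0 i = 0" for i :: 'n by (simp add: gam_def)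
        have "g 0 = foldr pd is (\<lambda>_. 1) y" unfolding g_def g0 by (simp add: ex_zero[abs_def])
        moreover have "foldr pd is (gavg m M \<rho> t) y = (\<Sum>b<M. g (of_real (real t) * uroot M b)) / of_nat M"
        proof -
          have "foldr pd is (gavg m M \<rho> t) y = foldr pd is (\<lambda>y. inverse (of_nat M) * (\<Sum>b<M. ex (\<lambda>i. of_real \<rho> * gam m (of_real (real t) * uroot M b) i) y)) y"
            by (simp add: gavg_def[abs_def] divide_inverse mult.commute)
          then show ?thesis unfolding g_def
            by (subst (asm) pds_cmult[OF open_UNIV], (intro smooth_on_sum smooth_on_ex open_UNIV)[1], simp,
                subst (asm) pds_sum[OF open_UNIV], (intro smooth_on_ex open_UNIV)[1], simp)
               (simp add: divide_inverse mult.commute)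
        qed
        ultimately show ?thesis
          by (subst pds_diff[OF open_UNIV smooth_on_gavg]) (auto intro: smooth_on_const)
      qed
      finally show "norm (foldr pd is (\<lambda>y. gavg m M \<rho> t y - 1) y) \<le> e" .
    qed
  qed
qed

section \<open>Neumann iteration on the frequency lattice\<close>

text \<open>The matrix that sends f to the Fourier coefficients of the sum of the f_k e_k H_k:
  multiplication by e_k shifts the coefficients of H_k by k.\<close>

definition smat :: "(('n::finite \<Rightarrow> int) \<Rightarrow> real^'n \<Rightarrow> complex) \<Rightarrow> ('n \<Rightarrow> int) \<Rightarrow> ('n \<Rightarrow> int) \<Rightarrow> complex" where
  "smat H l k = fc (H k) (\<lambda>i. l i - k i)"

text \<open>Iterates of f = v - S f from 0, with S cut to the columns in \<open>cube R\<close>.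
  Finitely many steps on a finite cube stand in for the inverse of 1 + S.\<close>

primrec neum :: "nat \<Rightarrow> (('n::finite \<Rightarrow> int) \<Rightarrow> real^'n \<Rightarrow> complex) \<Rightarrow> (('n \<Rightarrow> int) \<Rightarrow> complex) \<Rightarrow> nat \<Rightarrow> ('n \<Rightarrow> int) \<Rightarrow> complex" where
  "neum R H v 0 = (\<lambda>_. 0)"
| "neum R H v (Suc L) = (\<lambda>l. v l - (\<Sum>k\<in>cube R. smat H l k * neum R H v L k))"

text \<open>Peetre's inequality for \<open>wt\<close>, for exponents of either sign.\<close>

lemma wt_powr_shift:
  fixes k l :: "'n::finite \<Rightarrow> int"
  assumes "\<bar>\<sigma>\<bar> \<le> real s"
  shows "wt k powr \<sigma> \<le> wt (\<lambda>i. l i - k i) ^ s * wt l powr \<sigma>"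
proof -
  let ?d = "wt (\<lambda>i. l i - k i)"
  have d: "?d powr \<bar>\<sigma>\<bar> \<le> ?d ^ s"
    using wt_ge_1[of "\<lambda>i. l i - k i"] assms by (subst powr_realpow[symmetric]) (auto intro: powr_mono)
  have "wt k powr \<sigma> \<le> ?d powr \<bar>\<sigma>\<bar> * wt l powr \<sigma>"
  proof (cases "\<sigma> \<ge> 0")
    case True
    have "wt k \<le> ?d * wt l"
      using wt_add[of "\<lambda>i. - (l i - k i)" l] wt_minus[of "\<lambda>i. l i - k i"] by simp
    then have "wt k powr \<sigma> \<le> (?d * wt l) powr \<sigma>" using True wt_pos[of k] by (intro powr_mono2) auto
    then show ?thesis using True by (simp add: powr_mult)
  next
    case False
    have "wt l \<le> ?d * wt k" using wt_add[of "\<lambda>i. l i - k i" k] by simp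
    then have "(?d * wt k) powr \<sigma> \<le> wt l powr \<sigma>" using False wt_pos[of l] by (intro powr_mono2') auto
    then have "?d powr \<bar>\<sigma>\<bar> * (?d powr \<sigma> * wt k powr \<sigma>) \<le> ?d powr \<bar>\<sigma>\<bar> * wt l powr \<sigma>"
      by (intro mult_left_mono) (simp_all add: powr_mult)
    then show ?thesis using False wt_pos[of "\<lambda>i. l i - k i"] by (simp add: mult.assoc[symmetric] powr_add[symmetric])
  qed
  also have "\<dots> \<le> ?d ^ s * wt l powr \<sigma>" by (intro mult_right_mono d) simp
  finally show ?thesis .
qed

text \<open>A row sum criterion on weighted sup norms. Of the s+n+1 derivatives of H, s pay for
  moving the weight from k to l and n+1 for summation; \<kappa> makes the result 1/2. Positive
  \<sigma> will serve functionals, whose data grow, and negative \<sigma> smooth data.\<close>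

lemma smat_row_sum:
  obtains \<kappa> :: real where "\<kappa> > 0" "\<And>(H :: ('n::finite \<Rightarrow> int) \<Rightarrow> real^'n \<Rightarrow> complex) \<sigma> l R.
    (\<And>k. smooth_on UNIV (H k)) \<Longrightarrow> (\<And>k. supp2 (H k)) \<Longrightarrow> (\<And>k. dbound (cball 0 2) (s + CARD('n) + 1) (H k) \<kappa>) \<Longrightarrow>
    \<bar>\<sigma>\<bar> \<le> real s \<Longrightarrow> (\<Sum>k\<in>cube R. norm (smat H l k) * wt k powr \<sigma>) \<le> wt l powr \<sigma> / 2"
proof -
  obtain C where C: "C > 0" "\<And>K :: ('n \<Rightarrow> int) set. finite K \<Longrightarrow> (\<Sum>k\<in>K. 1 / wt k ^ (CARD('n) + 1)) \<le> C"
    using sum_wt_bounded by blast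
  define q where "q = s + CARD('n) + 1"
  define \<kappa> where "\<kappa> = 1 / (2 ^ (q + 1) * C)"
  have \<kappa>: "\<kappa> > 0" using C by (simp add: \<kappa>_def)
  show ?thesis
  proof (rule that[OF \<kappa>])
    fix H :: "('n \<Rightarrow> int) \<Rightarrow> real^'n \<Rightarrow> complex" and \<sigma> l R
    assume H: "\<And>k. smooth_on UNIV (H k)" "\<And>k. supp2 (H k)" "\<And>k. dbound (cball 0 2) (s + CARD('n) + 1) (H k) \<kappa>"
      and \<sigma>: "\<bar>\<sigma>\<bar> \<le> real s"
    have "norm (smat H l k) * wt k powr \<sigma> \<le> 2 ^ q * \<kappa> * wt l powr \<sigma> * (1 / wt (\<lambda>i. l i - k i) ^ (CARD('n) + 1))" for k
    proof -
      let ?d = "wt (\<lambda>i. l i - k i)"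
      have d: "?d > 0" by (rule wt_pos)
      have "norm (smat H l k) \<le> 2 ^ q * \<kappa> / ?d ^ q"
        unfolding smat_def by (rule fc_decay[OF H(1,2)]) (use H(3) in \<open>simp add: q_def\<close>)
      then have "norm (smat H l k) * wt k powr \<sigma> \<le> (2 ^ q * \<kappa> / ?d ^ q) * (?d ^ s * wt l powr \<sigma>)"
        using wt_powr_shift[OF \<sigma>, of k l] \<kappa> d by (intro mult_mono) auto
      also have "\<dots> = 2 ^ q * \<kappa> * wt l powr \<sigma> * (?d ^ s / ?d ^ q)" by simp
      also have "?d ^ s / ?d ^ q = 1 / ?d ^ (CARD('n) + 1)" using d by (simp add: q_def power_add)
      finally show ?thesis .
    qed
    then have "(\<Sum>k\<in>cube R. norm (smat H l k) * wt k powr \<sigma>) \<le>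
      (\<Sum>k\<in>cube R. 2 ^ q * \<kappa> * wt l powr \<sigma> * (1 / wt (\<lambda>i. l i - k i) ^ (CARD('n) + 1)))" by (intro sum_mono)
    also have "\<dots> = 2 ^ q * \<kappa> * wt l powr \<sigma> * (\<Sum>k\<in>cube R. 1 / wt (\<lambda>i. l i - k i) ^ (CARD('n) + 1))"
      by (rule sum_distrib_left[symmetric])
    also have "(\<Sum>k\<in>cube R. 1 / wt (\<lambda>i. l i - k i) ^ (CARD('n) + 1)) = (\<Sum>k\<in>(\<lambda>k i. l i - k i) ` cube R. 1 / wt k ^ (CARD('n) + 1))"
      by (subst sum.reindex) (auto simp: inj_on_def fun_eq_iff)
    also have "\<dots> \<le> C" by (rule C(2)) (simp add: finite_cube)
    also have "2 ^ q * \<kappa> * wt l powr \<sigma> * C = wt l powr \<sigma> / 2" using C by (simp add: \<kappa>_def)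
    finally show "(\<Sum>k\<in>cube R. norm (smat H l k) * wt k powr \<sigma>) \<le> wt l powr \<sigma> / 2"
      using \<kappa> by (simp add: mult_left_mono)
  qed
qed

text \<open>The row sums make S a contraction with factor 1/2 in the norm weighted by
  \<open>wt l powr \<sigma>\<close>. The difference of consecutive iterates is, up to sign, the
  residual of the truncated equation, which is why it is recorded.\<close>

lemma neum_bounds:
  assumes row: "\<And>l. (\<Sum>k\<in>cube R. norm (smat H l k) * wt k powr \<sigma>) \<le> wt l powr \<sigma> / 2"
    and v: "\<And>l. l \<in> cube R \<Longrightarrow> norm (v l) \<le> A * wt l powr \<sigma>" and A: "0 \<le> A" and l: "l \<in> cube R"
  shows "norm (neum R H v L l) \<le> 2 * A * wt l powr \<sigma>"
    and "norm (neum R H v (Suc L) l - neum R H v L l) \<le> A / 2 ^ L * wt l powr \<sigma>"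
proof -
  have S: "norm (\<Sum>k\<in>cube R. smat H l k * f k) \<le> D * (wt l powr \<sigma> / 2)"
    if f: "\<And>k. k \<in> cube R \<Longrightarrow> norm (f k) \<le> D * wt k powr \<sigma>" and D: "0 \<le> D" for f D l
  proof -
    have "norm (\<Sum>k\<in>cube R. smat H l k * f k) \<le> (\<Sum>k\<in>cube R. D * (norm (smat H l k) * wt k powr \<sigma>))"
    proof (rule sum_norm_le)
      fix k :: "'a \<Rightarrow> int" assume "k \<in> cube R"
      from mult_left_mono[OF f[OF this] norm_ge_zero[of "smat H l k"]]
      show "norm (smat H l k * f k) \<le> D * (norm (smat H l k) * wt k powr \<sigma>)" by (simp add: norm_mult mult_ac)
    qed
    also have "\<dots> \<le> D * (wt l powr \<sigma> / 2)" unfolding sum_distrib_left[symmetric] by (intro mult_left_mono row D)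
    finally show ?thesis .
  qed
  have 1: "norm (neum R H v L l) \<le> 2 * A * wt l powr \<sigma>" if "l \<in> cube R" for L l
    using that
  proof (induction L arbitrary: l)
    case (Suc L)
    have "norm (neum R H v (Suc L) l) \<le> norm (v l) + norm (\<Sum>k\<in>cube R. smat H l k * neum R H v L k)"
      by (simp add: norm_triangle_ineq4)
    also have "\<dots> \<le> A * wt l powr \<sigma> + 2 * A * (wt l powr \<sigma> / 2)"
      using v[OF Suc.prems] S[of "neum R H v L" "2 * A" l] Suc.IH A by (intro add_mono) auto
    finally show ?case by simp
  qed (use A in simp)
  show "norm (neum R H v L l) \<le> 2 * A * wt l powr \<sigma>" by (rule 1[OF l])
  have "norm (neum R H v (Suc L) l - neum R H v L l) \<le> A / 2 ^ L * wt l powr \<sigma>" if "l \<in> cube R" for L l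
    using that
  proof (induction L arbitrary: l)
    case (Suc L)
    have "neum R H v (Suc (Suc L)) l - neum R H v (Suc L) l =
        - (\<Sum>k\<in>cube R. smat H l k * (neum R H v (Suc L) k - neum R H v L k))"
      by (simp add: right_diff_distrib sum_subtractf)
    then have "norm (neum R H v (Suc (Suc L)) l - neum R H v (Suc L) l) \<le> A / 2 ^ L * (wt l powr \<sigma> / 2)"
      unfolding norm_minus_cancel using S[of "\<lambda>k. neum R H v (Suc L) k - neum R H v L k" "A / 2 ^ L" l] Suc.IH A by simp
    then show ?case by simp
  qed (use v in simp)
  from this[OF l] show "norm (neum R H v (Suc L) l - neum R H v L l) \<le> A / 2 ^ L * wt l powr \<sigma>" .
qed

section \<open>Parametrices for fixed coefficients\<close>

text \<open>A fixed choice of the constant, so that later constants can be defined by formulas that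
  visibly do not depend on \<epsilon>. The same applies to \<open>fouC\<close>.\<close>

definition latC :: "'n::finite itself \<Rightarrow> real" where
  "latC _ = (SOME C. C > 0 \<and> (\<forall>K :: ('n \<Rightarrow> int) set. finite K \<longrightarrow> (\<Sum>k\<in>K. 1 / wt k ^ (CARD('n) + 1)) \<le> C))"

lemma latC: "latC TYPE('n::finite) > 0"
  "finite (K :: ('n \<Rightarrow> int) set) \<Longrightarrow> (\<Sum>k\<in>K. 1 / wt k ^ (CARD('n) + 1)) \<le> latC TYPE('n)"
proof -
  have "\<exists>C>0. \<forall>K :: ('n \<Rightarrow> int) set. finite K \<longrightarrow> (\<Sum>k\<in>K. 1 / wt k ^ (CARD('n) + 1)) \<le> C"
  proof -
    obtain C where "C > 0" "\<And>K :: ('n \<Rightarrow> int) set. finite K \<Longrightarrow> (\<Sum>k\<in>K. 1 / wt k ^ (CARD('n) + 1)) \<le> C"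
      using sum_wt_bounded by blast
    then show ?thesis by blast
  qed
  from someI_ex[OF this] show "latC TYPE('n::finite) > 0"
    "finite (K :: ('n \<Rightarrow> int) set) \<Longrightarrow> (\<Sum>k\<in>K. 1 / wt k ^ (CARD('n) + 1)) \<le> latC TYPE('n)"
    unfolding latC_def by blast+
qed

definition fouC :: "'n::finite itself \<Rightarrow> real" where
  "fouC _ = (SOME C. C > 0 \<and> (\<forall>(g :: real^'n \<Rightarrow> complex) B j q R.
    smooth_on UNIV g \<longrightarrow> supp2 g \<longrightarrow> dbound (cball 0 2) (j + q + CARD('n) + 1) g B \<longrightarrow>
    dbound pibox j (\<lambda>y. g y - psum R g y) (C * 2 ^ q * B / (real R + 1) ^ q)))"

lemma fouC: "fouC TYPE('n::finite) > 0"
  "smooth_on UNIV (g :: real^'n \<Rightarrow> complex) \<Longrightarrow> supp2 g \<Longrightarrow> dbound (cball 0 2) (j + q + CARD('n) + 1) g B \<Longrightarrow>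
    dbound pibox j (\<lambda>y. g y - psum R g y) (fouC TYPE('n) * 2 ^ q * B / (real R + 1) ^ q)"
proof -
  have "\<exists>C>0. \<forall>(g :: real^'n \<Rightarrow> complex) B j q R.
    smooth_on UNIV g \<longrightarrow> supp2 g \<longrightarrow> dbound (cball 0 2) (j + q + CARD('n) + 1) g B \<longrightarrow>
    dbound pibox j (\<lambda>y. g y - psum R g y) (C * 2 ^ q * B / (real R + 1) ^ q)"
  proof -
    obtain C where "C > 0" "\<And>(g :: real^'n::finite \<Rightarrow> complex) B j q R.
    smooth_on UNIV g \<Longrightarrow> supp2 g \<Longrightarrow> dbound (cball 0 2) (j + q + CARD('n) + 1) g B \<Longrightarrow>
    dbound pibox j (\<lambda>y. g y - psum R g y) (C * 2 ^ q * B / (real R + 1) ^ q)"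
      using fourier_approx by blast
    then show ?thesis by blast
  qed
  from someI_ex[OF this] show "fouC TYPE('n) > 0"
    "smooth_on UNIV (g :: real^'n \<Rightarrow> complex) \<Longrightarrow> supp2 g \<Longrightarrow> dbound (cball 0 2) (j + q + CARD('n) + 1) g B \<Longrightarrow>
    dbound pibox j (\<lambda>y. g y - psum R g y) (fouC TYPE('n) * 2 ^ q * B / (real R + 1) ^ q)"
    unfolding fouC_def by blast+
qed

text \<open>The bound of \<open>dbound_ex\<close> for frequencies up to (T+1)^((m+1)^n), a number
  that dominates all components of the shifts on circles of radius at most T.\<close>

definition exbd :: "'n::finite itself \<Rightarrow> nat \<Rightarrow> nat \<Rightarrow> nat \<Rightarrow> real" where
  "exbd _ m T q = ((real T + 1) ^ ((m + 1) ^ CARD('n))) ^ q * exp (2 * (real T + 1) ^ ((m + 1) ^ CARD('n)) * CARD('n))"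

lemma exbd_pos: "exbd TYPE('n::finite) m T q > 0"
  by (simp add: exbd_def zero_less_mult_iff add_nonneg_pos)

lemma prod_list_mi_list: "(\<Prod>i\<leftarrow>mi_list \<alpha>. f i) = (\<Prod>i\<in>UNIV. f i ^ \<alpha> i :: complex)"
proof -
  have "distinct is \<Longrightarrow> (\<Prod>i\<leftarrow>concat (map (\<lambda>i. replicate (\<alpha> i) i) is). f i) = (\<Prod>i\<in>set is. f i ^ \<alpha> i)" for "is"
    by (induction "is") (auto simp: prod_list_replicate map_replicate)
  from this[OF coordinates(1)] show ?thesis by (simp add: mi_list_def coordinates(2))
qed

lemma mD_ex_shift: "mD \<alpha> (\<lambda>x. ex \<zeta> (x - x0)) x = mono_mi \<alpha> \<zeta> * ex \<zeta> (x - x0)"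
proof -
  have "mpd \<alpha> (\<lambda>x. ex \<zeta> (- x0 + 1 *\<^sub>R x)) x = of_real 1 ^ length (mi_list \<alpha>) * foldr pd (mi_list \<alpha>) (ex \<zeta>) (- x0 + 1 *\<^sub>R x)"
    unfolding mpd_eq_pds by (rule pds_affine[OF open_UNIV smooth_on_ex]) auto
  also have "\<dots> = \<i> ^ mi_order \<alpha> * mono_mi \<alpha> \<zeta> * ex \<zeta> (x - x0)"
    by (simp add: pds_ex prod_list_mi_list power_mult_distrib prod.distrib mono_mi_def mi_order_def power_sum)
  finally have "mpd \<alpha> (\<lambda>x. ex \<zeta> (x - x0)) x = \<i> ^ mi_order \<alpha> * mono_mi \<alpha> \<zeta> * ex \<zeta> (x - x0)" by simp
  moreover have "(- \<i>) ^ n * \<i> ^ n = 1" for n by (simp add: power_mult_distrib[symmetric])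
  ultimately show ?thesis by (simp add: mD_def mult.assoc[symmetric])
qed

lemma mD_sum:
  assumes "\<And>i. i \<in> I \<Longrightarrow> smooth_on UNIV (f i)"
  shows "mD \<alpha> (\<lambda>x. \<Sum>i\<in>I. f i x) x = (\<Sum>i\<in>I. mD \<alpha> (f i) x)"
  by (simp add: mD_def mpd_eq_pds pds_sum[OF open_UNIV assms] sum_distrib_left)

lemma mD_cmult:
  assumes "smooth_on UNIV f"
  shows "mD \<alpha> (\<lambda>x. c * f x) x = c * mD \<alpha> f x"
  by (simp add: mD_def mpd_eq_pds pds_cmult[OF open_UNIV assms])

lemma smooth_on_shift: "smooth_on UNIV f \<Longrightarrow> smooth_on UNIV (\<lambda>y. f (a + r *\<^sub>R y))"
  using smooth_on_affine[OF open_UNIV, of f a r] by simp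

lemma smooth_on_ex_shift: "smooth_on UNIV (\<lambda>x. ex \<zeta> (x - x0))"
  using smooth_on_shift[OF smooth_on_ex[OF open_UNIV], where a = "- x0" and r = 1] by simp

text \<open>
  A single \<open>\<epsilon>\<close>. The frequency \<open>k\<close> in \<open>y\<close> is \<open>fr k = k / \<rho>\<close> in \<open>x\<close>; \<open>zet k b\<close> is its complex shift by the
  \<open>b\<close>-th of \<open>M\<close> equidistant points of the circle, and \<open>R\<close> is the size of the frequency cube. The
  coefficients \<open>cs\<close> are cut off outside the ball of radius \<open>2 \<rho>\<close>, and \<open>\<theta>\<close> lives in the variable \<open>y\<close>.
\<close>

locale scheme =
  fixes m r T :: nat and x0 :: "real^'n::finite" and \<rho> cl cu :: real and \<theta> :: "real^'n \<Rightarrow> complex"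
    and p :: "nat \<Rightarrow> ('n \<Rightarrow> nat) \<Rightarrow> complex" and lam :: "nat \<Rightarrow> real" and cs :: "nat \<Rightarrow> real^'n \<Rightarrow> complex"
    and M R :: nat
  assumes \<rho>: "0 < \<rho>" "\<rho> \<le> 1"
    and cl: "0 < cl" and cu: "0 < cu" and M: "0 < M"
    and \<theta>: "smooth_on UNIV \<theta>" "supp2 \<theta>" "\<And>y. y \<in> cball 0 1 \<Longrightarrow> \<theta> y = 1"
    and lower: "\<And>q (\<xi> :: real^'n). \<exists>t\<in>{1..T}. \<forall>z. norm z = real t \<longrightarrow>
        cl * weight m q \<xi> \<le> norm (peval m q (\<lambda>i. rv \<xi> i + gam m z i))"
    and upper: "\<And>q (\<xi> :: real^'n) z. norm z \<le> real T \<Longrightarrow> norm (peval m q (\<lambda>i. rv \<xi> i + gam m z i)) \<le> cu * weight m q \<xi>"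
    and dom: "\<And>j \<xi>. j \<in> {1..r} \<Longrightarrow> weight m (p j) \<xi> \<le> lam j * weight m (p 0) \<xi>"
    and pos: "\<And>\<xi>. 0 < weight m (p 0) \<xi>"
    and cs: "\<And>j. j \<in> {1..r} \<Longrightarrow> smooth_on UNIV (cs j)" "\<And>j x. j \<in> {1..r} \<Longrightarrow> 2 * \<rho> < dist x0 x \<Longrightarrow> cs j x = 0"
begin

definition "fr k = (\<chi> i. of_int (k i) / \<rho>)" for k :: "'n \<Rightarrow> int"

text \<open>The radius is selected for P_0 at each frequency separately. It may jump with k, which
  is harmless because only bounds uniform in k are used.\<close>

definition "rad k = (SOME t. t \<in> {1..T} \<and> (\<forall>z. norm z = real t \<longrightarrow>
  cl * weight m (p 0) (fr k) \<le> norm (peval m (p 0) (\<lambda>i. rv (fr k) i + gam m z i))))"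

definition "zr k b = of_real (real (rad k)) * uroot M b"
definition "zet k b = (\<lambda>i. rv (fr k) i + gam m (zr k b) i)"
definition "ege k b = ex (\<lambda>i :: 'n. of_real \<rho> * gam m (zr k b) i)" for k :: "'n \<Rightarrow> int"
definition "Q j k b = peval m (p j) (zet k b)"
text \<open>\<open>Bk\<close> and \<open>W\<close> are circle averages of P_j / P_0 and of 1 / P_0
  against the shifted exponential: the former enters the perturbation, the latter the
  solution.\<close>

definition "Bk j k y = (\<Sum>b<M. (Q j k b / Q 0 k b) * ege k b y) / of_nat M"
definition "W k y = (\<Sum>b<M. (1 / Q 0 k b) * ege k b y) / of_nat M"
definition "ch j y = cs j (x0 + \<rho> *\<^sub>R y)"
text \<open>The factor \<theta> gives the discretisation error of the circle mean compact support.
  Where \<theta> = 1, the expression 1 + H_k is exactly the factor that the operator produces. The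
  other terms have compact support through the cut-off coefficients.\<close>

definition "H k y = \<theta> y * (gavg m M \<rho> (rad k) y - 1) + (\<Sum>j=1..r. ch j y * Bk j k y)"
definition "U f y = (\<Sum>k\<in>cube R. f k * (ex (kc k) y * W k y))"
definition "u f x = U f ((1 / \<rho>) *\<^sub>R (x - x0))"
definition "coef \<alpha> x = p 0 \<alpha> + (\<Sum>j=1..r. cs j x * p j \<alpha>)"
definition "Pu f x = (\<Sum>\<alpha> | mi_order \<alpha> \<le> m. coef \<alpha> x * mD \<alpha> (u f) x)"
definition "tP \<phi> x = (\<Sum>\<alpha> | mi_order \<alpha> \<le> m. (- 1) ^ mi_order \<alpha> * mD \<alpha> (\<lambda>x. coef \<alpha> x * \<phi> x) x)"

section \<open>Bounds on quotients of symbols and on the perturbation\<close>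

lemma rad: "rad k \<in> {1..T}"
  "norm z = real (rad k) \<Longrightarrow> cl * weight m (p 0) (fr k) \<le> norm (peval m (p 0) (\<lambda>i. rv (fr k) i + gam m z i))"
proof -
  have "\<exists>t. t \<in> {1..T} \<and> (\<forall>z. norm z = real t \<longrightarrow>
    cl * weight m (p 0) (fr k) \<le> norm (peval m (p 0) (\<lambda>i. rv (fr k) i + gam m z i)))"
    using lower by blast
  from someI_ex[OF this] show "rad k \<in> {1..T}"
    "norm z = real (rad k) \<Longrightarrow> cl * weight m (p 0) (fr k) \<le> norm (peval m (p 0) (\<lambda>i. rv (fr k) i + gam m z i))"
    unfolding rad_def by blast+
qed

lemma norm_zr: "norm (zr k b) = real (rad k)" by (simp add: zr_def norm_mult)

lemma Q0_lower: "cl * weight m (p 0) (fr k) \<le> norm (Q 0 k b)"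
  unfolding Q_def zet_def by (rule rad(2)[OF norm_zr])

lemma Q0_nz: "Q 0 k b \<noteq> 0"
  using Q0_lower[of k b] mult_pos_pos[OF cl pos[of "fr k"]] by auto

lemma lam_nonneg: "j \<in> {1..r} \<Longrightarrow> 0 \<le> lam j"
  using dom[of j 0] pos[of 0] weight_nonneg[of m "p j" 0] by (metis mult_less_0_iff not_less order_trans)

text \<open>The weights cancel: up to constants P_j is at most its weight at the real frequency, P_0
  is at least its own, and \<open>dom\<close> compares the two. No power of k is left.\<close>

lemma Q_upper:
  assumes j: "j \<in> {1..r}" shows "norm (Q j k b / Q 0 k b) \<le> (cu / cl) * lam j"
proof -
  have "norm (zr k b) \<le> real T" using rad(1)[of k] by (simp add: norm_zr)
  then have "norm (Q j k b) \<le> cu * weight m (p j) (fr k)" unfolding Q_def zet_def by (rule upper)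
  also have "\<dots> \<le> cu * (lam j * weight m (p 0) (fr k))" using dom[OF j] cu by (intro mult_left_mono) auto
  finally have 1: "norm (Q j k b) \<le> cu * (lam j * weight m (p 0) (fr k))" .
  have w: "0 < cl * weight m (p 0) (fr k)" using cl pos by simp
  have "norm (Q j k b / Q 0 k b) \<le> (cu * (lam j * weight m (p 0) (fr k))) / (cl * weight m (p 0) (fr k))"
    unfolding norm_divide using order_trans[OF norm_ge_zero 1] by (intro frac_le 1 w Q0_lower)
  also have "\<dots> = (cu / cl) * lam j" using pos[of "fr k"] by simp
  finally show ?thesis .
qed

lemma dbound_ege: "dbound (cball 0 2) q (ege k b) (exbd TYPE('n) m T q)"
  unfolding ege_def exbd_def
proof (rule dbound_ex)
  fix i :: 'n
  have "norm (gam m (zr k b) i) \<le> (real T + 1) ^ ((m + 1) ^ CARD('n))"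
    by (rule norm_gam_le) (use rad(1)[of k] in \<open>auto simp: norm_zr\<close>)
  moreover have "\<bar>\<rho>\<bar> * norm (gam m (zr k b) i) \<le> 1 * norm (gam m (zr k b) i)"
    using \<rho> by (intro mult_right_mono) auto
  ultimately show "norm (of_real \<rho> * gam m (zr k b) i) \<le> (real T + 1) ^ ((m + 1) ^ CARD('n))" by (simp add: norm_mult)
qed simp

lemma smooth_ege: "smooth_on UNIV (ege k b)"
  unfolding ege_def by (rule smooth_on_ex) simp

lemma dbound_average:
  assumes "\<And>b. norm (g b) \<le> G"
  shows "dbound (cball 0 2) q (\<lambda>y. (\<Sum>b<M. g b * ege k b y) / of_nat M) (G * exbd TYPE('n) m T q)"
proof -
  have "dbound (cball 0 2) q (\<lambda>y. \<Sum>b<M. g b * ege k b y) (\<Sum>b<M. G * exbd TYPE('n) m T q)"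
    by (rule dbound_sum[OF open_UNIV subset_UNIV])
       (intro smooth_on_mult smooth_on_const smooth_ege open_UNIV dbound_cmult[OF open_UNIV subset_UNIV smooth_ege dbound_ege]
          mult_right_mono assms less_imp_le exbd_pos)+
  then have "dbound (cball 0 2) q (\<lambda>y. inverse (of_nat M) * (\<Sum>b<M. g b * ege k b y)) (G * exbd TYPE('n) m T q)"
    by (rule dbound_cmult[OF open_UNIV subset_UNIV, rotated])
       (use M in \<open>auto intro!: smooth_on_sum smooth_on_mult smooth_on_const smooth_ege simp: norm_inverse mult.assoc[symmetric]\<close>)
  then show ?thesis by (simp add: divide_inverse mult.commute)
qed

lemma smooth_average: "smooth_on UNIV (\<lambda>y. (\<Sum>b<M. g b * ege k b y) / of_nat M)"
  unfolding divide_inverse by (intro smooth_on_mult smooth_on_sum smooth_on_const smooth_ege open_UNIV)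

lemma smooth_W: "smooth_on UNIV (W k)" and smooth_Bk: "smooth_on UNIV (Bk j k)"
  unfolding W_def[abs_def] Bk_def[abs_def] by (rule smooth_average)+

lemma dbound_W: "dbound (cball 0 2) q (W k) (exbd TYPE('n) m T q / (cl * weight m (p 0) (fr k)))"
proof -
  have w: "0 < cl * weight m (p 0) (fr k)" using cl pos by simp
  have "norm (1 / Q 0 k b) \<le> 1 / (cl * weight m (p 0) (fr k))" for b
    using Q0_lower[of k b] w by (simp add: norm_divide frac_le)
  from dbound_average[OF this] show ?thesis by (simp add: W_def[abs_def])
qed

lemma smooth_ch: "j \<in> {1..r} \<Longrightarrow> smooth_on UNIV (ch j)"
  unfolding ch_def[abs_def] by (rule smooth_on_shift[OF cs(1)])

lemma supp2_ch: "j \<in> {1..r} \<Longrightarrow> supp2 (ch j)"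
proof (intro allI impI)
  fix y :: "real^'n" assume j: "j \<in> {1..r}" and "y \<notin> cball 0 2"
  then have "2 * \<rho> < dist x0 (x0 + \<rho> *\<^sub>R y)" using \<rho> by (simp add: dist_norm)
  then show "ch j y = 0" unfolding ch_def by (rule cs(2)[OF j])
qed

lemma smooth_H: "smooth_on UNIV (H k)"
  unfolding H_def[abs_def]
  by (intro smooth_on_add smooth_on_mult smooth_on_sum smooth_on_diff smooth_on_const \<theta> smooth_on_gavg smooth_ch smooth_Bk open_UNIV)

lemma supp2_H: "supp2 (H k)"
  using \<theta>(2) supp2_ch by (auto simp: H_def intro!: sum.neutral)

lemma dbound_H:
  assumes "dbound (cball 0 2) q \<theta> B\<theta>" "0 \<le> B\<theta>"
    and "\<And>t. t \<in> {1..T} \<Longrightarrow> dbound (cball (0 :: real^'n) 2) q (\<lambda>y. gavg m M \<rho> t y - 1) a"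
    and "\<And>j. j \<in> {1..r} \<Longrightarrow> dbound (cball 0 2) q (\<lambda>y. of_real (lam j) * ch j y) \<kappa>"
  shows "dbound (cball 0 2) q (H k) (2 ^ q * B\<theta> * a + real r * (2 ^ q * \<kappa> * ((cu / cl) * exbd TYPE('n) m T q)))"
proof -
  have 1: "dbound (cball 0 2) q (\<lambda>y. ch j y * Bk j k y) (2 ^ q * \<kappa> * ((cu / cl) * exbd TYPE('n) m T q))"
    if j: "j \<in> {1..r}" for j
  proof -
    \<comment> \<open>The factor \<open>lam j\<close> is moved from the quotient to the coefficient,
      because smallness is available only for \<open>lam j\<close> times the coefficient. If
      \<open>lam j\<close> = 0, the quotients P_j / P_0 vanish by \<open>Q_upper\<close>, and
      division by 0 gives 0 as well.\<close>
    define B' where "B' y = (\<Sum>b<M. ((Q j k b / Q 0 k b) / of_real (lam j)) * ege k b y) / of_nat M" for y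
    have "norm ((Q j k b / Q 0 k b) / of_real (lam j)) \<le> cu / cl" for b
    proof (cases "lam j = 0")
      case False
      then show ?thesis using Q_upper[OF j, of k b] lam_nonneg[OF j]
        by (simp add: norm_divide[of _ "of_real (lam j)"] divide_le_eq del: divide_divide_eq_left)
    qed (use cl cu in auto)
    then have "dbound (cball 0 2) q B' ((cu / cl) * exbd TYPE('n) m T q)"
      unfolding B'_def[abs_def] by (rule dbound_average)
    moreover have "smooth_on UNIV B'" unfolding B'_def[abs_def] by (rule smooth_average)
    ultimately have "dbound (cball 0 2) q (\<lambda>y. (of_real (lam j) * ch j y) * B' y) (2 ^ q * \<kappa> * ((cu / cl) * exbd TYPE('n) m T q))"
      by (intro dbound_mult[OF open_UNIV subset_UNIV] assms(4)[OF j] smooth_on_mult smooth_on_const smooth_ch[OF j] open_UNIV)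
    moreover have "of_real (lam j) * B' y = Bk j k y" for y
    proof (cases "lam j = 0")
      case True
      then have z: "Q j k b / Q 0 k b = 0" for b using Q_upper[OF j, of k b] by simp
      show ?thesis unfolding Bk_def z by (simp add: True)
    next
      case False
      then show ?thesis by (simp add: B'_def Bk_def sum_distrib_left)
    qed
    then have "(\<lambda>y. (of_real (lam j) * ch j y) * B' y) = (\<lambda>y. ch j y * Bk j k y)" by (metis mult.left_commute mult.assoc)
    ultimately show ?thesis by simp
  qed
  have "dbound (cball 0 2) q (\<lambda>y. \<Sum>j=1..r. ch j y * Bk j k y) (\<Sum>j=1..r. 2 ^ q * \<kappa> * ((cu / cl) * exbd TYPE('n) m T q))"
    by (rule dbound_sum[OF open_UNIV subset_UNIV _ 1]) (auto intro!: smooth_on_mult smooth_ch smooth_Bk)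
  moreover have "dbound (cball 0 2) q (\<lambda>y. \<theta> y * (gavg m M \<rho> (rad k) y - 1)) (2 ^ q * B\<theta> * a)"
    by (intro dbound_mult[OF open_UNIV subset_UNIV] assms(1) assms(3)[OF rad(1)] \<theta> smooth_on_diff smooth_on_gavg smooth_on_const open_UNIV)
  ultimately show ?thesis unfolding H_def[abs_def]
    by (intro dbound_add[OF open_UNIV subset_UNIV, THEN dbound_mono])
       (auto intro!: smooth_on_mult \<theta> smooth_on_diff smooth_on_gavg smooth_on_const smooth_on_sum smooth_ch smooth_Bk)
qed

section \<open>Action of the operator on superpositions of shifted exponentials\<close>

lemma ex_scale: "ex (zet k b) (\<rho> *\<^sub>R y) = ex (kc k) y * ege k b y"
proof -
  have "zet k b i * (of_real \<rho> * of_real (y $ i)) = (kc k i + of_real \<rho> * gam m (zr k b) i) * of_real (y $ i)" for i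
    using \<rho> by (simp add: zet_def rv_def fr_def kc_def field_simps)
  then have "ex (zet k b) (\<rho> *\<^sub>R y) = ex (\<lambda>i. kc k i + of_real \<rho> * gam m (zr k b) i) y"
    by (simp only: ex_def vector_scaleR_component real_scaleR_def of_real_mult)
  then show ?thesis unfolding ege_def ex_add[symmetric] .
qed

lemma U_eq_u: "u f (x0 + \<rho> *\<^sub>R y) = U f y"
  using \<rho> by (simp add: u_def)

lemma smooth_U: "smooth_on UNIV (U f)"
  unfolding U_def[abs_def] by (intro smooth_on_sum smooth_on_mult smooth_on_const smooth_on_ex smooth_W open_UNIV)

lemma u_eq: "u f = (\<lambda>x. U f ((- (1 / \<rho>) *\<^sub>R x0) + (1 / \<rho>) *\<^sub>R x))"
  by (simp add: u_def[abs_def] scaleR_diff_right)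

lemma smooth_u: "smooth_on UNIV (u f)"
  unfolding u_eq by (rule smooth_on_shift[OF smooth_U])

lemma u_expand: "u f x = (\<Sum>k\<in>cube R. \<Sum>b<M. (f k / (Q 0 k b * of_nat M)) * ex (zet k b) (x - x0))"
proof -
  let ?y = "(1 / \<rho>) *\<^sub>R (x - x0)"
  have "ex (kc k) ?y * ege k b ?y = ex (zet k b) (x - x0)" for k b
    using ex_scale[of k b ?y] \<rho> by simp
  then show ?thesis
    by (simp add: u_def U_def W_def sum_distrib_left sum_divide_distrib mult_ac)
qed

lemma mD_u: "mD \<alpha> (u f) x = (\<Sum>k\<in>cube R. \<Sum>b<M. (f k / (Q 0 k b * of_nat M)) * (mono_mi \<alpha> (zet k b) * ex (zet k b) (x - x0)))"
  unfolding u_expand[abs_def]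
  by (subst mD_sum, (intro smooth_on_sum smooth_on_mult smooth_on_const smooth_on_ex_shift open_UNIV)[1],
      subst mD_sum, (intro smooth_on_sum smooth_on_mult smooth_on_const smooth_on_ex_shift open_UNIV)[1])
     (simp only: mD_cmult[OF smooth_on_ex_shift] mD_ex_shift)

text \<open>Shifted exponentials are eigenfunctions of the constant coefficient parts, so P(x,D)
  multiplies them by P_0(\<zeta>) plus the sum of the c_j(x) P_j(\<zeta>). Division by P_0(\<zeta>)
  and averaging leave the mean of the exponentials and the terms \<open>Bk\<close>, without any
  error.\<close>

lemma Pu_expand:
  "Pu f (x0 + \<rho> *\<^sub>R y) = (\<Sum>k\<in>cube R. f k * (ex (kc k) y * (gavg m M \<rho> (rad k) y + (\<Sum>j=1..r. ch j y * Bk j k y))))"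
proof -
  let ?x = "x0 + \<rho> *\<^sub>R y"
  have "(\<Sum>\<alpha> | mi_order \<alpha> \<le> m. coef \<alpha> ?x * mono_mi \<alpha> (zet k b)) = Q 0 k b + (\<Sum>j=1..r. ch j y * Q j k b)" for k b
  proof -
    have "coef \<alpha> ?x * mono_mi \<alpha> (zet k b) = p 0 \<alpha> * mono_mi \<alpha> (zet k b) + (\<Sum>j=1..r. ch j y * (p j \<alpha> * mono_mi \<alpha> (zet k b)))" for \<alpha>
      by (simp add: coef_def ch_def distrib_right sum_distrib_right mult.assoc)
    then have "(\<Sum>\<alpha> | mi_order \<alpha> \<le> m. coef \<alpha> ?x * mono_mi \<alpha> (zet k b)) =
      Q 0 k b + (\<Sum>\<alpha> | mi_order \<alpha> \<le> m. \<Sum>j=1..r. ch j y * (p j \<alpha> * mono_mi \<alpha> (zet k b)))"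
      by (simp only: Q_def peval_def sum.distrib)
    also have "(\<Sum>\<alpha> | mi_order \<alpha> \<le> m. \<Sum>j=1..r. ch j y * (p j \<alpha> * mono_mi \<alpha> (zet k b))) = (\<Sum>j=1..r. ch j y * Q j k b)"
      unfolding Q_def peval_def sum_distrib_left by (rule sum.swap)
    finally show ?thesis .
  qed
  note c = this
  have "Pu f ?x = (\<Sum>\<alpha> | mi_order \<alpha> \<le> m. \<Sum>k\<in>cube R. \<Sum>b<M. (f k / (Q 0 k b * of_nat M)) * ex (zet k b) (\<rho> *\<^sub>R y) * (coef \<alpha> ?x * mono_mi \<alpha> (zet k b)))"
    unfolding Pu_def mD_u by (simp add: sum_distrib_left mult_ac)
  also have "\<dots> = (\<Sum>k\<in>cube R. \<Sum>\<alpha> | mi_order \<alpha> \<le> m. \<Sum>b<M. (f k / (Q 0 k b * of_nat M)) * ex (zet k b) (\<rho> *\<^sub>R y) * (coef \<alpha> ?x * mono_mi \<alpha> (zet k b)))"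
    by (rule sum.swap)
  also have "\<dots> = (\<Sum>k\<in>cube R. \<Sum>b<M. (f k / (Q 0 k b * of_nat M)) * ex (zet k b) (\<rho> *\<^sub>R y) * (Q 0 k b + (\<Sum>j=1..r. ch j y * Q j k b)))"
    unfolding c[symmetric] sum_distrib_left by (rule sum.cong[OF refl], rule sum.swap)
  also have "\<dots> = (\<Sum>k\<in>cube R. f k * (ex (kc k) y * (gavg m M \<rho> (rad k) y + (\<Sum>j=1..r. ch j y * Bk j k y))))"
  proof (rule sum.cong[OF refl])
    fix k :: "'n \<Rightarrow> int"
    have "(f k / (Q 0 k b * of_nat M)) * ex (zet k b) (\<rho> *\<^sub>R y) * (Q 0 k b + (\<Sum>j=1..r. ch j y * Q j k b)) =
      f k * ex (kc k) y * (ege k b y / of_nat M) + f k * ex (kc k) y * (\<Sum>j=1..r. ch j y * (Q j k b / Q 0 k b * ege k b y / of_nat M))" for b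
      unfolding ex_scale using Q0_nz[of k b] M by (simp add: field_simps sum_distrib_left sum_divide_distrib)
    then have "(\<Sum>b<M. (f k / (Q 0 k b * of_nat M)) * ex (zet k b) (\<rho> *\<^sub>R y) * (Q 0 k b + (\<Sum>j=1..r. ch j y * Q j k b))) =
      f k * ex (kc k) y * ((\<Sum>b<M. ege k b y) / of_nat M) + f k * ex (kc k) y * (\<Sum>b<M. \<Sum>j=1..r. ch j y * (Q j k b / Q 0 k b * ege k b y / of_nat M))"
      by (simp only: sum.distrib sum_distrib_left[symmetric] sum_divide_distrib[symmetric])
    also have "(\<Sum>b<M. \<Sum>j=1..r. ch j y * (Q j k b / Q 0 k b * ege k b y / of_nat M)) = (\<Sum>j=1..r. ch j y * Bk j k y)"
      by (subst sum.swap) (simp add: Bk_def sum_distrib_left sum_divide_distrib)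
    also have "(\<Sum>b<M. ege k b y) / of_nat M = gavg m M \<rho> (rad k) y" by (simp add: gavg_def ege_def zr_def)
    finally show "(\<Sum>b<M. (f k / (Q 0 k b * of_nat M)) * ex (zet k b) (\<rho> *\<^sub>R y) * (Q 0 k b + (\<Sum>j=1..r. ch j y * Q j k b))) =
      f k * (ex (kc k) y * (gavg m M \<rho> (rad k) y + (\<Sum>j=1..r. ch j y * Bk j k y)))" by (simp add: algebra_simps)
  qed
  finally show ?thesis .
qed

lemma Pu_H:
  assumes "y \<in> cball 0 1"
  shows "Pu f (x0 + \<rho> *\<^sub>R y) = (\<Sum>k\<in>cube R. f k * ex (kc k) y) + (\<Sum>k\<in>cube R. f k * (ex (kc k) y * H k y))"
  unfolding Pu_expand H_def \<theta>(3)[OF assms] sum.distrib[symmetric] by (rule sum.cong) (simp_all add: algebra_simps)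

section \<open>Transposition against test functions\<close>

lemma smooth_coef: "smooth_on UNIV (coef \<alpha>)"
  unfolding coef_def[abs_def]
  by (intro smooth_on_add smooth_on_mult smooth_on_sum smooth_on_const cs open_UNIV)

text \<open>Integration by parts takes place in y. Each derivative brings a factor \<rho> on either
  side, and these cancel. A function that vanishes outside the ball of radius \<rho> vanishes for
  |y| > 1, so no boundary terms arise.\<close>

lemma pimean_mD_parts:
  assumes \<psi>: "smooth_on UNIV \<psi>" "\<And>x. \<rho> < dist x0 x \<Longrightarrow> \<psi> x = 0"
  shows "pimean (\<lambda>y. U f y * mD \<alpha> \<psi> (x0 + \<rho> *\<^sub>R y)) = (- 1) ^ mi_order \<alpha> * pimean (\<lambda>y. mD \<alpha> (u f) (x0 + \<rho> *\<^sub>R y) * \<psi> (x0 + \<rho> *\<^sub>R y))"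
proof -
  define \<Psi> where "\<Psi> y = \<psi> (x0 + \<rho> *\<^sub>R y)" for y
  have s\<Psi>: "smooth_on UNIV \<Psi>" unfolding \<Psi>_def[abs_def] by (rule smooth_on_shift[OF \<psi>(1)])
  have supp: "supp2 \<Psi>"
  proof (intro allI impI)
    fix y :: "real^'n" assume "y \<notin> cball 0 2"
    then have "\<rho> * 1 < \<rho> * norm y" using \<rho> by (intro mult_strict_left_mono) auto
    then show "\<Psi> y = 0" unfolding \<Psi>_def by (intro \<psi>(2)) (use \<rho> in \<open>simp add: dist_norm\<close>)
  qed
  have e1: "foldr pd is \<Psi> y = of_real \<rho> ^ length is * foldr pd is \<psi> (x0 + \<rho> *\<^sub>R y)" for "is" y
    unfolding \<Psi>_def[abs_def] by (rule pds_affine[OF open_UNIV \<psi>(1)]) simp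
  have e2: "foldr pd is (U f) y = of_real \<rho> ^ length is * foldr pd is (u f) (x0 + \<rho> *\<^sub>R y)" for "is" y
    using pds_affine[OF open_UNIV smooth_u, where a = x0 and r = \<rho> and y = y] by (simp add: U_eq_u)
  let ?is = "mi_list \<alpha>"
  have rev: "foldr pd (rev ?is) (U f) y = foldr pd ?is (U f) y" for y
    by (rule pds_perm[OF open_UNIV smooth_U]) auto
  have nz: "(of_real \<rho> :: complex) ^ mi_order \<alpha> \<noteq> 0" using \<rho> by simp
  have "of_real \<rho> ^ mi_order \<alpha> * pimean (\<lambda>y. U f y * mpd \<alpha> \<psi> (x0 + \<rho> *\<^sub>R y)) = pimean (\<lambda>y. U f y * foldr pd ?is \<Psi> y)"
    unfolding pimean_cmult[symmetric] e1 mpd_eq_pds length_mi_list by (simp add: mult_ac)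
  also have "\<dots> = (- 1) ^ mi_order \<alpha> * pimean (\<lambda>y. foldr pd ?is (U f) y * \<Psi> y)"
    unfolding pimean_parts[OF smooth_U s\<Psi> supp] rev length_mi_list ..
  also have "pimean (\<lambda>y. foldr pd ?is (U f) y * \<Psi> y) = of_real \<rho> ^ mi_order \<alpha> * pimean (\<lambda>y. mpd \<alpha> (u f) (x0 + \<rho> *\<^sub>R y) * \<psi> (x0 + \<rho> *\<^sub>R y))"
    unfolding pimean_cmult[symmetric] e2 mpd_eq_pds length_mi_list \<Psi>_def by (simp add: mult_ac)
  finally have "pimean (\<lambda>y. U f y * mpd \<alpha> \<psi> (x0 + \<rho> *\<^sub>R y)) = (- 1) ^ mi_order \<alpha> * pimean (\<lambda>y. mpd \<alpha> (u f) (x0 + \<rho> *\<^sub>R y) * \<psi> (x0 + \<rho> *\<^sub>R y))"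
    unfolding mult.left_commute[of "(- 1) ^ mi_order \<alpha>"] by (rule mult_left_cancel[OF nz, THEN iffD1])
  then have "(- \<i>) ^ mi_order \<alpha> * pimean (\<lambda>y. U f y * mpd \<alpha> \<psi> (x0 + \<rho> *\<^sub>R y)) =
      (- 1) ^ mi_order \<alpha> * ((- \<i>) ^ mi_order \<alpha> * pimean (\<lambda>y. mpd \<alpha> (u f) (x0 + \<rho> *\<^sub>R y) * \<psi> (x0 + \<rho> *\<^sub>R y)))"
    by (simp add: mult_ac)
  then show ?thesis unfolding pimean_cmult[symmetric] mD_def by (simp add: mult_ac)
qed

lemma smooth_mD: "smooth_on UNIV g \<Longrightarrow> smooth_on UNIV (mD \<alpha> g)"
  unfolding mD_def[abs_def] mpd_eq_pds by (intro smooth_on_mult smooth_on_const smooth_on_pds open_UNIV)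

lemma pimean_tP:
  assumes \<phi>: "smooth_on UNIV \<phi>" "\<And>x. \<rho> < dist x0 x \<Longrightarrow> \<phi> x = 0"
  shows "pimean (\<lambda>y. \<theta> y * (u f (x0 + \<rho> *\<^sub>R y) * tP \<phi> (x0 + \<rho> *\<^sub>R y))) = pimean (\<lambda>y. Pu f (x0 + \<rho> *\<^sub>R y) * \<phi> (x0 + \<rho> *\<^sub>R y))"
proof -
  let ?X = "\<lambda>y. x0 + \<rho> *\<^sub>R y"
  have s: "smooth_on UNIV (\<lambda>x. coef \<alpha> x * \<phi> x)" for \<alpha> by (intro smooth_on_mult smooth_coef \<phi> open_UNIV)
  have smX: "smooth_on UNIV (\<lambda>y. mD \<alpha> (\<lambda>x. coef \<alpha> x * \<phi> x) (?X y))" "smooth_on UNIV (\<lambda>y. mD \<alpha> (u f) (?X y))"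
    "smooth_on UNIV (\<lambda>y. coef \<alpha> (?X y))" "smooth_on UNIV (\<lambda>y. \<phi> (?X y))" for \<alpha>
    by (rule smooth_on_shift, (rule smooth_mD s smooth_u smooth_coef \<phi>(1))+)+
  have z: "tP \<phi> x = 0" if "\<rho> < dist x0 x" for x
  proof -
    have "mD \<alpha> (\<lambda>x. coef \<alpha> x * \<phi> x) x = 0" for \<alpha>
    proof -
      have "foldr pd (mi_list \<alpha>) (\<lambda>x. coef \<alpha> x * \<phi> x) x = foldr pd (mi_list \<alpha>) (\<lambda>_. 0) x"
        by (rule pds_cong_open[OF open_Compl[OF closed_cball[of x0 \<rho>]]]) (use \<phi>(2) that in auto)
      then show ?thesis by (simp add: mD_def mpd_eq_pds pds_zero)
    qed
    then show ?thesis by (simp add: tP_def)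
  qed
  have "\<theta> y * (u f (?X y) * tP \<phi> (?X y)) = U f y * tP \<phi> (?X y)" for y
  proof (cases "norm y \<le> 1")
    case True
    then show ?thesis using \<theta>(3)[of y] by (simp add: U_eq_u)
  next
    case False
    then have "\<rho> * 1 < \<rho> * norm y" using \<rho> by (intro mult_strict_left_mono) auto
    then have "tP \<phi> (?X y) = 0" by (intro z) (use \<rho> in \<open>simp add: dist_norm\<close>)
    then show ?thesis by simp
  qed
  then have "pimean (\<lambda>y. \<theta> y * (u f (?X y) * tP \<phi> (?X y))) = pimean (\<lambda>y. U f y * tP \<phi> (?X y))" by (simp only:)
  also have "\<dots> = pimean (\<lambda>y. \<Sum>\<alpha> | mi_order \<alpha> \<le> m. (- 1) ^ mi_order \<alpha> * (U f y * mD \<alpha> (\<lambda>x. coef \<alpha> x * \<phi> x) (?X y)))"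
    by (simp add: tP_def sum_distrib_left mult.left_commute)
  also have "\<dots> = (\<Sum>\<alpha> | mi_order \<alpha> \<le> m. (- 1) ^ mi_order \<alpha> * pimean (\<lambda>y. U f y * mD \<alpha> (\<lambda>x. coef \<alpha> x * \<phi> x) (?X y)))"
    unfolding pimean_cmult[symmetric]
    by (rule pimean_sum, rule smooth_continuous_pibox)
       (intro smooth_on_mult smooth_on_const smooth_U smX open_UNIV)
  also have "\<dots> = (\<Sum>\<alpha> | mi_order \<alpha> \<le> m. pimean (\<lambda>y. coef \<alpha> (?X y) * mD \<alpha> (u f) (?X y) * \<phi> (?X y)))"
  proof (rule sum.cong[OF refl])
    fix \<alpha> :: "'n \<Rightarrow> nat"
    have "pimean (\<lambda>y. U f y * mD \<alpha> (\<lambda>x. coef \<alpha> x * \<phi> x) (?X y)) =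
        (- 1) ^ mi_order \<alpha> * pimean (\<lambda>y. mD \<alpha> (u f) (?X y) * (coef \<alpha> (?X y) * \<phi> (?X y)))"
      by (rule pimean_mD_parts[OF s]) (simp add: \<phi>(2))
    moreover have "(- 1) ^ n * ((- 1) ^ n * c) = (c :: complex)" for n c
      by (simp add: mult.assoc[symmetric] power_mult_distrib[symmetric])
    ultimately show "(- 1) ^ mi_order \<alpha> * pimean (\<lambda>y. U f y * mD \<alpha> (\<lambda>x. coef \<alpha> x * \<phi> x) (?X y)) =
        pimean (\<lambda>y. coef \<alpha> (?X y) * mD \<alpha> (u f) (?X y) * \<phi> (?X y))" by (simp add: mult_ac)
  qed
  also have "\<dots> = pimean (\<lambda>y. \<Sum>\<alpha> | mi_order \<alpha> \<le> m. coef \<alpha> (?X y) * mD \<alpha> (u f) (?X y) * \<phi> (?X y))"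
    by (rule pimean_sum[symmetric], rule smooth_continuous_pibox)
       (intro smooth_on_mult smX open_UNIV)
  finally show ?thesis by (simp add: Pu_def sum_distrib_right)
qed

text \<open>Against the sum of the f_k e_k H_k the test function is split into its partial sum and
  the rest. The partial sum sees only frequencies in the cube, so a square matrix on
  \<open>cube R\<close> is enough; the rest is an error term.\<close>

lemma pimean_Pu:
  assumes \<phi>: "smooth_on UNIV \<phi>" "\<And>x. \<rho> < dist x0 x \<Longrightarrow> \<phi> x = 0"
  defines "\<Phi> \<equiv> \<lambda>y. \<phi> (x0 + \<rho> *\<^sub>R y)"
  shows "pimean (\<lambda>y. Pu f (x0 + \<rho> *\<^sub>R y) * \<phi> (x0 + \<rho> *\<^sub>R y)) =
    (\<Sum>l\<in>cube R. fc \<Phi> (\<lambda>i. - l i) * (f l + (\<Sum>k\<in>cube R. smat H l k * f k))) +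
    (\<Sum>k\<in>cube R. f k * pimean (\<lambda>y. (ex (kc k) y * H k y) * (\<Phi> y - psum R \<Phi> y)))"
proof -
  have s\<Phi>: "smooth_on UNIV \<Phi>" unfolding \<Phi>_def by (rule smooth_on_shift[OF \<phi>(1)])
  note cont = smooth_continuous_pibox smooth_on_mult smooth_on_const smooth_on_ex smooth_H s\<Phi> smooth_on_psum smooth_on_diff smooth_on_add smooth_on_sum open_UNIV
  \<comment> \<open>For |y| \<le> 1 this is \<open>Pu_H\<close>; elsewhere \<Phi> is 0 and the two
    terms with the partial sum cancel.\<close>
  have eq: "Pu f (x0 + \<rho> *\<^sub>R y) * \<phi> (x0 + \<rho> *\<^sub>R y) =
      (\<Sum>k\<in>cube R. f k * (\<Phi> y * ex (kc k) y)) + (\<Sum>k\<in>cube R. f k * ((ex (kc k) y * H k y) * psum R \<Phi> y) + f k * ((ex (kc k) y * H k y) * (\<Phi> y - psum R \<Phi> y)))" for y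
  proof (cases "norm y \<le> 1")
    case True
    have a: "f k * ((ex (kc k) y * H k y) * psum R \<Phi> y) + f k * ((ex (kc k) y * H k y) * (\<Phi> y - psum R \<Phi> y)) =
        f k * (ex (kc k) y * H k y) * \<Phi> y" for k by (simp add: algebra_simps)
    have b: "f k * (\<Phi> y * ex (kc k) y) = f k * ex (kc k) y * \<Phi> y" for k by simp
    show ?thesis unfolding a b sum_distrib_right[symmetric] using True by (simp add: Pu_H \<Phi>_def distrib_right)
  next
    case False
    then have "\<rho> * 1 < \<rho> * norm y" using \<rho> by (intro mult_strict_left_mono) auto
    then have "\<phi> (x0 + \<rho> *\<^sub>R y) = 0" by (intro \<phi>(2)) (use \<rho> in \<open>simp add: dist_norm\<close>)
    then show ?thesis by (simp add: \<Phi>_def)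
  qed
  have 1: "pimean (\<lambda>y. \<Phi> y * ex (kc k) y) = fc \<Phi> (\<lambda>i. - k i)" for k by (simp add: fc_def)
  have 2: "pimean (\<lambda>y. (ex (kc k) y * H k y) * psum R \<Phi> y) = (\<Sum>l\<in>cube R. fc \<Phi> (\<lambda>i. - l i) * smat H l k)" for k
  proof -
    have "pimean (\<lambda>y. (ex (kc k) y * H k y) * psum R \<Phi> y) = pimean (\<lambda>y. \<Sum>l\<in>cube R. fc \<Phi> l * (H k y * ex (kc (\<lambda>i. k i + l i)) y))"
    proof -
      have "ex (kc k) y * ex (kc l) y = ex (kc (\<lambda>i. k i + l i)) y" for l y
        unfolding ex_add[symmetric] by (simp add: kc_def)
      then have "(ex (kc k) y * H k y) * (fc \<Phi> l * ex (kc l) y) = fc \<Phi> l * (H k y * ex (kc (\<lambda>i. k i + l i)) y)" for l y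
        by (metis mult.assoc mult.commute)
      then show ?thesis by (simp only: psum_def sum_distrib_left)
    qed
    also have "\<dots> = (\<Sum>l\<in>cube R. fc \<Phi> l * pimean (\<lambda>y. H k y * ex (kc (\<lambda>i. k i + l i)) y))"
      unfolding pimean_cmult[symmetric] by (rule pimean_sum) (intro cont)
    also have "\<dots> = (\<Sum>l\<in>cube R. fc \<Phi> (\<lambda>i. - l i) * smat H l k)"
      by (rule sum.reindex_bij_witness[of _ "\<lambda>l i. - l i" "\<lambda>l i. - l i"])
         (auto simp: cube_minus smat_def fc_def add.commute)
    finally show ?thesis .
  qed
  have "pimean (\<lambda>y. Pu f (x0 + \<rho> *\<^sub>R y) * \<phi> (x0 + \<rho> *\<^sub>R y)) =
    (\<Sum>k\<in>cube R. f k * fc \<Phi> (\<lambda>i. - k i)) + (\<Sum>k\<in>cube R. f k * (\<Sum>l\<in>cube R. fc \<Phi> (\<lambda>i. - l i) * smat H l k)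
      + f k * pimean (\<lambda>y. (ex (kc k) y * H k y) * (\<Phi> y - psum R \<Phi> y)))"
  proof -
    have "pimean (\<lambda>y. Pu f (x0 + \<rho> *\<^sub>R y) * \<phi> (x0 + \<rho> *\<^sub>R y)) =
      pimean (\<lambda>y. \<Sum>k\<in>cube R. f k * (\<Phi> y * ex (kc k) y)) +
      pimean (\<lambda>y. \<Sum>k\<in>cube R. f k * ((ex (kc k) y * H k y) * psum R \<Phi> y) + f k * ((ex (kc k) y * H k y) * (\<Phi> y - psum R \<Phi> y)))"
      unfolding eq by (rule pimean_add) (intro cont)+
    also have "pimean (\<lambda>y. \<Sum>k\<in>cube R. f k * (\<Phi> y * ex (kc k) y)) = (\<Sum>k\<in>cube R. f k * fc \<Phi> (\<lambda>i. - k i))"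
      unfolding 1[symmetric] pimean_cmult[symmetric] by (rule pimean_sum) (intro cont)
    also have "pimean (\<lambda>y. \<Sum>k\<in>cube R. f k * ((ex (kc k) y * H k y) * psum R \<Phi> y) + f k * ((ex (kc k) y * H k y) * (\<Phi> y - psum R \<Phi> y))) =
      (\<Sum>k\<in>cube R. pimean (\<lambda>y. f k * ((ex (kc k) y * H k y) * psum R \<Phi> y) + f k * ((ex (kc k) y * H k y) * (\<Phi> y - psum R \<Phi> y))))"
      by (rule pimean_sum) (intro cont)
    also have "\<dots> = (\<Sum>k\<in>cube R. f k * (\<Sum>l\<in>cube R. fc \<Phi> (\<lambda>i. - l i) * smat H l k)
      + f k * pimean (\<lambda>y. (ex (kc k) y * H k y) * (\<Phi> y - psum R \<Phi> y)))"
      unfolding 2[symmetric] pimean_cmult[symmetric] by (rule sum.cong[OF refl], rule pimean_add) (intro cont)+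
    finally show ?thesis .
  qed
  also have "(\<Sum>k\<in>cube R. f k * (\<Sum>l\<in>cube R. fc \<Phi> (\<lambda>i. - l i) * smat H l k) + f k * pimean (\<lambda>y. (ex (kc k) y * H k y) * (\<Phi> y - psum R \<Phi> y))) =
    (\<Sum>l\<in>cube R. fc \<Phi> (\<lambda>i. - l i) * (\<Sum>k\<in>cube R. smat H l k * f k)) + (\<Sum>k\<in>cube R. f k * pimean (\<lambda>y. (ex (kc k) y * H k y) * (\<Phi> y - psum R \<Phi> y)))"
  proof -
    have "(\<Sum>k\<in>cube R. f k * (\<Sum>l\<in>cube R. fc \<Phi> (\<lambda>i. - l i) * smat H l k)) = (\<Sum>l\<in>cube R. fc \<Phi> (\<lambda>i. - l i) * (\<Sum>k\<in>cube R. smat H l k * f k))"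
      unfolding sum_distrib_left by (subst sum.swap) (simp add: mult_ac)
    then show ?thesis by (simp add: sum.distrib)
  qed
  finally show ?thesis by (simp add: distrib_left sum.distrib mult_ac add.assoc)
qed

end

section \<open>Truncation errors and bounds for the solution\<close>

lemma dbound_nonneg: "dbound K j f B \<Longrightarrow> x \<in> K \<Longrightarrow> 0 \<le> B"
  using dboundD0 norm_ge_zero order_trans by blast

lemma wt_powr_neg: "wt l powr - real s = 1 / wt l ^ s"
  using wt_pos[of l] by (simp add: powr_minus powr_realpow divide_inverse)

lemma wt_powr_nat: "wt l powr real s = wt l ^ s"
  using wt_pos[of l] by (simp add: powr_realpow)

text \<open>Brings the Neumann residual 2^(-R) to the scale 1/(R+1) of the Fourier
  truncation.\<close>

lemma two_power_ge: "real R + 1 \<le> 2 ^ R"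
proof -
  have "Suc R \<le> 2 ^ R" by (rule Suc_leI) (rule less_exp)
  then have "real (Suc R) \<le> real (2 ^ R)" by (simp only: of_nat_le_iff)
  then show ?thesis by simp
qed

lemma sum_wt_decay:
  fixes K :: "('n::finite \<Rightarrow> int) set"
  assumes "finite K" "0 \<le> D" "\<And>k. k \<in> K \<Longrightarrow> g k \<le> D / wt k ^ (CARD('n) + 1)"
  shows "(\<Sum>k\<in>K. g k) \<le> D * latC TYPE('n)"
proof -
  have "(\<Sum>k\<in>K. g k) \<le> (\<Sum>k\<in>K. D * (1 / wt k ^ (CARD('n) + 1)))" by (rule sum_mono) (use assms(3) in simp)
  also have "\<dots> \<le> D * latC TYPE('n)" unfolding sum_distrib_left[symmetric] by (intro mult_left_mono latC(2) assms)
  finally show ?thesis .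
qed

context scheme begin

definition "funC N = 2 ^ (N + CARD('n) + 1) * latC TYPE('n) + 2 * latC TYPE('n) * fouC TYPE('n) * 2 ^ (N + CARD('n) + 2)"

text \<open>Two errors occur: the residual after R Neumann steps, and the Fourier tail of the test
  function against coefficients that grow like \<open>wt k ^ N\<close>. Summing the latter over the
  cube costs (R+1)^(N+n+1), so a tail of order N+n+2 is needed to keep a factor 1/(R+1). With the
  n+1 derivatives of the tail estimate this makes N+2n+3.\<close>

lemma fun_error:
  assumes \<phi>: "smooth_on UNIV \<phi>" "\<And>x. \<rho> < dist x0 x \<Longrightarrow> \<phi> x = 0"
    and B: "dbound (cball 0 2) (N + 2 * CARD('n) + 3) (\<lambda>y. \<phi> (x0 + \<rho> *\<^sub>R y)) B"
    and row: "\<And>l. (\<Sum>k\<in>cube R. norm (smat H l k) * wt k powr real N) \<le> wt l powr real N / 2"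
    and H1: "\<And>k y. y \<in> cball 0 2 \<Longrightarrow> norm (H k y) \<le> 1"
    and v: "\<And>l. l \<in> cube R \<Longrightarrow> norm (v l) \<le> A * wt l ^ N" "0 \<le> A"
  defines "f \<equiv> neum R H v R"
  shows "norm (pimean (\<lambda>y. \<theta> y * (u f (x0 + \<rho> *\<^sub>R y) * tP \<phi> (x0 + \<rho> *\<^sub>R y))) -
      (\<Sum>l\<in>cube R. fc (\<lambda>y. \<phi> (x0 + \<rho> *\<^sub>R y)) (\<lambda>i. - l i) * v l)) \<le> funC N * A * B / (real R + 1)"
proof -
  define \<Phi> where "\<Phi> y = \<phi> (x0 + \<rho> *\<^sub>R y)" for y
  have s\<Phi>: "smooth_on UNIV \<Phi>" unfolding \<Phi>_def[abs_def] by (rule smooth_on_shift[OF \<phi>(1)])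
  have supp: "supp2 \<Phi>"
  proof (intro allI impI)
    fix y :: "real^'n" assume "y \<notin> cball 0 2"
    then have "\<rho> * 1 < \<rho> * norm y" using \<rho> by (intro mult_strict_left_mono) auto
    then show "\<Phi> y = 0" unfolding \<Phi>_def by (intro \<phi>(2)) (use \<rho> in \<open>simp add: dist_norm\<close>)
  qed
  have d\<Phi>: "dbound (cball 0 2) (N + 2 * CARD('n) + 3) \<Phi> B" using B by (simp add: \<Phi>_def[abs_def])
  have B0: "0 \<le> B" by (rule dbound_nonneg[OF B, of 0]) simp
  have v': "norm (v l) \<le> A * wt l powr real N" if "l \<in> cube R" for l using v(1)[OF that] by (simp add: wt_powr_nat)
  have nb: "norm (neum R H v L l) \<le> 2 * A * wt l powr real N"
    "norm (neum R H v (Suc L) l - neum R H v L l) \<le> A / 2 ^ L * wt l powr real N" if "l \<in> cube R" for l L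
    by (rule neum_bounds[OF row v' v(2) that], assumption)+
  have fb: "norm (f k) \<le> 2 * A * wt k ^ N" if "k \<in> cube R" for k
    using nb(1)[OF that, of R] by (simp add: f_def wt_powr_nat)
  \<comment> \<open>One more Neumann step measures how far f is from solving the truncated
    equation.\<close>
  define res where "res l = f l - neum R H v (Suc R) l" for l
  have rb: "norm (res l) \<le> A / 2 ^ R * wt l ^ N" if "l \<in> cube R" for l
    using nb(2)[OF that, of R] unfolding res_def f_def wt_powr_nat by (simp only: norm_minus_commute)
  have fres: "f l + (\<Sum>k\<in>cube R. smat H l k * f k) = v l + res l" for l by (simp add: res_def f_def)
  define E where "E k = pimean (\<lambda>y. (ex (kc k) y * H k y) * (\<Phi> y - psum R \<Phi> y))" for k
  have "pimean (\<lambda>y. \<theta> y * (u f (x0 + \<rho> *\<^sub>R y) * tP \<phi> (x0 + \<rho> *\<^sub>R y))) =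
    (\<Sum>l\<in>cube R. fc \<Phi> (\<lambda>i. - l i) * (f l + (\<Sum>k\<in>cube R. smat H l k * f k))) + (\<Sum>k\<in>cube R. f k * E k)"
    using pimean_tP[OF \<phi>, where f = f] pimean_Pu[OF \<phi>, where f = f] by (simp only: E_def \<Phi>_def[abs_def])
  then have "pimean (\<lambda>y. \<theta> y * (u f (x0 + \<rho> *\<^sub>R y) * tP \<phi> (x0 + \<rho> *\<^sub>R y))) =
    (\<Sum>l\<in>cube R. fc \<Phi> (\<lambda>i. - l i) * (v l + res l)) + (\<Sum>k\<in>cube R. f k * E k)"
    by (simp only: fres)
  then have "pimean (\<lambda>y. \<theta> y * (u f (x0 + \<rho> *\<^sub>R y) * tP \<phi> (x0 + \<rho> *\<^sub>R y))) - (\<Sum>l\<in>cube R. fc \<Phi> (\<lambda>i. - l i) * v l) =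
    (\<Sum>l\<in>cube R. fc \<Phi> (\<lambda>i. - l i) * res l) + (\<Sum>k\<in>cube R. f k * E k)"
    by (simp add: distrib_left sum.distrib)
  also have "norm \<dots> \<le> (\<Sum>l\<in>cube R. norm (fc \<Phi> (\<lambda>i. - l i) * res l)) + (\<Sum>k\<in>cube R. norm (f k * E k))"
    by (rule order_trans[OF norm_triangle_ineq]) (intro add_mono norm_sum)
  also have "(\<Sum>l\<in>cube R. norm (fc \<Phi> (\<lambda>i. - l i) * res l)) \<le> (2 ^ (N + CARD('n) + 1) * B * A / 2 ^ R) * latC TYPE('n)"
  proof (rule sum_wt_decay[OF finite_cube])
    show "0 \<le> 2 ^ (N + CARD('n) + 1) * B * A / 2 ^ R" using B0 v(2) by simp
    fix l :: "'n \<Rightarrow> int" assume l: "l \<in> cube R"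
    have "norm (fc \<Phi> (\<lambda>i. - l i)) \<le> 2 ^ (N + CARD('n) + 1) * B / wt l ^ (N + CARD('n) + 1)"
    proof -
      have "dbound (cball 0 2) (N + CARD('n) + 1) \<Phi> B" by (rule dbound_mono[OF d\<Phi>]) auto
      from fc_decay[OF s\<Phi> supp this, of "\<lambda>i. - l i"] show ?thesis by (simp only: wt_minus)
    qed
    then have "norm (fc \<Phi> (\<lambda>i. - l i) * res l) \<le> (2 ^ (N + CARD('n) + 1) * B / wt l ^ (N + CARD('n) + 1)) * (A / 2 ^ R * wt l ^ N)"
      unfolding norm_mult using rb[OF l] B0 wt_pos[of l] by (intro mult_mono) auto
    also have "\<dots> = (2 ^ (N + CARD('n) + 1) * B * A / 2 ^ R) / wt l ^ (CARD('n) + 1)"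
      using wt_pos[of l] by (simp add: power_add field_simps)
    finally show "norm (fc \<Phi> (\<lambda>i. - l i) * res l) \<le> (2 ^ (N + CARD('n) + 1) * B * A / 2 ^ R) / wt l ^ (CARD('n) + 1)" .
  qed
  also have "(2 ^ (N + CARD('n) + 1) * B * A / 2 ^ R) * latC TYPE('n) \<le> 2 ^ (N + CARD('n) + 1) * latC TYPE('n) * A * B / (real R + 1)"
    using divide_left_mono[OF two_power_ge[of R], of "2 ^ (N + CARD('n) + 1) * B * A * latC TYPE('n)"] B0 v(2) latC(1)[where 'n = 'n]
    by (simp add: mult_ac)
  also have "(\<Sum>k\<in>cube R. norm (f k * E k)) \<le> 2 * latC TYPE('n) * fouC TYPE('n) * 2 ^ (N + CARD('n) + 2) * A * B / (real R + 1)"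
  proof -
    define e where "e = fouC TYPE('n) * 2 ^ (N + CARD('n) + 2) * B / (real R + 1) ^ (N + CARD('n) + 2)"
    have e0: "0 \<le> e" using B0 fouC(1)[where 'n = 'n] by (simp add: e_def)
    have "dbound pibox 0 (\<lambda>y. \<Phi> y - psum R \<Phi> y) e"
      unfolding e_def by (rule fouC(2)[OF s\<Phi> supp]) (rule dbound_mono[OF d\<Phi>], auto)
    then have de: "norm (\<Phi> y - psum R \<Phi> y) \<le> e" if "y \<in> pibox" for y using dboundD0 that by blast
    have Eb: "norm (E k) \<le> e" for k
      unfolding E_def
    proof (rule norm_pimean)
      show "continuous_on pibox (\<lambda>y. (ex (kc k) y * H k y) * (\<Phi> y - psum R \<Phi> y))"
        by (intro smooth_continuous_pibox smooth_on_mult smooth_on_ex smooth_H smooth_on_diff s\<Phi> smooth_on_psum open_UNIV)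
      fix y :: "real^'n" assume y: "y \<in> pibox"
      have "norm (H k y) \<le> 1" using H1[of y k] supp2_H[of k] by (cases "y \<in> cball 0 2") auto
      then have "norm (H k y) * norm (\<Phi> y - psum R \<Phi> y) \<le> 1 * e" using de[OF y] by (intro mult_mono) auto
      then show "norm ((ex (kc k) y * H k y) * (\<Phi> y - psum R \<Phi> y)) \<le> e" by (simp add: norm_mult norm_ex_kc)
    qed
    have "(\<Sum>k\<in>cube R. norm (f k * E k)) \<le> (2 * A * e * (real R + 1) ^ (N + CARD('n) + 1)) * latC TYPE('n)"
    proof (rule sum_wt_decay[OF finite_cube])
      show "0 \<le> 2 * A * e * (real R + 1) ^ (N + CARD('n) + 1)" using e0 v(2) by simp
      fix k :: "'n \<Rightarrow> int" assume k: "k \<in> cube R"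
      have "norm (f k * E k) \<le> (2 * A * wt k ^ N) * e"
        unfolding norm_mult using fb[OF k] Eb[of k] v(2) wt_pos[of k] by (intro mult_mono) auto
      \<comment> \<open>Powers of \<open>wt k\<close> are inserted to expose the summable weight;
        the numerator is then estimated by the largest weight in the cube.\<close>
      also have "\<dots> = 2 * A * e * wt k ^ (N + CARD('n) + 1) / wt k ^ (CARD('n) + 1)"
        using wt_pos[of k] by (simp add: power_add)
      also have "\<dots> \<le> 2 * A * e * (real R + 1) ^ (N + CARD('n) + 1) / wt k ^ (CARD('n) + 1)"
        using wt_cube[OF k] wt_pos[of k] e0 v(2) by (intro divide_right_mono mult_left_mono power_mono) auto
      finally show "norm (f k * E k) \<le> 2 * A * e * (real R + 1) ^ (N + CARD('n) + 1) / wt k ^ (CARD('n) + 1)" .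
    qed
    also have "\<dots> = 2 * latC TYPE('n) * fouC TYPE('n) * 2 ^ (N + CARD('n) + 2) * A * B / (real R + 1)"
    proof -
      define X Y where "X = (real R + 1) ^ (N + CARD('n) + 1)" and "Y = real R + 1"
      have XY: "X > 0" "Y > 0" by (auto simp: X_def Y_def)
      have "(real R + 1) ^ (N + CARD('n) + 2) = X * Y" by (simp add: X_def Y_def)
      then have "e = fouC TYPE('n) * 2 ^ (N + CARD('n) + 2) * B / (X * Y)" by (simp only: e_def)
      then have "2 * A * e * X * latC TYPE('n) = 2 * latC TYPE('n) * fouC TYPE('n) * 2 ^ (N + CARD('n) + 2) * A * B / Y"
        using XY by (simp add: field_simps)
      then show ?thesis by (simp only: X_def Y_def)
    qed
    finally show ?thesis .
  qed
  finally show ?thesis by (simp add: funC_def \<Phi>_def[abs_def] add_divide_distrib[symmetric] algebra_simps)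
qed

definition "pairC N = 2 ^ (N + m + CARD('n) + 1) * (2 ^ (N + m + CARD('n) + 1) * (2 ^ (N + m + CARD('n) + 1) * exbd TYPE('n) m T (N + m + CARD('n) + 1) / cl)) * latC TYPE('n)"

text \<open>The number of derivatives of \<psi> is N for the growth of f, plus m for the inverse of
  P_0, whose weight is at least \<open>w / wt k ^ m\<close>, plus n+1 for summation over the
  cube.\<close>

lemma pairing_bound:
  assumes \<psi>: "smooth_on UNIV \<psi>" and B: "dbound (cball 0 2) (N + m + CARD('n) + 1) (\<lambda>y. \<psi> (x0 + \<rho> *\<^sub>R y)) B"
    and f: "\<And>k. k \<in> cube R \<Longrightarrow> norm (f k) \<le> D * wt k ^ N" "0 \<le> D"
    and B\<theta>: "dbound (cball 0 2) (N + m + CARD('n) + 1) \<theta> B\<theta>"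
    and low: "\<And>k. w \<le> wt k ^ m * weight m (p 0) (fr k)" "0 < w"
  shows "norm (pimean (\<lambda>y. \<theta> y * (u f (x0 + \<rho> *\<^sub>R y) * \<psi> (x0 + \<rho> *\<^sub>R y)))) \<le> pairC N * B\<theta> * D / w * B"
proof -
  define q where "q = N + m + CARD('n) + 1"
  define \<Psi> where "\<Psi> y = \<psi> (x0 + \<rho> *\<^sub>R y)" for y
  have s\<Psi>: "smooth_on UNIV \<Psi>" unfolding \<Psi>_def[abs_def] by (rule smooth_on_shift[OF \<psi>])
  have B0: "0 \<le> B" "0 \<le> B\<theta>" by (rule dbound_nonneg[OF B, of 0], simp, rule dbound_nonneg[OF B\<theta>, of 0], simp)
  define g where "g k y = \<theta> y * W k y * \<Psi> y" for k y
  have sg: "smooth_on UNIV (g k)" for k unfolding g_def[abs_def] by (intro smooth_on_mult \<theta> smooth_W s\<Psi> open_UNIV)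
  have supp: "supp2 (g k)" for k using \<theta>(2) by (simp add: g_def)
  have x0: "exbd TYPE('n) m T q > 0" by (rule exbd_pos)
  have dg: "dbound (cball 0 2) q (g k) (2 ^ q * (2 ^ q * B\<theta> * (exbd TYPE('n) m T q / (cl * weight m (p 0) (fr k)))) * B)" for k
    unfolding g_def[abs_def]
    by (intro dbound_mult[OF open_UNIV subset_UNIV] smooth_on_mult \<theta> smooth_W s\<Psi> open_UNIV dbound_W B\<theta>[folded q_def]
        B[folded q_def \<Psi>_def[abs_def]])
  have "pimean (\<lambda>y. \<theta> y * (u f (x0 + \<rho> *\<^sub>R y) * \<psi> (x0 + \<rho> *\<^sub>R y))) = pimean (\<lambda>y. \<Sum>k\<in>cube R. f k * (g k y * ex (kc k) y))"
    by (simp add: U_eq_u U_def g_def \<Psi>_def sum_distrib_left sum_distrib_right mult_ac)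
  also have "\<dots> = (\<Sum>k\<in>cube R. f k * fc (g k) (\<lambda>i. - k i))"
    unfolding fc_def pimean_cmult[symmetric] minus_minus
    by (rule pimean_sum) (intro smooth_continuous_pibox smooth_on_mult smooth_on_const sg smooth_on_ex open_UNIV)
  also have "norm \<dots> \<le> (\<Sum>k\<in>cube R. norm (f k * fc (g k) (\<lambda>i. - k i)))" by (rule norm_sum)
  also have "\<dots> \<le> (D * (2 ^ q * (2 ^ q * (2 ^ q * B\<theta> * exbd TYPE('n) m T q / cl / w) * B))) * latC TYPE('n)"
  proof (rule sum_wt_decay[OF finite_cube])
    show "0 \<le> D * (2 ^ q * (2 ^ q * (2 ^ q * B\<theta> * exbd TYPE('n) m T q / cl / w) * B))"
      using f(2) B0 x0 cl low(2) by simp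
    fix k :: "'n \<Rightarrow> int" assume k: "k \<in> cube R"
    have wp: "0 < weight m (p 0) (fr k)" by (rule pos)
    have inv: "1 / weight m (p 0) (fr k) \<le> wt k ^ m / w" using low(1)[of k] low(2) wp by (simp add: field_simps)
    have "norm (fc (g k) (\<lambda>i. - k i)) \<le> 2 ^ q * (2 ^ q * (2 ^ q * B\<theta> * (exbd TYPE('n) m T q / (cl * weight m (p 0) (fr k)))) * B) / wt k ^ q"
      using fc_decay[OF sg supp dg, of k "\<lambda>i. - k i"] by (simp only: wt_minus)
    also have "\<dots> = (2 ^ q * (2 ^ q * (2 ^ q * B\<theta> * exbd TYPE('n) m T q / cl) * B) / wt k ^ q) * (1 / weight m (p 0) (fr k))" by simp
    also have "\<dots> \<le> (2 ^ q * (2 ^ q * (2 ^ q * B\<theta> * exbd TYPE('n) m T q / cl) * B) / wt k ^ q) * (wt k ^ m / w)"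
      by (rule mult_left_mono[OF inv]) (use B0 x0 cl wt_pos[of k] in simp)
    finally have "norm (f k * fc (g k) (\<lambda>i. - k i)) \<le> (D * wt k ^ N) * ((2 ^ q * (2 ^ q * (2 ^ q * B\<theta> * exbd TYPE('n) m T q / cl) * B) / wt k ^ q) * (wt k ^ m / w))"
      unfolding norm_mult using f(1)[OF k] f(2) wt_pos[of k] by (intro mult_mono) auto
    also have "\<dots> = (D * (2 ^ q * (2 ^ q * (2 ^ q * B\<theta> * exbd TYPE('n) m T q / cl / w) * B))) * (wt k ^ N * wt k ^ m / wt k ^ q)" by (simp add: mult_ac)
    also have "wt k ^ N * wt k ^ m / wt k ^ q = 1 / wt k ^ (CARD('n) + 1)"
      using wt_pos[of k] by (simp add: q_def power_add)
    finally show "norm (f k * fc (g k) (\<lambda>i. - k i)) \<le> (D * (2 ^ q * (2 ^ q * (2 ^ q * B\<theta> * exbd TYPE('n) m T q / cl / w) * B))) / wt k ^ (CARD('n) + 1)" by simp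
  qed
  also have "\<dots> = pairC N * B\<theta> * D / w * B" by (simp add: pairC_def q_def)
  finally show ?thesis .
qed

text \<open>Here the decay of f pays: i powers for the derivatives, m for the inverse of P_0 and n+1
  for summation.\<close>

lemma U_bound:
  assumes f: "\<And>k. k \<in> cube R \<Longrightarrow> norm (f k) \<le> D / wt k ^ (i + m + CARD('n) + 1)" "0 \<le> D"
    and low: "\<And>k. w \<le> wt k ^ m * weight m (p 0) (fr k)" "0 < w"
  shows "dbound (cball 0 2) i (U f) (D * (2 ^ i * exbd TYPE('n) m T i / cl / w) * latC TYPE('n))"
proof -
  have x0: "exbd TYPE('n) m T i > 0" by (rule exbd_pos)
  have "dbound (cball 0 2) i (U f) (\<Sum>k\<in>cube R. norm (f k) * (2 ^ i * wt k ^ i * (exbd TYPE('n) m T i / (cl * weight m (p 0) (fr k)))))"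
    unfolding U_def[abs_def]
    by (intro dbound_sum[OF open_UNIV subset_UNIV] smooth_on_mult smooth_on_const smooth_on_ex smooth_W open_UNIV
        dbound_cmult[OF open_UNIV subset_UNIV _ _ order_refl] dbound_mult[OF open_UNIV subset_UNIV] dbound_ex_kc dbound_W)
  moreover have "(\<Sum>k\<in>cube R. norm (f k) * (2 ^ i * wt k ^ i * (exbd TYPE('n) m T i / (cl * weight m (p 0) (fr k))))) \<le>
      (D * (2 ^ i * exbd TYPE('n) m T i / cl / w)) * latC TYPE('n)"
  proof (rule sum_wt_decay[OF finite_cube])
    show "0 \<le> D * (2 ^ i * exbd TYPE('n) m T i / cl / w)" using f(2) x0 cl low(2) by simp
    fix k :: "'n \<Rightarrow> int" assume k: "k \<in> cube R"
    have wp: "0 < weight m (p 0) (fr k)" by (rule pos)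
    have inv: "1 / weight m (p 0) (fr k) \<le> wt k ^ m / w" using low(1)[of k] low(2) wp by (simp add: field_simps)
    have "2 ^ i * wt k ^ i * (exbd TYPE('n) m T i / (cl * weight m (p 0) (fr k))) = (2 ^ i * wt k ^ i * exbd TYPE('n) m T i / cl) * (1 / weight m (p 0) (fr k))" by simp
    also have "\<dots> \<le> (2 ^ i * wt k ^ i * exbd TYPE('n) m T i / cl) * (wt k ^ m / w)"
      by (rule mult_left_mono[OF inv]) (use x0 cl wt_pos[of k] in simp)
    finally have "norm (f k) * (2 ^ i * wt k ^ i * (exbd TYPE('n) m T i / (cl * weight m (p 0) (fr k)))) \<le>
        (D / wt k ^ (i + m + CARD('n) + 1)) * ((2 ^ i * wt k ^ i * exbd TYPE('n) m T i / cl) * (wt k ^ m / w))"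
      by (rule mult_mono[OF f(1)[OF k]]) (use f(2) x0 cl wp wt_pos[of k] in simp_all)
    also have "\<dots> = (D * (2 ^ i * exbd TYPE('n) m T i / cl / w)) * (wt k ^ i * wt k ^ m / wt k ^ (i + m + CARD('n) + 1))" by (simp add: mult_ac)
    also have "wt k ^ i * wt k ^ m / wt k ^ (i + m + CARD('n) + 1) = 1 / wt k ^ (CARD('n) + 1)"
      using wt_pos[of k] by (simp add: power_add)
    finally show "norm (f k) * (2 ^ i * wt k ^ i * (exbd TYPE('n) m T i / (cl * weight m (p 0) (fr k)))) \<le>
      (D * (2 ^ i * exbd TYPE('n) m T i / cl / w)) / wt k ^ (CARD('n) + 1)" by simp
  qed
  ultimately show ?thesis by (rule dbound_mono[OF _ order_refl order_refl])
qed

definition "smoothC j = (let s = j + 2 * CARD('n) + 3 in 2 ^ s * latC TYPE('n) + 2 * fouC TYPE('n) +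
  2 * fouC TYPE('n) * (2 * 2 ^ s * 2 ^ (j + CARD('n) + 2) * latC TYPE('n)))"

text \<open>The coefficients f decay to order s = j+2n+3. The sum G of the f_k e_k H_k is then
  bounded in C^(j+n+2), since n+1 powers go into summation, and j+n+2 derivatives are what a C^j
  estimate of its Fourier tail with rate 1/(R+1) requires.\<close>

lemma smooth_error:
  assumes V: "smooth_on UNIV V" "supp2 V" and B: "dbound (cball 0 2) (j + 2 * CARD('n) + 3) V B"
    and row: "\<And>l. (\<Sum>k\<in>cube R. norm (smat H l k) * wt k powr - real (j + 2 * CARD('n) + 3)) \<le> wt l powr - real (j + 2 * CARD('n) + 3) / 2"
    and H1: "\<And>k. dbound (cball 0 2) (j + CARD('n) + 2) (H k) 1"
  defines "f \<equiv> neum R H (fc V) R"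
  shows "dbound (ball 0 1) j (\<lambda>y. Pu f (x0 + \<rho> *\<^sub>R y) - V y) (smoothC j * B / (real R + 1))"
proof -
  define s where "s = j + 2 * CARD('n) + 3"
  define A where "A = 2 ^ s * B"
  have B0: "0 \<le> B" by (rule dbound_nonneg[OF B, of 0]) simp
  have A0: "0 \<le> A" using B0 by (simp add: A_def)
  have v: "norm (fc V l) \<le> A * wt l powr - real s" for l
    using fc_decay[OF V B[folded s_def], of l] by (simp add: wt_powr_neg A_def)
  note nb = neum_bounds[OF row[folded s_def] v A0]
  have fb: "norm (f k) \<le> 2 * A / wt k ^ s" if "k \<in> cube R" for k
    using nb(1)[OF that, of R] by (simp add: f_def wt_powr_neg)
  define res where "res l = f l - neum R H (fc V) (Suc R) l" for l
  have rb: "norm (res l) \<le> A / 2 ^ R / wt l ^ s" if "l \<in> cube R" for l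
    using nb(2)[OF that, of R] unfolding res_def f_def wt_powr_neg by (simp only: norm_minus_commute mult_1_right times_divide_eq_right)
  define G where "G y = (\<Sum>k\<in>cube R. f k * (ex (kc k) y * H k y))" for y
  have sG: "smooth_on UNIV G" unfolding G_def[abs_def]
    by (intro smooth_on_sum smooth_on_mult smooth_on_const smooth_on_ex smooth_H open_UNIV)
  have suppG: "supp2 G" using supp2_H by (auto simp: G_def)
  \<comment> \<open>The Fourier coefficients of G are S f, which turns the iteration on the lattice
    into a statement about functions.\<close>
  have fcG: "fc G l = (\<Sum>k\<in>cube R. smat H l k * f k)" for l
  proof -
    have "ex (kc k) y * ex (kc (\<lambda>i. - l i)) y = ex (kc (\<lambda>i. - (l i - k i))) y" for k y
      unfolding ex_add[symmetric] by (simp add: kc_def)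
    then have "G y * ex (kc (\<lambda>i. - l i)) y = (\<Sum>k\<in>cube R. f k * (H k y * ex (kc (\<lambda>i. - (l i - k i))) y))" for y
      unfolding G_def sum_distrib_right by (intro sum.cong refl) (metis mult.assoc mult.commute)
    then have "fc G l = (\<Sum>k\<in>cube R. f k * fc (H k) (\<lambda>i. l i - k i))"
      unfolding fc_def pimean_cmult[symmetric]
      by (simp only:) (rule pimean_sum, intro smooth_continuous_pibox smooth_on_mult smooth_on_const smooth_H smooth_on_ex open_UNIV)
    then show ?thesis by (simp add: smat_def mult.commute)
  qed
  have dG: "dbound (cball 0 2) (j + CARD('n) + 2) G (2 * A * 2 ^ (j + CARD('n) + 2) * latC TYPE('n))"
  proof -
    have "dbound (cball 0 2) (j + CARD('n) + 2) G (\<Sum>k\<in>cube R. norm (f k) * (2 ^ (j + CARD('n) + 2) * wt k ^ (j + CARD('n) + 2) * 1))"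
      unfolding G_def[abs_def]
      by (intro dbound_sum[OF open_UNIV subset_UNIV] smooth_on_mult smooth_on_const smooth_on_ex smooth_H open_UNIV
        dbound_cmult[OF open_UNIV subset_UNIV _ _ order_refl] dbound_mult[OF open_UNIV subset_UNIV] dbound_ex_kc H1)
    moreover have "(\<Sum>k\<in>cube R. norm (f k) * (2 ^ (j + CARD('n) + 2) * wt k ^ (j + CARD('n) + 2) * 1)) \<le> (2 * A * 2 ^ (j + CARD('n) + 2)) * latC TYPE('n)"
    proof (rule sum_wt_decay[OF finite_cube])
      fix k :: "'n \<Rightarrow> int" assume k: "k \<in> cube R"
      have "norm (f k) * (2 ^ (j + CARD('n) + 2) * wt k ^ (j + CARD('n) + 2) * 1) \<le> (2 * A / wt k ^ s) * (2 ^ (j + CARD('n) + 2) * wt k ^ (j + CARD('n) + 2) * 1)"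
        by (rule mult_right_mono[OF fb[OF k]]) (use wt_pos[of k] in simp)
      also have "\<dots> = (2 * A * 2 ^ (j + CARD('n) + 2)) * (wt k ^ (j + CARD('n) + 2) / wt k ^ s)" by simp
      also have "wt k ^ (j + CARD('n) + 2) / wt k ^ s = 1 / wt k ^ (CARD('n) + 1)"
      proof -
        have "s = (j + CARD('n) + 2) + (CARD('n) + 1)" by (simp add: s_def)
        then have "wt k ^ s = wt k ^ (j + CARD('n) + 2) * wt k ^ (CARD('n) + 1)" by (simp only: power_add)
        then show ?thesis using wt_pos[of k] by simp
      qed
      finally show "norm (f k) * (2 ^ (j + CARD('n) + 2) * wt k ^ (j + CARD('n) + 2) * 1) \<le> (2 * A * 2 ^ (j + CARD('n) + 2)) / wt k ^ (CARD('n) + 1)" by simp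
    qed (use A0 in simp)
    ultimately show ?thesis by (rule dbound_mono[OF _ order_refl order_refl])
  qed
  define E where "E y = (\<Sum>l\<in>cube R. res l * ex (kc l) y)" for y
  have sE: "smooth_on UNIV E" unfolding E_def[abs_def] by (intro smooth_on_sum smooth_on_mult smooth_on_const smooth_on_ex open_UNIV)
  have dE: "dbound pibox j E (2 ^ s * latC TYPE('n) * B / (real R + 1))"
  proof -
    have d1: "dbound pibox j E (\<Sum>l\<in>cube R. norm (res l) * wt l ^ j)"
      unfolding E_def[abs_def]
      by (intro dbound_sum[OF open_UNIV subset_UNIV] smooth_on_mult smooth_on_const smooth_on_ex open_UNIV
        dbound_cmult[OF open_UNIV subset_UNIV _ _ order_refl] dbound_ex_kc)
    have "(\<Sum>l\<in>cube R. norm (res l) * wt l ^ j) \<le> (A / 2 ^ R) * latC TYPE('n)"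
    proof (rule sum_wt_decay[OF finite_cube])
      fix l :: "'n \<Rightarrow> int" assume l: "l \<in> cube R"
      have "norm (res l) * wt l ^ j \<le> (A / 2 ^ R / wt l ^ s) * wt l ^ j"
        by (rule mult_right_mono[OF rb[OF l]]) (use wt_pos[of l] in simp)
      also have "\<dots> = (A / 2 ^ R) * (wt l ^ j / wt l ^ s)" by simp
      also have "\<dots> \<le> (A / 2 ^ R) * (1 / wt l ^ (CARD('n) + 1))"
      proof (rule mult_left_mono)
        have "s = j + (2 * CARD('n) + 3)" by (simp add: s_def)
        then have "wt l ^ s = wt l ^ j * wt l ^ (2 * CARD('n) + 3)" by (simp only: power_add)
        then have "wt l ^ j / wt l ^ s = 1 / wt l ^ (2 * CARD('n) + 3)" using wt_pos[of l] by simp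
        also have "\<dots> \<le> 1 / wt l ^ (CARD('n) + 1)"
          using wt_pos[of l] wt_ge_1[of l] by (intro divide_left_mono power_increasing mult_pos_pos) auto
        finally show "wt l ^ j / wt l ^ s \<le> 1 / wt l ^ (CARD('n) + 1)" .
      qed (use A0 in simp)
      finally show "norm (res l) * wt l ^ j \<le> (A / 2 ^ R) / wt l ^ (CARD('n) + 1)" by simp
    qed (use A0 in simp)
    also have "(A / 2 ^ R) * latC TYPE('n) \<le> 2 ^ s * latC TYPE('n) * B / (real R + 1)"
      using divide_left_mono[OF two_power_ge[of R], of "A * latC TYPE('n)"] A0 B0 latC(1)[where 'n = 'n]
      by (simp add: A_def mult_ac)
    finally show ?thesis by (rule dbound_mono[OF d1 order_refl order_refl])
  qed
  have dV: "dbound pibox j (\<lambda>y. V y - psum R V y) (2 * fouC TYPE('n) * B / (real R + 1))"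
  proof -
    have "dbound (cball 0 2) (j + 1 + CARD('n) + 1) V B" by (rule dbound_mono[OF B]) auto
    from fouC(2)[OF V this, of R] show ?thesis by (simp add: mult_ac)
  qed
  have dG': "dbound pibox j (\<lambda>y. G y - psum R G y) (2 * fouC TYPE('n) * (2 * 2 ^ s * 2 ^ (j + CARD('n) + 2) * latC TYPE('n)) * B / (real R + 1))"
  proof -
    have "dbound (cball 0 2) (j + 1 + CARD('n) + 1) G (2 * A * 2 ^ (j + CARD('n) + 2) * latC TYPE('n))"
      using dG by simp
    from fouC(2)[OF sG suppG this, of R] show ?thesis by (simp add: A_def mult_ac)
  qed
  have "dbound pibox j (\<lambda>y. E y - (V y - psum R V y) + (G y - psum R G y)) (2 ^ s * latC TYPE('n) * B / (real R + 1) + 2 * fouC TYPE('n) * B / (real R + 1)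
     + 2 * fouC TYPE('n) * (2 * 2 ^ s * 2 ^ (j + CARD('n) + 2) * latC TYPE('n)) * B / (real R + 1))"
    by (intro dbound_add[OF open_UNIV subset_UNIV] dbound_diff[OF open_UNIV subset_UNIV] dE dV dG' smooth_on_diff sE V sG smooth_on_psum open_UNIV)
  then have "dbound (ball 0 1) j (\<lambda>y. E y - (V y - psum R V y) + (G y - psum R G y)) (smoothC j * B / (real R + 1))"
  proof (rule dbound_mono)
    show "ball 0 1 \<subseteq> (pibox :: (real^'n) set)" using cball_subset_pibox by (rule order_trans[rotated]) auto
    show "2 ^ s * latC TYPE('n) * B / (real R + 1) + 2 * fouC TYPE('n) * B / (real R + 1)
     + 2 * fouC TYPE('n) * (2 * 2 ^ s * 2 ^ (j + CARD('n) + 2) * latC TYPE('n)) * B / (real R + 1) \<le> smoothC j * B / (real R + 1)"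
      unfolding smoothC_def Let_def s_def[symmetric] by (simp add: distrib_right add_divide_distrib)
  qed simp
  then show ?thesis
  proof (rule dbound_cong[OF open_ball order_refl, rotated])
    fix y :: "real^'n" assume "y \<in> ball 0 1"
    then have "Pu f (x0 + \<rho> *\<^sub>R y) = (\<Sum>k\<in>cube R. f k * ex (kc k) y) + G y"
      by (subst Pu_H) (auto simp: G_def)
    \<comment> \<open>Inside the cube the equation for the Fourier coefficients holds up to
      \<open>res\<close>; outside it nothing has been solved, and the tails of V and G remain as
      errors.\<close>
    moreover have "(\<Sum>k\<in>cube R. f k * ex (kc k) y) + psum R G y = psum R V y + E y"
    proof -
      have "f l + fc G l = fc V l + res l" for l by (simp add: res_def f_def fcG)
      then have "(\<Sum>l\<in>cube R. (f l + fc G l) * ex (kc l) y) = (\<Sum>l\<in>cube R. (fc V l + res l) * ex (kc l) y)" by simp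
      then show ?thesis by (simp add: psum_def E_def distrib_right sum.distrib)
    qed
    ultimately show "Pu f (x0 + \<rho> *\<^sub>R y) - V y = E y - (V y - psum R V y) + (G y - psum R G y)" by (simp add: algebra_simps)
  qed
qed

end

section \<open>Moderate and negligible nets\<close>

lemma eventually_inverse_ge: "\<forall>\<^sub>F \<epsilon> in at_right (0::real). c \<le> inverse \<epsilon>"
proof -
  have "\<forall>\<^sub>F \<epsilon> in at_right (0::real). 0 < \<epsilon> \<and> \<epsilon> < 1 / (\<bar>c\<bar> + 1)"
    unfolding eventually_at_right_field by (intro exI[of _ "1 / (\<bar>c\<bar> + 1)"]) auto
  then show ?thesis
  proof eventually_elim
    case (elim \<epsilon>)
    then have "(\<bar>c\<bar> + 1) * \<epsilon> < 1" by (simp add: field_simps)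
    then have "\<bar>c\<bar> * \<epsilon> < 1" using elim by (simp add: algebra_simps)
    moreover have "c * \<epsilon> \<le> \<bar>c\<bar> * \<epsilon>" using elim by (intro mult_right_mono) auto
    ultimately have "c * \<epsilon> < 1" by linarith
    then show ?case using elim by (simp add: field_simps)
  qed
qed

text \<open>One more power of 1/\<epsilon> absorbs the constant of the Landau symbol. Together with
  \<open>negligible_iff_ev\<close> this frees later estimates from such constants.\<close>

lemma moderate_iff_ev:
  "moderate (u :: real \<Rightarrow> 'a::real_normed_field) \<longleftrightarrow> (\<exists>N::nat. \<forall>\<^sub>F \<epsilon> in at_right 0. norm (u \<epsilon>) \<le> inverse (\<epsilon> ^ N))"
proof
  assume "moderate u"
  then obtain N :: nat where "u \<in> O[at_right 0](\<lambda>\<epsilon>. of_real (inverse (\<epsilon> ^ N)))" unfolding moderate_iff by blast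
  then obtain c where c: "\<forall>\<^sub>F \<epsilon> in at_right 0. norm (u \<epsilon>) \<le> c * norm (of_real (inverse (\<epsilon> ^ N)) :: 'a)" by (rule landau_o.bigE)
  have "\<forall>\<^sub>F \<epsilon> in at_right 0. norm (u \<epsilon>) \<le> inverse (\<epsilon> ^ Suc N)"
    using c eventually_small eventually_inverse_ge[of c]
  proof eventually_elim
    case (elim \<epsilon>)
    have "norm (u \<epsilon>) \<le> c * inverse (\<epsilon> ^ N)" using elim by (simp add: norm_inverse norm_power)
    also have "\<dots> \<le> inverse \<epsilon> * inverse (\<epsilon> ^ N)" using elim by (intro mult_right_mono) auto
    finally show ?case by (simp add: mult.commute)
  qed
  then show "\<exists>N::nat. \<forall>\<^sub>F \<epsilon> in at_right 0. norm (u \<epsilon>) \<le> inverse (\<epsilon> ^ N)" by blast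
next
  assume "\<exists>N::nat. \<forall>\<^sub>F \<epsilon> in at_right 0. norm (u \<epsilon>) \<le> inverse (\<epsilon> ^ N)"
  then obtain N :: nat where N: "\<forall>\<^sub>F \<epsilon> in at_right 0. norm (u \<epsilon>) \<le> inverse (\<epsilon> ^ N)" by blast
  have "\<forall>\<^sub>F \<epsilon> in at_right 0. norm (u \<epsilon>) \<le> 1 * norm (of_real (inverse (\<epsilon> ^ N)) :: 'a)"
    using N eventually_small by eventually_elim (simp add: norm_inverse norm_power)
  then show "moderate u" unfolding moderate_iff by (intro exI[of _ N] bigoI)
qed

lemma negligible_iff_ev:
  "negligible_net (u :: real \<Rightarrow> 'a::real_normed_field) \<longleftrightarrow> (\<forall>q::nat. \<forall>\<^sub>F \<epsilon> in at_right 0. norm (u \<epsilon>) \<le> \<epsilon> ^ q)"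
proof
  assume n: "negligible_net u"
  show "\<forall>q::nat. \<forall>\<^sub>F \<epsilon> in at_right 0. norm (u \<epsilon>) \<le> \<epsilon> ^ q"
  proof
    fix q :: nat
    have "u \<in> O[at_right 0](\<lambda>\<epsilon>. of_real (\<epsilon> ^ Suc q))" using n unfolding negligible_iff by blast
    then obtain c where c: "\<forall>\<^sub>F \<epsilon> in at_right 0. norm (u \<epsilon>) \<le> c * norm (of_real (\<epsilon> ^ Suc q) :: 'a)" by (rule landau_o.bigE)
    show "\<forall>\<^sub>F \<epsilon> in at_right 0. norm (u \<epsilon>) \<le> \<epsilon> ^ q"
      using c eventually_small eventually_inverse_ge[of c]
    proof eventually_elim
      case (elim \<epsilon>)
      have "norm (u \<epsilon>) \<le> c * (\<epsilon> * \<epsilon> ^ q)" using elim by (simp add: norm_power norm_mult)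
      also have "\<dots> = (c * \<epsilon>) * \<epsilon> ^ q" by simp
      also have "\<dots> \<le> 1 * \<epsilon> ^ q" using elim by (intro mult_right_mono) (auto simp: field_simps)
      finally show ?case by simp
    qed
  qed
next
  assume *: "\<forall>q::nat. \<forall>\<^sub>F \<epsilon> in at_right 0. norm (u \<epsilon>) \<le> \<epsilon> ^ q"
  show "negligible_net u" unfolding negligible_iff
  proof
    fix q :: nat
    have "\<forall>\<^sub>F \<epsilon> in at_right 0. norm (u \<epsilon>) \<le> 1 * norm (of_real (\<epsilon> ^ q) :: 'a)"
      using *[rule_format, of q] eventually_small by eventually_elim (simp add: norm_power)
    then show "u \<in> O[at_right 0](\<lambda>\<epsilon>. of_real (\<epsilon> ^ q))" by (rule bigoI)
  qed
qed

lemma moderate_dom: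
  fixes u :: "real \<Rightarrow> 'a::real_normed_field" and l :: "real \<Rightarrow> 'b::real_normed_field"
  assumes "moderate l" "\<forall>\<^sub>F \<epsilon> in at_right 0. norm (u \<epsilon>) \<le> norm (l \<epsilon>)"
  shows "moderate u"
proof -
  obtain N :: nat where N: "\<forall>\<^sub>F \<epsilon> in at_right 0. norm (l \<epsilon>) \<le> inverse (\<epsilon> ^ N)" using assms(1) unfolding moderate_iff_ev by blast
  have "\<forall>\<^sub>F \<epsilon> in at_right 0. norm (u \<epsilon>) \<le> inverse (\<epsilon> ^ N)" using N assms(2) by eventually_elim linarith
  then show ?thesis unfolding moderate_iff_ev by blast
qed

lemma negligible_dom:
  fixes u :: "real \<Rightarrow> 'a::real_normed_field" and l :: "real \<Rightarrow> 'b::real_normed_field"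
  assumes "negligible_net l" "\<forall>\<^sub>F \<epsilon> in at_right 0. norm (u \<epsilon>) \<le> norm (l \<epsilon>)"
  shows "negligible_net u"
  unfolding negligible_iff_ev
proof
  fix q :: nat
  have N: "\<forall>\<^sub>F \<epsilon> in at_right 0. norm (l \<epsilon>) \<le> \<epsilon> ^ q" using assms(1) unfolding negligible_iff_ev by blast
  show "\<forall>\<^sub>F \<epsilon> in at_right 0. norm (u \<epsilon>) \<le> \<epsilon> ^ q" using N assms(2) by eventually_elim linarith
qed

lemma moderate_norm: "moderate u \<Longrightarrow> moderate (\<lambda>\<epsilon>. norm (u \<epsilon>))"
  by (rule moderate_dom) auto

lemma negligible_norm: "negligible_net u \<Longrightarrow> negligible_net (\<lambda>\<epsilon>. norm (u \<epsilon>))"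
  by (rule negligible_dom) auto

lemma moderate_sum: "(\<And>i. i \<in> I \<Longrightarrow> moderate (f i)) \<Longrightarrow> moderate (\<lambda>\<epsilon>. \<Sum>i\<in>I. f i \<epsilon>)"
  by (induction I rule: infinite_finite_induct) (auto intro: moderate_const moderate_add)

lemma negligible_sum: "(\<And>i. i \<in> I \<Longrightarrow> negligible_net (f i)) \<Longrightarrow> negligible_net (\<lambda>\<epsilon>. \<Sum>i\<in>I. f i \<epsilon>)"
  by (induction I rule: infinite_finite_induct) (auto intro: negligible_zero negligible_add)

lemma negligible_imp_moderate: "negligible_net u \<Longrightarrow> moderate u"
  unfolding negligible_iff_ev moderate_iff_ev
  by (rule exI[of _ 0]) (drule spec[of _ 0], simp)

section \<open>Nets of smooth functions\<close>

text \<open>Moderateness with an arbitrary moderate majorant in place of the seminorm itself, a form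
  that fits the rules for \<open>dbound\<close>. On open sets it is equivalent by
  \<open>mnet_iff\<close>; \<open>nnet\<close> is the negligible counterpart.\<close>

definition mnet :: "(real^'n::finite) set \<Rightarrow> 'n fnet \<Rightarrow> bool" where
  "mnet \<Omega> u \<longleftrightarrow> (\<forall>\<epsilon>\<in>{0<..1}. smooth_on \<Omega> (u \<epsilon>)) \<and> (\<forall>K j. compact K \<longrightarrow> K \<subseteq> \<Omega> \<longrightarrow>
    (\<exists>l :: real \<Rightarrow> real. moderate l \<and> (\<forall>\<^sub>F \<epsilon> in at_right 0. dbound K j (u \<epsilon>) (l \<epsilon>))))"

definition nnet :: "(real^'n::finite) set \<Rightarrow> 'n fnet \<Rightarrow> bool" where
  "nnet \<Omega> u \<longleftrightarrow> (\<forall>\<epsilon>\<in>{0<..1}. smooth_on \<Omega> (u \<epsilon>)) \<and> (\<forall>K j. compact K \<longrightarrow> K \<subseteq> \<Omega> \<longrightarrow>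
    (\<exists>l :: real \<Rightarrow> real. negligible_net l \<and> (\<forall>\<^sub>F \<epsilon> in at_right 0. dbound K j (u \<epsilon>) (l \<epsilon>))))"

lemma ball_smooth_seminorms:
  "(\<forall>p\<in>smooth_seminorms \<Omega>. \<Phi> p) \<longleftrightarrow> (\<forall>K j. compact K \<longrightarrow> K \<subseteq> \<Omega> \<longrightarrow> \<Phi> (sup_seminorm K j))"
  unfolding smooth_seminorms_def by blast

lemma mnet_iff:
  assumes "open \<Omega>"
  shows "u \<in> moderate_nets (smooth_functions \<Omega>) (smooth_seminorms \<Omega>) \<longleftrightarrow> mnet \<Omega> u"
proof -
  have 1: "(\<forall>p\<in>smooth_seminorms \<Omega>. \<exists>N::nat. (\<lambda>\<epsilon>. p (u \<epsilon>)) \<in> O[at_right 0](\<lambda>\<epsilon>. inverse (\<epsilon> ^ N))) \<longleftrightarrow>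
    (\<forall>K j. compact K \<longrightarrow> K \<subseteq> \<Omega> \<longrightarrow> moderate (\<lambda>\<epsilon>. sup_seminorm K j (u \<epsilon>)))"
    unfolding ball_smooth_seminorms moderate_iff by simp
  have 2: "moderate (\<lambda>\<epsilon>. sup_seminorm K j (u \<epsilon>)) \<longleftrightarrow> (\<exists>l :: real \<Rightarrow> real. moderate l \<and> (\<forall>\<^sub>F \<epsilon> in at_right 0. dbound K j (u \<epsilon>) (l \<epsilon>)))"
    if u: "\<forall>\<epsilon>\<in>{0<..1}. smooth_on \<Omega> (u \<epsilon>)" and K: "compact K" "K \<subseteq> \<Omega>" for K j
  proof
    assume "moderate (\<lambda>\<epsilon>. sup_seminorm K j (u \<epsilon>))"
    moreover have "\<forall>\<^sub>F \<epsilon> in at_right 0. dbound K j (u \<epsilon>) (sup_seminorm K j (u \<epsilon>))"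
      using eventually_small by eventually_elim (rule dbound_sup_seminorm[OF assms K], use u in auto)
    ultimately show "\<exists>l :: real \<Rightarrow> real. moderate l \<and> (\<forall>\<^sub>F \<epsilon> in at_right 0. dbound K j (u \<epsilon>) (l \<epsilon>))" by blast
  next
    assume "\<exists>l :: real \<Rightarrow> real. moderate l \<and> (\<forall>\<^sub>F \<epsilon> in at_right 0. dbound K j (u \<epsilon>) (l \<epsilon>))"
    then obtain l :: "real \<Rightarrow> real" where l: "moderate l" "\<forall>\<^sub>F \<epsilon> in at_right 0. dbound K j (u \<epsilon>) (l \<epsilon>)" by blast
    show "moderate (\<lambda>\<epsilon>. sup_seminorm K j (u \<epsilon>))"
    proof (rule moderate_dom[OF l(1)])
      show "\<forall>\<^sub>F \<epsilon> in at_right 0. norm (sup_seminorm K j (u \<epsilon>)) \<le> norm (l \<epsilon>)"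
        using l(2) eventually_small
      proof eventually_elim
        case (elim \<epsilon>)
        then have s: "smooth_on \<Omega> (u \<epsilon>)" using u by auto
        have "dbound K j (u \<epsilon>) \<bar>l \<epsilon>\<bar>" using elim by (auto elim: dbound_mono)
        then show ?case using sup_seminorm_le_iff[OF assms K s] sup_seminorm_nonneg[OF assms K s, of j] by simp
      qed
    qed
  qed
  have "u \<in> moderate_nets (smooth_functions \<Omega>) (smooth_seminorms \<Omega>) \<longleftrightarrow> (\<forall>\<epsilon>\<in>{0<..1}. smooth_on \<Omega> (u \<epsilon>)) \<and>
      (\<forall>p\<in>smooth_seminorms \<Omega>. \<exists>N::nat. (\<lambda>\<epsilon>. p (u \<epsilon>)) \<in> O[at_right 0](\<lambda>\<epsilon>. inverse (\<epsilon> ^ N)))"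
    by (subst moderate_nets_def) (simp add: smooth_functions_def)
  then show ?thesis
    unfolding 1 mnet_def
    by (rule trans) (rule conj_cong[OF refl], intro all_cong1 imp_cong[OF refl] 2)
qed

lemma nnet_iff:
  assumes "open \<Omega>"
  shows "u \<in> negligible_nets (smooth_functions \<Omega>) (smooth_seminorms \<Omega>) \<longleftrightarrow> nnet \<Omega> u"
proof -
  have 1: "(\<forall>p\<in>smooth_seminorms \<Omega>. \<forall>N::nat. (\<lambda>\<epsilon>. p (u \<epsilon>)) \<in> O[at_right 0](\<lambda>\<epsilon>. \<epsilon> ^ N)) \<longleftrightarrow>
    (\<forall>K j. compact K \<longrightarrow> K \<subseteq> \<Omega> \<longrightarrow> negligible_net (\<lambda>\<epsilon>. sup_seminorm K j (u \<epsilon>)))"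
    unfolding ball_smooth_seminorms negligible_iff by simp
  have 2: "negligible_net (\<lambda>\<epsilon>. sup_seminorm K j (u \<epsilon>)) \<longleftrightarrow> (\<exists>l :: real \<Rightarrow> real. negligible_net l \<and> (\<forall>\<^sub>F \<epsilon> in at_right 0. dbound K j (u \<epsilon>) (l \<epsilon>)))"
    if u: "\<forall>\<epsilon>\<in>{0<..1}. smooth_on \<Omega> (u \<epsilon>)" and K: "compact K" "K \<subseteq> \<Omega>" for K j
  proof
    assume "negligible_net (\<lambda>\<epsilon>. sup_seminorm K j (u \<epsilon>))"
    moreover have "\<forall>\<^sub>F \<epsilon> in at_right 0. dbound K j (u \<epsilon>) (sup_seminorm K j (u \<epsilon>))"
      using eventually_small by eventually_elim (rule dbound_sup_seminorm[OF assms K], use u in auto)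
    ultimately show "\<exists>l :: real \<Rightarrow> real. negligible_net l \<and> (\<forall>\<^sub>F \<epsilon> in at_right 0. dbound K j (u \<epsilon>) (l \<epsilon>))" by blast
  next
    assume "\<exists>l :: real \<Rightarrow> real. negligible_net l \<and> (\<forall>\<^sub>F \<epsilon> in at_right 0. dbound K j (u \<epsilon>) (l \<epsilon>))"
    then obtain l :: "real \<Rightarrow> real" where l: "negligible_net l" "\<forall>\<^sub>F \<epsilon> in at_right 0. dbound K j (u \<epsilon>) (l \<epsilon>)" by blast
    show "negligible_net (\<lambda>\<epsilon>. sup_seminorm K j (u \<epsilon>))"
    proof (rule negligible_dom[OF l(1)])
      show "\<forall>\<^sub>F \<epsilon> in at_right 0. norm (sup_seminorm K j (u \<epsilon>)) \<le> norm (l \<epsilon>)"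
        using l(2) eventually_small
      proof eventually_elim
        case (elim \<epsilon>)
        then have s: "smooth_on \<Omega> (u \<epsilon>)" using u by auto
        have "dbound K j (u \<epsilon>) \<bar>l \<epsilon>\<bar>" using elim by (auto elim: dbound_mono)
        then show ?case using sup_seminorm_le_iff[OF assms K s] sup_seminorm_nonneg[OF assms K s, of j] by simp
      qed
    qed
  qed
  have "u \<in> negligible_nets (smooth_functions \<Omega>) (smooth_seminorms \<Omega>) \<longleftrightarrow> (\<forall>\<epsilon>\<in>{0<..1}. smooth_on \<Omega> (u \<epsilon>)) \<and>
      (\<forall>p\<in>smooth_seminorms \<Omega>. \<forall>N::nat. (\<lambda>\<epsilon>. p (u \<epsilon>)) \<in> O[at_right 0](\<lambda>\<epsilon>. \<epsilon> ^ N))"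
    by (subst negligible_nets_def) (simp add: smooth_functions_def)
  then show ?thesis
    unfolding 1 nnet_def
    by (rule trans) (rule conj_cong[OF refl], intro all_cong1 imp_cong[OF refl] 2)
qed

lemma mnetD: "mnet \<Omega> u \<Longrightarrow> \<epsilon> \<in> {0<..1} \<Longrightarrow> smooth_on \<Omega> (u \<epsilon>)"
  by (simp add: mnet_def)

lemma nnetD: "nnet \<Omega> u \<Longrightarrow> \<epsilon> \<in> {0<..1} \<Longrightarrow> smooth_on \<Omega> (u \<epsilon>)"
  by (simp add: nnet_def)

lemma mnet_bound:
  assumes "mnet \<Omega> u" "compact K" "K \<subseteq> \<Omega>"
  obtains l :: "real \<Rightarrow> real" where "moderate l" "\<forall>\<^sub>F \<epsilon> in at_right 0. dbound K j (u \<epsilon>) (l \<epsilon>)"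
  using assms unfolding mnet_def by blast

lemma nnet_bound:
  assumes "nnet \<Omega> u" "compact K" "K \<subseteq> \<Omega>"
  obtains l :: "real \<Rightarrow> real" where "negligible_net l" "\<forall>\<^sub>F \<epsilon> in at_right 0. dbound K j (u \<epsilon>) (l \<epsilon>)"
  using assms unfolding nnet_def by blast

lemma nnet_imp_mnet: "nnet \<Omega> u \<Longrightarrow> mnet \<Omega> u"
  unfolding nnet_def mnet_def by (meson negligible_imp_moderate)

lemma mnet_subset: "mnet \<Omega> u \<Longrightarrow> V \<subseteq> \<Omega> \<Longrightarrow> mnet V u"
  unfolding mnet_def by (meson smooth_on_subset subset_trans)

lemma nnet_subset: "nnet \<Omega> u \<Longrightarrow> V \<subseteq> \<Omega> \<Longrightarrow> nnet V u"
  unfolding nnet_def by (meson smooth_on_subset subset_trans)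

context
  fixes \<Omega> :: "(real^'n::finite) set"
  assumes o: "open \<Omega>"
begin

lemma mnet_add:
  assumes "mnet \<Omega> u" "mnet \<Omega> v" shows "mnet \<Omega> (\<lambda>\<epsilon> x. u \<epsilon> x + v \<epsilon> x)"
  unfolding mnet_def
proof (intro conjI ballI allI impI)
  show "smooth_on \<Omega> (\<lambda>x. u \<epsilon> x + v \<epsilon> x)" if "\<epsilon> \<in> {0<..1}" for \<epsilon>
    by (intro smooth_on_add[OF o] mnetD[OF _ that] assms)
  fix K j assume K: "compact K" "K \<subseteq> \<Omega>"
  obtain l :: "real \<Rightarrow> real" where l: "moderate l" "\<forall>\<^sub>F \<epsilon> in at_right 0. dbound K j (u \<epsilon>) (l \<epsilon>)"
    by (rule mnet_bound[OF assms(1) K])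
  obtain l' :: "real \<Rightarrow> real" where l': "moderate l'" "\<forall>\<^sub>F \<epsilon> in at_right 0. dbound K j (v \<epsilon>) (l' \<epsilon>)"
    by (rule mnet_bound[OF assms(2) K])
  have "\<forall>\<^sub>F \<epsilon> in at_right 0. dbound K j (\<lambda>x. u \<epsilon> x + v \<epsilon> x) (l \<epsilon> + l' \<epsilon>)"
    using l(2) l'(2) eventually_small
    by eventually_elim (rule dbound_add[OF o K(2)], auto intro: mnetD assms)
  then show "\<exists>l :: real \<Rightarrow> real. moderate l \<and> (\<forall>\<^sub>F \<epsilon> in at_right 0. dbound K j (\<lambda>x. u \<epsilon> x + v \<epsilon> x) (l \<epsilon>))"
    using moderate_add[OF l(1) l'(1)] by blast
qed

lemma nnet_add:
  assumes "nnet \<Omega> u" "nnet \<Omega> v" shows "nnet \<Omega> (\<lambda>\<epsilon> x. u \<epsilon> x + v \<epsilon> x)"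
  unfolding nnet_def
proof (intro conjI ballI allI impI)
  show "smooth_on \<Omega> (\<lambda>x. u \<epsilon> x + v \<epsilon> x)" if "\<epsilon> \<in> {0<..1}" for \<epsilon>
    by (intro smooth_on_add[OF o] nnetD[OF _ that] assms)
  fix K j assume K: "compact K" "K \<subseteq> \<Omega>"
  obtain l :: "real \<Rightarrow> real" where l: "negligible_net l" "\<forall>\<^sub>F \<epsilon> in at_right 0. dbound K j (u \<epsilon>) (l \<epsilon>)"
    by (rule nnet_bound[OF assms(1) K])
  obtain l' :: "real \<Rightarrow> real" where l': "negligible_net l'" "\<forall>\<^sub>F \<epsilon> in at_right 0. dbound K j (v \<epsilon>) (l' \<epsilon>)"
    by (rule nnet_bound[OF assms(2) K])
  have "\<forall>\<^sub>F \<epsilon> in at_right 0. dbound K j (\<lambda>x. u \<epsilon> x + v \<epsilon> x) (l \<epsilon> + l' \<epsilon>)"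
    using l(2) l'(2) eventually_small
    by eventually_elim (rule dbound_add[OF o K(2)], auto intro: nnetD assms)
  then show "\<exists>l :: real \<Rightarrow> real. negligible_net l \<and> (\<forall>\<^sub>F \<epsilon> in at_right 0. dbound K j (\<lambda>x. u \<epsilon> x + v \<epsilon> x) (l \<epsilon>))"
    using negligible_add[OF l(1) l'(1)] by blast
qed

lemma mnet_mult:
  assumes "mnet \<Omega> u" "mnet \<Omega> v" shows "mnet \<Omega> (\<lambda>\<epsilon> x. u \<epsilon> x * v \<epsilon> x)"
  unfolding mnet_def
proof (intro conjI ballI allI impI)
  show "smooth_on \<Omega> (\<lambda>x. u \<epsilon> x * v \<epsilon> x)" if "\<epsilon> \<in> {0<..1}" for \<epsilon>
    by (intro smooth_on_mult[OF o] mnetD[OF _ that] assms)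
  fix K j assume K: "compact K" "K \<subseteq> \<Omega>"
  obtain l :: "real \<Rightarrow> real" where l: "moderate l" "\<forall>\<^sub>F \<epsilon> in at_right 0. dbound K j (u \<epsilon>) (l \<epsilon>)"
    by (rule mnet_bound[OF assms(1) K])
  obtain l' :: "real \<Rightarrow> real" where l': "moderate l'" "\<forall>\<^sub>F \<epsilon> in at_right 0. dbound K j (v \<epsilon>) (l' \<epsilon>)"
    by (rule mnet_bound[OF assms(2) K])
  have "\<forall>\<^sub>F \<epsilon> in at_right 0. dbound K j (\<lambda>x. u \<epsilon> x * v \<epsilon> x) (2 ^ j * l \<epsilon> * l' \<epsilon>)"
    using l(2) l'(2) eventually_small
    by eventually_elim (rule dbound_mult[OF o K(2)], auto intro: mnetD assms)
  then show "\<exists>l :: real \<Rightarrow> real. moderate l \<and> (\<forall>\<^sub>F \<epsilon> in at_right 0. dbound K j (\<lambda>x. u \<epsilon> x * v \<epsilon> x) (l \<epsilon>))"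
    using moderate_mult[OF moderate_mult[OF moderate_const l(1)] l'(1)] by blast
qed

lemma nnet_mult:
  assumes "mnet \<Omega> u" "nnet \<Omega> v" shows "nnet \<Omega> (\<lambda>\<epsilon> x. u \<epsilon> x * v \<epsilon> x)"
  unfolding nnet_def
proof (intro conjI ballI allI impI)
  show "smooth_on \<Omega> (\<lambda>x. u \<epsilon> x * v \<epsilon> x)" if "\<epsilon> \<in> {0<..1}" for \<epsilon>
    by (intro smooth_on_mult[OF o] mnetD[OF _ that] nnet_imp_mnet assms)
  fix K j assume K: "compact K" "K \<subseteq> \<Omega>"
  obtain l :: "real \<Rightarrow> real" where l: "moderate l" "\<forall>\<^sub>F \<epsilon> in at_right 0. dbound K j (u \<epsilon>) (l \<epsilon>)"
    by (rule mnet_bound[OF assms(1) K])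
  obtain l' :: "real \<Rightarrow> real" where l': "negligible_net l'" "\<forall>\<^sub>F \<epsilon> in at_right 0. dbound K j (v \<epsilon>) (l' \<epsilon>)"
    by (rule nnet_bound[OF assms(2) K])
  have "\<forall>\<^sub>F \<epsilon> in at_right 0. dbound K j (\<lambda>x. u \<epsilon> x * v \<epsilon> x) (2 ^ j * l \<epsilon> * l' \<epsilon>)"
    using l(2) l'(2) eventually_small
    by eventually_elim (rule dbound_mult[OF o K(2)], auto intro: mnetD nnetD assms)
  then show "\<exists>l :: real \<Rightarrow> real. negligible_net l \<and> (\<forall>\<^sub>F \<epsilon> in at_right 0. dbound K j (\<lambda>x. u \<epsilon> x * v \<epsilon> x) (l \<epsilon>))"
    using negligible_mult[OF moderate_mult[OF moderate_const l(1)] l'(1)] by blast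
qed

lemma mnet_const:
  assumes "moderate c" shows "mnet \<Omega> (\<lambda>\<epsilon> x. c \<epsilon>)"
  unfolding mnet_def
  by (auto intro!: smooth_on_const[OF o] exI[of _ "\<lambda>\<epsilon>. norm (c \<epsilon>)"] moderate_norm assms always_eventually allI dbound_const)

lemma nnet_const:
  assumes "negligible_net c" shows "nnet \<Omega> (\<lambda>\<epsilon> x. c \<epsilon>)"
  unfolding nnet_def
  by (auto intro!: smooth_on_const[OF o] exI[of _ "\<lambda>\<epsilon>. norm (c \<epsilon>)"] negligible_norm assms always_eventually allI dbound_const)

lemma nnet_minus: "nnet \<Omega> u \<Longrightarrow> nnet \<Omega> (\<lambda>\<epsilon> x. - u \<epsilon> x)"
  using nnet_mult[OF mnet_const[OF moderate_const[of "- 1"]]] by simp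

lemma mnet_minus: "mnet \<Omega> u \<Longrightarrow> mnet \<Omega> (\<lambda>\<epsilon> x. - u \<epsilon> x)"
  using mnet_mult[OF mnet_const[OF moderate_const[of "- 1"]]] by simp

lemma nnet_diff: "nnet \<Omega> u \<Longrightarrow> nnet \<Omega> v \<Longrightarrow> nnet \<Omega> (\<lambda>\<epsilon> x. u \<epsilon> x - v \<epsilon> x)"
  using nnet_add[OF _ nnet_minus] by simp

lemma mnet_diff: "mnet \<Omega> u \<Longrightarrow> mnet \<Omega> v \<Longrightarrow> mnet \<Omega> (\<lambda>\<epsilon> x. u \<epsilon> x - v \<epsilon> x)"
  using mnet_add[OF _ mnet_minus] by simp

lemma mnet_sum: "(\<And>i. i \<in> I \<Longrightarrow> mnet \<Omega> (u i)) \<Longrightarrow> mnet \<Omega> (\<lambda>\<epsilon> x. \<Sum>i\<in>I. u i \<epsilon> x)"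
  by (induction I rule: infinite_finite_induct) (auto intro: mnet_const moderate_const mnet_add)

lemma nnet_sum: "(\<And>i. i \<in> I \<Longrightarrow> nnet \<Omega> (u i)) \<Longrightarrow> nnet \<Omega> (\<lambda>\<epsilon> x. \<Sum>i\<in>I. u i \<epsilon> x)"
  by (induction I rule: infinite_finite_induct) (auto intro: nnet_const negligible_zero nnet_add)

lemma smooth_on_mD: "smooth_on \<Omega> f \<Longrightarrow> smooth_on \<Omega> (mD \<alpha> f)"
  unfolding mD_def[abs_def] mpd_eq_pds by (intro smooth_on_mult smooth_on_const smooth_on_pds o)

lemma dbound_mD:
  assumes "K \<subseteq> \<Omega>" "smooth_on \<Omega> f" "dbound K (j + mi_order \<alpha>) f B"
  shows "dbound K j (mD \<alpha> f) B"
  unfolding mD_def[abs_def] mpd_eq_pds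
  by (rule dbound_cmult[OF o assms(1) smooth_on_pds[OF assms(2)] dbound_pds])
     (use assms(3) in \<open>auto simp: length_mi_list norm_power\<close>)

lemma mnet_mD: assumes "mnet \<Omega> u" shows "mnet \<Omega> (\<lambda>\<epsilon>. mD \<alpha> (u \<epsilon>))"
  unfolding mnet_def
proof (intro conjI ballI allI impI)
  show "smooth_on \<Omega> (mD \<alpha> (u \<epsilon>))" if "\<epsilon> \<in> {0<..1}" for \<epsilon>
    by (intro smooth_on_mD mnetD[OF _ that] assms)
  fix K j assume K: "compact K" "K \<subseteq> \<Omega>"
  obtain l :: "real \<Rightarrow> real" where l: "moderate l" "\<forall>\<^sub>F \<epsilon> in at_right 0. dbound K (j + mi_order \<alpha>) (u \<epsilon>) (l \<epsilon>)"
    by (rule mnet_bound[OF assms(1) K])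
  have "\<forall>\<^sub>F \<epsilon> in at_right 0. dbound K j (mD \<alpha> (u \<epsilon>)) (l \<epsilon>)"
    using l(2) eventually_small by eventually_elim (rule dbound_mD[OF K(2)], auto intro: mnetD assms)
  then show "\<exists>l :: real \<Rightarrow> real. moderate l \<and> (\<forall>\<^sub>F \<epsilon> in at_right 0. dbound K j (mD \<alpha> (u \<epsilon>)) (l \<epsilon>))"
    using l(1) by blast
qed

lemma nnet_mD: assumes "nnet \<Omega> u" shows "nnet \<Omega> (\<lambda>\<epsilon>. mD \<alpha> (u \<epsilon>))"
  unfolding nnet_def
proof (intro conjI ballI allI impI)
  show "smooth_on \<Omega> (mD \<alpha> (u \<epsilon>))" if "\<epsilon> \<in> {0<..1}" for \<epsilon>
    by (intro smooth_on_mD nnetD[OF _ that] assms)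
  fix K j assume K: "compact K" "K \<subseteq> \<Omega>"
  obtain l :: "real \<Rightarrow> real" where l: "negligible_net l" "\<forall>\<^sub>F \<epsilon> in at_right 0. dbound K (j + mi_order \<alpha>) (u \<epsilon>) (l \<epsilon>)"
    by (rule nnet_bound[OF assms(1) K])
  have "\<forall>\<^sub>F \<epsilon> in at_right 0. dbound K j (mD \<alpha> (u \<epsilon>)) (l \<epsilon>)"
    using l(2) eventually_small by eventually_elim (rule dbound_mD[OF K(2)], auto intro: nnetD assms)
  then show "\<exists>l :: real \<Rightarrow> real. negligible_net l \<and> (\<forall>\<^sub>F \<epsilon> in at_right 0. dbound K j (mD \<alpha> (u \<epsilon>)) (l \<epsilon>))"
    using l(1) by blast
qed

lemma mD_diff:
  assumes "smooth_on \<Omega> f" "smooth_on \<Omega> g" "x \<in> \<Omega>"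
  shows "mD \<alpha> (\<lambda>x. f x - g x) x = mD \<alpha> f x - mD \<alpha> g x"
  by (simp add: mD_def mpd_eq_pds pds_diff[OF o assms] right_diff_distrib)

lemma nnet_cong:
  assumes "nnet \<Omega> v" "\<And>\<epsilon> x. \<epsilon> \<in> {0<..1} \<Longrightarrow> x \<in> \<Omega> \<Longrightarrow> u \<epsilon> x = v \<epsilon> x" shows "nnet \<Omega> u"
  unfolding nnet_def
proof (intro conjI ballI allI impI)
  show "smooth_on \<Omega> (u \<epsilon>)" if "\<epsilon> \<in> {0<..1}" for \<epsilon>
    by (rule smooth_on_cong[OF o _ nnetD[OF assms(1) that]]) (use assms(2) that in auto)
  fix K j assume K: "compact K" "K \<subseteq> \<Omega>"
  obtain l :: "real \<Rightarrow> real" where l: "negligible_net l" "\<forall>\<^sub>F \<epsilon> in at_right 0. dbound K j (v \<epsilon>) (l \<epsilon>)"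
    by (rule nnet_bound[OF assms(1) K])
  have "\<forall>\<^sub>F \<epsilon> in at_right 0. dbound K j (u \<epsilon>) (l \<epsilon>)"
    using l(2) eventually_small
  proof eventually_elim
    case (elim \<epsilon>)
    then show ?case by (intro dbound_cong[OF o K(2), of "u \<epsilon>" "v \<epsilon>"]) (auto intro!: assms(2))
  qed
  then show "\<exists>l :: real \<Rightarrow> real. negligible_net l \<and> (\<forall>\<^sub>F \<epsilon> in at_right 0. dbound K j (u \<epsilon>) (l \<epsilon>))"
    using l(1) by blast
qed

lemma nnet_zero: "nnet \<Omega> (\<lambda>_ _. 0)"
  by (rule nnet_const[OF negligible_zero])

subsection \<open>Classes\<close>

lemma mem_gcls: "v \<in> gcls \<Omega> u \<longleftrightarrow> mnet \<Omega> u \<and> mnet \<Omega> v \<and> nnet \<Omega> (\<lambda>\<epsilon> x. u \<epsilon> x - v \<epsilon> x)"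
  unfolding gcls_def colombeau_rel_def mnet_iff[OF o] nnet_iff[OF o] fun_diff_def by auto

lemma gcls_eq:
  assumes "mnet \<Omega> u" "nnet \<Omega> (\<lambda>\<epsilon> x. u \<epsilon> x - v \<epsilon> x)" shows "gcls \<Omega> u = gcls \<Omega> v"
proof -
  have v: "mnet \<Omega> v" using mnet_diff[OF assms(1) nnet_imp_mnet[OF assms(2)]] by simp
  show ?thesis
  proof (rule set_eqI)
    fix w
    show "w \<in> gcls \<Omega> u \<longleftrightarrow> w \<in> gcls \<Omega> v"
      using nnet_diff[OF _ assms(2), of "\<lambda>\<epsilon> x. u \<epsilon> x - w \<epsilon> x"] nnet_add[OF _ assms(2), of "\<lambda>\<epsilon> x. v \<epsilon> x - w \<epsilon> x"] assms v
      by (auto simp: mem_gcls)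
  qed
qed

lemma gcls_in_gfuns: "mnet \<Omega> u \<Longrightarrow> gcls \<Omega> u \<in> gfuns \<Omega>"
  unfolding gfuns_def colombeau_space_def gcls_def by (rule quotientI) (simp add: mnet_iff[OF o])

lemma gfuns_rep:
  assumes "U \<in> gfuns \<Omega>"
  shows "grep U \<in> U" "mnet \<Omega> (grep U)" "U = gcls \<Omega> (grep U)"
proof -
  obtain u where u: "mnet \<Omega> u" "U = gcls \<Omega> u"
    using assms unfolding gfuns_def colombeau_space_def gcls_def by (auto elim!: quotientE simp: mnet_iff[OF o])
  have "u \<in> U" using u nnet_zero by (simp add: mem_gcls)
  then show g: "grep U \<in> U" unfolding grep_def by (rule someI[of "\<lambda>v. v \<in> U"])
  then show "mnet \<Omega> (grep U)" "U = gcls \<Omega> (grep U)" using u by (auto simp: mem_gcls intro!: gcls_eq)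
qed

lemma gfuns_mem:
  assumes "U \<in> gfuns \<Omega>" "v \<in> U"
  shows "mnet \<Omega> v" "U = gcls \<Omega> v" "nnet \<Omega> (\<lambda>\<epsilon> x. grep U \<epsilon> x - v \<epsilon> x)"
proof -
  have *: "v \<in> gcls \<Omega> (grep U)" using assms gfuns_rep[OF assms(1)] by simp
  then show "mnet \<Omega> v" "nnet \<Omega> (\<lambda>\<epsilon> x. grep U \<epsilon> x - v \<epsilon> x)" by (auto simp: mem_gcls)
  then show "U = gcls \<Omega> v" using gfuns_rep[OF assms(1)] gcls_eq by metis
qed

lemma grep_gcls:
  assumes "mnet \<Omega> u"
  shows "mnet \<Omega> (grep (gcls \<Omega> u))" "nnet \<Omega> (\<lambda>\<epsilon> x. grep (gcls \<Omega> u) \<epsilon> x - u \<epsilon> x)"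
proof -
  have "u \<in> gcls \<Omega> u" using assms nnet_zero by (simp add: mem_gcls)
  then show "mnet \<Omega> (grep (gcls \<Omega> u))" "nnet \<Omega> (\<lambda>\<epsilon> x. grep (gcls \<Omega> u) \<epsilon> x - u \<epsilon> x)"
    using gfuns_rep(2)[OF gcls_in_gfuns[OF assms]] gfuns_mem(3)[OF gcls_in_gfuns[OF assms]] by auto
qed

lemma gcls_eqD: "gcls \<Omega> u = gcls \<Omega> v \<Longrightarrow> mnet \<Omega> u \<Longrightarrow> nnet \<Omega> (\<lambda>\<epsilon> x. u \<epsilon> x - v \<epsilon> x)"
proof -
  assume a: "gcls \<Omega> u = gcls \<Omega> v" "mnet \<Omega> u"
  have "u \<in> gcls \<Omega> v" using a nnet_zero mem_gcls[of u u] by simp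
  then show ?thesis using nnet_minus[of "\<lambda>\<epsilon> x. v \<epsilon> x - u \<epsilon> x"] by (auto simp: mem_gcls)
qed

end

lemma grestrict_gcls:
  assumes "open \<Omega>" "open V" "V \<subseteq> \<Omega>" "mnet \<Omega> u"
  shows "grestrict V (gcls \<Omega> u) = gcls V u"
  unfolding grestrict_def
  using grep_gcls[OF assms(1,4)] assms(3) by (intro gcls_eq[OF assms(2)]) (auto intro: mnet_subset nnet_subset)

text \<open>Negligibility is local: a compact set is covered by finitely many closed balls, each
  inside one of the open sets. It follows that a net is negligible on the whole complement of its
  support, which is a union of open sets.\<close>

lemma nnet_Union:
  assumes "\<And>V. V \<in> \<V> \<Longrightarrow> open V" "\<And>V. V \<in> \<V> \<Longrightarrow> nnet V u" "\<Omega> \<subseteq> \<Union>\<V>"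
  shows "nnet \<Omega> (u :: 'n::finite fnet)"
  unfolding nnet_def
proof (intro conjI ballI allI impI)
  show "smooth_on \<Omega> (u \<epsilon>)" if "\<epsilon> \<in> {0<..1}" for \<epsilon>
    unfolding smooth_on_def
  proof (intro allI ballI)
    note \<epsilon> = that
    fix "is" :: "'n list" and x assume "x \<in> \<Omega>"
    then obtain V where "V \<in> \<V>" "x \<in> V" using assms(3) by blast
    then show "foldr pd is (u \<epsilon>) differentiable at x" using smooth_onD[OF nnetD[OF assms(2) \<epsilon>]] by blast
  qed
  fix K :: "(real^'n) set" and j assume K: "compact K" "K \<subseteq> \<Omega>"
  have "\<exists>r V. r > 0 \<and> V \<in> \<V> \<and> cball x r \<subseteq> V" if xK: "x \<in> K" for x
  proof -
    obtain V where V: "V \<in> \<V>" "x \<in> V" using xK K(2) assms(3) by blast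
    then obtain r where "r > 0" "cball x r \<subseteq> V" using assms(1)[OF V(1)] open_contains_cball by blast
    then show ?thesis using V by blast
  qed
  then obtain r V where rV: "\<And>x. x \<in> K \<Longrightarrow> r x > 0 \<and> V x \<in> \<V> \<and> cball x (r x) \<subseteq> V x" by metis
  have "K \<subseteq> (\<Union>x\<in>K. ball x (r x))" using rV by fastforce
  then obtain X where X: "X \<subseteq> K" "finite X" "K \<subseteq> (\<Union>x\<in>X. ball x (r x))"
    by (rule compactE_image[OF K(1) open_ball])
  have "\<exists>l :: real \<Rightarrow> real. negligible_net l \<and> (\<forall>\<^sub>F \<epsilon> in at_right 0. dbound (cball x (r x)) j (u \<epsilon>) (l \<epsilon>))" if "x \<in> X" for x
  proof -
    have "V x \<in> \<V>" "cball x (r x) \<subseteq> V x" using rV that X(1) by auto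
    from nnet_bound[OF assms(2)[OF this(1)] compact_cball this(2)] show ?thesis by blast
  qed
  then obtain l :: "real^'n \<Rightarrow> real \<Rightarrow> real" where l: "\<And>x. x \<in> X \<Longrightarrow> negligible_net (l x)"
    "\<And>x. x \<in> X \<Longrightarrow> \<forall>\<^sub>F \<epsilon> in at_right 0. dbound (cball x (r x)) j (u \<epsilon>) (l x \<epsilon>)" by metis
  have "\<forall>\<^sub>F \<epsilon> in at_right 0. \<forall>x\<in>X. dbound (cball x (r x)) j (u \<epsilon>) (l x \<epsilon>)"
    using X(2) l(2) by (simp add: eventually_ball_finite)
  then have "\<forall>\<^sub>F \<epsilon> in at_right 0. dbound K j (u \<epsilon>) (\<Sum>x\<in>X. \<bar>l x \<epsilon>\<bar>)"
  proof eventually_elim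
    case (elim \<epsilon>)
    show ?case unfolding dbound_def
    proof (intro allI ballI impI)
      fix "is" :: "'n list" and y assume y: "y \<in> K" "length is \<le> j"
      then obtain x where x: "x \<in> X" "y \<in> cball x (r x)" using X(3) by fastforce
      have "norm (foldr pd is (u \<epsilon>) y) \<le> l x \<epsilon>" using elim x y by (auto intro: dboundD)
      also have "\<dots> \<le> \<bar>l x \<epsilon>\<bar>" by simp
      also have "\<dots> \<le> (\<Sum>x\<in>X. \<bar>l x \<epsilon>\<bar>)" by (rule member_le_sum[OF x(1)]) (use X(2) in auto)
      finally show "norm (foldr pd is (u \<epsilon>) y) \<le> (\<Sum>x\<in>X. \<bar>l x \<epsilon>\<bar>)" .
    qed
  qed
  moreover have "negligible_net (\<lambda>\<epsilon>. \<Sum>x\<in>X. \<bar>l x \<epsilon>\<bar>)"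
    using negligible_norm[OF l(1)] by (intro negligible_sum) simp
  ultimately show "\<exists>l :: real \<Rightarrow> real. negligible_net l \<and> (\<forall>\<^sub>F \<epsilon> in at_right 0. dbound K j (u \<epsilon>) (l \<epsilon>))" by blast
qed

section \<open>Supports and extension by zero\<close>

lemma gsupport_gcls:
  assumes "open \<Omega>" "mnet \<Omega> u"
  shows "gsupport \<Omega> (gcls \<Omega> u) = \<Omega> - \<Union>{V. open V \<and> V \<subseteq> \<Omega> \<and> nnet V u}"
proof -
  have "grestrict V (gcls \<Omega> u) = gcls V (\<lambda>_ _. 0) \<longleftrightarrow> nnet V u" if V: "open V" "V \<subseteq> \<Omega>" for V
  proof -
    have m: "mnet V u" by (rule mnet_subset[OF assms(2) V(2)])
    show ?thesis unfolding grestrict_gcls[OF assms(1) V assms(2)]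
      using gcls_eqD[OF V(1) _ m, of "\<lambda>_ _. 0"] gcls_eq[OF V(1) m, of "\<lambda>_ _. 0"] by auto
  qed
  then have "{V. open V \<and> V \<subseteq> \<Omega> \<and> grestrict V (gcls \<Omega> u) = gcls V (\<lambda>_ _. 0)} = {V. open V \<and> V \<subseteq> \<Omega> \<and> nnet V u}" by auto
  then show ?thesis by (simp add: gsupport_def)
qed

lemma nnet_off_support:
  assumes "open \<Omega>" "mnet \<Omega> u"
  shows "nnet (\<Omega> - gsupport \<Omega> (gcls \<Omega> u)) u"
  by (rule nnet_Union[of "{V. open V \<and> V \<subseteq> \<Omega> \<and> nnet V u}"]) (auto simp: gsupport_gcls[OF assms])

lemma smooth_on_cutoff:
  assumes "open \<Omega>" "closed C" "C \<subseteq> \<Omega>" "smooth_on UNIV \<theta>" "\<And>x. x \<notin> C \<Longrightarrow> \<theta> x = 0" "smooth_on \<Omega> f"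
  shows "smooth_on UNIV (\<lambda>x. \<theta> x * f x)"
proof -
  have "smooth_on \<Omega> (\<lambda>x. \<theta> x * f x)"
    by (rule smooth_on_mult[OF assms(1) smooth_on_subset[OF assms(4) subset_UNIV] assms(6)])
  moreover have "smooth_on (- C) (\<lambda>x. \<theta> x * f x)"
    by (rule smooth_on_cong[OF open_Compl[OF assms(2)] _ smooth_on_const[OF open_Compl[OF assms(2)], of 0]]) (use assms(5) in auto)
  ultimately have "smooth_on (\<Omega> \<union> - C) (\<lambda>x. \<theta> x * f x)" by (rule smooth_on_Un)
  then show ?thesis by (rule smooth_on_subset) (use assms(3) in blast)
qed

lemma mnet_fixed:
  assumes "open \<Omega>" "smooth_on \<Omega> f" shows "mnet \<Omega> (\<lambda>\<epsilon>. f)"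
  unfolding mnet_def
proof (intro conjI ballI allI impI assms)
  fix K j assume K: "compact K" "K \<subseteq> \<Omega>"
  have "\<forall>\<^sub>F \<epsilon> in at_right (0::real). dbound K j f (sup_seminorm K j f)"
    by (intro always_eventually allI dbound_sup_seminorm[OF assms(1) K assms(2)])
  then show "\<exists>l :: real \<Rightarrow> real. moderate l \<and> (\<forall>\<^sub>F \<epsilon> in at_right 0. dbound K j f (l \<epsilon>))"
    by (intro exI[of _ "\<lambda>_. sup_seminorm K j f"] conjI moderate_const)
qed

lemma dbound_extend_zero:
  fixes f :: "real^'n::finite \<Rightarrow> complex"
  assumes "closed C" "\<And>x. x \<notin> C \<Longrightarrow> f x = 0" "dbound C j f B"
  shows "dbound K j f \<bar>B\<bar>"
  unfolding dbound_def
proof (intro allI ballI impI)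
  fix "is" :: "'n list" and x :: "real^'n" assume l: "length is \<le> j"
  show "norm (foldr pd is f x) \<le> \<bar>B\<bar>"
  proof (cases "x \<in> C")
    case True
    then show ?thesis using dboundD[OF assms(3) True l] by simp
  next
    case False
    have "foldr pd is f x = foldr pd is (\<lambda>_. 0) x"
      by (rule pds_cong_open[of "- C"]) (use assms False in auto)
    then show ?thesis by (simp add: pds_zero)
  qed
qed

lemma mnet_cutoff:
  assumes "open \<Omega>" "compact C" "C \<subseteq> \<Omega>" "smooth_on UNIV \<theta>" "\<And>x. x \<notin> C \<Longrightarrow> \<theta> x = 0" "mnet \<Omega> f"
  shows "mnet UNIV (\<lambda>\<epsilon> x. \<theta> x * f \<epsilon> x)"
  unfolding mnet_def
proof (intro conjI ballI allI impI)
  show "smooth_on UNIV (\<lambda>x. \<theta> x * f \<epsilon> x)" if "\<epsilon> \<in> {0<..1}" for \<epsilon>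
    by (rule smooth_on_cutoff[OF assms(1) compact_imp_closed[OF assms(2)] assms(3-5) mnetD[OF assms(6) that]])
  have m: "mnet \<Omega> (\<lambda>\<epsilon> x. \<theta> x * f \<epsilon> x)"
    by (rule mnet_mult[OF assms(1) mnet_fixed[OF assms(1)] assms(6)]) (rule smooth_on_subset[OF assms(4)], simp)
  fix K :: "(real^'a) set" and j
  obtain l :: "real \<Rightarrow> real" where l: "moderate l" "\<forall>\<^sub>F \<epsilon> in at_right 0. dbound C j (\<lambda>x. \<theta> x * f \<epsilon> x) (l \<epsilon>)"
    by (rule mnet_bound[OF m assms(2,3)])
  have "\<forall>\<^sub>F \<epsilon> in at_right 0. dbound K j (\<lambda>x. \<theta> x * f \<epsilon> x) \<bar>l \<epsilon>\<bar>"
    using l(2) by eventually_elim (rule dbound_extend_zero[OF compact_imp_closed[OF assms(2)]], use assms(5) in auto)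
  then show "\<exists>l :: real \<Rightarrow> real. moderate l \<and> (\<forall>\<^sub>F \<epsilon> in at_right 0. dbound K j (\<lambda>x. \<theta> x * f \<epsilon> x) (l \<epsilon>))"
    using moderate_norm[OF l(1)] by auto
qed

lemma compact_subset_ball:
  fixes x0 :: "'a::metric_space"
  assumes "compact K" "K \<subseteq> ball x0 \<rho>" "0 < \<rho>"
  obtains a where "0 < a" "a < \<rho>" "K \<subseteq> cball x0 a"
proof (cases "K = {}")
  case False
  have "continuous_on K (\<lambda>x. dist x0 x)" by (intro continuous_intros)
  from continuous_attains_sup[OF assms(1) False this]
  obtain x where x: "x \<in> K" "\<forall>y\<in>K. dist x0 y \<le> dist x0 x" by blast
  show ?thesis by (rule that[of "max (\<rho> / 2) (dist x0 x)"]) (use x assms in \<open>auto simp: le_max_iff_disj\<close>)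
qed (use assms that[of "\<rho> / 2"] in auto)

text \<open>A representative is multiplied by a cutoff that is 1 near the support. What is removed
  lives off the support, where the net is negligible, so the class is unchanged. The new net
  vanishes outside a smaller ball for every \<epsilon>, as integration by parts for fixed \<epsilon>
  requires.\<close>

lemma gfuns_c_rep:
  assumes "\<phi> \<in> gfuns_c (ball x0 \<rho>)" "0 < \<rho>"
  obtains w \<rho>' where "0 < \<rho>'" "\<rho>' < \<rho>" "mnet UNIV w" "\<And>\<epsilon> x. \<rho>' < dist x0 x \<Longrightarrow> w \<epsilon> x = 0" "\<phi> = gcls (ball x0 \<rho>) w"
proof -
  let ?B = "ball x0 \<rho>"
  have g: "\<phi> \<in> gfuns ?B" "compact (gsupport ?B \<phi>)" using assms by (auto simp: gfuns_c_def)
  note rep = gfuns_rep[OF open_ball g(1)]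
  have "gsupport ?B \<phi> \<subseteq> ?B" by (auto simp: gsupport_def)
  then obtain a where a: "0 < a" "a < \<rho>" "gsupport ?B \<phi> \<subseteq> cball x0 a" using compact_subset_ball[OF g(2) _ assms(2)] by blast
  \<comment> \<open>Radii a < b < c < \<rho>: the support lies within a, the cutoff is 1 up to b and
    0 from c on.\<close>
  define b c where "b = (a + \<rho>) / 2" and "c = (b + \<rho>) / 2"
  have bc: "a < b" "b < c" "c < \<rho>" "0 < b" using a by (auto simp: b_def c_def)
  obtain \<theta> where \<theta>: "smooth_on UNIV \<theta>" "\<And>x. x \<in> cball x0 b \<Longrightarrow> \<theta> x = 1" "\<And>x. c \<le> dist x0 x \<Longrightarrow> \<theta> x = 0"
    using cutoff_exists[OF bc(4,2)] by blast
  define w where "w \<epsilon> x = \<theta> x * grep \<phi> \<epsilon> x" for \<epsilon> x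
  have w: "mnet UNIV w" unfolding w_def[abs_def]
    by (rule mnet_cutoff[OF open_ball compact_cball[of x0 c] _ \<theta>(1) _ rep(2)]) (use bc \<theta>(3) in auto)
  have "nnet ?B (\<lambda>\<epsilon> x. grep \<phi> \<epsilon> x - w \<epsilon> x)"
  proof (rule nnet_Union[of "{ball x0 b, ?B - gsupport ?B \<phi>}"])
    have "closed (gsupport ?B \<phi>)" using g(2) by (rule compact_imp_closed)
    then have oK: "open (?B - gsupport ?B \<phi>)" by (simp add: open_Diff)
    then show "open V" if "V \<in> {ball x0 b, ?B - gsupport ?B \<phi>}" for V using that by auto
    have "nnet (ball x0 b) (\<lambda>\<epsilon> x. grep \<phi> \<epsilon> x - w \<epsilon> x)"
      by (rule nnet_cong[OF open_ball nnet_zero[OF open_ball]]) (use \<theta>(2) in \<open>simp add: w_def\<close>)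
    moreover have "nnet (?B - gsupport ?B \<phi>) (\<lambda>\<epsilon> x. grep \<phi> \<epsilon> x - w \<epsilon> x)"
    proof -
      have n: "nnet (?B - gsupport ?B \<phi>) (grep \<phi>)"
        using nnet_off_support[OF open_ball rep(2)] unfolding rep(3)[symmetric] .
      have "nnet (?B - gsupport ?B \<phi>) (\<lambda>\<epsilon> x. (1 - \<theta> x) * grep \<phi> \<epsilon> x)"
        by (rule nnet_mult[OF oK mnet_fixed[OF oK] n])
           (rule smooth_on_diff[OF oK smooth_on_const[OF oK] smooth_on_subset[OF \<theta>(1) subset_UNIV]])
      then show ?thesis by (simp add: w_def left_diff_distrib)
    qed
    ultimately show "nnet V (\<lambda>\<epsilon> x. grep \<phi> \<epsilon> x - w \<epsilon> x)" if "V \<in> {ball x0 b, ?B - gsupport ?B \<phi>}" for V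
      using that by auto
    show "?B \<subseteq> \<Union>{ball x0 b, ?B - gsupport ?B \<phi>}" using a(3) bc(1) by force
  qed
  then have "\<phi> = gcls ?B w" using rep gcls_eq[OF open_ball rep(2)] by metis
  then show ?thesis using that[of c w] bc w \<theta>(3) by (auto simp: w_def)
qed

text \<open>Evaluates the definite description. The class of w on the whole space is an extension
  with the right support. Any other one differs from it negligibly on the ball and, both being
  negligible there, outside the smaller closed ball; these two open sets cover the space.\<close>

lemma gextend_gcls:
  assumes \<rho>: "\<rho>' < \<rho>" and w: "mnet UNIV w" and z: "\<And>\<epsilon> x. \<rho>' < dist x0 x \<Longrightarrow> w \<epsilon> x = 0"
  shows "gextend (ball x0 \<rho>) (gcls (ball x0 \<rho>) w) = gcls UNIV w"
proof -
  let ?B = "ball x0 \<rho>"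
  have wB: "mnet ?B w" by (rule mnet_subset[OF w]) simp
  have oc: "open (- cball x0 \<rho>')" by (rule open_Compl[OF closed_cball])
  have zn: "nnet (- cball x0 \<rho>') w" by (rule nnet_cong[OF oc nnet_zero[OF oc]]) (use z in auto)
  have cover: "?B \<union> - cball x0 \<rho>' = UNIV" using \<rho> by auto
  have supp: "gsupport UNIV (gcls UNIV w) = gsupport ?B (gcls ?B w)"
  proof (rule set_eqI)
    fix x
    have "(\<exists>V. open V \<and> V \<subseteq> UNIV \<and> nnet V w \<and> x \<in> V) \<longleftrightarrow> \<not> (x \<in> ?B \<and> \<not> (\<exists>V. open V \<and> V \<subseteq> ?B \<and> nnet V w \<and> x \<in> V))"
    proof (cases "x \<in> ?B")
      case True
      have "open (V \<inter> ?B) \<and> V \<inter> ?B \<subseteq> ?B \<and> nnet (V \<inter> ?B) w \<and> x \<in> V \<inter> ?B" if "open V" "nnet V w" "x \<in> V" for V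
        using that True by (auto intro: nnet_subset)
      then show ?thesis using True by blast
    next
      case False
      then have "x \<in> - cball x0 \<rho>'" using cover by blast
      then show ?thesis using False zn oc by blast
    qed
    then show "x \<in> gsupport UNIV (gcls UNIV w) \<longleftrightarrow> x \<in> gsupport ?B (gcls ?B w)"
      unfolding gsupport_gcls[OF open_UNIV w] gsupport_gcls[OF open_ball wB] by auto
  qed
  have suppB: "gsupport ?B (gcls ?B w) \<subseteq> cball x0 \<rho>'"
  proof -
    have "open (?B - cball x0 \<rho>')" "nnet (?B - cball x0 \<rho>') w" by (auto intro: nnet_subset[OF zn])
    then show ?thesis unfolding gsupport_gcls[OF open_ball wB] by blast
  qed
  show ?thesis unfolding gextend_def
  proof (rule the_equality)
    show "gcls UNIV w \<in> gfuns UNIV \<and> grestrict ?B (gcls UNIV w) = gcls ?B w \<and> gsupport UNIV (gcls UNIV w) = gsupport ?B (gcls ?B w)"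
      using supp by (simp add: gcls_in_gfuns[OF open_UNIV w] grestrict_gcls[OF open_UNIV open_ball _ w])
  next
    fix v assume v: "v \<in> gfuns UNIV \<and> grestrict ?B v = gcls ?B w \<and> gsupport UNIV v = gsupport ?B (gcls ?B w)"
    then have rep: "mnet UNIV (grep v)" "v = gcls UNIV (grep v)" using gfuns_rep[OF open_UNIV] by blast+
    have "gcls ?B (grep v) = gcls ?B w"
      using v rep(2) grestrict_gcls[OF open_UNIV open_ball _ rep(1), of x0 \<rho>] by simp
    then have 1: "nnet ?B (\<lambda>\<epsilon> x. grep v \<epsilon> x - w \<epsilon> x)"
      by (rule gcls_eqD[OF open_ball _ mnet_subset[OF rep(1)]]) simp
    have "nnet (- cball x0 \<rho>') (grep v)"
      using nnet_off_support[OF open_UNIV rep(1)] unfolding rep(2)[symmetric]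
      by (rule nnet_subset) (use v suppB in auto)
    then have 2: "nnet (- cball x0 \<rho>') (\<lambda>\<epsilon> x. grep v \<epsilon> x - w \<epsilon> x)" by (rule nnet_diff[OF oc _ zn])
    have "nnet UNIV (\<lambda>\<epsilon> x. grep v \<epsilon> x - w \<epsilon> x)"
      by (rule nnet_Union[of "{?B, - cball x0 \<rho>'}"]) (use 1 2 cover in auto)
    then show "v = gcls UNIV w" using rep gcls_eq[OF open_UNIV rep(1)] by metis
  qed
qed

section \<open>Generalized numbers and basic functionals\<close>

lemma gen_num_eqI:
  assumes "moderate u" "negligible_net (\<lambda>\<epsilon>. u \<epsilon> - v \<epsilon>)"
  shows "abs_gen_num u = abs_gen_num v"
proof -
  have "moderate (\<lambda>\<epsilon>. u \<epsilon> + - (u \<epsilon> - v \<epsilon>))"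
    by (intro moderate_add moderate_uminus assms negligible_imp_moderate)
  then have "gen_num_rel u v" using assms by (simp add: gen_num_rel_iff)
  then show ?thesis by (rule Quotient_rel_abs[OF Quotient_gen_num])
qed

lemma gen_num_eqD:
  assumes "abs_gen_num u = abs_gen_num v" "moderate u" "moderate v"
  shows "negligible_net (\<lambda>\<epsilon>. u \<epsilon> - v \<epsilon>)"
proof -
  have "gen_num_rel u u" "gen_num_rel v v" using assms by (simp_all add: gen_num_rel_iff negligible_zero)
  then have "gen_num_rel u v" using assms(1) Quotient_rel[OF Quotient_gen_num] by metis
  then show ?thesis by (simp add: gen_num_rel_iff)
qed

lemma abs_gen_num_add:
  assumes "moderate u" "moderate v"
  shows "abs_gen_num u + abs_gen_num v = abs_gen_num (\<lambda>\<epsilon>. u \<epsilon> + v \<epsilon>)"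
  using assms by (intro plus_gen_num.abs_eq) (simp_all add: gen_num_rel_iff negligible_zero)

lemma abs_gen_num_mult:
  assumes "moderate u" "moderate v"
  shows "abs_gen_num u * abs_gen_num v = abs_gen_num (\<lambda>\<epsilon>. u \<epsilon> * v \<epsilon>)"
  using assms by (intro times_gen_num.abs_eq) (simp_all add: gen_num_rel_iff negligible_zero)

lemma rep_gen_num: "abs_gen_num (rep_gen_num a) = a" "moderate (rep_gen_num a)"
  using Quotient_abs_rep[OF Quotient_gen_num, of a] Quotient_rep_reflp[OF Quotient_gen_num, of a]
  by (auto simp: gen_num_rel_iff)

definition linear_functional :: "((real^'n::finite \<Rightarrow> complex) \<Rightarrow> complex) \<Rightarrow> bool" where
  "linear_functional T \<longleftrightarrow> (\<forall>f g. smooth_on UNIV f \<longrightarrow> smooth_on UNIV g \<longrightarrow> T (\<lambda>x. f x + g x) = T f + T g) \<and>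
     (\<forall>a f. smooth_on UNIV f \<longrightarrow> T (\<lambda>x. a * f x) = a * T f)"

lemma linear_functional_diff:
  assumes "linear_functional T" "smooth_on UNIV f" "smooth_on UNIV g"
  shows "T (\<lambda>x. f x - g x) = T f - T g"
proof -
  have "T (\<lambda>x. (f x - g x) + g x) = T (\<lambda>x. f x - g x) + T g"
    using assms unfolding linear_functional_def by (metis open_UNIV smooth_on_diff)
  then show ?thesis by simp
qed

lemma linear_functional_sum:
  assumes "linear_functional T" "\<And>i. i \<in> I \<Longrightarrow> smooth_on UNIV (f i)"
  shows "T (\<lambda>x. \<Sum>i\<in>I. a i * f i x) = (\<Sum>i\<in>I. a i * T (f i))"
proof -
  have z: "T (\<lambda>x. 0) = 0"
  proof -
    have "T (\<lambda>x. 0 * (0 :: complex)) = 0 * T (\<lambda>x. 0)"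
      using assms(1) smooth_on_const[OF open_UNIV, of 0] unfolding linear_functional_def by blast
    then show ?thesis by simp
  qed
  show ?thesis using assms(2)
  proof (induction I rule: infinite_finite_induct)
    case (insert i I)
    have s: "smooth_on UNIV (\<lambda>x. a i * f i x)" "smooth_on UNIV (\<lambda>x. \<Sum>i\<in>I. a i * f i x)"
      using insert.prems by (auto intro!: smooth_on_sum smooth_on_mult smooth_on_const)
    have "T (\<lambda>x. a i * f i x + (\<Sum>i\<in>I. a i * f i x)) = T (\<lambda>x. a i * f i x) + T (\<lambda>x. \<Sum>i\<in>I. a i * f i x)"
      using assms(1) s unfolding linear_functional_def by blast
    moreover have "T (\<lambda>x. a i * f i x) = a i * T (f i)"
      using assms(1) insert.prems unfolding linear_functional_def by blast
    ultimately show ?case using insert by simp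
  qed (simp_all add: z)
qed

lemma functional_net:
  assumes lin: "\<And>\<epsilon>. \<epsilon> \<in> {0<..1} \<Longrightarrow> linear_functional (Tn \<epsilon>)" and K: "compact K" and l: "moderate (l :: real \<Rightarrow> real)"
    and b: "\<forall>\<^sub>F \<epsilon> in at_right 0. \<forall>f. smooth_on UNIV f \<longrightarrow> norm (Tn \<epsilon> f) \<le> l \<epsilon> * sup_seminorm K j f"
    and u: "mnet UNIV u"
  shows "moderate (\<lambda>\<epsilon>. Tn \<epsilon> (u \<epsilon>))"
    and "nnet UNIV (\<lambda>\<epsilon> x. u \<epsilon> x - v \<epsilon> x) \<Longrightarrow> negligible_net (\<lambda>\<epsilon>. Tn \<epsilon> (u \<epsilon>) - Tn \<epsilon> (v \<epsilon>))"
proof -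
  have *: "norm (Tn \<epsilon> f) \<le> norm (l \<epsilon> * L)"
    if "\<forall>f. smooth_on UNIV f \<longrightarrow> norm (Tn \<epsilon> f) \<le> l \<epsilon> * sup_seminorm K j f" "smooth_on UNIV f" "dbound K j f L" for \<epsilon> f L
  proof -
    have s: "0 \<le> sup_seminorm K j f" "sup_seminorm K j f \<le> \<bar>L\<bar>"
      using sup_seminorm_le_iff[OF open_UNIV K subset_UNIV that(2)] sup_seminorm_nonneg[OF open_UNIV K subset_UNIV that(2)]
        dbound_mono[OF that(3) order_refl order_refl, of "\<bar>L\<bar>"] by auto
    have "norm (Tn \<epsilon> f) \<le> l \<epsilon> * sup_seminorm K j f" using that by blast
    also have "\<dots> \<le> \<bar>l \<epsilon>\<bar> * \<bar>L\<bar>" using s by (intro mult_mono) auto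
    finally show ?thesis by (simp add: abs_mult)
  qed
  obtain L :: "real \<Rightarrow> real" where L: "moderate L" "\<forall>\<^sub>F \<epsilon> in at_right 0. dbound K j (u \<epsilon>) (L \<epsilon>)"
    by (rule mnet_bound[OF u K subset_UNIV])
  show "moderate (\<lambda>\<epsilon>. Tn \<epsilon> (u \<epsilon>))"
  proof (rule moderate_dom[OF moderate_mult[OF l L(1)]])
    show "\<forall>\<^sub>F \<epsilon> in at_right 0. norm (Tn \<epsilon> (u \<epsilon>)) \<le> norm (l \<epsilon> * L \<epsilon>)"
      using b L(2) eventually_small by eventually_elim (rule *, auto intro: mnetD[OF u])
  qed
  assume n: "nnet UNIV (\<lambda>\<epsilon> x. u \<epsilon> x - v \<epsilon> x)"
  obtain L' :: "real \<Rightarrow> real" where L': "negligible_net L'" "\<forall>\<^sub>F \<epsilon> in at_right 0. dbound K j (\<lambda>x. u \<epsilon> x - v \<epsilon> x) (L' \<epsilon>)"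
    by (rule nnet_bound[OF n K subset_UNIV])
  have v: "mnet UNIV v" using mnet_diff[OF open_UNIV u nnet_imp_mnet[OF n]] by simp
  show "negligible_net (\<lambda>\<epsilon>. Tn \<epsilon> (u \<epsilon>) - Tn \<epsilon> (v \<epsilon>))"
  proof (rule negligible_dom[OF negligible_mult[OF l L'(1)]])
    show "\<forall>\<^sub>F \<epsilon> in at_right 0. norm (Tn \<epsilon> (u \<epsilon>) - Tn \<epsilon> (v \<epsilon>)) \<le> norm (l \<epsilon> * L' \<epsilon>)"
      using b L'(2) eventually_small
    proof eventually_elim
      case (elim \<epsilon>)
      then have e: "\<epsilon> \<in> {0<..1}" by simp
      have "Tn \<epsilon> (u \<epsilon>) - Tn \<epsilon> (v \<epsilon>) = Tn \<epsilon> (\<lambda>x. u \<epsilon> x - v \<epsilon> x)"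
        by (rule linear_functional_diff[symmetric, OF lin[OF e] mnetD[OF u e] mnetD[OF v e]])
      then show ?case using *[OF elim(1) nnetD[OF n e] elim(2)] by simp
    qed
  qed
qed

lemma functional_exists:
  assumes lin: "\<And>\<epsilon>. linear_functional (Tn \<epsilon>)" and K: "compact K" and l: "moderate (l :: real \<Rightarrow> real)"
    and b: "\<forall>\<^sub>F \<epsilon> in at_right 0. \<forall>f :: real^'n::finite \<Rightarrow> complex. smooth_on UNIV f \<longrightarrow> norm (Tn \<epsilon> f) \<le> l \<epsilon> * sup_seminorm K j f"
  obtains T where "T \<in> basic_functionals" "\<And>u. mnet UNIV u \<Longrightarrow> T (gcls UNIV u) = abs_gen_num (\<lambda>\<epsilon>. Tn \<epsilon> (u \<epsilon>))"
proof -
  obtain M :: nat where M: "\<forall>\<^sub>F \<epsilon> in at_right 0. norm (l \<epsilon>) \<le> inverse (\<epsilon> ^ M)" using l unfolding moderate_iff_ev by blast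
  have "\<forall>\<^sub>F \<epsilon> in at_right 0. \<forall>f :: real^'n \<Rightarrow> complex. smooth_on UNIV f \<longrightarrow> norm (Tn \<epsilon> f) \<le> inverse (\<epsilon> ^ M) * sup_seminorm K j f"
    using b M
  proof eventually_elim
    case (elim \<epsilon>)
    show ?case
    proof (intro allI impI)
      fix f :: "real^'n \<Rightarrow> complex" assume f: "smooth_on UNIV f"
      have "norm (Tn \<epsilon> f) \<le> l \<epsilon> * sup_seminorm K j f" using elim f by blast
      also have "\<dots> \<le> inverse (\<epsilon> ^ M) * sup_seminorm K j f"
        using elim(2) sup_seminorm_nonneg[OF open_UNIV K subset_UNIV f] by (intro mult_right_mono) auto
      finally show "norm (Tn \<epsilon> f) \<le> inverse (\<epsilon> ^ M) * sup_seminorm K j f" .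
    qed
  qed
  then obtain e0 where e0: "e0 > 0" "\<And>\<epsilon> f. 0 < \<epsilon> \<Longrightarrow> \<epsilon> < e0 \<Longrightarrow> smooth_on UNIV (f :: real^'n \<Rightarrow> complex) \<Longrightarrow> norm (Tn \<epsilon> f) \<le> inverse (\<epsilon> ^ M) * sup_seminorm K j f"
    unfolding eventually_at_right_field by blast
  define \<eta> where "\<eta> = min 1 (e0 / 2)"
  have \<eta>: "\<eta> \<in> {0<..1}" "\<eta> < e0" using e0(1) by (auto simp: \<eta>_def)
  define Tn' where "Tn' \<epsilon> = (if \<epsilon> \<in> {0<..\<eta>} then Tn \<epsilon> else (\<lambda>_. 0))" for \<epsilon>
  have lin': "linear_functional (Tn' \<epsilon>)" for \<epsilon> using lin by (auto simp: Tn'_def linear_functional_def)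
  have b': "norm (Tn' \<epsilon> f) \<le> inverse (\<epsilon> ^ M) * sup_seminorm K j f" if "\<epsilon> \<in> {0<..1}" "smooth_on UNIV f" for \<epsilon> f
    using that e0(2)[of \<epsilon> f] \<eta> sup_seminorm_nonneg[OF open_UNIV K subset_UNIV that(2), of j] by (auto simp: Tn'_def)
  have mM: "moderate (\<lambda>\<epsilon>::real. inverse (\<epsilon> ^ M))"
    unfolding moderate_iff_ev by (intro exI[of _ M]) (use eventually_small in eventually_elim, simp)
  have b'': "\<forall>\<^sub>F \<epsilon> in at_right 0. \<forall>f. smooth_on UNIV f \<longrightarrow> norm (Tn' \<epsilon> f) \<le> inverse (\<epsilon> ^ M) * sup_seminorm K j f"
    using eventually_small by eventually_elim (use b' in auto)
  have eqT: "\<forall>\<^sub>F \<epsilon> in at_right 0. Tn' \<epsilon> = Tn \<epsilon>"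
    unfolding eventually_at_right_field using \<eta> by (intro exI[of _ \<eta>]) (auto simp: Tn'_def)
  define T where "T U = abs_gen_num (\<lambda>\<epsilon>. Tn' \<epsilon> (grep U \<epsilon>))" for U
  note fn = functional_net[OF lin' K mM b'']
  have Tg: "T (gcls UNIV u) = abs_gen_num (\<lambda>\<epsilon>. Tn' \<epsilon> (u \<epsilon>))" if u: "mnet UNIV u" for u
    unfolding T_def using grep_gcls[OF open_UNIV u] by (intro gen_num_eqI fn)
  have Tg2: "abs_gen_num (\<lambda>\<epsilon>. Tn' \<epsilon> (u \<epsilon>)) = abs_gen_num (\<lambda>\<epsilon>. Tn \<epsilon> (u \<epsilon>))" if u: "mnet UNIV u" for u
  proof (rule gen_num_eqI[OF fn(1)[OF u]])
    show "negligible_net (\<lambda>\<epsilon>. Tn' \<epsilon> (u \<epsilon>) - Tn \<epsilon> (u \<epsilon>))"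
      by (rule negligible_dom[OF negligible_zero[where 'a = real]]) (use eqT in eventually_elim, simp)
  qed
  have cd: "Tn' \<epsilon> \<in> compact_distributions" if "\<epsilon> \<in> {0<..1}" for \<epsilon>
    unfolding compact_distributions_def using lin'[of \<epsilon>] b'[OF that] K unfolding linear_functional_def by blast
  have def: "defines_functional Tn' T"
    unfolding defines_functional_def
  proof (intro conjI ballI cd)
    fix U :: "'n gfun" and v assume "U \<in> gfuns UNIV" "v \<in> U"
    note m = gfuns_mem[OF open_UNIV this]
    show "T U = abs_gen_num (\<lambda>\<epsilon>. Tn' \<epsilon> (v \<epsilon>))" unfolding m(2) by (rule Tg[OF m(1)])
  qed auto
  have "T \<in> basic_functionals"
    unfolding basic_functionals_def mem_Collect_eq
  proof (intro conjI ballI allI)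
    fix U V assume U: "U \<in> gfuns (UNIV :: (real^'n) set)" and V: "V \<in> gfuns (UNIV :: (real^'n) set)"
    note mU = gfuns_rep(2)[OF open_UNIV U] and mV = gfuns_rep(2)[OF open_UNIV V]
    have "T (gadd UNIV U V) = abs_gen_num (\<lambda>\<epsilon>. Tn' \<epsilon> (\<lambda>x. grep U \<epsilon> x + grep V \<epsilon> x))"
      unfolding gadd_def by (rule Tg[OF mnet_add[OF open_UNIV mU mV]])
    also have "\<dots> = abs_gen_num (\<lambda>\<epsilon>. Tn' \<epsilon> (grep U \<epsilon>) + Tn' \<epsilon> (grep V \<epsilon>))"
    proof (rule gen_num_eqI)
      show "moderate (\<lambda>\<epsilon>. Tn' \<epsilon> (\<lambda>x. grep U \<epsilon> x + grep V \<epsilon> x))" by (rule fn(1)[OF mnet_add[OF open_UNIV mU mV]])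
      have "\<forall>\<^sub>F \<epsilon> in at_right 0. norm (Tn' \<epsilon> (\<lambda>x. grep U \<epsilon> x + grep V \<epsilon> x) - (Tn' \<epsilon> (grep U \<epsilon>) + Tn' \<epsilon> (grep V \<epsilon>))) \<le> norm (0::real)"
        using eventually_small
      proof eventually_elim
        case (elim \<epsilon>)
        then have e: "\<epsilon> \<in> {0<..1}" by simp
        have "Tn' \<epsilon> (\<lambda>x. grep U \<epsilon> x + grep V \<epsilon> x) = Tn' \<epsilon> (grep U \<epsilon>) + Tn' \<epsilon> (grep V \<epsilon>)"
          using lin'[of \<epsilon>] mnetD[OF mU e] mnetD[OF mV e] unfolding linear_functional_def by blast
        then show ?case by simp
      qed
      then show "negligible_net (\<lambda>\<epsilon>. Tn' \<epsilon> (\<lambda>x. grep U \<epsilon> x + grep V \<epsilon> x) - (Tn' \<epsilon> (grep U \<epsilon>) + Tn' \<epsilon> (grep V \<epsilon>)))"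
        by (rule negligible_dom[OF negligible_zero])
    qed
    also have "\<dots> = T U + T V" unfolding T_def by (rule abs_gen_num_add[symmetric]) (rule fn(1), rule mU mV)+
    finally show "T (gadd UNIV U V) = T U + T V" .
  next
    fix a U assume U: "U \<in> gfuns (UNIV :: (real^'n) set)"
    note mU = gfuns_rep(2)[OF open_UNIV U]
    have mm: "mnet UNIV (\<lambda>\<epsilon> x. rep_gen_num a \<epsilon> * grep U \<epsilon> x)"
      by (rule mnet_mult[OF open_UNIV mnet_const[OF open_UNIV rep_gen_num(2)] mU])
    have "T (gscale UNIV a U) = abs_gen_num (\<lambda>\<epsilon>. Tn' \<epsilon> (\<lambda>x. rep_gen_num a \<epsilon> * grep U \<epsilon> x))"
      unfolding gscale_def by (rule Tg[OF mm])
    also have "\<dots> = abs_gen_num (\<lambda>\<epsilon>. rep_gen_num a \<epsilon> * Tn' \<epsilon> (grep U \<epsilon>))"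
    proof (rule gen_num_eqI[OF fn(1)[OF mm]])
      have "\<forall>\<^sub>F \<epsilon> in at_right 0. norm (Tn' \<epsilon> (\<lambda>x. rep_gen_num a \<epsilon> * grep U \<epsilon> x) - rep_gen_num a \<epsilon> * Tn' \<epsilon> (grep U \<epsilon>)) \<le> norm (0::real)"
        using eventually_small
      proof eventually_elim
        case (elim \<epsilon>)
        then have e: "\<epsilon> \<in> {0<..1}" by simp
        have "Tn' \<epsilon> (\<lambda>x. rep_gen_num a \<epsilon> * grep U \<epsilon> x) = rep_gen_num a \<epsilon> * Tn' \<epsilon> (grep U \<epsilon>)"
          using lin'[of \<epsilon>] mnetD[OF mU e] unfolding linear_functional_def by blast
        then show ?case by simp
      qed
      then show "negligible_net (\<lambda>\<epsilon>. Tn' \<epsilon> (\<lambda>x. rep_gen_num a \<epsilon> * grep U \<epsilon> x) - rep_gen_num a \<epsilon> * Tn' \<epsilon> (grep U \<epsilon>))"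
        by (rule negligible_dom[OF negligible_zero])
    qed
    also have "\<dots> = abs_gen_num (rep_gen_num a) * T U"
      unfolding T_def by (rule abs_gen_num_mult[symmetric, OF rep_gen_num(2) fn(1)[OF mU]])
    finally show "T (gscale UNIV a U) = a * T U" by (simp add: rep_gen_num(1))
  next
    have "\<forall>f. smooth_on UNIV f \<longrightarrow> (\<forall>\<epsilon>\<in>{0<..1}. norm (Tn' \<epsilon> f) \<le> 1 * inverse (\<epsilon> ^ M) * sup_seminorm K j f)" using b' by simp
    then show "\<exists>Tn. defines_functional Tn T \<and> (\<exists>K j c (M::nat) \<eta>. compact K \<and> 0 < c \<and> \<eta> \<in> {0<..1} \<and>
         (\<forall>f. smooth_on UNIV f \<longrightarrow> (\<forall>\<epsilon>\<in>{0<..\<eta>}. norm (Tn \<epsilon> f) \<le> c * inverse (\<epsilon> ^ M) * sup_seminorm K j f)))"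
      using def K by (intro exI[of _ Tn'] conjI exI[of _ K] exI[of _ j] exI[of _ "1::real"] exI[of _ M]) auto
  qed
  then show ?thesis using that[of T] Tg Tg2 by simp
qed

section \<open>Ellipticity and growth conditions for nets\<close>

text \<open>At a fixed \<xi> the weight is controlled by the coefficients. Combined with
  \<open>weight_triangle\<close> this shows that negligible changes of the coefficients change the
  weight negligibly.\<close>

lemma weight_coeff_bound:
  fixes \<xi> :: "real^'n::finite"
  obtains C :: real where "C \<ge> 0" "\<And>q. weight m q \<xi> \<le> C * (\<Sum>\<beta> | mi_order \<beta> \<le> m. norm (q \<beta>))"
proof -
  define B where "B \<alpha> \<beta> = norm (\<Prod>i\<in>UNIV. of_nat (\<beta> i choose \<alpha> i) * rv \<xi> i ^ (\<beta> i - \<alpha> i))" for \<alpha> \<beta> :: "'n \<Rightarrow> nat"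
  let ?S = "{\<alpha> :: 'n \<Rightarrow> nat. mi_order \<alpha> \<le> m}"
  define D where "D = (\<Sum>\<alpha>\<in>?S. \<Sum>\<beta>\<in>?S. B \<alpha> \<beta>)"
  have B0: "0 \<le> B \<alpha> \<beta>" for \<alpha> \<beta> by (simp add: B_def)
  have "weight m q \<xi> \<le> (fact m ^ CARD('n) * D) * (\<Sum>\<beta>\<in>?S. norm (q \<beta>))" for q
  proof -
    have "norm (tayl m q (rv \<xi>) \<alpha>) \<le> (\<Sum>\<beta>\<in>?S. B \<alpha> \<beta>) * (\<Sum>\<beta>\<in>?S. norm (q \<beta>))" for \<alpha>
    proof -
      have "norm (tayl m q (rv \<xi>) \<alpha>) \<le> (\<Sum>\<beta>\<in>?S. norm (q \<beta>) * B \<alpha> \<beta>)"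
        unfolding tayl_def B_def norm_mult[symmetric] by (rule norm_sum)
      also have "\<dots> \<le> (\<Sum>\<beta>\<in>?S. (\<Sum>\<gamma>\<in>?S. norm (q \<gamma>)) * B \<alpha> \<beta>)"
        by (intro sum_mono mult_right_mono B0 member_le_sum finite_mi) auto
      finally show ?thesis unfolding sum_distrib_left[symmetric] by (simp add: mult.commute)
    qed
    then have "(\<Sum>\<alpha>\<in>?S. norm (tayl m q (rv \<xi>) \<alpha>)) \<le> D * (\<Sum>\<beta>\<in>?S. norm (q \<beta>))"
      unfolding D_def sum_distrib_right by (intro sum_mono) (simp add: sum_distrib_right)
    then show ?thesis
      using weight_le_sum_tayl[of m q \<xi>] by (smt (verit) mult.assoc mult_left_mono zero_le_power fact_ge_zero)
  qed
  moreover have "0 \<le> fact m ^ CARD('n) * D" unfolding D_def by (intro mult_nonneg_nonneg sum_nonneg B0) auto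
  ultimately show ?thesis by (rule that[rotated])
qed

lemma weight_triangle: "weight m q \<xi> \<le> weight m q' \<xi> + weight m (\<lambda>\<alpha>. q \<alpha> - q' \<alpha>) \<xi>"
proof -
  let ?S = "{\<alpha> :: 'a \<Rightarrow> nat. mi_order \<alpha> \<le> m}"
  let ?c = "\<lambda>\<alpha> :: 'a \<Rightarrow> nat. (\<Prod>i\<in>UNIV. fact (\<alpha> i)) :: real"
  let ?t = "\<lambda>q \<alpha>. norm (tayl m q (rv \<xi>) \<alpha>)"
  have d: "tayl m q (rv \<xi>) \<alpha> = tayl m q' (rv \<xi>) \<alpha> + tayl m (\<lambda>\<alpha>. q \<alpha> - q' \<alpha>) (rv \<xi>) \<alpha>" for \<alpha>
    by (simp add: tayl_def sum.distrib[symmetric] distrib_right[symmetric])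
  have c: "0 \<le> ?c \<alpha>" for \<alpha> by (intro prod_nonneg) auto
  have "L2_set (\<lambda>\<alpha>. ?c \<alpha> * ?t q \<alpha>) ?S \<le> L2_set (\<lambda>\<alpha>. ?c \<alpha> * ?t q' \<alpha> + ?c \<alpha> * ?t (\<lambda>\<alpha>. q \<alpha> - q' \<alpha>) \<alpha>) ?S"
    unfolding d[abs_def] distrib_left[symmetric]
    by (intro L2_set_mono mult_left_mono norm_triangle_ineq c mult_nonneg_nonneg norm_ge_zero)
  also have "\<dots> \<le> L2_set (\<lambda>\<alpha>. ?c \<alpha> * ?t q' \<alpha>) ?S + L2_set (\<lambda>\<alpha>. ?c \<alpha> * ?t (\<lambda>\<alpha>. q \<alpha> - q' \<alpha>) \<alpha>) ?S"
    by (rule L2_set_triangle_ineq)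
  finally show ?thesis by (simp add: weight_eq L2_set_def)
qed

lemma negligible_small:
  assumes "negligible_net (u :: real \<Rightarrow> 'a::real_normed_field)" "0 < (e :: real)"
  shows "\<forall>\<^sub>F \<epsilon> in at_right 0. norm (u \<epsilon>) \<le> e"
proof -
  have "\<forall>\<^sub>F \<epsilon> in at_right 0. norm (u \<epsilon>) \<le> \<epsilon> ^ 1" using assms(1) unfolding negligible_iff_ev by blast
  moreover have "\<forall>\<^sub>F \<epsilon> in at_right 0. \<epsilon> < e" by (rule eventually_at_rightI[of 0 e]) (use assms in auto)
  ultimately show ?thesis by eventually_elim simp
qed

text \<open>Invertibility gives W h = 1 up to a negligible net, with h moderate, hence W \<ge>
  \<epsilon>^N / 2 for the representative chosen by \<open>rep_gen_num\<close>. Passing to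
  \<open>Pn\<close> changes the weight only negligibly.\<close>

lemma elliptic_lower_bound:
  fixes P :: "('n::finite \<Rightarrow> nat) \<Rightarrow> complex gen_num"
  assumes rep: "poly_represents m Pn P" and inv: "gweight m P \<xi> dvd 1"
  obtains N :: nat where "\<forall>\<^sub>F \<epsilon> in at_right 0. \<epsilon> ^ N \<le> weight m (Pn \<epsilon>) \<xi>"
proof -
  let ?S = "{\<alpha> :: 'n \<Rightarrow> nat. mi_order \<alpha> \<le> m}"
  define W where "W \<epsilon> = weight m (\<lambda>\<alpha>. rep_gen_num (P \<alpha>) \<epsilon>) \<xi>" for \<epsilon>
  obtain C where C: "C \<ge> 0" "\<And>q. weight m q \<xi> \<le> C * (\<Sum>\<beta>\<in>?S. norm (q \<beta>))" by (rule weight_coeff_bound[of m \<xi>]) blast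
  have absw: "norm (weight m q \<xi>) \<le> norm (C * (\<Sum>\<beta>\<in>?S. norm (q \<beta>)))" for q
    using C(2)[of q] weight_nonneg[of m q \<xi>] by simp
  have mW: "moderate W"
    by (rule moderate_dom[of "\<lambda>\<epsilon>. C * (\<Sum>\<beta>\<in>?S. norm (rep_gen_num (P \<beta>) \<epsilon>))"])
       (intro moderate_mult moderate_const moderate_sum moderate_norm rep_gen_num always_eventually allI absw[folded W_def] | simp only: W_def absw)+
  have nd: "negligible_net (\<lambda>\<epsilon>. weight m (\<lambda>\<alpha>. rep_gen_num (P \<alpha>) \<epsilon> - Pn \<epsilon> \<alpha>) \<xi>)"
  proof (rule negligible_dom[of "\<lambda>\<epsilon>. C * (\<Sum>\<beta>\<in>?S. norm (rep_gen_num (P \<beta>) \<epsilon> - Pn \<epsilon> \<beta>))"])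
    have "negligible_net (\<lambda>\<epsilon>. rep_gen_num (P \<beta>) \<epsilon> - Pn \<epsilon> \<beta>)" if "\<beta> \<in> ?S" for \<beta>
      using rep that rep_gen_num[of "P \<beta>"] by (intro gen_num_eqD) (auto simp: poly_represents_def)
    then show "negligible_net (\<lambda>\<epsilon>. C * (\<Sum>\<beta>\<in>?S. norm (rep_gen_num (P \<beta>) \<epsilon> - Pn \<epsilon> \<beta>)))"
      by (intro negligible_mult moderate_const negligible_sum negligible_norm)
  qed (intro always_eventually allI absw)
  obtain g where "1 = gweight m P \<xi> * g" using inv by (rule dvdE)
  then have g: "abs_gen_num (\<lambda>_. 1) = abs_gen_num (\<lambda>\<epsilon>. W \<epsilon> * rep_gen_num g \<epsilon>)"
    using abs_gen_num_mult[OF mW rep_gen_num(2)[of g]]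
    by (simp add: rep_gen_num(1) gweight_def W_def[abs_def] one_gen_num_def)
  define h where "h = rep_gen_num g"
  have mh: "moderate h" unfolding h_def by (rule rep_gen_num)
  obtain N :: nat where N: "\<forall>\<^sub>F \<epsilon> in at_right 0. norm (h \<epsilon>) \<le> inverse (\<epsilon> ^ N)" using mh unfolding moderate_iff_ev by blast
  have "negligible_net (\<lambda>\<epsilon>. 1 - W \<epsilon> * h \<epsilon>)"
    unfolding h_def by (rule gen_num_eqD[OF g]) (intro moderate_const moderate_mult mW rep_gen_num)+
  then have n1: "\<forall>\<^sub>F \<epsilon> in at_right 0. norm (1 - W \<epsilon> * h \<epsilon>) \<le> 1 / 2" by (rule negligible_small) simp
  have n2: "\<forall>\<^sub>F \<epsilon> in at_right 0. norm (weight m (\<lambda>\<alpha>. rep_gen_num (P \<alpha>) \<epsilon> - Pn \<epsilon> \<alpha>) \<xi>) \<le> \<epsilon> ^ Suc N"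
    using nd unfolding negligible_iff_ev by blast
  \<comment> \<open>For \<epsilon> \<le> 1/4 the error \<epsilon>^(N+1) takes away at most half of
    \<epsilon>^N / 2, and what is left is still at least \<epsilon>^(N+1).\<close>
  have "\<forall>\<^sub>F \<epsilon> in at_right 0. \<epsilon> ^ Suc N \<le> weight m (Pn \<epsilon>) \<xi>"
    using N n1 n2 eventually_small eventually_inverse_ge[of 4]
  proof eventually_elim
    case (elim \<epsilon>)
    have W0: "0 \<le> W \<epsilon>" by (simp add: W_def weight_nonneg)
    have "1 / 2 \<le> W \<epsilon> * h \<epsilon>" using elim(2) unfolding real_norm_def by linarith
    also have "\<dots> \<le> W \<epsilon> * inverse (\<epsilon> ^ N)" using elim(1) W0 by (intro mult_left_mono) auto
    finally have "1 / 2 * \<epsilon> ^ N \<le> W \<epsilon>" using elim(4) by (simp add: field_simps)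
    moreover have "W \<epsilon> \<le> weight m (Pn \<epsilon>) \<xi> + \<epsilon> ^ Suc N"
      using weight_triangle[of m "\<lambda>\<alpha>. rep_gen_num (P \<alpha>) \<epsilon>" \<xi> "Pn \<epsilon>"] elim(3) by (simp add: W_def)
    moreover have "\<epsilon> ^ Suc N \<le> 1 / 4 * \<epsilon> ^ N"
      using elim(4,5) by (simp add: field_simps)
    ultimately show ?case by linarith
  qed
  then show ?thesis by (rule that)
qed

text \<open>The factor l stays with f because only the product is controlled: for l = 0 the supremum
  may be infinite while the product is 0.\<close>

lemma deriv_sup_dbound:
  assumes "open \<Omega>" "smooth_on \<Omega> f" "\<bar>deriv_sup \<Omega> k f * ereal l\<bar> \<le> ereal B" "0 \<le> l" "real q \<le> k"
  shows "dbound \<Omega> q (\<lambda>x. of_real l * f x) B"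
proof -
  have s: "smooth_on \<Omega> (\<lambda>x. of_real l * f x)" by (intro smooth_on_mult smooth_on_const assms)
  have "norm (mpd \<alpha> (\<lambda>x. of_real l * f x) x) \<le> B" if x: "x \<in> \<Omega>" "mi_order \<alpha> \<le> q" for \<alpha> x
  proof -
    have "ereal (norm (mpd \<alpha> f x)) \<le> deriv_sup \<Omega> k f"
      unfolding deriv_sup_def using x assms(5) by (intro SUP_upper2[of \<alpha>] SUP_upper2[of x]) auto
    then have "ereal (norm (mpd \<alpha> f x)) * ereal l \<le> deriv_sup \<Omega> k f * ereal l"
      using assms(4) by (intro ereal_mult_right_mono) auto
    also have "\<dots> \<le> \<bar>deriv_sup \<Omega> k f * ereal l\<bar>" by (cases "deriv_sup \<Omega> k f * ereal l") auto
    also note assms(3)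
    finally have "norm (mpd \<alpha> f x) * l \<le> B" by simp
    then show ?thesis
      unfolding mpd_eq_pds pds_cmult[OF assms(1,2) x(1)] using assms(4) by (simp add: norm_mult mult.commute mpd_eq_pds)
  qed
  then show ?thesis unfolding dbound_iff_mpd[OF assms(1) order_refl s] by blast
qed

text \<open>Proper derivatives gain a factor \<open>\<rho>\<close>; the function itself is handled by the mean value theorem.\<close>

lemma dbound_rescale:
  fixes g :: "real^'n::finite \<Rightarrow> complex" and B \<rho> e :: real
  assumes "open \<Omega>" "cball x0 (2 * \<rho>) \<subseteq> \<Omega>" "smooth_on \<Omega> g" "dbound \<Omega> (Suc q) g B" "0 < \<rho>" "\<rho> \<le> 1" "norm (g x0) \<le> e"
  shows "dbound (cball 0 2) (Suc q) (\<lambda>y. g (x0 + \<rho> *\<^sub>R y)) (e + 2 * CARD('n) * \<rho> * B)"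
  unfolding dbound_def
proof (intro allI ballI impI)
  fix "is" :: "'n list" and y :: "real^'n" assume y: "y \<in> cball 0 2" and l: "length is \<le> Suc q"
  let ?x = "x0 + \<rho> *\<^sub>R y"
  have x: "?x \<in> cball x0 (2 * \<rho>)" using y assms(5) by (simp add: dist_norm mult.commute)
  have x0: "x0 \<in> \<Omega>" using assms(2,5) by auto
  have B: "0 \<le> B" using norm_ge_zero dboundD0[OF assms(4) x0] by (rule order_trans)
  have e: "0 \<le> e" using norm_ge_zero assms(7) by (rule order_trans)
  show "norm (foldr pd is (\<lambda>y. g (x0 + \<rho> *\<^sub>R y)) y) \<le> e + 2 * CARD('n) * \<rho> * B"
  proof (cases "is")
    case Nil
    have dg: "(g has_derivative frechet_derivative g (at z)) (at z within cball x0 (2 * \<rho>))" if "z \<in> cball x0 (2 * \<rho>)" for z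
      using smooth_on_differentiable[OF assms(3)] that assms(2) frechet_derivative_works has_derivative_at_withinI by blast
    \<comment> \<open>The derivative is a combination of n partial derivatives, each at most B; this
      is the factor n of the statement. The factor 2 comes from |y| \<le> 2.\<close>
    have on: "onorm (frechet_derivative g (at z)) \<le> CARD('n) * B" if z: "z \<in> cball x0 (2 * \<rho>)" for z
    proof (rule onorm_le)
      fix h :: "real^'n"
      have lin: "linear (frechet_derivative g (at z))"
        using smooth_on_differentiable[OF assms(3)] z assms(2) linear_frechet_derivative by blast
      have "frechet_derivative g (at z) h = frechet_derivative g (at z) (\<Sum>i\<in>UNIV. h $ i *\<^sub>R axis i 1)"
        using basis_expansion[of h] by (simp add: scalar_mult_eq_scaleR)
      also have "\<dots> = (\<Sum>i\<in>UNIV. h $ i *\<^sub>R pd i g z)"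
        by (simp add: linear_sum[OF lin] linear_scale[OF lin] pd_def)
      also have "norm \<dots> \<le> (\<Sum>i\<in>(UNIV :: 'n set). norm h * B)"
      proof (rule sum_norm_le)
        fix i :: 'n
        have "norm (foldr pd [i] g z) \<le> B" by (rule dboundD[OF assms(4)]) (use z assms(2) in auto)
        then show "norm (h $ i *\<^sub>R pd i g z) \<le> norm h * B"
          using component_le_norm_cart[of h i] by (auto intro!: mult_mono)
      qed
      finally show "norm (frechet_derivative g (at z) h) \<le> CARD('n) * B * norm h" by (simp add: mult_ac)
    qed
    have "norm (g ?x - g x0) \<le> CARD('n) * B * norm (?x - x0)"
      by (rule differentiable_bound[OF convex_cball dg on x]) (use assms(5) in auto)
    also have "\<dots> \<le> CARD('n) * B * (2 * \<rho>)"
      using y assms(5) B by (intro mult_left_mono mult_nonneg_nonneg) auto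
    finally have "norm (g ?x - g x0) \<le> 2 * CARD('n) * \<rho> * B" by (simp add: mult_ac)
    moreover have "norm (g ?x) \<le> norm (g x0) + norm (g ?x - g x0)" by (rule norm_triangle_sub)
    ultimately show ?thesis using Nil assms(7) by simp
  next
    case (Cons i js)
    have "norm (foldr pd is (\<lambda>y. g (x0 + \<rho> *\<^sub>R y)) y) = \<rho> ^ length is * norm (foldr pd is g ?x)"
      using x assms(2,5) by (subst pds_affine[OF assms(1,3)]) (auto simp: norm_mult norm_power)
    also have "\<dots> \<le> \<rho> ^ 1 * B"
      using assms(5,6) x assms(2) l Cons by (intro mult_mono power_decreasing dboundD[OF assms(4)]) auto
    also have "\<dots> \<le> e + 2 * CARD('n) * \<rho> * B"
    proof -
      have "real 1 \<le> real CARD('n)" by (simp only: of_nat_le_iff) (simp add: Suc_leI)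
      then have "1 \<le> 2 * real CARD('n)" by linarith
      from mult_right_mono[OF this, of "\<rho> * B"] have "\<rho> * B \<le> (2 * CARD('n)) * (\<rho> * B)" using B assms(5) by simp
      then show ?thesis using e by (simp add: mult_ac)
    qed
    finally show ?thesis .
  qed
qed

section \<open>Nets of parametrices\<close>

lemma nnet_mult_diff:
  assumes "open \<Omega>" "nnet \<Omega> (\<lambda>\<epsilon> x. a \<epsilon> x - a' \<epsilon> x)" "nnet \<Omega> (\<lambda>\<epsilon> x. b \<epsilon> x - b' \<epsilon> x)" "mnet \<Omega> a'" "mnet \<Omega> b"
  shows "nnet \<Omega> (\<lambda>\<epsilon> x. a \<epsilon> x * b \<epsilon> x - a' \<epsilon> x * b' \<epsilon> x)"
proof -
  have "nnet \<Omega> (\<lambda>\<epsilon> x. b \<epsilon> x * (a \<epsilon> x - a' \<epsilon> x) + a' \<epsilon> x * (b \<epsilon> x - b' \<epsilon> x))"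
    by (rule nnet_add[OF assms(1) nnet_mult[OF assms(1,5,2)] nnet_mult[OF assms(1,4,3)]])
  then show ?thesis by (simp add: algebra_simps)
qed

lemma nnet_mD_diff:
  assumes "open \<Omega>" "nnet \<Omega> (\<lambda>\<epsilon> x. u \<epsilon> x - v \<epsilon> x)" "mnet \<Omega> u" "mnet \<Omega> v"
  shows "nnet \<Omega> (\<lambda>\<epsilon> x. mD \<alpha> (u \<epsilon>) x - mD \<alpha> (v \<epsilon>) x)"
  by (rule nnet_cong[OF assms(1) nnet_mD[OF assms(1,2)]])
     (rule mD_diff[symmetric, OF assms(1) mnetD[OF assms(3)] mnetD[OF assms(4)]])

text \<open>Counterpart of \<open>dbound_affine\<close> for the way back from y to x; the price
  |r|^j will be a power of 1/\<rho>, independent of \<epsilon>.\<close>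

lemma dbound_affine_expand:
  fixes K :: "(real^'n::finite) set"
  assumes "open U" "K \<subseteq> U" "smooth_on U f" "dbound K j f B" "1 \<le> \<bar>r\<bar>"
    and K': "\<And>y. y \<in> K' \<Longrightarrow> a + r *\<^sub>R y \<in> K"
  shows "dbound K' j (\<lambda>y. f (a + r *\<^sub>R y)) (\<bar>r\<bar> ^ j * B)"
  unfolding dbound_def
proof (intro allI ballI impI)
  fix "is" :: "'n list" and y assume y: "y \<in> K'" and l: "length is \<le> j"
  have "norm (foldr pd is (\<lambda>y. f (a + r *\<^sub>R y)) y) = \<bar>r\<bar> ^ length is * norm (foldr pd is f (a + r *\<^sub>R y))"
    using K'[OF y] assms(2) by (subst pds_affine[OF assms(1,3)]) (auto simp: norm_mult norm_power)
  also have "\<dots> \<le> \<bar>r\<bar> ^ j * B"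
    using assms(5) l by (intro mult_mono power_increasing dboundD[OF assms(4)] K' y) auto
  finally show "norm (foldr pd is (\<lambda>y. f (a + r *\<^sub>R y)) y) \<le> \<bar>r\<bar> ^ j * B" .
qed

text \<open>Fixes \<rho> and the representatives for all \<epsilon>. Smallness of the coefficients
  enters later through \<open>H_small\<close>, separately for each order of differentiation, because
  one half of the theorem provides it for a single order and the other half for all orders.\<close>

locale net_scheme =
  fixes m r T :: nat and x0 :: "real^'n::finite" and \<rho> cl cu :: real and \<theta> :: "real^'n \<Rightarrow> complex"
    and \<Omega> :: "(real^'n) set" and P :: "nat \<Rightarrow> ('n \<Rightarrow> nat) \<Rightarrow> complex gen_num" and c :: "nat \<Rightarrow> 'n gfun"
    and Pn :: "nat \<Rightarrow> real \<Rightarrow> ('n \<Rightarrow> nat) \<Rightarrow> complex" and cn :: "nat \<Rightarrow> 'n fnet" and l :: "nat \<Rightarrow> real \<Rightarrow> real"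
  assumes \<rho>: "0 < \<rho>" "\<rho> \<le> 1"
    and cl: "0 < cl" and cu: "0 < cu"
    and \<theta>: "smooth_on UNIV \<theta>" "supp2 \<theta>" "\<And>y. y \<in> cball 0 1 \<Longrightarrow> \<theta> y = 1"
    and lower: "\<And>q (\<xi> :: real^'n). \<exists>t\<in>{1..T}. \<forall>z. norm z = real t \<longrightarrow>
        cl * weight m q \<xi> \<le> norm (peval m q (\<lambda>i. rv \<xi> i + gam m z i))"
    and upper: "\<And>q (\<xi> :: real^'n) z. norm z \<le> real T \<Longrightarrow> norm (peval m q (\<lambda>i. rv \<xi> i + gam m z i)) \<le> cu * weight m q \<xi>"
    and \<Omega>: "open \<Omega>" "cball x0 (2 * \<rho>) \<subseteq> \<Omega>"
    and rep: "\<And>j. j \<in> {0..r} \<Longrightarrow> poly_represents m (Pn j) (P j)"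
    and c: "\<And>j. j \<in> {1..r} \<Longrightarrow> c j \<in> gfuns \<Omega>" and cn: "\<And>j. j \<in> {1..r} \<Longrightarrow> cn j \<in> c j"
    and dom: "\<And>j. j \<in> {1..r} \<Longrightarrow> weight_dominated m (Pn j) (Pn 0) (l j)"
    and ell: "\<exists>\<xi>. gweight m (P 0) \<xi> dvd 1"
begin

text \<open>A single number serves as number of roots of unity, as size of the frequency cube and as
  number of Neumann steps.\<close>

definition "Rn \<epsilon> = nat \<lceil>exp (1 / \<epsilon>)\<rceil>" for \<epsilon> :: real
definition "\<theta>x x = \<theta> ((1 / \<rho>) *\<^sub>R (x - x0))"
text \<open>The cut-off makes the coefficients global without changing them on the ball of radius
  \<rho>, where the equation is posed.\<close>

definition "csn j \<epsilon> x = \<theta>x x * cn j \<epsilon> x"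
definition "coefn \<alpha> \<epsilon> x = Pn 0 \<epsilon> \<alpha> + (\<Sum>j=1..r. csn j \<epsilon> x * Pn j \<epsilon> \<alpha>)"

text \<open>The assumptions of \<open>scheme\<close> are established for small \<epsilon> only, so
  they are kept as a predicate; solution nets, defined for all \<epsilon>, are set to 0 where it
  fails.\<close>

abbreviation "sch \<epsilon> \<equiv> scheme m r T x0 \<rho> cl cu \<theta> (\<lambda>j. Pn j \<epsilon>) (\<lambda>j. l j \<epsilon>) (\<lambda>j. csn j \<epsilon>) (Rn \<epsilon>)"
abbreviation "Hn \<epsilon> \<equiv> scheme.H m r T x0 \<rho> cl \<theta> (\<lambda>j. Pn j \<epsilon>) (\<lambda>j. csn j \<epsilon>) (Rn \<epsilon>)"
abbreviation "un \<epsilon> \<equiv> scheme.u m T x0 \<rho> cl (\<lambda>j. Pn j \<epsilon>) (Rn \<epsilon>) (Rn \<epsilon>)"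
abbreviation "pcoef \<equiv> perturbed_coeffs \<Omega> r c P"

section \<open>Truncation parameter and localised coefficients\<close>

lemma Rn_ge: "0 < \<epsilon> \<Longrightarrow> exp (1 / \<epsilon>) \<le> real (Rn \<epsilon>)"
  unfolding Rn_def by linarith

lemma Rn_pos: "0 < \<epsilon> \<Longrightarrow> 0 < Rn \<epsilon>"
  using Rn_ge[of \<epsilon>] exp_gt_zero[of "1 / \<epsilon>"] by linarith

lemma Rn_large: "\<forall>\<^sub>F \<epsilon> in at_right 0. M0 \<le> Rn \<epsilon>"
  using eventually_inverse_ge[of "real M0"] eventually_small
proof eventually_elim
  case (elim \<epsilon>)
  have "real M0 \<le> 1 / \<epsilon>" using elim by (simp add: inverse_eq_divide)
  also have "\<dots> \<le> exp (1 / \<epsilon>)" using exp_ge_add_one_self[of "1 / \<epsilon>"] by linarith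
  also have "\<dots> \<le> real (Rn \<epsilon>)" using elim by (intro Rn_ge) auto
  finally show ?case by simp
qed

lemma negligible_Rn: "negligible_net (\<lambda>\<epsilon>. 1 / (real (Rn \<epsilon>) + 1))"
  unfolding negligible_iff_ev
proof
  fix q :: nat
  have "\<forall>\<^sub>F x :: real in at_top. x ^ q / exp x < 1" by (rule order_tendstoD(2)[OF tendsto_power_div_exp_0]) simp
  then have "\<forall>\<^sub>F \<epsilon> in at_right 0. inverse \<epsilon> ^ q / exp (inverse \<epsilon> :: real) < 1"
    by (rule eventually_compose_filterlim[OF _ filterlim_inverse_at_top_right])
  then show "\<forall>\<^sub>F \<epsilon> in at_right 0. norm (1 / (real (Rn \<epsilon>) + 1)) \<le> \<epsilon> ^ q"
    using eventually_small
  proof eventually_elim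
    case (elim \<epsilon>)
    have "1 / (real (Rn \<epsilon>) + 1) \<le> 1 / (1 / \<epsilon>) ^ q"
      using elim Rn_ge[of \<epsilon>] by (intro divide_left_mono) (auto simp: inverse_eq_divide divide_less_eq)
    then show ?case using elim by (simp add: power_one_over)
  qed
qed

lemma negligible_over_Rn: "moderate (A :: real \<Rightarrow> real) \<Longrightarrow> negligible_net (\<lambda>\<epsilon>. A \<epsilon> / (real (Rn \<epsilon>) + 1))"
  using negligible_mult[OF _ negligible_Rn, of A] by simp

lemma \<theta>x_eq: "\<theta>x = (\<lambda>x. \<theta> ((- (1 / \<rho>) *\<^sub>R x0) + (1 / \<rho>) *\<^sub>R x))"
  by (simp add: \<theta>x_def[abs_def] scaleR_diff_right)

lemma smooth_\<theta>x: "smooth_on UNIV \<theta>x"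
  unfolding \<theta>x_eq by (rule smooth_on_shift[OF \<theta>(1)])

lemma norm_rescaled: "norm ((1 / \<rho>) *\<^sub>R (x - x0)) = dist x0 x / \<rho>"
  using \<rho> by (simp add: dist_norm norm_minus_commute)

lemma \<theta>x_1: "dist x0 x \<le> \<rho> \<Longrightarrow> \<theta>x x = 1"
  unfolding \<theta>x_def by (rule \<theta>(3)) (simp only: mem_cball dist_0_norm norm_rescaled, use \<rho> in \<open>simp add: divide_le_eq\<close>)

lemma \<theta>x_0: "x \<notin> cball x0 (2 * \<rho>) \<Longrightarrow> \<theta>x x = 0"
  unfolding \<theta>x_def using \<theta>(2)[rule_format, of "(1 / \<rho>) *\<^sub>R (x - x0)"] \<rho>
  by (simp only: mem_cball dist_0_norm norm_rescaled) (simp add: divide_le_eq)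

lemma \<theta>x_scaled: "\<theta>x (x0 + \<rho> *\<^sub>R y) = \<theta> y"
  using \<rho> by (simp add: \<theta>x_def)

lemma mnet_cn: "j \<in> {1..r} \<Longrightarrow> mnet \<Omega> (cn j)"
  by (rule gfuns_mem(1)[OF \<Omega>(1) c cn])

lemma mnet_csn: "j \<in> {1..r} \<Longrightarrow> mnet UNIV (csn j)"
  unfolding csn_def[abs_def]
  by (rule mnet_cutoff[OF \<Omega>(1) compact_cball \<Omega>(2) smooth_\<theta>x \<theta>x_0 mnet_cn])

section \<open>Representatives of the operator and of its transpose\<close>

lemma moderate_Pn: "j \<in> {0..r} \<Longrightarrow> mi_order \<alpha> \<le> m \<Longrightarrow> moderate (\<lambda>\<epsilon>. Pn j \<epsilon> \<alpha>)"
  using rep[of j] by (simp add: poly_represents_def)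

lemma negligible_Pn:
  assumes "j \<in> {0..r}" "mi_order \<alpha> \<le> m" shows "negligible_net (\<lambda>\<epsilon>. rep_gen_num (P j \<alpha>) \<epsilon> - Pn j \<epsilon> \<alpha>)"
  using rep[OF assms(1)] assms(2) rep_gen_num[of "P j \<alpha>"] by (intro gen_num_eqD) (auto simp: poly_represents_def)

lemma mnet_coefn: "mi_order \<alpha> \<le> m \<Longrightarrow> mnet UNIV (coefn \<alpha>)"
  unfolding coefn_def[abs_def]
  by (intro mnet_add mnet_sum mnet_mult mnet_const open_UNIV moderate_Pn mnet_csn) auto

text \<open>The representatives from the growth hypotheses may replace those chosen by
  \<open>rep_gen_num\<close> and \<open>grep\<close>, the differences being negligible; on this ball
  the cut-off is 1.\<close>

lemma pcoef_class:
  assumes \<alpha>: "mi_order \<alpha> \<le> m"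
  shows "grestrict (ball x0 \<rho>) (pcoef \<alpha>) = gcls (ball x0 \<rho>) (coefn \<alpha>)"
proof -
  let ?B = "ball x0 \<rho>"
  have sub: "?B \<subseteq> \<Omega>" using \<Omega>(2) \<rho> by auto
  let ?p = "\<lambda>\<epsilon> x. rep_gen_num (P 0 \<alpha>) \<epsilon> + (\<Sum>j=1..r. grep (c j) \<epsilon> x * rep_gen_num (P j \<alpha>) \<epsilon>)"
  have mp: "mnet \<Omega> ?p"
    by (intro mnet_add mnet_sum mnet_mult mnet_const \<Omega>(1) rep_gen_num gfuns_rep(2)[OF \<Omega>(1) c]) auto
  have d: "nnet ?B (\<lambda>\<epsilon> x. grep (c j) \<epsilon> x * rep_gen_num (P j \<alpha>) \<epsilon> - csn j \<epsilon> x * Pn j \<epsilon> \<alpha>)" if j: "j \<in> {1..r}" for j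
  proof (rule nnet_mult_diff[OF open_ball])
    have "nnet ?B (\<lambda>\<epsilon> x. grep (c j) \<epsilon> x - cn j \<epsilon> x)"
      by (rule nnet_subset[OF gfuns_mem(3)[OF \<Omega>(1) c cn] sub]) (use j in auto)
    then show "nnet ?B (\<lambda>\<epsilon> x. grep (c j) \<epsilon> x - csn j \<epsilon> x)"
      by (rule nnet_cong[OF open_ball]) (simp add: csn_def \<theta>x_1)
    show "nnet ?B (\<lambda>\<epsilon> x. rep_gen_num (P j \<alpha>) \<epsilon> - Pn j \<epsilon> \<alpha>)"
      by (rule nnet_const[OF open_ball negligible_Pn[OF _ \<alpha>]]) (use j in auto)
    show "mnet ?B (csn j)" by (rule mnet_subset[OF mnet_csn[OF j] subset_UNIV])
    show "mnet ?B (\<lambda>\<epsilon> x. rep_gen_num (P j \<alpha>) \<epsilon>)" by (rule mnet_const[OF open_ball rep_gen_num(2)])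
  qed
  have "nnet ?B (\<lambda>\<epsilon> x. (rep_gen_num (P 0 \<alpha>) \<epsilon> - Pn 0 \<epsilon> \<alpha>) +
      (\<Sum>j=1..r. grep (c j) \<epsilon> x * rep_gen_num (P j \<alpha>) \<epsilon> - csn j \<epsilon> x * Pn j \<epsilon> \<alpha>))"
    by (rule nnet_add[OF open_ball nnet_const[OF open_ball negligible_Pn[OF _ \<alpha>]] nnet_sum[OF open_ball d]]) auto
  then have "nnet ?B (\<lambda>\<epsilon> x. ?p \<epsilon> x - coefn \<alpha> \<epsilon> x)"
    by (rule nnet_cong[OF open_ball]) (simp add: coefn_def sum_subtractf)
  then have "gcls ?B ?p = gcls ?B (coefn \<alpha>)" by (rule gcls_eq[OF open_ball mnet_subset[OF mp sub]])
  then show ?thesis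
    unfolding perturbed_coeffs_def grestrict_gcls[OF \<Omega>(1) open_ball sub mp] .
qed

text \<open>\<open>diff_op\<close> works with representatives chosen by \<open>grep\<close> on the
  ball. Products and derivatives respect negligible differences, so explicit global nets may take
  their place; \<open>transposed_op_class\<close> does the same for the transpose.\<close>

lemma diff_op_class:
  assumes u: "mnet UNIV u"
  shows "diff_op (ball x0 \<rho>) m (\<lambda>\<alpha>. grestrict (ball x0 \<rho>) (pcoef \<alpha>)) (grestrict (ball x0 \<rho>) (gcls UNIV u)) =
    gcls (ball x0 \<rho>) (\<lambda>\<epsilon> x. \<Sum>\<alpha> | mi_order \<alpha> \<le> m. coefn \<alpha> \<epsilon> x * mD \<alpha> (u \<epsilon>) x)" (is "_ = gcls ?B ?rhs")
    and "mnet UNIV (\<lambda>\<epsilon> x. \<Sum>\<alpha> | mi_order \<alpha> \<le> m. coefn \<alpha> \<epsilon> x * mD \<alpha> (u \<epsilon>) x)"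
proof -
  show m: "mnet UNIV ?rhs" by (intro mnet_sum mnet_mult mnet_mD mnet_coefn u open_UNIV) auto
  have uB: "mnet ?B u" by (rule mnet_subset[OF u subset_UNIV])
  note g = grep_gcls[OF open_ball uB]
  have "nnet ?B (\<lambda>\<epsilon> x. \<Sum>\<alpha> | mi_order \<alpha> \<le> m.
      coefn \<alpha> \<epsilon> x * mD \<alpha> (u \<epsilon>) x - grep (gcls ?B (coefn \<alpha>)) \<epsilon> x * mD \<alpha> (grep (gcls ?B u) \<epsilon>) x)"
  proof (rule nnet_sum[OF open_ball])
    fix \<alpha> :: "'n \<Rightarrow> nat" assume "\<alpha> \<in> {\<alpha>. mi_order \<alpha> \<le> m}"
    then have cB: "mnet ?B (coefn \<alpha>)" using mnet_subset[OF mnet_coefn subset_UNIV] by simp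
    note gc = grep_gcls[OF open_ball cB]
    have "nnet ?B (\<lambda>\<epsilon> x. grep (gcls ?B (coefn \<alpha>)) \<epsilon> x * mD \<alpha> (grep (gcls ?B u) \<epsilon>) x - coefn \<alpha> \<epsilon> x * mD \<alpha> (u \<epsilon>) x)"
      by (rule nnet_mult_diff[OF open_ball gc(2) nnet_mD_diff[OF open_ball g(2,1) uB] cB mnet_mD[OF open_ball g(1)]])
    from nnet_minus[OF open_ball this]
    show "nnet ?B (\<lambda>\<epsilon> x. coefn \<alpha> \<epsilon> x * mD \<alpha> (u \<epsilon>) x - grep (gcls ?B (coefn \<alpha>)) \<epsilon> x * mD \<alpha> (grep (gcls ?B u) \<epsilon>) x)"
      by simp
  qed
  then have n: "nnet ?B (\<lambda>\<epsilon> x. ?rhs \<epsilon> x - (\<Sum>\<alpha> | mi_order \<alpha> \<le> m. grep (grestrict ?B (pcoef \<alpha>)) \<epsilon> x * mD \<alpha> (grep (gcls ?B u) \<epsilon>) x))"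
    by (rule nnet_cong[OF open_ball]) (simp add: pcoef_class sum_subtractf)
  show "diff_op ?B m (\<lambda>\<alpha>. grestrict ?B (pcoef \<alpha>)) (grestrict ?B (gcls UNIV u)) = gcls ?B ?rhs"
    unfolding diff_op_def grestrict_gcls[OF open_UNIV open_ball subset_UNIV u]
    by (rule gcls_eq[symmetric, OF open_ball mnet_subset[OF m subset_UNIV] n])
qed

lemma transposed_op_class:
  assumes u: "mnet UNIV u"
  shows "transposed_op (ball x0 \<rho>) m (\<lambda>\<alpha>. grestrict (ball x0 \<rho>) (pcoef \<alpha>)) (gcls (ball x0 \<rho>) u) =
    gcls (ball x0 \<rho>) (\<lambda>\<epsilon> x. \<Sum>\<alpha> | mi_order \<alpha> \<le> m. (- 1) ^ mi_order \<alpha> * mD \<alpha> (\<lambda>x. coefn \<alpha> \<epsilon> x * u \<epsilon> x) x)" (is "_ = gcls ?B ?rhs")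
    and "mnet UNIV (\<lambda>\<epsilon> x. \<Sum>\<alpha> | mi_order \<alpha> \<le> m. (- 1) ^ mi_order \<alpha> * mD \<alpha> (\<lambda>x. coefn \<alpha> \<epsilon> x * u \<epsilon> x) x)"
proof -
  have mprod: "mnet UNIV (\<lambda>\<epsilon> x. coefn \<alpha> \<epsilon> x * u \<epsilon> x)" if "mi_order \<alpha> \<le> m" for \<alpha>
    by (rule mnet_mult[OF open_UNIV mnet_coefn[OF that] u])
  show m: "mnet UNIV ?rhs"
    by (intro mnet_sum[OF open_UNIV] mnet_mult[OF open_UNIV mnet_const[OF open_UNIV moderate_const]] mnet_mD[OF open_UNIV mprod]) auto
  have uB: "mnet ?B u" by (rule mnet_subset[OF u subset_UNIV])
  note g = grep_gcls[OF open_ball uB]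
  have "nnet ?B (\<lambda>\<epsilon> x. \<Sum>\<alpha> | mi_order \<alpha> \<le> m. (- 1) ^ mi_order \<alpha> *
      (mD \<alpha> (\<lambda>x. coefn \<alpha> \<epsilon> x * u \<epsilon> x) x - mD \<alpha> (\<lambda>x. grep (gcls ?B (coefn \<alpha>)) \<epsilon> x * grep (gcls ?B u) \<epsilon> x) x))"
  proof (rule nnet_sum[OF open_ball])
    fix \<alpha> :: "'n \<Rightarrow> nat" assume "\<alpha> \<in> {\<alpha>. mi_order \<alpha> \<le> m}"
    then have cB: "mnet ?B (coefn \<alpha>)" using mnet_subset[OF mnet_coefn subset_UNIV] by simp
    note gc = grep_gcls[OF open_ball cB]
    have "nnet ?B (\<lambda>\<epsilon> x. grep (gcls ?B (coefn \<alpha>)) \<epsilon> x * grep (gcls ?B u) \<epsilon> x - coefn \<alpha> \<epsilon> x * u \<epsilon> x)"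
      by (rule nnet_mult_diff[OF open_ball gc(2) g(2) cB g(1)])
    from nnet_minus[OF open_ball this]
    have d: "nnet ?B (\<lambda>\<epsilon> x. coefn \<alpha> \<epsilon> x * u \<epsilon> x - grep (gcls ?B (coefn \<alpha>)) \<epsilon> x * grep (gcls ?B u) \<epsilon> x)" by simp
    show "nnet ?B (\<lambda>\<epsilon> x. (- 1) ^ mi_order \<alpha> *
      (mD \<alpha> (\<lambda>x. coefn \<alpha> \<epsilon> x * u \<epsilon> x) x - mD \<alpha> (\<lambda>x. grep (gcls ?B (coefn \<alpha>)) \<epsilon> x * grep (gcls ?B u) \<epsilon> x) x))"
      by (rule nnet_mult[OF open_ball mnet_const[OF open_ball moderate_const]
            nnet_mD_diff[OF open_ball d mnet_mult[OF open_ball cB uB] mnet_mult[OF open_ball gc(1) g(1)]]])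
  qed
  then have n: "nnet ?B (\<lambda>\<epsilon> x. ?rhs \<epsilon> x - (\<Sum>\<alpha> | mi_order \<alpha> \<le> m. (- 1) ^ mi_order \<alpha> *
      mD \<alpha> (\<lambda>x. grep (grestrict ?B (pcoef \<alpha>)) \<epsilon> x * grep (gcls ?B u) \<epsilon> x) x))"
    by (rule nnet_cong[OF open_ball]) (simp add: pcoef_class sum_subtractf right_diff_distrib)
  show "transposed_op ?B m (\<lambda>\<alpha>. grestrict ?B (pcoef \<alpha>)) (gcls ?B u) = gcls ?B ?rhs"
    unfolding transposed_op_def by (rule gcls_eq[symmetric, OF open_ball mnet_subset[OF m subset_UNIV] n])
qed

text \<open>The weight of P_0 is at least \<epsilon>^N at one real point. By
  \<open>weight_shift\<close> it is then positive at every real point, and at the frequencies k /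
  \<rho> the loss is only \<open>wt k ^ m\<close>, which gives w.\<close>

lemma eventually_scheme:
  obtains w where "moderate (\<lambda>\<epsilon>. 1 / w \<epsilon>)"
    "\<forall>\<^sub>F \<epsilon> in at_right 0. sch \<epsilon> \<and> 0 < w \<epsilon> \<and> (\<forall>k. w \<epsilon> \<le> wt k ^ m * weight m (Pn 0 \<epsilon>) (\<chi> i. of_int (k i) / \<rho>))"
proof -
  obtain \<xi>0 where \<xi>0: "gweight m (P 0) \<xi>0 dvd 1" using ell by blast
  have r0: "0 \<in> {0..r}" by simp
  obtain N :: nat where N: "\<forall>\<^sub>F \<epsilon> in at_right 0. \<epsilon> ^ N \<le> weight m (Pn 0 \<epsilon>) \<xi>0"
    by (rule elliptic_lower_bound[OF rep[OF r0] \<xi>0])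
  obtain C where C: "C > 0" "\<And>q (\<xi> :: real^'n) \<xi>0 H. 1 \<le> H \<Longrightarrow> (\<And>i. \<bar>\<xi>0 $ i - \<xi> $ i\<bar> \<le> H) \<Longrightarrow>
    weight m q \<xi>0 \<le> C * H ^ m * weight m q \<xi>" by (rule weight_shift[of m]) blast
  \<comment> \<open>Chosen so that every coordinate of \<xi>0 - k / \<rho> is at most
    \<open>h * wt k\<close> in modulus.\<close>
  define h where "h = norm \<xi>0 + 1 / \<rho> + 1"
  have h: "h \<ge> 1" using \<rho> by (simp add: h_def)
  define w where "w \<epsilon> = \<epsilon> ^ N / (C * h ^ m)" for \<epsilon> :: real
  have "moderate (\<lambda>\<epsilon>::real. inverse (\<epsilon> ^ N))"
    unfolding moderate_iff_ev by (intro exI[of _ N]) (use eventually_small in eventually_elim, simp)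
  then have "moderate (\<lambda>\<epsilon>. (C * h ^ m) * inverse (\<epsilon> ^ N))" by (intro moderate_mult moderate_const)
  then have mw: "moderate (\<lambda>\<epsilon>. 1 / w \<epsilon>)" by (simp add: w_def divide_inverse mult_ac)
  have "\<forall>\<^sub>F \<epsilon> in at_right 0. sch \<epsilon> \<and> 0 < w \<epsilon> \<and> (\<forall>k. w \<epsilon> \<le> wt k ^ m * weight m (Pn 0 \<epsilon>) (\<chi> i. of_int (k i) / \<rho>))"
    using N eventually_small
  proof eventually_elim
    case (elim \<epsilon>)
    then have e: "\<epsilon> \<in> {0<..1}" by simp
    have pos: "0 < weight m (Pn 0 \<epsilon>) \<xi>" for \<xi>
    proof -
      have "weight m (Pn 0 \<epsilon>) \<xi>0 \<le> C * (1 + norm (\<xi>0 - \<xi>)) ^ m * weight m (Pn 0 \<epsilon>) \<xi>"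
      proof (rule C(2))
        fix i show "\<bar>\<xi>0 $ i - \<xi> $ i\<bar> \<le> 1 + norm (\<xi>0 - \<xi>)" using component_le_norm_cart[of "\<xi>0 - \<xi>" i] by simp
      qed simp
      moreover have "0 < weight m (Pn 0 \<epsilon>) \<xi>0" using elim by (auto intro: less_le_trans[of _ "\<epsilon> ^ N"])
      ultimately have "0 < C * (1 + norm (\<xi>0 - \<xi>)) ^ m * weight m (Pn 0 \<epsilon>) \<xi>" by linarith
      moreover have "0 < C * (1 + norm (\<xi>0 - \<xi>)) ^ m" using C(1) by (intro mult_pos_pos zero_less_power add_pos_nonneg) auto
      ultimately show ?thesis using zero_less_mult_pos by blast
    qed
    have "w \<epsilon> \<le> wt k ^ m * weight m (Pn 0 \<epsilon>) (\<chi> i. of_int (k i) / \<rho>)" for k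
    proof -
      have "weight m (Pn 0 \<epsilon>) \<xi>0 \<le> C * (h * wt k) ^ m * weight m (Pn 0 \<epsilon>) (\<chi> i. of_int (k i) / \<rho>)"
      proof (rule C(2))
        show "1 \<le> h * wt k" using mult_mono[OF h wt_ge_1[of k]] h by simp
        fix i
        have 1: "\<bar>\<xi>0 $ i\<bar> \<le> norm \<xi>0" by (rule component_le_norm_cart)
        have 2: "\<bar>real_of_int (k i)\<bar> / \<rho> \<le> wt k / \<rho>" using abs_le_wt[of k i] \<rho> by (intro divide_right_mono) auto
        have 3: "norm \<xi>0 * 1 \<le> norm \<xi>0 * wt k" using wt_ge_1[of k] by (intro mult_left_mono) auto
        have "\<bar>\<xi>0 $ i - real_of_int (k i) / \<rho>\<bar> \<le> \<bar>\<xi>0 $ i\<bar> + \<bar>real_of_int (k i) / \<rho>\<bar>" by (rule abs_triangle_ineq4)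
        also have "\<bar>real_of_int (k i) / \<rho>\<bar> = \<bar>real_of_int (k i)\<bar> / \<rho>" using \<rho> by simp
        also have "\<bar>\<xi>0 $ i\<bar> + \<bar>real_of_int (k i)\<bar> / \<rho> \<le> h * wt k"
          using 1 2 3 wt_ge_1[of k] by (simp add: h_def distrib_right)
        finally show "\<bar>\<xi>0 $ i - (\<chi> i. real_of_int (k i) / \<rho>) $ i\<bar> \<le> h * wt k" by simp
      qed
      then have "\<epsilon> ^ N \<le> (C * h ^ m) * (wt k ^ m * weight m (Pn 0 \<epsilon>) (\<chi> i. of_int (k i) / \<rho>))"
        using elim(1) by (simp add: power_mult_distrib mult_ac)
      then show ?thesis using C(1) h by (simp add: w_def divide_le_eq mult_ac zero_less_power)
    qed
    moreover have "0 < w \<epsilon>" using elim C(1) h by (simp add: w_def zero_less_power)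
    moreover have "sch \<epsilon>"
    proof -
      have "csn j \<epsilon> x = 0" if "2 * \<rho> < dist x0 x" for j x using \<theta>x_0[of x] that by (simp add: csn_def)
      then show ?thesis
        by unfold_locales
          (use \<rho> cl cu \<theta> lower upper pos e dom mnetD[OF mnet_csn e] Rn_pos[of \<epsilon>] in \<open>auto simp: weight_dominated_def\<close>)
    qed
    ultimately show ?case by blast
  qed
  then show ?thesis using mw that by blast
qed

text \<open>The allowance \<tau> is shared equally: one half for the discretised mean, which is met
  once \<open>Rn \<epsilon>\<close> is large, the other for the coefficients, whose bound \<kappa>
  is prescribed in advance.\<close>

lemma H_small:
  assumes B\<theta>: "dbound (cball 0 2) q \<theta> B\<theta>" "0 \<le> B\<theta>" and \<tau>: "0 < \<tau>"
    and \<kappa>: "real r * (2 ^ q * (2 ^ q * B\<theta> * \<kappa>) * ((cu / cl) * exbd TYPE('n) m T q)) \<le> \<tau> / 2"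
    and small: "\<And>j. j \<in> {1..r} \<Longrightarrow> \<forall>\<^sub>F \<epsilon> in at_right 0. dbound (cball 0 2) q (\<lambda>y. of_real (l j \<epsilon>) * cn j \<epsilon> (x0 + \<rho> *\<^sub>R y)) \<kappa>"
  shows "\<forall>\<^sub>F \<epsilon> in at_right 0. \<forall>k. dbound (cball 0 2) q (Hn \<epsilon> k) \<tau>"
proof -
  define a where "a = \<tau> / (2 * (2 ^ q * B\<theta> + 1))"
  have pB: "0 < 2 ^ q * B\<theta> + 1" using B\<theta>(2) by (intro add_nonneg_pos) auto
  have a: "0 < a" using \<tau> pB by (simp add: a_def)
  have "z * (\<tau> / (2 * z)) = \<tau> / 2" if "0 < z" for z :: real using that by simp
  from this[OF pB] have "(2 ^ q * B\<theta> + 1) * a = \<tau> / 2" unfolding a_def .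
  then have aa: "2 ^ q * B\<theta> * a \<le> \<tau> / 2" using a by (simp add: distrib_right)
  obtain M0 where M0: "\<And>M \<rho> t. M0 \<le> M \<Longrightarrow> 0 < M \<Longrightarrow> \<bar>\<rho>\<bar> \<le> 1 \<Longrightarrow> t \<in> {1..T} \<Longrightarrow> dbound (cball (0 :: real^'n) 2) q (\<lambda>y. gavg m M \<rho> t y - 1) a"
    by (rule gavg_tendsto_1[OF a, where m = m and T = T and q = q]) (rule that, blast)
  obtain w where w: "\<forall>\<^sub>F \<epsilon> in at_right 0. sch \<epsilon> \<and> 0 < w \<epsilon> \<and> (\<forall>k. w \<epsilon> \<le> wt k ^ m * weight m (Pn 0 \<epsilon>) (\<chi> i. of_int (k i) / \<rho>))"
    using eventually_scheme by blast
  have "\<forall>\<^sub>F \<epsilon> in at_right 0. \<forall>j\<in>{1..r}. dbound (cball 0 2) q (\<lambda>y. of_real (l j \<epsilon>) * cn j \<epsilon> (x0 + \<rho> *\<^sub>R y)) \<kappa>"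
    using small by (simp add: eventually_ball_finite)
  then show ?thesis using w eventually_small Rn_large[of M0]
  proof eventually_elim
    case (elim \<epsilon>)
    then have e: "\<epsilon> \<in> {0<..1}" by simp
    interpret scheme m r T x0 \<rho> cl cu \<theta> "\<lambda>j. Pn j \<epsilon>" "\<lambda>j. l j \<epsilon>" "\<lambda>j. csn j \<epsilon>" "Rn \<epsilon>" "Rn \<epsilon>" using elim by blast
    let ?U = "{y. x0 + \<rho> *\<^sub>R y \<in> \<Omega>}"
    have U: "open ?U" by (rule open_vimage[OF \<Omega>(1), unfolded vimage_def]) (intro continuous_intros)
    have cU: "cball 0 2 \<subseteq> ?U"
    proof
      fix y :: "real^'n" assume "y \<in> cball 0 2"
      then have "x0 + \<rho> *\<^sub>R y \<in> cball x0 (2 * \<rho>)" using \<rho> by (simp add: dist_norm mult.commute)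
      then show "y \<in> ?U" using \<Omega>(2) by blast
    qed
    have "dbound (cball 0 2) q (\<lambda>y. of_real (l j \<epsilon>) * ch j y) (2 ^ q * B\<theta> * \<kappa>)" if j: "j \<in> {1..r}" for j
    proof (rule dbound_cong[OF U cU])
      show "dbound (cball 0 2) q (\<lambda>y. \<theta> y * (of_real (l j \<epsilon>) * cn j \<epsilon> (x0 + \<rho> *\<^sub>R y))) (2 ^ q * B\<theta> * \<kappa>)"
        by (rule dbound_mult[OF U cU smooth_on_subset[OF \<theta>(1) subset_UNIV] smooth_on_mult[OF U smooth_on_const[OF U]] B\<theta>(1)])
           (use elim(1) j smooth_on_affine[OF \<Omega>(1) mnetD[OF mnet_cn[OF j] e]] in auto)
    qed (simp add: ch_def csn_def \<theta>x_scaled)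
    then have *: "dbound (cball 0 2) q (Hn \<epsilon> k) (2 ^ q * B\<theta> * a + real r * (2 ^ q * (2 ^ q * B\<theta> * \<kappa>) * ((cu / cl) * exbd TYPE('n) m T q)))" for k
      by (intro dbound_H B\<theta> M0) (use elim Rn_pos[of \<epsilon>] \<rho> in auto)
    show ?case using dbound_mono[OF * order_refl order_refl add_mono[OF aa \<kappa>]] by simp
  qed
qed

lemma smooth_rescaled: "smooth_on UNIV g \<Longrightarrow> smooth_on UNIV (\<lambda>x. g ((1 / \<rho>) *\<^sub>R (x - x0)))"
  using smooth_on_shift[of g "- (1 / \<rho>) *\<^sub>R x0" "1 / \<rho>"] by (simp add: scaleR_diff_right)

lemma dbound_rescaled:
  obtains C where "0 \<le> C" "\<And>g B K. smooth_on UNIV g \<Longrightarrow> dbound (cball 0 2) N g B \<Longrightarrow>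
    dbound K N (\<lambda>x. \<theta>x x * g ((1 / \<rho>) *\<^sub>R (x - x0))) (C * B)"
proof -
  obtain B\<theta> where B\<theta>: "B\<theta> > 0" "dbound (cball 0 2) N \<theta> B\<theta>"
    by (rule dbound_exists[OF open_UNIV compact_cball subset_UNIV \<theta>(1)])
  have "dbound K N (\<lambda>x. \<theta>x x * g ((1 / \<rho>) *\<^sub>R (x - x0))) ((1 / \<rho>) ^ N * 2 ^ N * B\<theta> * B)"
    if g: "smooth_on UNIV g" and B: "dbound (cball 0 2) N g B" for g B K
  proof -
    have B0: "0 \<le> B" by (rule dbound_nonneg[OF B, of 0]) simp
    have s: "smooth_on UNIV (\<lambda>y. \<theta> y * g y)" by (rule smooth_on_mult[OF open_UNIV \<theta>(1) g])
    have "dbound (cball 0 2) N (\<lambda>y. \<theta> y * g y) (2 ^ N * B\<theta> * B)"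
      by (rule dbound_mult[OF open_UNIV subset_UNIV \<theta>(1) g B\<theta>(2) B])
    then have "dbound UNIV N (\<lambda>y. \<theta> y * g y) \<bar>2 ^ N * B\<theta> * B\<bar>"
      by (rule dbound_extend_zero[OF closed_cball, rotated]) (use \<theta>(2) in simp)
    then have "dbound UNIV N (\<lambda>y. \<theta> y * g y) (2 ^ N * B\<theta> * B)" using B0 B\<theta>(1) by (simp add: abs_mult)
    then have "dbound K N (\<lambda>x. (\<lambda>y. \<theta> y * g y) ((- (1 / \<rho>) *\<^sub>R x0) + (1 / \<rho>) *\<^sub>R x)) (\<bar>1 / \<rho>\<bar> ^ N * (2 ^ N * B\<theta> * B))"
      by (rule dbound_affine_expand[OF open_UNIV subset_UNIV s]) (use \<rho> in auto)
    then show ?thesis using \<rho> by (simp add: \<theta>x_def scaleR_diff_right mult.assoc)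
  qed
  moreover have "0 \<le> (1 / \<rho>) ^ N * 2 ^ N * B\<theta>" using \<rho> B\<theta> by simp
  ultimately show ?thesis by (rule that[rotated])
qed

lemma dbound_shrunk:
  assumes "smooth_on UNIV f" "dbound (cball x0 (2 * \<rho>)) j f B"
  shows "dbound (cball 0 2) j (\<lambda>y. f (x0 + \<rho> *\<^sub>R y)) B"
  by (rule dbound_affine[OF open_UNIV subset_UNIV assms]) (use \<rho> in \<open>auto simp: dist_norm mult.commute\<close>)

section \<open>Solutions as functionals and as generalized functions\<close>

lemma mD_zero_outside:
  assumes "\<And>x. a < dist x0 x \<Longrightarrow> f x = 0" "a < dist x0 x"
  shows "mD \<alpha> f x = 0"
proof -
  have "foldr pd (mi_list \<alpha>) f x = foldr pd (mi_list \<alpha>) (\<lambda>_. 0) x"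
    by (rule pds_cong_open[OF open_Compl[OF closed_cball[of x0 a]]]) (use assms in auto)
  then show ?thesis by (simp add: mD_def mpd_eq_pds pds_zero)
qed

text \<open>F is evaluated on cut-off exponentials, which gives data growing like
  \<open>wt k ^ N\<close>, and the iteration is estimated in the weight of exponent N. By
  \<open>fun_error\<close> the value of T at the transposed operator is close to the sum of data
  times Fourier coefficients. That sum is F at the cut-off partial sum of the test function, so it
  differs from the value of F by a Fourier tail.\<close>

lemma solve_functional:
  assumes F: "defines_functional Fn F" and K: "compact K" and lF: "moderate (lF :: real \<Rightarrow> real)"
    and Fb: "\<forall>\<^sub>F \<epsilon> in at_right 0. \<forall>f. smooth_on UNIV f \<longrightarrow> norm (Fn \<epsilon> f) \<le> lF \<epsilon> * sup_seminorm K N f"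
    and row: "\<And>(H :: ('n \<Rightarrow> int) \<Rightarrow> real^'n \<Rightarrow> complex) \<sigma> l R. (\<And>k. smooth_on UNIV (H k)) \<Longrightarrow> (\<And>k. supp2 (H k)) \<Longrightarrow>
      (\<And>k. dbound (cball 0 2) (N + CARD('n) + 1) (H k) \<kappa>) \<Longrightarrow> \<bar>\<sigma>\<bar> \<le> real N \<Longrightarrow>
      (\<Sum>k\<in>cube R. norm (smat H l k) * wt k powr \<sigma>) \<le> wt l powr \<sigma> / 2"
    and small: "\<forall>\<^sub>F \<epsilon> in at_right 0. \<forall>k. dbound (cball 0 2) (N + CARD('n) + 1) (Hn \<epsilon> k) \<kappa>" and \<kappa>: "\<kappa> \<le> 1"
  shows "\<exists>T\<in>basic_functionals. functional_eq_on (ball x0 \<rho>) m pcoef T F"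
proof -
  let ?X = "\<lambda>y. x0 + \<rho> *\<^sub>R y" and ?Y = "\<lambda>x. (1 / \<rho>) *\<^sub>R (x - x0)"
  let ?n = "CARD('n)"
  obtain CE where CE: "0 \<le> CE" "\<And>g B K. smooth_on UNIV g \<Longrightarrow> dbound (cball 0 2) N g B \<Longrightarrow>
    dbound K N (\<lambda>x. \<theta>x x * g (?Y x)) (CE * B)" by (rule dbound_rescaled[of N]) blast
  obtain w where w: "moderate (\<lambda>\<epsilon>. 1 / w \<epsilon>)"
    "\<forall>\<^sub>F \<epsilon> in at_right 0. sch \<epsilon> \<and> 0 < w \<epsilon> \<and> (\<forall>k. w \<epsilon> \<le> wt k ^ m * weight m (Pn 0 \<epsilon>) (\<chi> i. of_int (k i) / \<rho>))"
    by (rule eventually_scheme)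
  obtain B\<theta> where B\<theta>: "B\<theta> > 0" "dbound (cball 0 2) (N + m + ?n + 1) \<theta> B\<theta>"
    by (rule dbound_exists[OF open_UNIV compact_cball subset_UNIV \<theta>(1)])
  \<comment> \<open>The sign of k is reversed so that pairing the data with \<open>fc \<Phi>\<close>
    at -k rebuilds the Fourier series of \<Phi>.\<close>
  define ek where "ek k x = \<theta>x x * ex (kc (\<lambda>i. - k i)) (?Y x)" for k :: "'n \<Rightarrow> int" and x
  define v where "v \<epsilon> k = Fn \<epsilon> (ek k)" for \<epsilon> k
  define f where "f \<epsilon> = neum (Rn \<epsilon>) (Hn \<epsilon>) (v \<epsilon>) (Rn \<epsilon>)" for \<epsilon>
  \<comment> \<open>Integration against \<open>un\<close> in the variable y, cut off by \<theta> so
    that the support is compact. The normalisation by \<open>pimean\<close> is that of the Fourier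
    coefficients, so no Jacobian remains.\<close>
  define Tn where "Tn \<epsilon> \<psi> = (if sch \<epsilon> then pimean (\<lambda>y. \<theta> y * (un \<epsilon> (f \<epsilon>) (?X y) * \<psi> (?X y))) else 0)" for \<epsilon> \<psi>
  define A where "A \<epsilon> = \<bar>lF \<epsilon>\<bar> * CE" for \<epsilon>
  have A0: "0 \<le> A \<epsilon>" for \<epsilon> using CE(1) by (simp add: A_def)
  have mA: "moderate A" unfolding A_def[abs_def] using moderate_norm[OF lF] by (intro moderate_mult moderate_const) simp
  have Flin: "linear_functional (Fn \<epsilon>)" if "\<epsilon> \<in> {0<..1}" for \<epsilon>
    using F that unfolding defines_functional_def compact_distributions_def linear_functional_def by blast
  have sek: "smooth_on UNIV (ek k)" for k
    unfolding ek_def[abs_def] by (intro smooth_on_mult smooth_\<theta>x smooth_rescaled smooth_on_ex open_UNIV)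
  have Fle: "norm (Fn \<epsilon> g) \<le> \<bar>lF \<epsilon>\<bar> * L"
    if "\<forall>f. smooth_on UNIV f \<longrightarrow> norm (Fn \<epsilon> f) \<le> lF \<epsilon> * sup_seminorm K N f" "smooth_on UNIV g" "dbound K N g L" "0 \<le> L" for \<epsilon> g L
  proof -
    have "sup_seminorm K N g \<le> L" using sup_seminorm_le_iff[OF open_UNIV K subset_UNIV that(2)] that by blast
    moreover have "norm (Fn \<epsilon> g) \<le> lF \<epsilon> * sup_seminorm K N g" using that by blast
    moreover have "lF \<epsilon> * sup_seminorm K N g \<le> \<bar>lF \<epsilon>\<bar> * sup_seminorm K N g"
      using sup_seminorm_nonneg[OF open_UNIV K subset_UNIV that(2), of N] by (intro mult_right_mono) auto
    ultimately show ?thesis using mult_left_mono[of "sup_seminorm K N g" L "\<bar>lF \<epsilon>\<bar>"] by linarith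
  qed
  have vb: "norm (v \<epsilon> k) \<le> A \<epsilon> * wt k ^ N"
    if "\<forall>f. smooth_on UNIV f \<longrightarrow> norm (Fn \<epsilon> f) \<le> lF \<epsilon> * sup_seminorm K N f" for \<epsilon> k
  proof -
    have "dbound K N (ek k) (CE * wt k ^ N)"
      unfolding ek_def using CE(2)[OF smooth_on_ex[OF open_UNIV] dbound_ex_kc[of _ N "\<lambda>i. - k i"], unfolded wt_minus] .
    moreover have "0 \<le> CE * wt k ^ N" using CE(1) wt_ge_1[of k] by simp
    ultimately show ?thesis unfolding v_def A_def using Fle[OF that sek] by (metis mult.assoc)
  qed
  have Hrow: "(\<Sum>k\<in>cube (Rn \<epsilon>). norm (smat (Hn \<epsilon>) l k) * wt k powr real N) \<le> wt l powr real N / 2"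
    if "sch \<epsilon>" "\<forall>k. dbound (cball 0 2) (N + ?n + 1) (Hn \<epsilon> k) \<kappa>" for \<epsilon> l
    by (rule row) (use that scheme.smooth_H[OF that(1)] scheme.supp2_H[OF that(1)] in auto)
  have fb: "norm (f \<epsilon> k) \<le> (2 * A \<epsilon>) * wt k ^ N"
    if "sch \<epsilon>" "\<forall>k. dbound (cball 0 2) (N + ?n + 1) (Hn \<epsilon> k) \<kappa>"
      "\<forall>f. smooth_on UNIV f \<longrightarrow> norm (Fn \<epsilon> f) \<le> lF \<epsilon> * sup_seminorm K N f" "k \<in> cube (Rn \<epsilon>)" for \<epsilon> k
  proof -
    have wp: "wt l powr real N = wt l ^ N" for l :: "'n \<Rightarrow> int" using wt_ge_1[of l] by (intro powr_realpow) simp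
    show ?thesis unfolding f_def wp[symmetric]
      by (rule neum_bounds(1)[OF Hrow[OF that(1,2)]]) (use vb[OF that(3)] A0 that(4) wp in auto)
  qed
  have lin: "linear_functional (Tn \<epsilon>)" for \<epsilon>
  proof (cases "sch \<epsilon>")
    case True
    have c: "continuous_on pibox (\<lambda>y. \<theta> y * (un \<epsilon> (f \<epsilon>) (?X y) * \<psi> (?X y)))" if "smooth_on UNIV \<psi>" for \<psi>
    proof -
      have "smooth_on UNIV (\<lambda>y. \<theta> y * (un \<epsilon> (f \<epsilon>) (?X y) * \<psi> (?X y)))"
        by (rule smooth_on_mult[OF open_UNIV \<theta>(1) smooth_on_mult[OF open_UNIV smooth_on_shift[OF scheme.smooth_u[OF True]] smooth_on_shift[OF that]]])
      then show ?thesis by (rule continuous_on_subset[OF smooth_on_continuous_on]) simp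
    qed
    have "Tn \<epsilon> (\<lambda>x. a x + b x) = Tn \<epsilon> a + Tn \<epsilon> b" if "smooth_on UNIV a" "smooth_on UNIV b" for a b
      using True pimean_add[OF c[OF that(1)] c[OF that(2)]] by (simp add: Tn_def distrib_left)
    moreover have "Tn \<epsilon> (\<lambda>x. a * b x) = a * Tn \<epsilon> b" for a b
      using True pimean_cmult[of a "\<lambda>y. \<theta> y * (un \<epsilon> (f \<epsilon>) (?X y) * b (?X y))"] by (simp add: Tn_def mult_ac)
    ultimately show ?thesis by (simp add: linear_functional_def)
  qed (simp add: Tn_def linear_functional_def)
  define PC where "PC = scheme.pairC TYPE('n) m T cl N"
  define lT where "lT \<epsilon> = PC * B\<theta> * (2 * A \<epsilon>) * (1 / w \<epsilon>)" for \<epsilon>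
  have mlT: "moderate lT" unfolding lT_def[abs_def] by (intro moderate_mult moderate_const mA w(1))
  have Tb: "\<forall>\<^sub>F \<epsilon> in at_right 0. \<forall>\<psi>. smooth_on UNIV \<psi> \<longrightarrow> norm (Tn \<epsilon> \<psi>) \<le> lT \<epsilon> * sup_seminorm (cball x0 (2 * \<rho>)) (N + m + ?n + 1) \<psi>"
    using w(2) small Fb
  proof eventually_elim
    case (elim \<epsilon>)
    then have s: "sch \<epsilon>" by blast
    show ?case
    proof (intro allI impI)
      fix \<psi> :: "real^'n \<Rightarrow> complex" assume \<psi>: "smooth_on UNIV \<psi>"
      have "norm (Tn \<epsilon> \<psi>) \<le> PC * B\<theta> * (2 * A \<epsilon>) / w \<epsilon> * sup_seminorm (cball x0 (2 * \<rho>)) (N + m + ?n + 1) \<psi>"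
        unfolding Tn_def PC_def if_P[OF s]
      proof (rule scheme.pairing_bound[OF s \<psi> dbound_shrunk[OF \<psi> dbound_sup_seminorm[OF open_UNIV compact_cball subset_UNIV \<psi>]] fb[OF s elim(2,3)] _ B\<theta>(2)])
        show "w \<epsilon> \<le> wt k ^ m * weight m (Pn 0 \<epsilon>) (scheme.fr \<rho> k)" for k using elim(1) by (simp add: scheme.fr_def[OF s])
      qed (use elim A0 in auto)
      then show "norm (Tn \<epsilon> \<psi>) \<le> lT \<epsilon> * sup_seminorm (cball x0 (2 * \<rho>)) (N + m + ?n + 1) \<psi>" by (simp add: lT_def)
    qed
  qed
  obtain T where T: "T \<in> basic_functionals" "\<And>u. mnet UNIV u \<Longrightarrow> T (gcls UNIV u) = abs_gen_num (\<lambda>\<epsilon>. Tn \<epsilon> (u \<epsilon>))"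
    using functional_exists[OF lin compact_cball mlT Tb] by blast
  have "functional_eq_on (ball x0 \<rho>) m pcoef T F"
    unfolding functional_eq_on_def
  proof
    fix \<phi> assume "\<phi> \<in> gfuns_c (ball x0 \<rho>)"
    then obtain \<rho>' u where \<rho>': "0 < \<rho>'" "\<rho>' < \<rho>" and u: "mnet UNIV u" "\<And>\<epsilon> x. \<rho>' < dist x0 x \<Longrightarrow> u \<epsilon> x = 0" "\<phi> = gcls (ball x0 \<rho>) u"
      by (rule gfuns_c_rep[OF _ \<rho>(1)]) blast
    define tu where "tu \<epsilon> x = (\<Sum>\<alpha> | mi_order \<alpha> \<le> m. (- 1) ^ mi_order \<alpha> * mD \<alpha> (\<lambda>x. coefn \<alpha> \<epsilon> x * u \<epsilon> x) x)" for \<epsilon> x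
    have tu: "mnet UNIV tu" "transposed_op (ball x0 \<rho>) m (\<lambda>\<alpha>. grestrict (ball x0 \<rho>) (pcoef \<alpha>)) \<phi> = gcls (ball x0 \<rho>) tu"
      using transposed_op_class[OF u(1)] unfolding tu_def[abs_def] u(3) by auto
    have tu0: "tu \<epsilon> x = 0" if "\<rho>' < dist x0 x" for \<epsilon> x
    proof -
      have "mD \<alpha> (\<lambda>x. coefn \<alpha> \<epsilon> x * u \<epsilon> x) x = 0" for \<alpha> by (rule mD_zero_outside[OF _ that]) (simp add: u(2))
      then show ?thesis by (simp add: tu_def)
    qed
    have TL: "T (gextend (ball x0 \<rho>) (gcls (ball x0 \<rho>) tu)) = abs_gen_num (\<lambda>\<epsilon>. Tn \<epsilon> (tu \<epsilon>))"
    proof -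
      have "gextend (ball x0 \<rho>) (gcls (ball x0 \<rho>) tu) = gcls UNIV tu"
        by (rule gextend_gcls[OF \<rho>'(2) tu(1)]) (rule tu0)
      then show ?thesis using T(2)[OF tu(1)] by simp
    qed
    have FR: "F (gextend (ball x0 \<rho>) \<phi>) = abs_gen_num (\<lambda>\<epsilon>. Fn \<epsilon> (u \<epsilon>))"
    proof -
      have "u \<in> gcls UNIV u" using u(1) nnet_zero[OF open_UNIV] by (simp add: mem_gcls[OF open_UNIV])
      with F gcls_in_gfuns[OF open_UNIV u(1)] have "F (gcls UNIV u) = abs_gen_num (\<lambda>\<epsilon>. Fn \<epsilon> (u \<epsilon>))"
        by (simp add: defines_functional_def)
      moreover have "gextend (ball x0 \<rho>) \<phi> = gcls UNIV u"
        unfolding u(3) by (rule gextend_gcls[OF \<rho>'(2) u(1)]) (rule u(2))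
      ultimately show ?thesis by simp
    qed
    obtain L :: "real \<Rightarrow> real" where L: "moderate L" "\<forall>\<^sub>F \<epsilon> in at_right 0. dbound (cball x0 (2 * \<rho>)) (N + 2 * ?n + 3) (u \<epsilon>) (L \<epsilon>)"
      by (rule mnet_bound[OF u(1) compact_cball subset_UNIV])
    define FC where "FC = scheme.funC TYPE('n) N"
    define FO where "FO = fouC TYPE('n)"
    \<comment> \<open>The first term is the error of the scheme, the second the Fourier tail of the
      test function under F.\<close>
    define Er where "Er \<epsilon> = FC * A \<epsilon> * L \<epsilon> + \<bar>lF \<epsilon>\<bar> * (CE * (FO * 2 ^ 1 * L \<epsilon>))" for \<epsilon>
    have mEr: "moderate Er" unfolding Er_def[abs_def] using moderate_norm[OF lF]
      by (intro moderate_add moderate_mult moderate_const mA L(1)) simp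
    have "abs_gen_num (\<lambda>\<epsilon>. Tn \<epsilon> (tu \<epsilon>)) = abs_gen_num (\<lambda>\<epsilon>. Fn \<epsilon> (u \<epsilon>))"
    proof (rule gen_num_eqI)
      show "moderate (\<lambda>\<epsilon>. Tn \<epsilon> (tu \<epsilon>))" by (rule functional_net(1)[OF lin compact_cball mlT Tb tu(1)])
      show "negligible_net (\<lambda>\<epsilon>. Tn \<epsilon> (tu \<epsilon>) - Fn \<epsilon> (u \<epsilon>))"
      proof (rule negligible_dom[OF negligible_over_Rn[OF mEr]])
        show "\<forall>\<^sub>F \<epsilon> in at_right 0. norm (Tn \<epsilon> (tu \<epsilon>) - Fn \<epsilon> (u \<epsilon>)) \<le> norm (Er \<epsilon> / (real (Rn \<epsilon>) + 1))"
          using w(2) small Fb L(2) eventually_small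
        proof eventually_elim
          case (elim \<epsilon>)
          then have s: "sch \<epsilon>" and e: "\<epsilon> \<in> {0<..1}" by auto
          define \<Phi> where "\<Phi> y = u \<epsilon> (?X y)" for y
          have su: "smooth_on UNIV (u \<epsilon>)" by (rule mnetD[OF u(1) e])
          have s\<Phi>: "smooth_on UNIV \<Phi>" unfolding \<Phi>_def[abs_def] by (rule smooth_on_shift[OF su])
          have b\<Phi>: "dbound (cball 0 2) (N + 2 * ?n + 3) \<Phi> (L \<epsilon>)" unfolding \<Phi>_def by (rule dbound_shrunk[OF su elim(4)])
          have supp\<Phi>: "supp2 \<Phi>"
          proof (intro allI impI)
            fix y :: "real^'n" assume "y \<notin> cball 0 2"
            then have "\<rho> * 2 < \<rho> * norm y" using \<rho> by (intro mult_strict_left_mono) auto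
            moreover have "dist x0 (?X y) = \<rho> * norm y" using \<rho> by (simp add: dist_norm)
            ultimately have "\<rho>' < dist x0 (?X y)" using \<rho>' by linarith
            then show "\<Phi> y = 0" unfolding \<Phi>_def by (rule u(2))
          qed
          have L0: "0 \<le> L \<epsilon>" by (rule dbound_nonneg[OF b\<Phi>, of 0]) simp
          have tu_eq: "tu \<epsilon> = scheme.tP m r (\<lambda>j. Pn j \<epsilon>) (\<lambda>j. csn j \<epsilon>) (u \<epsilon>)"
          proof
            fix x
            have "coefn \<alpha> \<epsilon> = scheme.coef r (\<lambda>j. Pn j \<epsilon>) (\<lambda>j. csn j \<epsilon>) \<alpha>" for \<alpha>
              by (rule ext) (simp add: coefn_def scheme.coef_def[OF s])
            then show "tu \<epsilon> x = scheme.tP m r (\<lambda>j. Pn j \<epsilon>) (\<lambda>j. csn j \<epsilon>) (u \<epsilon>) x"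
              by (simp add: tu_def scheme.tP_def[OF s])
          qed
          define S where "S = (\<Sum>k\<in>cube (Rn \<epsilon>). fc \<Phi> (\<lambda>i. - k i) * v \<epsilon> k)"
          have 1: "norm (Tn \<epsilon> (tu \<epsilon>) - S) \<le> FC * A \<epsilon> * L \<epsilon> / (real (Rn \<epsilon>) + 1)"
            unfolding Tn_def if_P[OF s] tu_eq S_def FC_def f_def \<Phi>_def
          proof (rule scheme.fun_error[OF s su _ b\<Phi>[unfolded \<Phi>_def] Hrow[OF s elim(2)]])
            fix k and y :: "real^'n" assume "y \<in> cball 0 2"
            then show "norm (Hn \<epsilon> k y) \<le> 1" using dboundD0[OF elim(2)[rule_format]] \<kappa> by (meson order_trans)
          qed (use \<rho>' vb[OF elim(3)] A0 in \<open>auto intro: u(2)\<close>)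
          have S: "S = Fn \<epsilon> (\<lambda>x. \<theta>x x * psum (Rn \<epsilon>) \<Phi> (?Y x))"
          proof -
            have "S = (\<Sum>k\<in>cube (Rn \<epsilon>). fc \<Phi> k * v \<epsilon> (\<lambda>i. - k i))"
              unfolding S_def by (rule sum.reindex_bij_witness[of _ "\<lambda>k i. - k i" "\<lambda>k i. - k i"]) (auto simp: cube_def)
            also have "\<dots> = Fn \<epsilon> (\<lambda>x. \<Sum>k\<in>cube (Rn \<epsilon>). fc \<Phi> k * ek (\<lambda>i. - k i) x)"
              unfolding v_def by (rule linear_functional_sum[symmetric, OF Flin[OF e] sek])
            finally show ?thesis by (simp add: ek_def psum_def sum_distrib_left mult_ac)
          qed
          have u_eq: "u \<epsilon> = (\<lambda>x. \<theta>x x * \<Phi> (?Y x))"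
          proof
            fix x
            have "?X (?Y x) = x" using \<rho> by simp
            then have "\<Phi> (?Y x) = u \<epsilon> x" by (simp only: \<Phi>_def)
            then show "u \<epsilon> x = \<theta>x x * \<Phi> (?Y x)"
              using \<rho>' \<theta>x_1[of x] u(2)[of x \<epsilon>] by (cases "dist x0 x \<le> \<rho>") auto
          qed
          have sp: "smooth_on UNIV (psum (Rn \<epsilon>) \<Phi>)" by (rule smooth_on_psum)
          have bE: "dbound (cball 0 2) N (\<lambda>y. \<Phi> y - psum (Rn \<epsilon>) \<Phi> y) (FO * 2 ^ 1 * L \<epsilon> / (real (Rn \<epsilon>) + 1) ^ 1)"
            unfolding FO_def
            by (rule dbound_mono[OF fouC(2)[OF s\<Phi> supp\<Phi> dbound_mono[OF b\<Phi> order_refl _ order_refl]] cball_subset_pibox order_refl order_refl]) simp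
          have "norm (S - Fn \<epsilon> (u \<epsilon>)) = norm (Fn \<epsilon> (u \<epsilon>) - S)" by (rule norm_minus_commute)
          also have "Fn \<epsilon> (u \<epsilon>) - S = Fn \<epsilon> (\<lambda>x. \<theta>x x * \<Phi> (?Y x) - \<theta>x x * psum (Rn \<epsilon>) \<Phi> (?Y x))"
            unfolding S by (subst (1) u_eq)
              (rule linear_functional_diff[symmetric, OF Flin[OF e]]; intro smooth_on_mult smooth_\<theta>x open_UNIV smooth_rescaled s\<Phi> sp)
          also have "\<dots> = Fn \<epsilon> (\<lambda>x. \<theta>x x * (\<Phi> (?Y x) - psum (Rn \<epsilon>) \<Phi> (?Y x)))" by (simp add: right_diff_distrib)
          also have "norm \<dots> \<le> \<bar>lF \<epsilon>\<bar> * (CE * (FO * 2 ^ 1 * L \<epsilon> / (real (Rn \<epsilon>) + 1) ^ 1))"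
          proof (rule Fle[OF elim(3)])
            have sd: "smooth_on UNIV (\<lambda>y. \<Phi> y - psum (Rn \<epsilon>) \<Phi> y)" by (rule smooth_on_diff[OF open_UNIV s\<Phi> sp])
            show "smooth_on UNIV (\<lambda>x. \<theta>x x * (\<Phi> (?Y x) - psum (Rn \<epsilon>) \<Phi> (?Y x)))"
              by (rule smooth_on_mult[OF open_UNIV smooth_\<theta>x smooth_rescaled[OF sd]])
            show "dbound K N (\<lambda>x. \<theta>x x * (\<Phi> (?Y x) - psum (Rn \<epsilon>) \<Phi> (?Y x))) (CE * (FO * 2 ^ 1 * L \<epsilon> / (real (Rn \<epsilon>) + 1) ^ 1))"
              by (rule CE(2)[OF sd bE])
            show "0 \<le> CE * (FO * 2 ^ 1 * L \<epsilon> / (real (Rn \<epsilon>) + 1) ^ 1)"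
              using CE(1) L0 fouC(1)[where 'n = 'n] by (simp add: FO_def)
          qed
          finally have "norm (S - Fn \<epsilon> (u \<epsilon>)) \<le> \<bar>lF \<epsilon>\<bar> * (CE * (FO * 2 ^ 1 * L \<epsilon>)) / (real (Rn \<epsilon>) + 1)" by simp
          then have "norm (Tn \<epsilon> (tu \<epsilon>) - Fn \<epsilon> (u \<epsilon>)) \<le> Er \<epsilon> / (real (Rn \<epsilon>) + 1)"
            using norm_triangle_ineq[of "Tn \<epsilon> (tu \<epsilon>) - S" "S - Fn \<epsilon> (u \<epsilon>)"] 1 by (simp add: Er_def add_divide_distrib)
          then show ?case unfolding real_norm_def by (rule order_trans) (rule abs_ge_self)
        qed
      qed
    qed
    then show "T (gextend (ball x0 \<rho>) (transposed_op (ball x0 \<rho>) m (\<lambda>\<alpha>. grestrict (ball x0 \<rho>) (pcoef \<alpha>)) \<phi>)) = F (gextend (ball x0 \<rho>) \<phi>)"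
      unfolding tu(2) TL FR .
  qed
  then show ?thesis using T(1) by blast
qed

text \<open>One net of coefficients has to be estimated in every C^j. The iteration itself does not
  involve j: only the weight in which it is measured and the range of admissible \<epsilon> change
  with j. For this the perturbation must become small in every order.\<close>

lemma solve_gfun:
  assumes small: "\<And>q \<tau>. 0 < \<tau> \<Longrightarrow> \<forall>\<^sub>F \<epsilon> in at_right 0. \<forall>k. dbound (cball 0 2) q (Hn \<epsilon> k) \<tau>" and v: "v \<in> gfuns_c UNIV"
  shows "\<exists>u\<in>gfuns_c UNIV. gfun_eq_on (ball x0 \<rho>) m pcoef u v"
proof -
  let ?X = "\<lambda>y. x0 + \<rho> *\<^sub>R y" and ?Y = "\<lambda>x. (1 / \<rho>) *\<^sub>R (x - x0)"
  let ?n = "CARD('n)"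
  have v': "v \<in> gfuns UNIV" using v by (simp add: gfuns_c_def)
  define vn where "vn = grep v"
  have mv: "mnet UNIV vn" "v = gcls UNIV vn" unfolding vn_def by (rule gfuns_rep[OF open_UNIV v'])+
  \<comment> \<open>The right-hand side is localised before it is expanded; it is unchanged for |y|
    \<le> 1, which covers the ball where the equation is to hold.\<close>
  define V where "V \<epsilon> y = \<theta> y * vn \<epsilon> (?X y)" for \<epsilon> y
  have sV: "smooth_on UNIV (V \<epsilon>)" if "\<epsilon> \<in> {0<..1}" for \<epsilon>
    unfolding V_def[abs_def] by (rule smooth_on_mult[OF open_UNIV \<theta>(1) smooth_on_shift[OF mnetD[OF mv(1) that]]])
  have suppV: "supp2 (V \<epsilon>)" for \<epsilon> using \<theta>(2) by (simp add: V_def)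
  have bV: "\<exists>L :: real \<Rightarrow> real. moderate L \<and> (\<forall>\<^sub>F \<epsilon> in at_right 0. dbound (cball 0 2) q (V \<epsilon>) (L \<epsilon>))" for q
  proof -
    obtain B\<theta> where B\<theta>: "B\<theta> > 0" "dbound (cball 0 2) q \<theta> B\<theta>"
      by (rule dbound_exists[OF open_UNIV compact_cball subset_UNIV \<theta>(1)])
    obtain L :: "real \<Rightarrow> real" where L: "moderate L" "\<forall>\<^sub>F \<epsilon> in at_right 0. dbound (cball x0 (2 * \<rho>)) q (vn \<epsilon>) (L \<epsilon>)"
      by (rule mnet_bound[OF mv(1) compact_cball subset_UNIV])
    have "\<forall>\<^sub>F \<epsilon> in at_right 0. dbound (cball 0 2) q (V \<epsilon>) (2 ^ q * B\<theta> * L \<epsilon>)"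
      using L(2) eventually_small
    proof eventually_elim
      case (elim \<epsilon>)
      then have s: "smooth_on UNIV (vn \<epsilon>)" using mnetD[OF mv(1)] by simp
      show ?case unfolding V_def
        by (rule dbound_mult[OF open_UNIV subset_UNIV \<theta>(1) smooth_on_shift[OF s] B\<theta>(2) dbound_shrunk[OF s elim(1)]])
    qed
    moreover have "moderate (\<lambda>\<epsilon>. 2 ^ q * B\<theta> * L \<epsilon>)" by (intro moderate_mult moderate_const L(1))
    ultimately show ?thesis by blast
  qed
  \<comment> \<open>Negative exponents measure decay; how small \<epsilon> must be depends on
    s.\<close>
  have row: "\<forall>\<^sub>F \<epsilon> in at_right 0. sch \<epsilon> \<longrightarrow> (\<forall>l. (\<Sum>k\<in>cube (Rn \<epsilon>). norm (smat (Hn \<epsilon>) l k) * wt k powr - real s) \<le> wt l powr - real s / 2)" for s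
  proof -
    obtain \<kappa> :: real where \<kappa>: "0 < \<kappa>" "\<And>(H :: ('n \<Rightarrow> int) \<Rightarrow> real^'n \<Rightarrow> complex) \<sigma> l R. (\<And>k. smooth_on UNIV (H k)) \<Longrightarrow> (\<And>k. supp2 (H k)) \<Longrightarrow>
      (\<And>k. dbound (cball 0 2) (s + ?n + 1) (H k) \<kappa>) \<Longrightarrow> \<bar>\<sigma>\<bar> \<le> real s \<Longrightarrow>
      (\<Sum>k\<in>cube R. norm (smat H l k) * wt k powr \<sigma>) \<le> wt l powr \<sigma> / 2"
      by (rule smat_row_sum[where s = s]) (rule that, blast+)
    show ?thesis using small[OF \<kappa>(1), of "s + ?n + 1"]
    proof eventually_elim
      case (elim \<epsilon>)
      show ?case
      proof (intro impI allI)
        fix l assume "sch \<epsilon>"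
        then show "(\<Sum>k\<in>cube (Rn \<epsilon>). norm (smat (Hn \<epsilon>) l k) * wt k powr - real s) \<le> wt l powr - real s / 2"
          by (intro \<kappa>(2) scheme.smooth_H scheme.supp2_H elim[rule_format]) auto
      qed
    qed
  qed
  obtain w where w: "moderate (\<lambda>\<epsilon>. 1 / w \<epsilon>)"
    "\<forall>\<^sub>F \<epsilon> in at_right 0. sch \<epsilon> \<and> 0 < w \<epsilon> \<and> (\<forall>k. w \<epsilon> \<le> wt k ^ m * weight m (Pn 0 \<epsilon>) (\<chi> i. of_int (k i) / \<rho>))"
    by (rule eventually_scheme)
  define f where "f \<epsilon> = neum (Rn \<epsilon>) (Hn \<epsilon>) (fc (V \<epsilon>)) (Rn \<epsilon>)" for \<epsilon>
  \<comment> \<open>The cut-off makes the support compact and does not change the function on the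
    ball of radius \<rho>.\<close>
  define Uf where "Uf \<epsilon> x = (if sch \<epsilon> then \<theta>x x * un \<epsilon> (f \<epsilon>) x else 0)" for \<epsilon> x
  have sUf: "smooth_on UNIV (Uf \<epsilon>)" for \<epsilon>
  proof (cases "sch \<epsilon>")
    case True
    have "Uf \<epsilon> = (\<lambda>x. \<theta>x x * un \<epsilon> (f \<epsilon>) x)" using True by (simp add: Uf_def fun_eq_iff)
    then show ?thesis using smooth_on_mult[OF open_UNIV smooth_\<theta>x scheme.smooth_u[OF True]] by simp
  qed (simp add: Uf_def[abs_def] smooth_on_const[OF open_UNIV])
  have mU: "mnet UNIV Uf"
    unfolding mnet_def
  proof (intro conjI ballI allI impI sUf)
    fix K :: "(real^'n) set" and j
    define q where "q = j + m + ?n + 1"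
    obtain CE where CE: "0 \<le> CE" "\<And>g B K. smooth_on UNIV g \<Longrightarrow> dbound (cball 0 2) j g B \<Longrightarrow>
      dbound K j (\<lambda>x. \<theta>x x * g (?Y x)) (CE * B)" by (rule dbound_rescaled[of j]) blast
    obtain L :: "real \<Rightarrow> real" where L: "moderate L" "\<forall>\<^sub>F \<epsilon> in at_right 0. dbound (cball 0 2) q (V \<epsilon>) (L \<epsilon>)" using bV by blast
    define G where "G \<epsilon> = CE * ((2 * (2 ^ q * L \<epsilon>)) * (2 ^ j * exbd TYPE('n) m T j / cl * (1 / w \<epsilon>)) * latC TYPE('n))" for \<epsilon>
    have "\<forall>\<^sub>F \<epsilon> in at_right 0. dbound K j (Uf \<epsilon>) (G \<epsilon>)"
      using w(2) L(2) row[of q] eventually_small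
    proof eventually_elim
      case (elim \<epsilon>)
      then have s: "sch \<epsilon>" and e: "\<epsilon> \<in> {0<..1}" by auto
      have L0: "0 \<le> L \<epsilon>" by (rule dbound_nonneg[OF elim(2), of 0]) simp
      have wp: "wt k powr - real q = 1 / wt k ^ q" for k :: "'n \<Rightarrow> int"
        using wt_ge_1[of k] by (simp add: powr_minus_divide powr_realpow)
      have fb: "norm (f \<epsilon> k) \<le> (2 * (2 ^ q * L \<epsilon>)) / wt k ^ q" if "k \<in> cube (Rn \<epsilon>)" for k
      proof -
        have "norm (f \<epsilon> k) \<le> 2 * (2 ^ q * L \<epsilon>) * wt k powr - real q"
          unfolding f_def
        proof (rule neum_bounds(1))
          show "(\<Sum>k\<in>cube (Rn \<epsilon>). norm (smat (Hn \<epsilon>) l k) * wt k powr - real q) \<le> wt l powr - real q / 2" for l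
            using elim(3) s by blast
          show "norm (fc (V \<epsilon>) l) \<le> 2 ^ q * L \<epsilon> * wt l powr - real q" for l
            using fc_decay[OF sV[OF e] suppV elim(2), of l] by (simp add: wp)
        qed (use L0 that in auto)
        then show ?thesis by (simp add: wp)
      qed
      have "dbound (cball 0 2) j (scheme.U m T \<rho> cl (\<lambda>j. Pn j \<epsilon>) (Rn \<epsilon>) (Rn \<epsilon>) (f \<epsilon>))
          ((2 * (2 ^ q * L \<epsilon>)) * (2 ^ j * exbd TYPE('n) m T j / cl / w \<epsilon>) * latC TYPE('n))"
        unfolding q_def by (rule scheme.U_bound[OF s fb[unfolded q_def]]) (use elim(1) L0 in \<open>auto simp: scheme.fr_def[OF s] q_def\<close>)
      from CE(2)[OF scheme.smooth_U[OF s] this]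
      show ?case by (simp add: Uf_def[abs_def] s G_def scheme.u_def[OF s])
    qed
    moreover have "moderate G" unfolding G_def[abs_def] by (intro moderate_mult moderate_const L(1) w(1))
    ultimately show "\<exists>l :: real \<Rightarrow> real. moderate l \<and> (\<forall>\<^sub>F \<epsilon> in at_right 0. dbound K j (Uf \<epsilon>) (l \<epsilon>))" by blast
  qed
  have "gcls UNIV Uf \<in> gfuns_c UNIV"
  proof -
    have o: "open (- cball x0 (2 * \<rho>))" by (rule open_Compl[OF closed_cball])
    have "nnet (- cball x0 (2 * \<rho>)) Uf"
      by (rule nnet_cong[OF o nnet_zero[OF o]]) (use \<theta>x_0 in \<open>simp add: Uf_def\<close>)
    then have "gsupport UNIV (gcls UNIV Uf) \<subseteq> cball x0 (2 * \<rho>)"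
      unfolding gsupport_gcls[OF open_UNIV mU] using o by blast
    moreover have "closed (gsupport UNIV (gcls UNIV Uf))"
      unfolding gsupport_gcls[OF open_UNIV mU] by (intro closed_Diff closed_UNIV open_Union) auto
    ultimately have "compact (gsupport UNIV (gcls UNIV Uf))"
      by (meson bounded_cball bounded_subset compact_eq_bounded_closed)
    then show ?thesis using gcls_in_gfuns[OF open_UNIV mU] by (simp add: gfuns_c_def)
  qed
  moreover have "gfun_eq_on (ball x0 \<rho>) m pcoef (gcls UNIV Uf) v"
    unfolding gfun_eq_on_def diff_op_class(1)[OF mU] mv(2) grestrict_gcls[OF open_UNIV open_ball subset_UNIV mv(1)]
  proof (rule gcls_eq[OF open_ball mnet_subset[OF diff_op_class(2)[OF mU] subset_UNIV]])
    let ?B = "ball x0 \<rho>"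
    let ?E = "\<lambda>\<epsilon> x. (\<Sum>\<alpha> | mi_order \<alpha> \<le> m. coefn \<alpha> \<epsilon> x * mD \<alpha> (Uf \<epsilon>) x) - vn \<epsilon> x"
    have sE: "smooth_on UNIV (?E \<epsilon>)" if "\<epsilon> \<in> {0<..1}" for \<epsilon>
      by (rule mnetD[OF mnet_diff[OF open_UNIV diff_op_class(2)[OF mU] mv(1)] that])
    show "nnet ?B ?E"
      unfolding nnet_def
    proof (intro conjI ballI allI impI)
      show "smooth_on ?B (?E \<epsilon>)" if "\<epsilon> \<in> {0<..1}" for \<epsilon> by (rule smooth_on_subset[OF sE[OF that] subset_UNIV])
      fix K j assume K: "compact K" "K \<subseteq> ?B"
      obtain L :: "real \<Rightarrow> real" where L: "moderate L" "\<forall>\<^sub>F \<epsilon> in at_right 0. dbound (cball 0 2) (j + 2 * ?n + 3) (V \<epsilon>) (L \<epsilon>)" using bV by blast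
      define SC where "SC = scheme.smoothC TYPE('n) j"
      define G where "G \<epsilon> = (1 / \<rho>) ^ j * (SC * L \<epsilon>)" for \<epsilon>
      have mG: "moderate G" unfolding G_def[abs_def] by (intro moderate_mult moderate_const L(1))
      have "\<forall>\<^sub>F \<epsilon> in at_right 0. dbound K j (?E \<epsilon>) (G \<epsilon> / (real (Rn \<epsilon>) + 1))"
        using w(2) L(2) row[of "j + 2 * ?n + 3"] small[OF zero_less_one, of "j + ?n + 2"] eventually_small
      proof eventually_elim
        case (elim \<epsilon>)
        then have s: "sch \<epsilon>" and e: "\<epsilon> \<in> {0<..1}" by auto
        define D where "D y = ?E \<epsilon> (?X y)" for y
        have sD: "smooth_on UNIV D" unfolding D_def[abs_def] by (rule smooth_on_shift[OF sE[OF e]])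
        let ?Pu = "scheme.Pu m r T x0 \<rho> cl (\<lambda>j. Pn j \<epsilon>) (\<lambda>j. csn j \<epsilon>) (Rn \<epsilon>) (Rn \<epsilon>) (f \<epsilon>)"
        have eqD: "D y = ?Pu (?X y) - V \<epsilon> y" if y: "y \<in> ball 0 1" for y
        proof -
          have xB: "?X y \<in> ?B" using y \<rho> mult_strict_left_mono[of "norm y" 1 \<rho>] by (simp add: dist_norm)
          have "mD \<alpha> (Uf \<epsilon>) (?X y) = mD \<alpha> (un \<epsilon> (f \<epsilon>)) (?X y)" for \<alpha>
          proof -
            have "foldr pd (mi_list \<alpha>) (Uf \<epsilon>) (?X y) = foldr pd (mi_list \<alpha>) (un \<epsilon> (f \<epsilon>)) (?X y)"
              by (rule pds_cong_open[OF open_ball _ xB]) (use \<theta>x_1 in \<open>simp add: Uf_def s\<close>)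
            then show ?thesis by (simp add: mD_def mpd_eq_pds)
          qed
          moreover have "\<theta> y = 1" using y by (intro \<theta>(3)) auto
          ultimately show ?thesis
            by (simp add: D_def scheme.Pu_def[OF s] V_def coefn_def scheme.coef_def[OF s])
        qed
        have "dbound (ball 0 1) j (\<lambda>y. ?Pu (?X y) - V \<epsilon> y) (SC * L \<epsilon> / (real (Rn \<epsilon>) + 1))"
          unfolding SC_def f_def
          by (rule scheme.smooth_error[OF s sV[OF e] suppV elim(2)]) (use elim(3,4) s in blast)+
        from dbound_cong[OF open_ball order_refl eqD this]
        have "dbound (ball 0 1) j D (SC * L \<epsilon> / (real (Rn \<epsilon>) + 1))" .
        then have "dbound K j (\<lambda>x. D ((- (1 / \<rho>) *\<^sub>R x0) + (1 / \<rho>) *\<^sub>R x)) (\<bar>1 / \<rho>\<bar> ^ j * (SC * L \<epsilon> / (real (Rn \<epsilon>) + 1)))"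
        proof (rule dbound_affine_expand[OF open_UNIV subset_UNIV sD])
          fix x assume "x \<in> K"
          then have "norm (?Y x) < 1" unfolding norm_rescaled using K(2) \<rho> by auto
          then show "(- (1 / \<rho>) *\<^sub>R x0) + (1 / \<rho>) *\<^sub>R x \<in> ball 0 1" by (simp add: scaleR_diff_right)
        qed (use \<rho> in auto)
        moreover have "(\<lambda>x. D ((- (1 / \<rho>) *\<^sub>R x0) + (1 / \<rho>) *\<^sub>R x)) = ?E \<epsilon>"
        proof -
          have "?X ((- (1 / \<rho>) *\<^sub>R x0) + (1 / \<rho>) *\<^sub>R x) = x" for x using \<rho> by (simp add: scaleR_diff_right)
          then show ?thesis by (simp only: D_def)
        qed
        moreover have "\<bar>1 / \<rho>\<bar> ^ j * (SC * L \<epsilon> / (real (Rn \<epsilon>) + 1)) = G \<epsilon> / (real (Rn \<epsilon>) + 1)"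
          using \<rho> by (simp add: G_def)
        ultimately show ?case by simp
      qed
      then show "\<exists>l :: real \<Rightarrow> real. negligible_net l \<and> (\<forall>\<^sub>F \<epsilon> in at_right 0. dbound K j (?E \<epsilon>) (l \<epsilon>))"
        using negligible_over_Rn[OF mG] by blast
    qed
  qed
  ultimately show ?thesis by blast
qed

end

section \<open>The solvability theorem\<close>

text \<open>For small \<epsilon> the dominating weight is positive and the dominated one
  nonnegative, which fixes the sign of l. The sign is needed to multiply inequalities in the
  extended reals by l.\<close>

lemma dominating_nonneg:
  assumes rep: "poly_represents m Pn P" and inv: "gweight m P \<xi> dvd 1" and dom: "weight_dominated m Qn Pn l"
  shows "\<forall>\<^sub>F \<epsilon> in at_right 0. 0 \<le> l \<epsilon>"
proof -
  obtain N :: nat where "\<forall>\<^sub>F \<epsilon> in at_right 0. \<epsilon> ^ N \<le> weight m (Pn \<epsilon>) \<xi>"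
    by (rule elliptic_lower_bound[OF rep inv])
  then show ?thesis using eventually_small
  proof eventually_elim
    case (elim \<epsilon>)
    have "0 < \<epsilon> ^ N" using elim by simp
    then have "0 < weight m (Pn \<epsilon>) \<xi>" using elim by linarith
    moreover have "0 \<le> l \<epsilon> * weight m (Pn \<epsilon>) \<xi>"
      using dom weight_nonneg[of m "Qn \<epsilon>" \<xi>] elim unfolding weight_dominated_def
      by (meson greaterThanAtMost_iff order_trans)
    ultimately show ?case by (simp add: zero_le_mult_iff)
  qed
qed

lemma growth_dbound:
  assumes "open \<Omega>" "mnet \<Omega> u" "\<forall>\<^sub>F \<epsilon> in at_right 0. 0 \<le> l \<epsilon>" "real q \<le> k"
    and "ereal_bigo (\<lambda>\<epsilon>. deriv_sup \<Omega> k (u \<epsilon>) * ereal (l \<epsilon>)) g"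
  shows "\<exists>C. \<forall>\<^sub>F \<epsilon> in at_right 0. dbound \<Omega> q (\<lambda>x. of_real (l \<epsilon>) * u \<epsilon> x) (C * \<bar>g \<epsilon>\<bar>)"
proof -
  obtain C where C: "\<forall>\<^sub>F \<epsilon> in at_right 0. \<bar>deriv_sup \<Omega> k (u \<epsilon>) * ereal (l \<epsilon>)\<bar> \<le> ereal (C * \<bar>g \<epsilon>\<bar>)"
    using assms(5) unfolding ereal_bigo_def by blast
  have "\<forall>\<^sub>F \<epsilon> in at_right 0. dbound \<Omega> q (\<lambda>x. of_real (l \<epsilon>) * u \<epsilon> x) (C * \<bar>g \<epsilon>\<bar>)"
    using C assms(3) eventually_small
  proof eventually_elim
    case (elim \<epsilon>)
    then have "smooth_on \<Omega> (u \<epsilon>)" using mnetD[OF assms(2)] by simp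
    from deriv_sup_dbound[OF assms(1) this elim(1,2) assms(4)] show ?case .
  qed
  then show ?thesis by blast
qed

text \<open>The point value is taken through the representative chosen by \<open>grep\<close>. The
  growth hypotheses speak of another representative, whose value at x0 differs by a negligible
  number.\<close>

lemma negligible_at_point:
  assumes "open \<Omega>" "x0 \<in> \<Omega>" "U \<in> gfuns \<Omega>" "gvalue U x0 = 0" "u \<in> U"
  shows "negligible_net (\<lambda>\<epsilon>. u \<epsilon> x0)"
proof -
  have K: "compact {x0}" "{x0} \<subseteq> \<Omega>" using assms(2) by auto
  obtain l :: "real \<Rightarrow> real" where l: "moderate l" "\<forall>\<^sub>F \<epsilon> in at_right 0. dbound {x0} 0 (grep U \<epsilon>) (l \<epsilon>)"
    by (rule mnet_bound[OF gfuns_rep(2)[OF assms(1,3)] K])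
  have "moderate (\<lambda>\<epsilon>. grep U \<epsilon> x0)"
    by (rule moderate_dom[OF l(1)]) (use l(2) in eventually_elim, use dboundD0 in fastforce)
  then have g: "negligible_net (\<lambda>\<epsilon>. grep U \<epsilon> x0)"
    using gen_num_eqD[of "\<lambda>\<epsilon>. grep U \<epsilon> x0" "\<lambda>_. 0"] assms(4) by (simp add: gvalue_def zero_gen_num_def moderate_const)
  obtain l' :: "real \<Rightarrow> real" where l': "negligible_net l'" "\<forall>\<^sub>F \<epsilon> in at_right 0. dbound {x0} 0 (\<lambda>x. grep U \<epsilon> x - u \<epsilon> x) (l' \<epsilon>)"
    by (rule nnet_bound[OF gfuns_mem(3)[OF assms(1,3,5)] K])
  have "negligible_net (\<lambda>\<epsilon>. grep U \<epsilon> x0 - u \<epsilon> x0)"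
    by (rule negligible_dom[OF l'(1)]) (use l'(2) in eventually_elim, use dboundD0 in fastforce)
  from negligible_add[OF g negligible_uminus[OF this]] show ?thesis by simp
qed

lemma small_factor:
  assumes "0 \<le> (Z::real)" "0 < \<tau>" obtains \<kappa> where "0 < \<kappa>" "Z * \<kappa> \<le> \<tau>"
proof (rule that[of "\<tau> / (Z + 1)"])
  show "Z * (\<tau> / (Z + 1)) \<le> \<tau>" using assms by (simp add: field_simps)
qed (use assms in simp)

theorem theorem5p5:
  fixes \<Omega> :: "(real^'n::finite) set"
    and x0 :: "real^'n"
    and m r :: nat
    and P :: "nat \<Rightarrow> ('n \<Rightarrow> nat) \<Rightarrow> complex gen_num"
    and c :: "nat \<Rightarrow> 'n gfun"
  assumes "open \<Omega>" and "x0 \<in> \<Omega>"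
    and "\<forall>j\<in>{1..r}. c j \<in> gfuns \<Omega>"
    and h1: "\<forall>j\<in>{1..r}. gvalue (c j) x0 = 0"
    and h2: "\<exists>\<xi>. gweight m (P 0) \<xi> dvd 1"
    and h3: "\<forall>j\<in>{1..r}. stronger m (P 0) (P j)"
  shows
    "(\<forall>N::nat.
        (\<exists>(p::real) Pn cn (l :: nat \<Rightarrow> real \<Rightarrow> real).
           1 \<le> p \<and>
           (\<forall>j\<in>{0..r}. poly_represents m (Pn j) (P j)) \<and>
           (\<forall>j\<in>{1..r}. cn j \<in> c j \<and> moderate (l j) \<and> weight_dominated m (Pn j) (Pn 0) (l j) \<and>
              ereal_bigo
                (\<lambda>\<epsilon>. deriv_sup \<Omega> (real CARD('n) + 1 + (real CARD('n) + 1) / p + real N) (cn j \<epsilon>)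
                      * ereal (l j \<epsilon>))
                (\<lambda>\<epsilon>. 1)))
        \<longrightarrow>
        (\<exists>\<delta>>0. ball x0 \<delta> \<subseteq> \<Omega> \<and>
           (\<forall>F\<in>basic_functionals. of_order N F \<longrightarrow>
              (\<exists>T\<in>basic_functionals.
                 functional_eq_on (ball x0 \<delta>) m (perturbed_coeffs \<Omega> r c P) T F))))
     \<and>
     ((\<exists>Pn cn (l :: nat \<Rightarrow> real \<Rightarrow> real).
           (\<forall>j\<in>{0..r}. poly_represents m (Pn j) (P j)) \<and>
           (\<forall>j\<in>{1..r}. cn j \<in> c j \<and> moderate (l j) \<and> weight_dominated m (Pn j) (Pn 0) (l j) \<and>
              (\<forall>N::nat. \<exists>a>0. ereal_bigo
                (\<lambda>\<epsilon>. deriv_sup \<Omega> (real CARD('n) + 1 + real N) (cn j \<epsilon>) * ereal (l j \<epsilon>))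
                (\<lambda>\<epsilon>. \<epsilon> powr a))))
        \<longrightarrow>
        (\<exists>\<delta>>0. ball x0 \<delta> \<subseteq> \<Omega> \<and>
           (\<forall>F\<in>basic_functionals. \<exists>T\<in>basic_functionals.
              functional_eq_on (ball x0 \<delta>) m (perturbed_coeffs \<Omega> r c P) T F) \<and>
           (\<forall>v\<in>gfuns_c UNIV. \<exists>u\<in>gfuns_c UNIV.
              gfun_eq_on (ball x0 \<delta>) m (perturbed_coeffs \<Omega> r c P) u v)))"
proof -
  let ?n = "CARD('n)"
  obtain T :: nat and cl cu :: real where good: "0 < cl" "0 < cu"
    "\<And>q (\<xi> :: real^'n). \<exists>t\<in>{1..T}. \<forall>z. norm z = real t \<longrightarrow> cl * weight m q \<xi> \<le> norm (peval m q (\<lambda>i. rv \<xi> i + gam m z i))"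
    "\<And>q (\<xi> :: real^'n) z. norm z \<le> real T \<Longrightarrow> norm (peval m q (\<lambda>i. rv \<xi> i + gam m z i)) \<le> cu * weight m q \<xi>"
    by (rule good_radius[of m]) blast
  obtain \<theta> :: "real^'n \<Rightarrow> complex" where \<theta>: "smooth_on UNIV \<theta>" "\<And>y. y \<in> cball 0 1 \<Longrightarrow> \<theta> y = 1" "\<And>y. 2 \<le> dist 0 y \<Longrightarrow> \<theta> y = 0"
    by (rule cutoff_exists[of 1 2 0]) auto
  obtain R0 where R0: "0 < R0" "cball x0 R0 \<subseteq> \<Omega>" using assms(1,2) open_contains_cball by blast
  obtain \<xi>0 where \<xi>0: "gweight m (P 0) \<xi>0 dvd 1" using h2 by blast
  have scheme: "net_scheme m r T x0 \<rho> cl cu \<theta> \<Omega> P c Pn cn l"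
    if "0 < \<rho>" "\<rho> \<le> 1" "2 * \<rho> \<le> R0" "\<forall>j\<in>{0..r}. poly_represents m (Pn j) (P j)"
      "\<forall>j\<in>{1..r}. cn j \<in> c j \<and> weight_dominated m (Pn j) (Pn 0) (l j)" for \<rho> Pn cn l
  proof
    show "cball x0 (2 * \<rho>) \<subseteq> \<Omega>" using R0(2) that(3) by auto
    show "\<forall>y. y \<notin> cball 0 2 \<longrightarrow> \<theta> y = 0" using \<theta>(3) by auto
  qed (use that good \<theta> assms(1,3) h2 in auto)
  \<comment> \<open>Inverts the bound of \<open>dbound_H\<close>: how small the coefficients have to
    be for their share of the perturbation to stay below half of \<tau>.\<close>
  have threshold: "\<exists>\<kappa>>0. real r * (2 ^ q * (2 ^ q * B\<theta> * \<kappa>) * ((cu / cl) * exbd TYPE('n) m T q)) \<le> \<tau> / 2"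
    if "0 < \<tau>" "0 < B\<theta>" for q :: nat and B\<theta> \<tau> :: real
  proof -
    have "0 \<le> real r * (2 ^ q * (2 ^ q * B\<theta>) * ((cu / cl) * exbd TYPE('n) m T q))"
      using that(2) good(1,2) exbd_pos[where 'n = 'n, of m T q] by simp
    moreover have "0 < \<tau> / 2" using that by simp
    ultimately obtain \<kappa> where "0 < \<kappa>" "real r * (2 ^ q * (2 ^ q * B\<theta>) * ((cu / cl) * exbd TYPE('n) m T q)) * \<kappa> \<le> \<tau> / 2"
      by (rule small_factor)
    then show ?thesis by (intro exI[of _ \<kappa>]) (simp add: mult_ac)
  qed
  have nonneg: "\<forall>\<^sub>F \<epsilon> in at_right 0. 0 \<le> l j \<epsilon>"
    if "\<forall>j\<in>{0..r}. poly_represents m (Pn j) (P j)" "weight_dominated m (Pn j) (Pn 0) (l j)" for Pn j and l :: "nat \<Rightarrow> real \<Rightarrow> real"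
    by (rule dominating_nonneg[OF _ \<xi>0 that(2)]) (use that(1) in auto)
  show ?thesis
  proof (intro conjI allI impI)
    fix N :: nat
    let ?k = "\<lambda>p. real ?n + 1 + (real ?n + 1) / p + real N"
    let ?q = "N + ?n + 1"
    assume "\<exists>(p::real) Pn cn (l :: nat \<Rightarrow> real \<Rightarrow> real). 1 \<le> p \<and> (\<forall>j\<in>{0..r}. poly_represents m (Pn j) (P j)) \<and>
       (\<forall>j\<in>{1..r}. cn j \<in> c j \<and> moderate (l j) \<and> weight_dominated m (Pn j) (Pn 0) (l j) \<and>
          ereal_bigo (\<lambda>\<epsilon>. deriv_sup \<Omega> (?k p) (cn j \<epsilon>) * ereal (l j \<epsilon>)) (\<lambda>\<epsilon>. 1))"
    then obtain p Pn cn and l :: "nat \<Rightarrow> real \<Rightarrow> real" where p: "1 \<le> p" and reps: "\<forall>j\<in>{0..r}. poly_represents m (Pn j) (P j)"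
      and hyp: "\<forall>j\<in>{1..r}. cn j \<in> c j \<and> moderate (l j) \<and> weight_dominated m (Pn j) (Pn 0) (l j) \<and>
          ereal_bigo (\<lambda>\<epsilon>. deriv_sup \<Omega> (?k p) (cn j \<epsilon>) * ereal (l j \<epsilon>)) (\<lambda>\<epsilon>. 1)" by blast
    obtain \<kappa> :: real where \<kappa>: "0 < \<kappa>" "\<And>(H :: ('n \<Rightarrow> int) \<Rightarrow> real^'n \<Rightarrow> complex) \<sigma> l R. (\<And>k. smooth_on UNIV (H k)) \<Longrightarrow> (\<And>k. supp2 (H k)) \<Longrightarrow>
      (\<And>k. dbound (cball 0 2) ?q (H k) \<kappa>) \<Longrightarrow> \<bar>\<sigma>\<bar> \<le> real N \<Longrightarrow> (\<Sum>k\<in>cube R. norm (smat H l k) * wt k powr \<sigma>) \<le> wt l powr \<sigma> / 2"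
      by (rule smat_row_sum[where s = N]) (rule that, blast+)
    \<comment> \<open>The bound \<kappa> serves the row sums, the bound 1 the pointwise estimate of
      the perturbation in the error terms.\<close>
    define \<tau> where "\<tau> = min \<kappa> 1"
    have \<tau>: "0 < \<tau>" "\<tau> \<le> \<kappa>" "\<tau> \<le> 1" using \<kappa>(1) by (auto simp: \<tau>_def)
    obtain B\<theta> where B\<theta>: "B\<theta> > 0" "dbound (cball 0 2) ?q \<theta> B\<theta>"
      by (rule dbound_exists[OF open_UNIV compact_cball subset_UNIV \<theta>(1)])
    obtain \<kappa>0 where \<kappa>0: "0 < \<kappa>0" "real r * (2 ^ ?q * (2 ^ ?q * B\<theta> * \<kappa>0) * ((cu / cl) * exbd TYPE('n) m T ?q)) \<le> \<tau> / 2"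
      using threshold[OF \<tau>(1) B\<theta>(1)] by blast
    have mcn: "mnet \<Omega> (cn j)" if "j \<in> {1..r}" for j
      using gfuns_mem(1)[OF assms(1)] assms(3) hyp that by blast
    have "\<exists>C. \<forall>\<^sub>F \<epsilon> in at_right 0. dbound \<Omega> ?q (\<lambda>x. of_real (l j \<epsilon>) * cn j \<epsilon> x) (C * \<bar>1\<bar>)" if j: "j \<in> {1..r}" for j
    proof (rule growth_dbound[OF assms(1) mcn[OF j] nonneg[OF reps]])
      have "0 \<le> (real ?n + 1) / p" using p by simp
      then show "real ?q \<le> ?k p" by simp
    qed (use hyp j in blast)+
    then have "\<forall>j\<in>{1..r}. \<exists>C. \<forall>\<^sub>F \<epsilon> in at_right 0. dbound \<Omega> ?q (\<lambda>x. of_real (l j \<epsilon>) * cn j \<epsilon> x) C" by simp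
    from bchoice[OF this] obtain C where C: "\<And>j. j \<in> {1..r} \<Longrightarrow> \<forall>\<^sub>F \<epsilon> in at_right 0. dbound \<Omega> ?q (\<lambda>x. of_real (l j \<epsilon>) * cn j \<epsilon> x) (C j)"
      by blast
    define Cs where "Cs = (\<Sum>j\<in>{1..r}. \<bar>C j\<bar>)"
    have Cs: "C j \<le> Cs" if "j \<in> {1..r}" for j
      using member_le_sum[OF that, of "\<lambda>j. \<bar>C j\<bar>"] by (simp add: Cs_def)
    \<comment> \<open>The radius is fixed before \<epsilon>: the bounds \<open>C j\<close> hold for
      all small \<epsilon>, so the variation over the ball of radius 2 \<rho> is at most half of
      \<kappa>0 uniformly. The other half is left for the value at x0, which is negligible.\<close>
    have "0 \<le> 2 * ?n * Cs" by (simp add: Cs_def sum_nonneg)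
    moreover have "0 < \<kappa>0 / 2" using \<kappa>0(1) by simp
    ultimately obtain \<rho>0 where \<rho>0: "0 < \<rho>0" "2 * ?n * Cs * \<rho>0 \<le> \<kappa>0 / 2" by (rule small_factor)
    define \<rho> where "\<rho> = min \<rho>0 (min 1 (R0 / 2))"
    have rho: "0 < \<rho>" "\<rho> \<le> 1" "2 * \<rho> \<le> R0" "\<rho> \<le> \<rho>0" using \<rho>0(1) R0(1) by (auto simp: \<rho>_def min_le_iff_disj)
    interpret net_scheme m r T x0 \<rho> cl cu \<theta> \<Omega> P c Pn cn l
      by (rule scheme[OF rho(1-3) reps]) (use hyp in blast)
    have small: "\<forall>\<^sub>F \<epsilon> in at_right 0. \<forall>k. dbound (cball 0 2) ?q (Hn \<epsilon> k) \<tau>"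
    proof (rule H_small[OF B\<theta>(2) less_imp_le[OF B\<theta>(1)] \<tau>(1) \<kappa>0(2)])
      fix j assume j: "j \<in> {1..r}"
      have "negligible_net (\<lambda>\<epsilon>. of_real (l j \<epsilon>) * cn j \<epsilon> x0)"
      proof (rule negligible_mult)
        show "negligible_net (\<lambda>\<epsilon>. cn j \<epsilon> x0)"
          by (rule negligible_at_point[OF assms(1,2)]) (use assms(3) h1 hyp j in auto)
        show "moderate (\<lambda>\<epsilon>. complex_of_real (l j \<epsilon>))" using hyp j by (auto intro: moderate_dom[of "l j"])
      qed
      then have "\<forall>\<^sub>F \<epsilon> in at_right 0. norm (of_real (l j \<epsilon>) * cn j \<epsilon> x0) \<le> \<kappa>0 / 2"
        by (rule negligible_small) (use \<kappa>0(1) in simp)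
      then show "\<forall>\<^sub>F \<epsilon> in at_right 0. dbound (cball 0 2) ?q (\<lambda>y. of_real (l j \<epsilon>) * cn j \<epsilon> (x0 + \<rho> *\<^sub>R y)) \<kappa>0"
        using C[OF j] eventually_small
      proof eventually_elim
        case (elim \<epsilon>)
        have s: "smooth_on \<Omega> (\<lambda>x. of_real (l j \<epsilon>) * cn j \<epsilon> x)"
          by (rule smooth_on_mult[OF assms(1) smooth_on_const[OF assms(1)] mnetD[OF mcn[OF j]]]) (use elim in simp)
        have "2 * ?n * \<rho> * C j \<le> 2 * ?n * \<rho> * Cs" using rho(1) Cs[OF j] by (intro mult_left_mono) auto
        also have "\<dots> \<le> 2 * ?n * Cs * \<rho>0"
          using rho(4) mult_left_mono[OF rho(4), of "2 * ?n * Cs"] by (simp add: Cs_def sum_nonneg mult_ac)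
        finally have le: "\<kappa>0 / 2 + 2 * ?n * \<rho> * C j \<le> \<kappa>0" using \<rho>0(2) by linarith
        show ?case
          using dbound_rescale[OF assms(1) \<Omega>(2) s _ rho(1,2) elim(1), of "N + ?n" "C j"] elim(2) dbound_mono[OF _ order_refl order_refl le] by simp
      qed
    qed
    have sol: "\<exists>T\<in>basic_functionals. functional_eq_on (ball x0 \<rho>) m (perturbed_coeffs \<Omega> r c P) T F" if oF: "of_order N F" for F
    proof -
      obtain Fn K and lF :: "real \<Rightarrow> real" where F: "defines_functional Fn F" "compact K" "moderate lF"
        "\<forall>f. smooth_on UNIV f \<longrightarrow> (\<forall>\<epsilon>\<in>{0<..1}. norm (Fn \<epsilon> f) \<le> lF \<epsilon> * sup_seminorm K N f)"
        using oF unfolding of_order_def by blast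
      show ?thesis
      proof (rule solve_functional[OF F(1-3) _ _ small \<tau>(3)])
        show "\<forall>\<^sub>F \<epsilon> in at_right 0. \<forall>f. smooth_on UNIV f \<longrightarrow> norm (Fn \<epsilon> f) \<le> lF \<epsilon> * sup_seminorm K N f"
          using eventually_small by eventually_elim (use F(4) in auto)
      qed (rule \<kappa>(2), blast, blast, rule dbound_mono[OF _ order_refl order_refl \<tau>(2)], blast, blast)
    qed
    have "ball x0 \<rho> \<subseteq> \<Omega>" using \<Omega>(2) rho(1) by auto
    then show "\<exists>\<delta>>0. ball x0 \<delta> \<subseteq> \<Omega> \<and> (\<forall>F\<in>basic_functionals. of_order N F \<longrightarrow>
        (\<exists>T\<in>basic_functionals. functional_eq_on (ball x0 \<delta>) m (perturbed_coeffs \<Omega> r c P) T F))"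
      using sol rho(1) by (intro exI[of _ \<rho>]) simp
  next
    let ?k = "\<lambda>N :: nat. real ?n + 1 + real N"
    assume "\<exists>Pn cn (l :: nat \<Rightarrow> real \<Rightarrow> real). (\<forall>j\<in>{0..r}. poly_represents m (Pn j) (P j)) \<and>
       (\<forall>j\<in>{1..r}. cn j \<in> c j \<and> moderate (l j) \<and> weight_dominated m (Pn j) (Pn 0) (l j) \<and>
          (\<forall>N::nat. \<exists>a>0. ereal_bigo (\<lambda>\<epsilon>. deriv_sup \<Omega> (?k N) (cn j \<epsilon>) * ereal (l j \<epsilon>)) (\<lambda>\<epsilon>. \<epsilon> powr a)))"
    then obtain Pn cn and l :: "nat \<Rightarrow> real \<Rightarrow> real" where reps: "\<forall>j\<in>{0..r}. poly_represents m (Pn j) (P j)"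
      and hyp: "\<forall>j\<in>{1..r}. cn j \<in> c j \<and> moderate (l j) \<and> weight_dominated m (Pn j) (Pn 0) (l j) \<and>
          (\<forall>N::nat. \<exists>a>0. ereal_bigo (\<lambda>\<epsilon>. deriv_sup \<Omega> (?k N) (cn j \<epsilon>) * ereal (l j \<epsilon>)) (\<lambda>\<epsilon>. \<epsilon> powr a))" by blast
    \<comment> \<open>Here the ball only has to fit into \<Omega>, since the factor \<epsilon>^a
      provides the smallness. Hence one radius serves functionals of all orders and all C^j
      estimates.\<close>
    define \<rho> where "\<rho> = min 1 (R0 / 2)"
    have rho: "0 < \<rho>" "\<rho> \<le> 1" "2 * \<rho> \<le> R0" using R0(1) by (auto simp: \<rho>_def)
    interpret net_scheme m r T x0 \<rho> cl cu \<theta> \<Omega> P c Pn cn l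
      by (rule scheme[OF rho reps]) (use hyp in blast)
    have small: "\<forall>\<^sub>F \<epsilon> in at_right 0. \<forall>k. dbound (cball 0 2) q (Hn \<epsilon> k) \<tau>" if \<tau>: "0 < \<tau>" for q \<tau>
    proof -
      obtain B\<theta> where B\<theta>: "B\<theta> > 0" "dbound (cball 0 2) q \<theta> B\<theta>"
        by (rule dbound_exists[OF open_UNIV compact_cball subset_UNIV \<theta>(1)])
      obtain \<kappa>0 where \<kappa>0: "0 < \<kappa>0" "real r * (2 ^ q * (2 ^ q * B\<theta> * \<kappa>0) * ((cu / cl) * exbd TYPE('n) m T q)) \<le> \<tau> / 2"
        using threshold[OF \<tau> B\<theta>(1)] by blast
      show ?thesis
      proof (rule H_small[OF B\<theta>(2) less_imp_le[OF B\<theta>(1)] \<tau> \<kappa>0(2)])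
        fix j assume j: "j \<in> {1..r}"
        obtain a where a: "0 < a" "ereal_bigo (\<lambda>\<epsilon>. deriv_sup \<Omega> (?k q) (cn j \<epsilon>) * ereal (l j \<epsilon>)) (\<lambda>\<epsilon>. \<epsilon> powr a)"
          using hyp j by blast
        have nn: "\<forall>\<^sub>F \<epsilon> in at_right 0. 0 \<le> l j \<epsilon>" by (rule nonneg[OF reps]) (use hyp j in blast)
        have "\<exists>C. \<forall>\<^sub>F \<epsilon> in at_right 0. dbound \<Omega> q (\<lambda>x. of_real (l j \<epsilon>) * cn j \<epsilon> x) (C * \<bar>\<epsilon> powr a\<bar>)"
          by (rule growth_dbound[OF assms(1) mnet_cn[OF j] nn _ a(2)]) simp
        then obtain C where C: "\<forall>\<^sub>F \<epsilon> in at_right 0. dbound \<Omega> q (\<lambda>x. of_real (l j \<epsilon>) * cn j \<epsilon> x) (C * \<bar>\<epsilon> powr a\<bar>)" by blast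
        have "((\<lambda>\<epsilon>. C * \<epsilon> powr a) \<longlongrightarrow> C * 0) (at_right 0)"
          using a(1) by (intro tendsto_mult tendsto_const tendsto_zero_powrI[where b = a] tendsto_ident_at) (auto simp: eventually_at_right_field intro!: exI[of _ 1])
        then have "\<forall>\<^sub>F \<epsilon> in at_right 0. C * \<epsilon> powr a < \<kappa>0" by (rule order_tendstoD(2)) (use \<kappa>0(1) in simp)
        then show "\<forall>\<^sub>F \<epsilon> in at_right 0. dbound (cball 0 2) q (\<lambda>y. of_real (l j \<epsilon>) * cn j \<epsilon> (x0 + \<rho> *\<^sub>R y)) \<kappa>0"
          using C eventually_small
        proof eventually_elim
          case (elim \<epsilon>)
          have s: "smooth_on \<Omega> (\<lambda>x. of_real (l j \<epsilon>) * cn j \<epsilon> x)"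
            by (rule smooth_on_mult[OF assms(1) smooth_on_const[OF assms(1)] mnetD[OF mnet_cn[OF j]]]) (use elim in simp)
          have b: "dbound \<Omega> q (\<lambda>x. of_real (l j \<epsilon>) * cn j \<epsilon> x) \<kappa>0"
            by (rule dbound_mono[OF elim(2) order_refl order_refl]) (use elim(1) in simp)
          show ?case
          proof (rule dbound_affine[OF assms(1) order_refl s b])
            fix y :: "real^'n" assume "y \<in> cball 0 2"
            then have "x0 + \<rho> *\<^sub>R y \<in> cball x0 (2 * \<rho>)" using rho by (simp add: dist_norm mult.commute)
            then show "x0 + \<rho> *\<^sub>R y \<in> \<Omega>" using \<Omega>(2) by blast
          qed (use rho in auto)
        qed
      qed
    qed
    have sol: "\<exists>T\<in>basic_functionals. functional_eq_on (ball x0 \<rho>) m (perturbed_coeffs \<Omega> r c P) T F" if "F \<in> basic_functionals" for F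
    proof -
      \<comment> \<open>Each basic functional comes with some finite order j of differentiation, and
        the exponent of the weight in the iteration is taken equal to it.\<close>
      obtain Fn K j C and M :: nat and \<eta> where F: "defines_functional Fn F" "compact K" "\<eta> \<in> {0<..1}"
        "\<forall>f. smooth_on UNIV f \<longrightarrow> (\<forall>\<epsilon>\<in>{0<..\<eta>}. norm (Fn \<epsilon> f) \<le> C * inverse (\<epsilon> ^ M) * sup_seminorm K j f)"
        using \<open>F \<in> basic_functionals\<close> unfolding basic_functionals_def by blast
      obtain \<kappa> :: real where \<kappa>: "0 < \<kappa>" "\<And>(H :: ('n \<Rightarrow> int) \<Rightarrow> real^'n \<Rightarrow> complex) \<sigma> l R. (\<And>k. smooth_on UNIV (H k)) \<Longrightarrow> (\<And>k. supp2 (H k)) \<Longrightarrow>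
        (\<And>k. dbound (cball 0 2) (j + ?n + 1) (H k) \<kappa>) \<Longrightarrow> \<bar>\<sigma>\<bar> \<le> real j \<Longrightarrow> (\<Sum>k\<in>cube R. norm (smat H l k) * wt k powr \<sigma>) \<le> wt l powr \<sigma> / 2"
        by (rule smat_row_sum[where s = j]) (rule that, blast+)
      have min: "0 < min \<kappa> 1" "min \<kappa> 1 \<le> \<kappa>" "min \<kappa> 1 \<le> 1" using \<kappa>(1) by auto
      have "moderate (\<lambda>\<epsilon>::real. inverse (\<epsilon> ^ M))"
        unfolding moderate_iff_ev by (intro exI[of _ M]) (use eventually_small in eventually_elim, simp)
      then have ml: "moderate (\<lambda>\<epsilon>. C * inverse (\<epsilon> ^ M))" by (intro moderate_mult moderate_const)
      show ?thesis
      proof (rule solve_functional[OF F(1,2) ml _ _ small[OF min(1)] min(3)])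
        have "\<forall>\<^sub>F \<epsilon> in at_right 0. \<epsilon> \<in> {0<..\<eta>}"
          unfolding eventually_at_right_field using F(3) by (intro exI[of _ \<eta>]) auto
        then show "\<forall>\<^sub>F \<epsilon> in at_right 0. \<forall>f. smooth_on UNIV f \<longrightarrow> norm (Fn \<epsilon> f) \<le> C * inverse (\<epsilon> ^ M) * sup_seminorm K j f"
          by eventually_elim (use F(4) in blast)
      qed (rule \<kappa>(2), blast, blast, rule dbound_mono[OF _ order_refl order_refl min(2)], blast, blast)
    qed
    have "ball x0 \<rho> \<subseteq> \<Omega>" using \<Omega>(2) rho(1) by auto
    then show "\<exists>\<delta>>0. ball x0 \<delta> \<subseteq> \<Omega> \<and>
        (\<forall>F\<in>basic_functionals. \<exists>T\<in>basic_functionals. functional_eq_on (ball x0 \<delta>) m (perturbed_coeffs \<Omega> r c P) T F) \<and>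
        (\<forall>v\<in>gfuns_c UNIV. \<exists>u\<in>gfuns_c UNIV. gfun_eq_on (ball x0 \<delta>) m (perturbed_coeffs \<Omega> r c P) u v)"
      using sol solve_gfun[OF small] rho(1) by (intro exI[of _ \<rho>] conjI ballI) auto
  qed
qed

end
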